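(* Let $\varepsilon_k\to0$ be a subsequence such that $\rho^{\varepsilon_k}$ converges to $\rho$ strongly in $L^p(0,T;W^{-1,1}(\Omega))$. Then $$\lim_{\varepsilon\to0}|\{u^\varepsilon(x,t)\ge\varepsilon\}|\ \ge\ \int_\Omega\rho(t,x)\,dx\ \ge\ \min\big\{(63\,t+|\{u_{in}>0\}|^7)^{1/7},\,|\Omega|\big\}\qquad\text{for all }t\in[0,T].$$ Moreover, if $\partial\Sigma(t_0)\subset\Omega$, then the stronger inequality $$\int_\Omega\rho(t,x)\,dx\ \ge\ (1008\,t+|\{u_{in}>0\}|^7)^{1/7}\qquad\text{for all }t\in[0,t_0]$$ holds.
   Context: Here $p\in[1,\infty)$ and $T>0$ are arbitrary (the family $\{\rho^\varepsilon\}_{\varepsilon>0}$ defined below is relatively compact in $L^p(0,T;W^{-1,1}(\Omega))$ for any such $p$ and $T$), and $|A|$ is the Lebesgue measure of $A$. The limit satisfies $0\le\rho\le1$ a.e., and $$\Sigma(t)=\Big\{x\in\Omega:\ \exists r>0,\ \int_{B_r(x)\cap\Omega}[1-\rho(t,y)]\,dy=0\Big\},\qquad B_r(x)=(x-r,x+r).$$ Let $\Omega\subset\mathbb R$ be a bounded open interval, $n\in(0,3)$, and $u_{in}\in H^1(\Omega)$, $u_{in}\ge0$, $\int_\Omega u_{in}\,dx=1$. For $\varepsilon>0$ (a small parameter) consider the thin film problem $|\ln\varepsilon|^{-1}\partial_tu+\partial_x\big((\varepsilon^{3-n}u^n+u^3)\partial_{xxx}u\big)=0$ in $(0,\infty)\times\Omega$,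 with $(\varepsilon^{3-n}u^n+u^3)u_{xxx}=0$ and $u_x=0$ on $(0,\infty)\times\partial\Omega$, and $u(0,\cdot)=u_{in}$. Let $B(s)=\int_0^s\int_r^\infty\frac{1}{v^{n-1}+v^2}\,dv\,dr$ and $B^\varepsilon(s)=|\ln\varepsilon|^{-1}B(s/\varepsilon)$. For each $\varepsilon$, $u^\varepsilon$ denotes a fixed non-negative weak solution such that, with $\rho^\varepsilon:=B^\varepsilon(u^\varepsilon)$, for every $T>0$: (i) $u^\varepsilon\in L^\infty((0,T);H^1(\Omega))$, $u^\varepsilon u^\varepsilon_{xxx}\in L^2((0,T)\times\Omega)$; (ii) $\int_\Omega u^\varepsilon(t)\,dx=\int_\Omega u_{in}\,dx$ for all $t>0$; (iii) $\frac12\int_\Omega|u^\varepsilon_x(t)|^2dx+\int_0^t\int_{\{u^\varepsilon>0\}}|\ln\varepsilon|(\varepsilon^{3-n}(u^\varepsilon)^n+(u^\varepsilon)^3)|u^\varepsilon_{xxx}|^2dx\,ds\le\frac12\int_\Omega|\partial_xu_{in}|^2dx$ for all $t>0$; (iv) $\int_\Omega\rho^\varepsilon(t)\,dx\ge\int_0^t\int_\Omega u^\varepsilon|u^\varepsilon_{xx}|^2dx\,ds+\int_\Omega\rho^\varepsilon(0)\,dx$ (with $u^\varepsilon|u^\varepsilon_{xx}|^2:=0$ on $\{u^\varepsilon=0\}$); (v) $u^\varepsilon\in L^2((0,T);H^2(\Omega))$ if $n<2$, and $(u^\varepsilon)^{3/2}\in L^2((0,T);H^2(\Omega))$, $((u^\varepsilon)^{3/4})_x\in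 L^4((0,T)\times\Omega)$ if $n\ge2$; (vi) $\partial_t\rho^\varepsilon=T^\varepsilon+\partial_xR^\varepsilon$ in the sense of distributions, where $T^\varepsilon=-u^\varepsilon u^\varepsilon_xu^\varepsilon_{xxx}\in L^2((0,T);L^1(\Omega))$, $R^\varepsilon=-|\ln\varepsilon|(B^\varepsilon)'(u^\varepsilon)(\varepsilon^{3-n}(u^\varepsilon)^{n-1}+(u^\varepsilon)^2)u^\varepsilon u^\varepsilon_{xxx}$, and $\langle T^\varepsilon,\varphi\rangle=\int_\Omega u^\varepsilon(u^\varepsilon_{xx})^2\varphi\,dx-\frac56\int_\Omega(u^\varepsilon_x)^3\varphi'\,dx-\frac12\int_\Omega u^\varepsilon(u^\varepsilon_x)^2\varphi''\,dx$ for all $\varphi\in C^\infty(\overline\Omega)$. *)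

theory Defs
  imports "HOL-Analysis.Analysis"
begin

(* Functions of time and space are curried, u t x with t first.  Integrals and measurability
   refer to lborel, i.e. equivalence classes are handled through Borel representatives. *)

section \<open>Smooth functions and test functions\<close>

definition smooth :: "(real \<Rightarrow> real) \<Rightarrow> bool" where
  "smooth \<phi> \<longleftrightarrow> (\<forall>k x. ((deriv ^^ k) \<phi>) field_differentiable (at x))"

definition test_fun :: "real set \<Rightarrow> (real \<Rightarrow> real) set" where
  "test_fun S = {\<phi>. smooth \<phi> \<and> (\<exists>K. compact K \<and> K \<subseteq> S \<and> (\<forall>x. x \<notin> K \<longrightarrow> \<phi> x = 0))}"

definition dt :: "(real \<Rightarrow> real \<Rightarrow> real) \<Rightarrow> real \<Rightarrow> real \<Rightarrow> real" where
  "dt \<phi> t x = deriv (\<lambda>s. \<phi> s x) t"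

definition dx :: "(real \<Rightarrow> real \<Rightarrow> real) \<Rightarrow> real \<Rightarrow> real \<Rightarrow> real" where
  "dx \<phi> t x = deriv (\<phi> t) x"

(* D i j is the mixed partial derivative of order i in t and j in x. *)
definition smooth2 :: "(real \<Rightarrow> real \<Rightarrow> real) \<Rightarrow> bool" where
  "smooth2 \<phi> \<longleftrightarrow> (\<exists>D :: nat \<Rightarrow> nat \<Rightarrow> real \<Rightarrow> real \<Rightarrow> real. D 0 0 = \<phi> \<and>
     (\<forall>i j. continuous_on UNIV (\<lambda>(t, x). D i j t x) \<and>
       (\<forall>t x. ((\<lambda>s. D i j s x) has_real_derivative D (Suc i) j t x) (at t) \<and>
              (D i j t has_real_derivative D i (Suc j) t x) (at x))))"

definition test_fun2 :: "(real \<times> real) set \<Rightarrow> (real \<Rightarrow> real \<Rightarrow> real) set" where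
  "test_fun2 G = {\<phi>. smooth2 \<phi> \<and>
     (\<exists>K. compact K \<and> K \<subseteq> G \<and> (\<forall>t x. (t, x) \<notin> K \<longrightarrow> \<phi> t x = 0))}"

section \<open>Function spaces\<close>

definition in_L :: "nat \<Rightarrow> 'a::euclidean_space set \<Rightarrow> ('a \<Rightarrow> real) \<Rightarrow> bool" where
  "in_L q S f \<longleftrightarrow> set_borel_measurable lborel S f \<and> set_integrable lborel S (\<lambda>z. \<bar>f z\<bar> ^ q)"

definition weak_deriv_on :: "real set \<Rightarrow> (real \<Rightarrow> real) \<Rightarrow> (real \<Rightarrow> real) \<Rightarrow> bool" where
  "weak_deriv_on S f g \<longleftrightarrow>
     (\<forall>K. compact K \<longrightarrow> K \<subseteq> S \<longrightarrow> set_integrable lborel K f \<and> set_integrable lborel K g) \<and>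
     (\<forall>\<phi>\<in>test_fun S. (LBINT x:S. f x * deriv \<phi> x) = - (LBINT x:S. g x * \<phi> x))"

(* f lies in H^1(S), with weak derivative g *)
definition H1_deriv :: "real set \<Rightarrow> (real \<Rightarrow> real) \<Rightarrow> (real \<Rightarrow> real) \<Rightarrow> bool" where
  "H1_deriv S f g \<longleftrightarrow> in_L 2 S f \<and> in_L 2 S g \<and> weak_deriv_on S f g"

definition cyl :: "real \<Rightarrow> real \<Rightarrow> real \<Rightarrow> (real \<times> real) set" where
  "cyl T a b = {0<..<T} \<times> {a<..<b}"

(* Bochner spaces over (0,T).  The target spaces are separable, so Bochner measurability
   amounts to joint measurability of a representative (and of its spatial derivatives). *)

definition Linf_H1 :: "real \<Rightarrow> real \<Rightarrow> real \<Rightarrow> (real \<Rightarrow> real \<Rightarrow> real) \<Rightarrow> bool" where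
  "Linf_H1 T a b f \<longleftrightarrow> (\<exists>g C.
     set_borel_measurable lborel (cyl T a b) (\<lambda>(t, x). f t x) \<and>
     set_borel_measurable lborel (cyl T a b) (\<lambda>(t, x). g t x) \<and>
     (AE t in lborel. t \<in> {0<..<T} \<longrightarrow>
        H1_deriv {a<..<b} (f t) (g t) \<and>
        (LBINT x:{a<..<b}. (f t x)\<^sup>2 + (g t x)\<^sup>2) \<le> C))"

definition L2_H2 :: "real \<Rightarrow> real \<Rightarrow> real \<Rightarrow> (real \<Rightarrow> real \<Rightarrow> real) \<Rightarrow> bool" where
  "L2_H2 T a b f \<longleftrightarrow> (\<exists>g h.
     in_L 2 (cyl T a b) (\<lambda>(t, x). f t x) \<and>
     in_L 2 (cyl T a b) (\<lambda>(t, x). g t x) \<and>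
     in_L 2 (cyl T a b) (\<lambda>(t, x). h t x) \<and>
     (AE t in lborel. t \<in> {0<..<T} \<longrightarrow>
        weak_deriv_on {a<..<b} (f t) (g t) \<and> weak_deriv_on {a<..<b} (g t) (h t)))"

definition L2_L1 :: "real \<Rightarrow> real \<Rightarrow> real \<Rightarrow> (real \<Rightarrow> real \<Rightarrow> real) \<Rightarrow> bool" where
  "L2_L1 T a b f \<longleftrightarrow>
     set_borel_measurable lborel (cyl T a b) (\<lambda>(t, x). f t x) \<and>
     (AE t in lborel. t \<in> {0<..<T} \<longrightarrow> set_integrable lborel {a<..<b} (f t)) \<and>
     set_integrable lborel {0<..<T} (\<lambda>t. (LBINT x:{a<..<b}. \<bar>f t x\<bar>)\<^sup>2)"

(* W^{-1,1}(a,b) norm of an integrable function: the dual norm against W_0^{1,infinity}. *)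
definition norm_Wm11 :: "real \<Rightarrow> real \<Rightarrow> (real \<Rightarrow> real) \<Rightarrow> real" where
  "norm_Wm11 a b f =
     (SUP \<phi>\<in>{\<phi> \<in> test_fun {a<..<b}. \<forall>x. \<bar>\<phi> x\<bar> \<le> 1 \<and> \<bar>deriv \<phi> x\<bar> \<le> 1}.
        \<bar>LBINT x:{a<..<b}. f x * \<phi> x\<bar>)"

definition tendsto_Lp_Wm11 ::
  "real \<Rightarrow> real \<Rightarrow> real \<Rightarrow> real \<Rightarrow> (nat \<Rightarrow> real \<Rightarrow> real \<Rightarrow> real) \<Rightarrow> (real \<Rightarrow> real \<Rightarrow> real) \<Rightarrow> bool" where
  "tendsto_Lp_Wm11 p T a b f g \<longleftrightarrow>
     (\<lambda>k. \<integral>\<^sup>+t\<in>{0<..<T}. ennreal (norm_Wm11 a b (\<lambda>x. f k t x - g t x) powr p) \<partial>lborel)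
       \<longlonglongrightarrow> 0"

section \<open>The thin film problem\<close>

definition B_fun :: "real \<Rightarrow> real \<Rightarrow> real" where
  "B_fun n s = (LBINT r:{0<..<s}. (LBINT v:{r<..}. 1 / (v powr (n - 1) + v\<^sup>2)))"

definition B_eps :: "real \<Rightarrow> real \<Rightarrow> real \<Rightarrow> real" where
  "B_eps n \<epsilon> s = B_fun n (s / \<epsilon>) / \<bar>ln \<epsilon>\<bar>"

definition mobility :: "real \<Rightarrow> real \<Rightarrow> real \<Rightarrow> real" where
  "mobility n \<epsilon> s = \<epsilon> powr (3 - n) * s powr n + s ^ 3"

(* ux is the weak derivative on the whole interval; uxx and uxxx are weak derivatives on the
   positivity set only.  Their values where u = 0 are irrelevant: below they always occur
   multiplied by a factor that vanishes there. *)
definition spatial_derivs :: "real \<Rightarrow> real \<Rightarrow> (real \<Rightarrow> real \<Rightarrow> real) \<Rightarrow> (real \<Rightarrow> real \<Rightarrow> real) \<Rightarrow>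
    (real \<Rightarrow> real \<Rightarrow> real) \<Rightarrow> (real \<Rightarrow> real \<Rightarrow> real) \<Rightarrow> bool" where
  "spatial_derivs a b u ux uxx uxxx \<longleftrightarrow>
     set_borel_measurable lborel ({0<..} \<times> {a<..<b}) (\<lambda>(t, x). ux t x) \<and>
     set_borel_measurable lborel ({0<..} \<times> {a<..<b}) (\<lambda>(t, x). uxx t x) \<and>
     set_borel_measurable lborel ({0<..} \<times> {a<..<b}) (\<lambda>(t, x). uxxx t x) \<and>
     (\<forall>t>0. weak_deriv_on {a<..<b} (u t) (ux t)) \<and>
     (AE t in lborel. t > 0 \<longrightarrow>
        weak_deriv_on {x\<in>{a<..<b}. u t x > 0} (ux t) (uxx t) \<and>
        weak_deriv_on {x\<in>{a<..<b}. u t x > 0} (uxx t) (uxxx t))"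

(* Non-negative weak solution, with u its continuous representative up to t = 0 and up to the
   boundary.  The test functions need not vanish at x = a, b, which encodes the no-flux
   condition; u_x = 0 holds as a one-sided derivative at the end points. *)
definition weak_solution :: "real \<Rightarrow> real \<Rightarrow> real \<Rightarrow> real \<Rightarrow> (real \<Rightarrow> real) \<Rightarrow>
    (real \<Rightarrow> real \<Rightarrow> real) \<Rightarrow> (real \<Rightarrow> real \<Rightarrow> real) \<Rightarrow> bool" where
  "weak_solution a b n \<epsilon> uin u uxxx \<longleftrightarrow>
     continuous_on ({0..} \<times> {a..b}) (\<lambda>(t, x). u t x) \<and>
     (\<forall>t\<ge>0. \<forall>x\<in>{a..b}. u t x \<ge> 0) \<and>
     (AE x in lborel. x \<in> {a<..<b} \<longrightarrow> u 0 x = uin x) \<and>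
     (AE t in lborel. t > 0 \<longrightarrow>
        (u t has_real_derivative 0) (at a within {a..b}) \<and>
        (u t has_real_derivative 0) (at b within {a..b})) \<and>
     (\<forall>T>0. set_integrable lborel (cyl T a b) (\<lambda>(t, x). mobility n \<epsilon> (u t x) * uxxx t x)) \<and>
     (\<forall>\<phi>\<in>test_fun2 ({0<..} \<times> UNIV).
        (LBINT z:{0<..} \<times> {a<..<b}. (case z of (t, x) \<Rightarrow>
           u t x * dt \<phi> t x / \<bar>ln \<epsilon>\<bar> + mobility n \<epsilon> (u t x) * uxxx t x * dx \<phi> t x)) = 0)"

(* deriv (B_eps n e) 0 may fail to exist; it only occurs multiplied by u = 0 *)
definition R_eps :: "real \<Rightarrow> real \<Rightarrow> (real \<Rightarrow> real \<Rightarrow> real) \<Rightarrow> (real \<Rightarrow> real \<Rightarrow> real) \<Rightarrow>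
    real \<Rightarrow> real \<Rightarrow> real" where
  "R_eps n \<epsilon> u uxxx t x =
     - \<bar>ln \<epsilon>\<bar> * deriv (B_eps n \<epsilon>) (u t x) *
       (\<epsilon> powr (3 - n) * u t x powr (n - 1) + (u t x)\<^sup>2) * (u t x * uxxx t x)"

definition T_eps :: "(real \<Rightarrow> real \<Rightarrow> real) \<Rightarrow> (real \<Rightarrow> real \<Rightarrow> real) \<Rightarrow> (real \<Rightarrow> real \<Rightarrow> real) \<Rightarrow>
    real \<Rightarrow> real \<Rightarrow> real" where
  "T_eps u ux uxxx t x = - (u t x * ux t x * uxxx t x)"

(* Properties (i)-(vi) of the solution.  The dissipation terms are non-negative and are written
   as [0,infinity]-valued integrals, so that the inequalities include their finiteness. *)

definition regularity :: "real \<Rightarrow> real \<Rightarrow> (real \<Rightarrow> real \<Rightarrow> real) \<Rightarrow> (real \<Rightarrow> real \<Rightarrow> real) \<Rightarrow> bool" where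
  "regularity a b u uxxx \<longleftrightarrow>
     (\<forall>T>0. Linf_H1 T a b u \<and> in_L 2 (cyl T a b) (\<lambda>(t, x). u t x * uxxx t x))"

definition mass_conservation ::
  "real \<Rightarrow> real \<Rightarrow> (real \<Rightarrow> real) \<Rightarrow> (real \<Rightarrow> real \<Rightarrow> real) \<Rightarrow> bool" where
  "mass_conservation a b uin u \<longleftrightarrow>
     (\<forall>t>0. (LBINT x:{a<..<b}. u t x) = (LBINT x:{a<..<b}. uin x))"

definition energy_inequality :: "real \<Rightarrow> real \<Rightarrow> real \<Rightarrow> real \<Rightarrow> (real \<Rightarrow> real) \<Rightarrow>
    (real \<Rightarrow> real \<Rightarrow> real) \<Rightarrow> (real \<Rightarrow> real \<Rightarrow> real) \<Rightarrow> (real \<Rightarrow> real \<Rightarrow> real) \<Rightarrow> bool" where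
  "energy_inequality a b n \<epsilon> duin u ux uxxx \<longleftrightarrow>
     (\<forall>t>0. (\<integral>\<^sup>+x\<in>{a<..<b}. ennreal ((ux t x)\<^sup>2 / 2) \<partial>lborel)
          + (\<integral>\<^sup>+z\<in>cyl t a b. (case z of (s, x) \<Rightarrow>
               ennreal (\<bar>ln \<epsilon>\<bar> * mobility n \<epsilon> (u s x) * (uxxx s x)\<^sup>2)) \<partial>lborel)
        \<le> (\<integral>\<^sup>+x\<in>{a<..<b}. ennreal ((duin x)\<^sup>2 / 2) \<partial>lborel))"

definition entropy_inequality :: "real \<Rightarrow> real \<Rightarrow> real \<Rightarrow> real \<Rightarrow>
    (real \<Rightarrow> real \<Rightarrow> real) \<Rightarrow> (real \<Rightarrow> real \<Rightarrow> real) \<Rightarrow> bool" where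
  "entropy_inequality a b n \<epsilon> u uxx \<longleftrightarrow>
     (\<forall>t>0. ennreal (LBINT x:{a<..<b}. B_eps n \<epsilon> (u t x))
        \<ge> (\<integral>\<^sup>+z\<in>cyl t a b. (case z of (s, x) \<Rightarrow> ennreal (u s x * (uxx s x)\<^sup>2)) \<partial>lborel)
          + ennreal (LBINT x:{a<..<b}. B_eps n \<epsilon> (u 0 x)))"

definition second_order_regularity ::
  "real \<Rightarrow> real \<Rightarrow> real \<Rightarrow> (real \<Rightarrow> real \<Rightarrow> real) \<Rightarrow> bool" where
  "second_order_regularity a b n u \<longleftrightarrow>
     (\<forall>T>0.
       (n < 2 \<longrightarrow> L2_H2 T a b u) \<and>
       (n \<ge> 2 \<longrightarrow> L2_H2 T a b (\<lambda>t x. u t x powr (3/2)) \<and>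
          (\<exists>g. in_L 4 (cyl T a b) (\<lambda>(t, x). g t x) \<and>
             (AE t in lborel. t \<in> {0<..<T} \<longrightarrow>
                weak_deriv_on {a<..<b} (\<lambda>x. u t x powr (3/4)) (g t)))))"

definition rho_equation :: "real \<Rightarrow> real \<Rightarrow> real \<Rightarrow> real \<Rightarrow> (real \<Rightarrow> real \<Rightarrow> real) \<Rightarrow>
    (real \<Rightarrow> real \<Rightarrow> real) \<Rightarrow> (real \<Rightarrow> real \<Rightarrow> real) \<Rightarrow> (real \<Rightarrow> real \<Rightarrow> real) \<Rightarrow> bool" where
  "rho_equation a b n \<epsilon> u ux uxx uxxx \<longleftrightarrow>
     (\<forall>T>0.
       L2_L1 T a b (T_eps u ux uxxx) \<and>
       (\<forall>K. compact K \<longrightarrow> K \<subseteq> cyl T a b \<longrightarrow>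
          set_integrable lborel K (\<lambda>(t, x). R_eps n \<epsilon> u uxxx t x)) \<and>
       (\<forall>\<phi>\<in>test_fun2 (cyl T a b).
          - (LBINT z:cyl T a b. (case z of (t, x) \<Rightarrow> B_eps n \<epsilon> (u t x) * dt \<phi> t x))
          = (LBINT z:cyl T a b. (case z of (t, x) \<Rightarrow> T_eps u ux uxxx t x * \<phi> t x))
            - (LBINT z:cyl T a b. (case z of (t, x) \<Rightarrow> R_eps n \<epsilon> u uxxx t x * dx \<phi> t x))) \<and>
       (AE t in lborel. t \<in> {0<..<T} \<longrightarrow>
          (\<forall>\<phi>. smooth \<phi> \<longrightarrow>
            (LBINT x:{a<..<b}. T_eps u ux uxxx t x * \<phi> x)
            = (LBINT x:{a<..<b}. u t x * (uxx t x)\<^sup>2 * \<phi> x)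
              - 5/6 * (LBINT x:{a<..<b}. (ux t x) ^ 3 * deriv \<phi> x)
              - 1/2 * (LBINT x:{a<..<b}. u t x * (ux t x)\<^sup>2 * deriv (deriv \<phi>) x))))"

definition thin_film_solution :: "real \<Rightarrow> real \<Rightarrow> real \<Rightarrow> real \<Rightarrow> (real \<Rightarrow> real) \<Rightarrow> (real \<Rightarrow> real) \<Rightarrow>
    (real \<Rightarrow> real \<Rightarrow> real) \<Rightarrow> bool" where
  "thin_film_solution a b n \<epsilon> uin duin u \<longleftrightarrow> (\<exists>ux uxx uxxx.
     spatial_derivs a b u ux uxx uxxx \<and>
     weak_solution a b n \<epsilon> uin u uxxx \<and>
     regularity a b u uxxx \<and>
     mass_conservation a b uin u \<and>
     energy_inequality a b n \<epsilon> duin u ux uxxx \<and>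
     entropy_inequality a b n \<epsilon> u uxx \<and>
     second_order_regularity a b n u \<and>
     rho_equation a b n \<epsilon> u ux uxx uxxx)"

section \<open>The limit\<close>

definition Sigma_set :: "real \<Rightarrow> real \<Rightarrow> (real \<Rightarrow> real \<Rightarrow> real) \<Rightarrow> real \<Rightarrow> real set" where
  "Sigma_set a b \<rho> t =
     {x\<in>{a<..<b}. \<exists>r>0. (LBINT y:{x - r<..<x + r} \<inter> {a<..<b}. 1 - \<rho> t y) = 0}"

(* A limit rho in L^p(0,T;W^{-1,1}) is only determined for almost every t.  Statements about
   rho(t) for every t in [0,T] refer to the representative r that is left-continuous into
   W^{-1,1} on (0,T] and whose value r0 at t = 0 is the W^{-1,1} limit of the initial values
   f k = rho^{eps_k}(0).  It is unique: each r t is determined up to null sets in x. *)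
definition time_representative :: "real \<Rightarrow> real \<Rightarrow> real \<Rightarrow> (nat \<Rightarrow> real \<Rightarrow> real) \<Rightarrow>
    (real \<Rightarrow> real \<Rightarrow> real) \<Rightarrow> (real \<Rightarrow> real \<Rightarrow> real) \<Rightarrow> bool" where
  "time_representative T a b f \<rho> r \<longleftrightarrow>
     set_borel_measurable lborel ({0..T} \<times> {a<..<b}) (\<lambda>(t, x). r t x) \<and>
     (\<forall>t\<in>{0..T}. AE x in lborel. x \<in> {a<..<b} \<longrightarrow> 0 \<le> r t x \<and> r t x \<le> 1) \<and>
     (AE z in lborel. z \<in> cyl T a b \<longrightarrow> (case z of (t, x) \<Rightarrow> r t x = \<rho> t x)) \<and>
     (\<forall>t\<in>{0<..T}. ((\<lambda>s. norm_Wm11 a b (\<lambda>x. r s x - r t x)) \<longlongrightarrow> 0) (at_left t)) \<and>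
     (\<lambda>k. norm_Wm11 a b (\<lambda>x. f k x - r 0 x)) \<longlonglongrightarrow> 0"

end

(* Write u for the solution at time t, V and W for its first two space derivatives.  Integrating the
   derivative of k(u) V W psi - k'(u) V^3 psi / 3 - k(u) V^2 psi' / 2, where k is a convex C^2
   truncation of the identity at a small level delta, shows that <T^eps, psi> is bounded below by an
   error that is integrable in time and small with eps, for every psi >= 0.  Hence the integrals of
   rho^eps(t) phi, phi >= 0, are increasing in t up to o(1); the limit is increasing in t, and its
   left-continuous representative is a supremum of averages over earlier time windows.

   Taking psi = 1 - phi with phi close to 1, the mass of rho^eps grows at least like the dissipation
   int u W^2.  Two integrations by parts and Cauchy-Schwarz, with int u = 1, bound the dissipation
   below by 9/l^6 if u is small somewhere, and by 144/l^6 if u is small at both end points; here l is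
   the measure of {u > delta}, which is at most the mass of rho^eps up to o(1).  So the mass l(t) of
   the limit satisfies l' >= c/l^6, that is (l^7)' >= 7c, in integrated form.  While l(t) < |Omega|, u is
   small somewhere; if the frontier of Sigma(t0) stays in Omega, then rho(t0) is not identically 1
   near the end points, and monotonicity and the uniform Hoelder bound make u small there at all
   earlier times. *)

theory Submission
  imports Defs "HOL-Real_Asymp.Real_Asymp"
begin

text \<open>The third derivative is controlled only by the dissipation of |ln eps| u^3 u_xxx^2,
  which degenerates where u is small. The truncation satisfies k(u)^2 <= u^3/delta, so the term k(u)
  u_x u_xxx psi costs 1/sqrt(delta |ln eps|); removing the truncation costs sqrt(delta), through
  u_x^3 on {u small}. The choice delta = |ln eps|^(-1/2) balances both at |ln eps|^(-1/4). The
  equation for rho^eps can be tested only inside Omega, and the entropy inequality compares only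
  with time 0; increments of the mass over (s,t) come from combining the two over all of (0,T).
  Constants: let m be the measure of the support to the left of x, shifted by q. The integral of m^2
  over the support is l^3/3 for q = 0, which needs one zero, and l^3/12 for q = l/2, which needs
  zeros at both ends. Squaring 3 and 12 gives 9 and 144, the derivative of l^7 a factor 7: 63 = 7*9,
  1008 = 7*144. The convergence controls time integrals only, never a single time, and the limit
  mass may jump upwards. Hence bounds at time t hold with a small time gap, and the growth of l^7 is
  proved on partitions.\<close>

abbreviation evt :: "(nat => bool) => bool" (binder "EV " 10) where
 "evt Q \<equiv> eventually Q sequentially"

abbreviation tends_seq :: "(nat => 'a::topological_space) => 'a => bool" (infix "---->" 60) where
 "tends_seq \<equiv> LIMSEQ"

abbreviation L1_on :: "'a::euclidean_space set => ('a => real) => bool" where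
 "L1_on \<equiv> set_integrable lborel"

abbreviation meas_on :: "'a::euclidean_space set => ('a => real) => bool" where
 "meas_on \<equiv> set_borel_measurable lborel"

section \<open>Smooth cut-off functions\<close>

text \<open>The derivative is an existential witness instead of \<open>deriv\<close>, so closure
  under sums, products, affine substitution and inverses is an induction on the order;
  \<open>smooth_iff_Ck\<close> carries the results back to \<open>smooth\<close>.\<close>

primrec Ck :: "nat => (real => real) => bool" where
 "Ck 0 f \<longleftrightarrow> True"
| "Ck (Suc k) f \<longleftrightarrow> (\<exists>f'. (\<forall>x. (f has_real_derivative f' x) (at x)) & Ck k f')"

lemma Ck_SucD: "Ck (Suc k) f ==> Ck k f"
proof (induction k arbitrary: f)
 case (Suc k)
 then obtain f' where "\<forall>x. (f has_real_derivative f' x) (at x)" "Ck (Suc k) f'"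
  by auto
 with Suc.IH[of f'] show ?case by auto
qed simp

lemma Ck_deriv_funpow: "Ck (Suc k) f ==> (deriv ^^ k) f field_differentiable (at x)"
proof (induction k arbitrary: f)
 case 0
 then show ?case by (auto simp: field_differentiable_def)
next
 case (Suc k)
 then obtain f' where "\<forall>x. (f has_real_derivative f' x) (at x)" "Ck (Suc k) f'"
  by auto
 moreover from this have "deriv f = f'"
  by (auto intro: DERIV_imp_deriv)
 ultimately show ?case
  using Suc.IH[of f'] by (simp add: funpow_Suc_right del: funpow.simps)
qed

lemma smooth_iff_Ck: "smooth f \<longleftrightarrow> (\<forall>k. Ck k f)"
proof
 assume f: "\<forall>k. Ck k f"
 show "smooth f"
  unfolding smooth_def using f Ck_deriv_funpow by blast
next
 have "Ck k f" if "\<forall>j x. (deriv ^^ j) f field_differentiable (at x)" for k f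
  using that
 proof (induction k arbitrary: f)
  case (Suc k)
  have 1: "(f has_real_derivative deriv f x) (at x)" for x
   using Suc.prems[rule_format, of 0 x] by (simp add: DERIV_deriv_iff_field_differentiable)
  have "\<forall>j x. (deriv ^^ j) (deriv f) field_differentiable (at x)"
  proof safe
   fix j x
   show "(deriv ^^ j) (deriv f) field_differentiable (at x)"
    using Suc.prems[rule_format, of "Suc j" x] by (simp add: funpow_Suc_right del: funpow.simps)
  qed
  with Suc.IH[of "deriv f"] have "Ck k (deriv f)"
   by blast
  with 1 show ?case by auto
 qed simp
 moreover assume "smooth f"
 ultimately show "\<forall>k. Ck k f"
  unfolding smooth_def by blast
qed

lemma smoothI: "(!!x. (f has_real_derivative f' x) (at x)) ==> smooth f' ==> smooth f"
 unfolding smooth_iff_Ck by (metis Ck.simps not0_implies_Suc)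

lemma Ck_const: "Ck k (%x. c)"
proof (induction k arbitrary: c)
 case (Suc k)
 have "\<forall>x. ((%x. c) has_real_derivative 0) (at x)" by auto
 with Suc[of 0] show ?case by (auto intro!: exI[of _ "%x. 0"])
qed simp

lemma Ck_add: "Ck k f ==> Ck k g ==> Ck k (%x. f x + g x)"
proof (induction k arbitrary: f g)
 case (Suc k)
 then obtain f' g' where "\<forall>x. (f has_real_derivative f' x) (at x)" "Ck k f'"
  "\<forall>x. (g has_real_derivative g' x) (at x)" "Ck k g'" by auto
 with Suc.IH[of f' g'] show ?case
  by (auto intro!: exI[of _ "%x. f' x + g' x"] derivative_intros)
qed simp

lemma Ck_mult: "Ck k f ==> Ck k g ==> Ck k (%x. f x * g x)"
proof (induction k arbitrary: f g)
 case (Suc k)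
 then obtain f' g' where *: "\<forall>x. (f has_real_derivative f' x) (at x)" "Ck k f'"
  "\<forall>x. (g has_real_derivative g' x) (at x)" "Ck k g'" by auto
 have "Ck k (%x. f' x * g x + f x * g' x)"
  using Suc.prems Suc.IH[of f' g] Suc.IH[of f g'] * by (intro Ck_add) (auto dest: Ck_SucD simp del: Ck.simps)
 moreover have "\<forall>x. ((%x. f x * g x) has_real_derivative f' x * g x + f x * g' x) (at x)"
  using * by (auto intro!: derivative_eq_intros)
 ultimately show ?case by auto
qed simp

lemma Ck_affine: "Ck k f ==> Ck k (%x. f (c * x + d))"
proof (induction k arbitrary: f)
 case (Suc k)
 then obtain f' where *: "\<forall>x. (f has_real_derivative f' x) (at x)" "Ck k f'" by auto
 have "\<forall>x. ((%x. f (c * x + d)) has_real_derivative f' (c * x + d) * c) (at x)"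
  by (auto intro!: DERIV_chain2[of f] *(1)[rule_format] derivative_eq_intros)
 moreover have "Ck k (%x. f' (c * x + d) * c)"
  using Suc.IH[of f'] * by (intro Ck_mult Ck_const) auto
 ultimately show ?case
  by auto
qed simp

lemma Ck_inverse:
 assumes "!!x. f x \<noteq> 0"
 shows "Ck k f ==> Ck k (%x. inverse (f x))"
proof (induction k)
 case (Suc k)
 then obtain f' where *: "\<forall>x. (f has_real_derivative f' x) (at x)" "Ck k f'" by auto
 have "\<forall>x. ((%x. inverse (f x)) has_real_derivative (- 1) * (inverse (f x) * f' x * inverse (f x))) (at x)"
  using assms * by (auto intro!: derivative_eq_intros)
 moreover have "Ck k (%x. (- 1) * (inverse (f x) * f' x * inverse (f x)))"
  using Suc * by (intro Ck_mult Ck_const) (auto dest: Ck_SucD simp del: Ck.simps)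
 ultimately show ?case
  by auto
qed simp

lemma smooth_const: "smooth (%x. c)"
 and smooth_add: "smooth f ==> smooth g ==> smooth (%x. f x + g x)"
 and smooth_mult: "smooth f ==> smooth g ==> smooth (%x. f x * g x)"
 and smooth_affine: "smooth f ==> smooth (%x. f (c * x + d))"
 and smooth_inverse: "smooth f ==> (!!x. f x \<noteq> 0) ==> smooth (%x. inverse (f x))"
 by (auto simp: smooth_iff_Ck intro: Ck_const Ck_add Ck_mult Ck_affine Ck_inverse)

lemma smooth_diff: "smooth f ==> smooth g ==> smooth (%x. f x - g x)"
 using smooth_add[of f "%x. (- 1) * g x"] smooth_mult[of "%x. - 1" g] smooth_const[of "- 1"] by simp

lemma smooth_has_deriv: "smooth f ==> (f has_real_derivative deriv f x) (at x)"
 unfolding smooth_def DERIV_deriv_iff_field_differentiable[symmetric]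
 by (metis funpow_0)

lemma smooth_deriv: "smooth f ==> smooth (deriv f)"
 unfolding smooth_def by (metis comp_apply funpow_Suc_right)

lemma smooth_continuous: "smooth f ==> continuous_on S f"
 by (meson DERIV_isCont continuous_at_imp_continuous_on smooth_has_deriv)

lemma smooth_measurable: "smooth f ==> f \<in> borel_measurable borel"
 by (intro borel_measurable_continuous_onI smooth_continuous)

text \<open>The functions p(1/x) exp(-1/x), extended by 0 to x <= 0, form a family closed under
  differentiation; this gives smoothness at 0 without formulas for the higher derivatives.\<close>

definition exp_cut :: "real poly => real => real" where
 "exp_cut p x = (if x > 0 then poly p (1 / x) * exp (- (1 / x)) else 0)"

lemma poly_times_exp_tendsto_0: "((%y. poly p y * exp (- y)) \<longlongrightarrow> 0) (at_top :: real filter)"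
proof (induction p)
 case 0
 then show ?case by simp
next
 case (pCons c p)
 have c: "((%y::real. c * exp (- y)) \<longlongrightarrow> 0) at_top"
  by (intro tendsto_mult_right_zero filterlim_compose[OF exp_at_bot] filterlim_uminus_at_bot_at_top)
 have d: "((%y. y * (poly p y * exp (- y))) \<longlongrightarrow> 0) at_top"
 proof -
  have "((%y::real. \<Sum>i\<le>degree p. coeff p i * (y ^ (i + 1) / exp y)) \<longlongrightarrow> (\<Sum>i\<le>degree p. coeff p i * 0)) at_top"
   by (intro tendsto_sum tendsto_mult tendsto_const tendsto_power_div_exp_0)
  moreover have "(\<Sum>i\<le>degree p. coeff p i * (y ^ (i + 1) / exp y)) = y * (poly p y * exp (- y))" for y
   by (simp add: poly_altdef sum_distrib_left sum_distrib_right exp_minus field_simps)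
  ultimately show ?thesis by simp
 qed
 show ?case
  using tendsto_add[OF c d] by (simp add: algebra_simps)
qed

text \<open>For x > 0 the chain rule gives (p - p')(1/x) exp(-1/x) / x^2, whence the factor X^2 in
  the new polynomial. At 0 the difference quotient is again in the family, with polynomial X p, and
  \<open>poly_times_exp_tendsto_0\<close> at 1/x gives the limit 0.\<close>

lemma exp_cut_has_deriv:
 "(exp_cut p has_real_derivative exp_cut ([:0, 0, 1:] * (p - pderiv p)) x) (at x)"
proof -
 consider "x < 0" | "x > 0" | "x = 0" by linarith
 then show ?thesis
 proof cases
  case 1
  have "((%x. 0) has_real_derivative 0) (at x)" by simp
  then have "(exp_cut p has_real_derivative 0) (at x)"
   by (rule DERIV_cong_ev[THEN iffD1, rotated 3, OF _ refl _ refl])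
    (use eventually_nhds_in_open[of "{..<0}" x] 1 in \<open>auto elim!: eventually_mono simp: exp_cut_def\<close>)
  then show ?thesis using 1 by (simp add: exp_cut_def)
 next
  case 2
  have "((%x. poly p (1 / x) * exp (- (1 / x))) has_real_derivative
    poly (pderiv p) (1 / x) * (- (1 / x^2)) * exp (- (1 / x)) + poly p (1 / x) * (exp (- (1 / x)) * (1 / x^2))) (at x)"
   using 2 by (auto intro!: derivative_eq_intros DERIV_chain2[OF poly_DERIV] simp: power2_eq_square)
  then have "(exp_cut p has_real_derivative
    poly (pderiv p) (1 / x) * (- (1 / x^2)) * exp (- (1 / x)) + poly p (1 / x) * (exp (- (1 / x)) * (1 / x^2))) (at x)"
   by (rule DERIV_cong_ev[THEN iffD1, rotated 3, OF _ refl _ refl])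
    (use eventually_nhds_in_open[of "{0<..}" x] 2 in \<open>auto elim!: eventually_mono simp: exp_cut_def\<close>)
  moreover have "poly (pderiv p) (1 / x) * (- (1 / x^2)) * exp (- (1 / x)) + poly p (1 / x) * (exp (- (1 / x)) * (1 / x^2))
    = exp_cut ([:0, 0, 1:] * (p - pderiv p)) x"
   using 2 by (simp add: exp_cut_def power2_eq_square field_simps)
  ultimately show ?thesis by simp
 next
  case 3
  have "((%x. exp_cut p x / x) \<longlongrightarrow> 0) (at_right 0)"
  proof -
   have "((%x. poly ([:0, 1:] * p) (inverse x) * exp (- (inverse x))) \<longlongrightarrow> 0) (at_right (0::real))"
    by (rule filterlim_compose[OF poly_times_exp_tendsto_0 filterlim_inverse_at_top_right])
   then show ?thesis
    by (rule Lim_transform_eventually)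
     (auto simp: exp_cut_def eventually_at_filter field_simps)
  qed
  moreover have "((%x. exp_cut p x / x) \<longlongrightarrow> 0) (at_left 0)"
   by (rule Lim_transform_eventually[OF tendsto_const])
    (auto simp: exp_cut_def eventually_at_filter)
  ultimately have "((%x. exp_cut p x / x) \<longlongrightarrow> 0) (at 0)"
   by (simp add: filterlim_split_at)
  then show ?thesis
   using 3 by (simp add: DERIV_def exp_cut_def)
 qed
qed

lemma smooth_exp_cut: "smooth (exp_cut p)"
proof -
 have "Ck k (exp_cut p)" for k p
  by (induction k arbitrary: p) (auto intro: exp_cut_has_deriv)
 then show ?thesis by (simp add: smooth_iff_Ck)
qed

definition smooth_step :: "real => real" where
 "smooth_step x = exp_cut 1 x * inverse (exp_cut 1 x + exp_cut 1 (1 - x))"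

lemma exp_cut_1_nonneg: "exp_cut 1 x >= 0" and exp_cut_1_pos: "x > 0 ==> exp_cut 1 x > 0"
 by (auto simp: exp_cut_def)

lemma exp_cut_1_sum_pos: "exp_cut 1 x + exp_cut 1 (1 - x) > 0"
 using exp_cut_1_nonneg[of x] exp_cut_1_nonneg[of "1 - x"] exp_cut_1_pos[of x] exp_cut_1_pos[of "1 - x"]
 by (cases "x > 0") auto

lemma smooth_smooth_step: "smooth smooth_step"
 unfolding smooth_step_def[abs_def]
 using smooth_affine[OF smooth_exp_cut, of 1 "-1" 1] exp_cut_1_sum_pos
 by (intro smooth_mult smooth_inverse smooth_add smooth_exp_cut) (auto simp: less_imp_neq[symmetric] order_less_imp_not_eq2)

lemma smooth_step_le_0: "x <= 0 ==> smooth_step x = 0"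
 by (simp add: smooth_step_def exp_cut_def)

lemma smooth_step_ge_1: "x >= 1 ==> smooth_step x = 1"
 using exp_cut_1_pos[of x] by (simp add: smooth_step_def exp_cut_def)

lemma smooth_step_nonneg: "smooth_step x >= 0" and smooth_step_le_1: "smooth_step x <= 1"
 using exp_cut_1_nonneg[of x] exp_cut_1_nonneg[of "1 - x"] exp_cut_1_sum_pos[of x]
 by (auto simp: smooth_step_def field_simps)

lemma smooth_step_pos: "x > 0 ==> smooth_step x > 0"
 using exp_cut_1_pos[of x] exp_cut_1_sum_pos[of x] by (simp add: smooth_step_def)

text \<open>The ramps of width 1/j lie inside the interval from c to d, so the support does not grow
  with j and the pointwise limit is the indicator of the open interval.\<close>

definition bump :: "real => real => nat => real => real" where
 "bump c d j x = smooth_step (real j * (x - c)) * smooth_step (real j * (d - x))"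

lemma smooth_bump: "smooth (bump c d j)"
proof -
 have "smooth (%x. smooth_step (real j * x + - real j * c) * smooth_step (- real j * x + real j * d))"
  by (intro smooth_mult smooth_affine smooth_smooth_step)
 then show ?thesis by (simp add: bump_def[abs_def] algebra_simps)
qed

lemma bump_nonneg: "bump c d j x >= 0" and bump_le_1: "bump c d j x <= 1"
 by (auto simp: bump_def smooth_step_nonneg smooth_step_le_1 mult_le_one)

lemma bump_outside: "x \<notin> {c<..<d} ==> bump c d j x = 0"
proof -
 assume "x \<notin> {c<..<d}"
 then have "real j * (x - c) <= 0 \<or> real j * (d - x) <= 0"
  by (auto simp: mult_nonneg_nonpos)
 then show ?thesis by (auto simp: bump_def smooth_step_le_0)
qed

lemma bump_pos: "x \<in> {c<..<d} ==> j > 0 ==> bump c d j x > 0"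
 by (auto simp: bump_def intro!: mult_pos_pos smooth_step_pos)

lemma bump_tendsto: "(%j. bump c d j x) ----> indicator {c<..<d} x"
proof (cases "x \<in> {c<..<d}")
 case True
 obtain N where N: "1 / (x - c) <= real N" "1 / (d - x) <= real N"
  by (metis max.bounded_iff real_arch_simple)
 have "bump c d j x = 1" if "j >= N" for j
 proof -
  have "1 / (x - c) <= real j" "1 / (d - x) <= real j" using N that by linarith+
  then show ?thesis using True
   by (auto simp: bump_def smooth_step_ge_1 field_simps)
 qed
 then show ?thesis using True
  by (intro tendsto_eventually) (auto simp: eventually_at_top_linorder)
qed (simp add: bump_outside)

lemma bump_test_fun: "{c..d} <= S ==> bump c d j \<in> test_fun S"
 unfolding test_fun_def using smooth_bump[of c d j] bump_outside[of _ c d j]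
 by (auto intro!: exI[of _ "{c..d}"])

lemma test_fun_deriv_outside:
 fixes \<phi> :: "real => real"
 assumes "!!x. x \<notin> K ==> \<phi> x = 0" "compact K" "x \<notin> K"
 shows "deriv \<phi> x = 0"
proof -
 have "eventually (%y. \<phi> y = 0) (nhds x)"
  by (rule eventually_mono[OF eventually_nhds_in_open[of "- K" x]])
   (use assms compact_imp_closed[of K] in \<open>auto simp: open_Compl\<close>)
 then have "(\<phi> has_real_derivative 0) (at x)"
  using DERIV_cong_ev[of x x \<phi> "%x. 0" 0 0] by simp
 then show ?thesis by (rule DERIV_imp_deriv)
qed

lemma compact_support_bounded:
 assumes "continuous_on UNIV f" "compact K" "!!x. x \<notin> K ==> f x = (0::real)"
 obtains B where "!!x. \<bar>f x\<bar> <= B" "B > 0"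
proof -
 have "bounded (f ` K)"
  using assms by (meson compact_continuous_image compact_imp_bounded continuous_on_subset subset_UNIV)
 then obtain B where "B > 0" "!!x. x \<in> K ==> \<bar>f x\<bar> <= B"
  by (auto simp: bounded_pos)
 then show thesis
  using assms(3) by (intro that[of B]) (metis abs_zero less_eq_real_def)
qed

lemma test_fun_bounded:
 assumes "\<phi> \<in> test_fun S"
 obtains B where "!!x. \<bar>\<phi> x\<bar> <= B" "!!x. \<bar>deriv \<phi> x\<bar> <= B" "!!x. \<bar>deriv (deriv \<phi>) x\<bar> <= B" "B > 0"
proof -
 obtain K where K: "compact K" "!!x. x \<notin> K ==> \<phi> x = 0" and s: "smooth \<phi>"
  using assms by (auto simp: test_fun_def)
 have K1: "!!x. x \<notin> K ==> deriv \<phi> x = 0"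
  using test_fun_deriv_outside K by blast
 have K2: "!!x. x \<notin> K ==> deriv (deriv \<phi>) x = 0"
  using test_fun_deriv_outside K K1 by blast
 obtain B0 where "!!x. \<bar>\<phi> x\<bar> <= B0" "B0 > 0"
  using compact_support_bounded[OF smooth_continuous[OF s] K] by metis
 moreover obtain B1 where "!!x. \<bar>deriv \<phi> x\<bar> <= B1" "B1 > 0"
  using compact_support_bounded[OF smooth_continuous[OF smooth_deriv[OF s]] K(1) K1] by metis
 moreover obtain B2 where "!!x. \<bar>deriv (deriv \<phi>) x\<bar> <= B2" "B2 > 0"
  using compact_support_bounded[OF smooth_continuous[OF smooth_deriv[OF smooth_deriv[OF s]]] K(1) K2] by metis
 ultimately show thesis
  by (intro that[of "max B0 (max B1 B2)"]) (auto simp: le_max_iff_disj)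
qed

section \<open>Primitives of locally integrable functions\<close>

text \<open>F is locally absolutely continuous on S with density f, written as the fundamental
  theorem on compact subintervals. S need not be an interval, so the positivity set of u fits; f
  need only be integrable, as is the case for u_xxx.\<close>

definition prim_on :: "real set => (real => real) => (real => real) => bool" where
 "prim_on S F f \<longleftrightarrow> (\<forall>c d. c <= d --> {c..d} <= S -->
  L1_on {c..d} f & F d - F c = (LBINT x:{c..d}. f x))"

lemma prim_onD:
 assumes "prim_on S F f" "c <= d" "{c..d} <= S"
 shows "L1_on {c..d} f" "F d - F c = (LBINT x:{c..d}. f x)"
 using assms by (auto simp: prim_on_def)

lemma prim_on_subset: "prim_on S F f ==> S' <= S ==> prim_on S' F f"
 unfolding prim_on_def by (meson subset_trans)

lemma LBINT_Icc_split:
 fixes f :: "real => real"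
 assumes "L1_on {a..c} f" "a <= b" "b <= c"
 shows "(LBINT x:{a..c}. f x) = (LBINT x:{a..b}. f x) + (LBINT x:{b..c}. f x)"
proof -
 have *: "{a..c} = {a..b} \<union> {b..c}" using assms by auto
 have "AE x in lborel. x \<noteq> b" by (rule AE_lborel_singleton)
 then have "AE x in lborel. \<not> (x \<in> {a..b} & x \<in> {b..c})"
  by eventually_elim auto
 then show ?thesis
  unfolding * using assms
  by (intro set_integral_Un_AE) (auto intro!: set_integrable_subset[OF assms(1)])
qed

lemma set_integrable_continuous_mult:
 fixes f g :: "real => real"
 assumes f: "L1_on {c..d} f" and g: "continuous_on {c..d} g"
 shows "L1_on {c..d} (%x. f x * g x)"
proof -
 obtain B where B: "!!x. x \<in> {c..d} ==> \<bar>g x\<bar> <= B"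
 proof -
  obtain B where "\<forall>x\<in>g ` {c..d}. norm x <= B"
   using compact_imp_bounded[OF compact_continuous_image[OF g compact_Icc]]
   unfolding bounded_iff by blast
  then show thesis by (intro that[of B]) simp
 qed
 have m: "(%x. indicator {c..d} x *\<^sub>R g x) \<in> borel_measurable lborel"
  using borel_integrable_atLeastAtMost'[OF g]
  by (auto simp: set_integrable_def)
 show ?thesis
 proof (rule set_integrable_bound[of lborel _ "%x. B * f x"])
  show "L1_on {c..d} (%x. B * f x)" using f by simp
  have "(%x. (indicator {c..d} x *\<^sub>R f x) * (indicator {c..d} x *\<^sub>R g x)) \<in> borel_measurable lborel"
   using f m by (intro borel_measurable_times) (auto simp: set_integrable_def)
  then show "meas_on {c..d} (%x. f x * g x)"
   unfolding set_borel_measurable_def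
   by (rule measurable_cong[THEN iffD1, rotated]) (auto simp: indicator_def)
  show "AE x\<in>{c..d} in lborel. norm (f x * g x) <= norm (B * f x)"
  proof (intro always_eventually allI impI)
   fix x assume "x \<in> {c..d}"
   with B[OF this] show "norm (f x * g x) <= norm (B * f x)"
    by (simp add: abs_mult mult.commute[of "\<bar>f x\<bar>"] mult_right_mono)
  qed
 qed
qed

text \<open>An increment that agrees with an integral up to o(length) in the sense of a fixed
 integrable majorant agrees exactly; this replaces partitions.\<close>

lemma increment_eq_integral:
 fixes H :: "real => real"
 assumes cd: "c <= d" and h: "L1_on {c..d} h" and m: "L1_on {c..d} m"
  and m0: "!!x. m x >= 0"
  and local: "!!\<eta> x. \<eta> > 0 ==> x \<in> {c..d} ==> \<exists>\<delta>>0. \<forall>p q. c <= p --> p <= x --> x <= q --> q <= d --> q - p < \<delta> -->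
   \<bar>H q - H p - (LBINT x:{p..q}. h x)\<bar> <= \<eta> * (LBINT x:{p..q}. m x)"
 shows "H d - H c = (LBINT x:{c..d}. h x)"
proof -
 have *: "\<bar>H d - H c - (LBINT x:{c..d}. h x)\<bar> <= \<eta> * (LBINT x:{c..d}. m x)" if \<eta>: "\<eta> > 0" for \<eta>
 proof -
  \<comment> \<open>Both sides are additive over adjacent intervals, so bisection spreads the local
    estimate to the whole interval.\<close>
  have "c <= c & d <= d --> \<bar>H d - H c - (LBINT x:{c..d}. h x)\<bar> <= \<eta> * (LBINT x:{c..d}. m x)"
   using cd
  proof (induction rule: Bolzano[where P="%p q. c <= p & q <= d -->
    \<bar>H q - H p - (LBINT x:{p..q}. h x)\<bar> <= \<eta> * (LBINT x:{p..q}. m x)"])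
   case (trans p q r)
   show ?case
   proof
    assume 1: "c <= p & r <= d"
    have hi: "L1_on {p..r} h" and mi: "L1_on {p..r} m"
     by (rule set_integrable_subset[OF h] set_integrable_subset[OF m]; use 1 in auto)+
    have "(LBINT x:{p..r}. h x) = (LBINT x:{p..q}. h x) + (LBINT x:{q..r}. h x)"
     "(LBINT x:{p..r}. m x) = (LBINT x:{p..q}. m x) + (LBINT x:{q..r}. m x)"
     using LBINT_Icc_split hi mi trans by blast+
    moreover have "\<bar>H q - H p - (LBINT x:{p..q}. h x)\<bar> <= \<eta> * (LBINT x:{p..q}. m x)"
     "\<bar>H r - H q - (LBINT x:{q..r}. h x)\<bar> <= \<eta> * (LBINT x:{q..r}. m x)"
     using trans 1 by auto
    ultimately show "\<bar>H r - H p - (LBINT x:{p..r}. h x)\<bar> <= \<eta> * (LBINT x:{p..r}. m x)"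
     by (simp add: distrib_left)
   qed
  next
   case (local x)
   then obtain \<delta> where "\<delta> > 0" "\<forall>p q. c <= p --> p <= x --> x <= q --> q <= d --> q - p < \<delta> -->
   \<bar>H q - H p - (LBINT x:{p..q}. h x)\<bar> <= \<eta> * (LBINT x:{p..q}. m x)"
    using assms(5)[OF \<eta>, of x] by auto
   then show ?case by (intro exI[of _ \<delta>]) auto
  qed
  then show ?thesis by simp
 qed
 have M: "0 <= (LBINT x:{c..d}. m x)"
  unfolding set_lebesgue_integral_def by (intro integral_nonneg_AE) (auto simp: m0)
 have "\<bar>H d - H c - (LBINT x:{c..d}. h x)\<bar> <= 0"
 proof (rule field_le_epsilon)
  fix e :: real assume e: "e > 0"
  show "\<bar>H d - H c - (LBINT x:{c..d}. h x)\<bar> <= 0 + e"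
  proof -
   have "\<bar>H d - H c - (LBINT x:{c..d}. h x)\<bar> <= e / (1 + (LBINT x:{c..d}. m x)) * (LBINT x:{c..d}. m x)"
    by (rule *) (use e M in auto)
   also have "\<dots> <= e"
    using e M by (simp add: divide_le_eq mult_left_mono)
   finally show ?thesis by simp
  qed
 qed
 then show ?thesis by simp
qed

lemma set_integral_abs_le:
 assumes "set_integrable M A f"
 shows "\<bar>LINT x:A|M. f x\<bar> <= (LINT x:A|M. \<bar>f x :: real\<bar>)"
 using integral_abs_bound[of M "%x. indicator A x * f x"]
 by (simp add: set_lebesgue_integral_def abs_mult)

text \<open>By the mean value theorem an increment of F(u) is F'(xi) times an increment of u, hence
  the integral of F'(xi) \<open>ux\<close>. Continuity makes F'(xi) close to F'(u y) on short
  intervals, and |\<open>ux\<close>| is the majorant for \<open>increment_eq_integral\<close>. That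
  the image of S is an interval keeps xi in the domain of F'.\<close>

lemma prim_on_chain:
 assumes u: "prim_on S u ux" and F: "!!y. y \<in> u ` S ==> (F has_real_derivative F' y) (at y)"
  and F': "continuous_on (u ` S) F'" and cu: "continuous_on S u"
  and conv: "is_interval (u ` S)"
 shows "prim_on S (%x. F (u x)) (%x. F' (u x) * ux x)"
 unfolding prim_on_def
proof safe
 fix c d assume cd: "c <= d" "{c..d} <= S"
 note ui = prim_onD[OF u cd]
 have cF: "continuous_on S (%x. F' (u x))"
  using continuous_on_compose2[OF F' cu] by auto
 show int: "L1_on {c..d} (%x. F' (u x) * ux x)"
  using set_integrable_continuous_mult[OF ui(1), of "%x. F' (u x)"] continuous_on_subset[OF cF cd(2)]
  by (simp add: mult.commute)
 show "F (u d) - F (u c) = (LBINT x:{c..d}. F' (u x) * ux x)"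
 proof (rule increment_eq_integral[where m="%x. \<bar>ux x\<bar>"])
  fix \<eta> x :: real assume \<eta>: "\<eta> > 0" and x: "x \<in> {c..d}"
  have xS: "x \<in> S" using x cd by auto
  obtain \<delta>1 where d1: "\<delta>1 > 0" "!!y. y \<in> u ` S ==> \<bar>y - u x\<bar> < \<delta>1 ==> \<bar>F' y - F' (u x)\<bar> < \<eta> / 2"
   using F'[unfolded continuous_on_iff dist_real_def, THEN bspec, OF imageI[OF xS], rule_format, OF half_gt_zero[OF \<eta>]]
   by blast
  obtain \<delta> where d: "\<delta> > 0" "!!y. y \<in> S ==> \<bar>y - x\<bar> < \<delta> ==> \<bar>u y - u x\<bar> < \<delta>1"
   using cu[unfolded continuous_on_iff dist_real_def, THEN bspec, OF xS, rule_format, OF d1(1)]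
   by blast
  show "\<exists>\<delta>>0. \<forall>p q. c <= p --> p <= x --> x <= q --> q <= d --> q - p < \<delta> -->
   \<bar>F (u q) - F (u p) - (LBINT x:{p..q}. F' (u x) * ux x)\<bar> <= \<eta> * (LBINT x:{p..q}. \<bar>ux x\<bar>)"
  proof (intro exI[of _ \<delta>] conjI allI impI d)
   fix p q assume pq: "c <= p" "p <= x" "x <= q" "q <= d" "q - p < \<delta>"
   have sub: "{p..q} <= S" using pq cd by auto
   have near: "\<bar>u y - u x\<bar> < \<delta>1" if "y \<in> {p..q}" for y
    using d(2)[OF subsetD[OF sub that]] that pq by auto
   have up: "L1_on {p..q} ux" "u q - u p = (LBINT x:{p..q}. ux x)"
    using prim_onD[OF u _ sub] pq by auto
   obtain \<xi> where xi: "F (u q) - F (u p) = F' \<xi> * (u q - u p)" "\<xi> \<in> u ` S" "\<bar>\<xi> - u x\<bar> < \<delta>1"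
   proof -
    have pqS: "u p \<in> u ` S" "u q \<in> u ` S" using pq by (auto intro!: imageI subsetD[OF sub])
    have nn: "\<bar>u p - u x\<bar> < \<delta>1" "\<bar>u q - u x\<bar> < \<delta>1" using near pq by auto
    have in1: "!!z. min (u p) (u q) <= z ==> z <= max (u p) (u q) ==> z \<in> u ` S"
     using conv pqS unfolding is_interval_1 by (metis max_def min_def)
    consider "u p = u q" | "u p < u q" | "u q < u p" by linarith
    then show thesis
    proof cases
     case 1 then show ?thesis using that[of "u p"] pqS nn by auto
    next
     case 2
     have "\<exists>z>u p. z < u q & F (u q) - F (u p) = (u q - u p) * F' z"
      by (rule MVT2[OF 2]) (use in1 F 2 in auto)
     then show ?thesis using that in1 nn 2 by (auto simp: mult.commute)
    next
     case 3
     have "\<exists>z>u q. z < u p & F (u p) - F (u q) = (u p - u q) * F' z"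
      by (rule MVT2[OF 3]) (use in1 F 3 in auto)
     then obtain z where z: "z > u q" "z < u p" "F (u p) - F (u q) = (u p - u q) * F' z" by auto
     show ?thesis
      by (rule that[of z]) (use z in1 nn 3 in \<open>auto simp: algebra_simps\<close>)
    qed
   qed
   have i1: "L1_on {p..q} (%x. F' (u x) * ux x)"
    by (rule set_integrable_subset[OF int]) (use pq in auto)
   have i2: "L1_on {p..q} (%x. F' \<xi> * ux x)" using up by simp
   have "F (u q) - F (u p) - (LBINT x:{p..q}. F' (u x) * ux x)
     = (LBINT y:{p..q}. F' \<xi> * ux y - F' (u y) * ux y)"
    using xi up i1 i2 by (simp add: set_integral_diff)
   also have "\<bar>\<dots>\<bar> <= (LBINT y:{p..q}. \<bar>F' \<xi> * ux y - F' (u y) * ux y\<bar>)"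
    using i1 i2 by (intro set_integral_abs_le) auto
   also have "\<dots> <= (LBINT y:{p..q}. \<eta> * \<bar>ux y\<bar>)"
   proof (rule set_integral_mono)
    fix y assume y: "y \<in> {p..q}"
    have "\<bar>F' \<xi> - F' (u x)\<bar> < \<eta> / 2" "\<bar>F' (u y) - F' (u x)\<bar> < \<eta> / 2"
     using d1(2)[OF xi(2,3)] d1(2)[OF imageI[OF subsetD[OF sub y]] near[OF y]] by auto
    then have "\<bar>F' \<xi> - F' (u y)\<bar> <= \<eta>" by linarith
    then show "\<bar>F' \<xi> * ux y - F' (u y) * ux y\<bar> <= \<eta> * \<bar>ux y\<bar>"
     by (simp add: left_diff_distrib[symmetric] abs_mult mult_right_mono)
   qed (use up i1 i2 in \<open>auto intro!: set_integrable_abs\<close>)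
   finally show "\<bar>F (u q) - F (u p) - (LBINT x:{p..q}. F' (u x) * ux x)\<bar> <= \<eta> * (LBINT x:{p..q}. \<bar>ux x\<bar>)"
    by simp
  qed
 qed (use cd int ui in \<open>auto intro: set_integrable_abs\<close>)
qed

text \<open>F q G q - F p G p = (F q - F p) G q + F p (G q - G p) replaces a pointwise product rule,
  since the factors need not be differentiable at every point; the majorant is |f| + |g|.\<close>

lemma prim_on_mult:
 assumes F: "prim_on S F f" and G: "prim_on S G g" and cF: "continuous_on S F" and cG: "continuous_on S G"
 shows "prim_on S (%x. F x * G x) (%x. f x * G x + F x * g x)"
 unfolding prim_on_def
proof safe
 fix c d assume cd: "c <= d" "{c..d} <= S"
 note Fi = prim_onD[OF F cd] and Gi = prim_onD[OF G cd]
 have int1: "L1_on {c..d} (%x. f x * G x)" 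
  using set_integrable_continuous_mult[OF Fi(1)] continuous_on_subset[OF cG cd(2)] by blast
 have int2: "L1_on {c..d} (%x. F x * g x)" 
  using set_integrable_continuous_mult[OF Gi(1), of F] continuous_on_subset[OF cF cd(2)]
  by (simp add: mult.commute)
 show int: "L1_on {c..d} (%x. f x * G x + F x * g x)"
  using int1 int2 by simp
 show "F d * G d - F c * G c = (LBINT x:{c..d}. f x * G x + F x * g x)"
 proof (rule increment_eq_integral[where m="%x. \<bar>f x\<bar> + \<bar>g x\<bar>"])
  fix \<eta> x :: real assume \<eta>: "\<eta> > 0" and x: "x \<in> {c..d}"
  have xS: "x \<in> S" using x cd by auto
  obtain \<delta>1 where d1: "\<delta>1 > 0" "!!y. y \<in> S ==> \<bar>y - x\<bar> < \<delta>1 ==> \<bar>F y - F x\<bar> < \<eta> / 2"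
   using cF[unfolded continuous_on_iff dist_real_def, THEN bspec, OF xS, rule_format, OF half_gt_zero[OF \<eta>]]
   by blast
  obtain \<delta>2 where d2: "\<delta>2 > 0" "!!y. y \<in> S ==> \<bar>y - x\<bar> < \<delta>2 ==> \<bar>G y - G x\<bar> < \<eta> / 2"
   using cG[unfolded continuous_on_iff dist_real_def, THEN bspec, OF xS, rule_format, OF half_gt_zero[OF \<eta>]]
   by blast
  show "\<exists>\<delta>>0. \<forall>p q. c <= p --> p <= x --> x <= q --> q <= d --> q - p < \<delta> -->
   \<bar>F q * G q - F p * G p - (LBINT x:{p..q}. f x * G x + F x * g x)\<bar> <= \<eta> * (LBINT x:{p..q}. \<bar>f x\<bar> + \<bar>g x\<bar>)"
  proof (intro exI[of _ "min \<delta>1 \<delta>2"] conjI allI impI)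
   fix p q assume pq: "c <= p" "p <= x" "x <= q" "q <= d" "q - p < min \<delta>1 \<delta>2"
   have sub: "{p..q} <= S" using pq cd by auto
   have near: "\<bar>F y - F x\<bar> < \<eta> / 2" "\<bar>G y - G x\<bar> < \<eta> / 2" if "y \<in> {p..q}" for y
    using d1(2)[OF subsetD[OF sub that]] d2(2)[OF subsetD[OF sub that]] that pq by auto
   have fp: "L1_on {p..q} f" "F q - F p = (LBINT x:{p..q}. f x)"
    and gp: "L1_on {p..q} g" "G q - G p = (LBINT x:{p..q}. g x)"
    using prim_onD[OF F _ sub] prim_onD[OF G _ sub] pq by auto
   have i1: "L1_on {p..q} (%x. f x * G x + F x * g x)"
    by (rule set_integrable_subset[OF int]) (use pq in auto)
   have i2: "L1_on {p..q} (%x. f x * G q + F p * g x)" using fp gp by simp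
   have eq: "F q * G q - F p * G p - (LBINT x:{p..q}. f x * G x + F x * g x)
     = (LBINT x:{p..q}. f x * G q + F p * g x - (f x * G x + F x * g x))"
   proof -
    have "(LBINT x:{p..q}. f x * G q + F p * g x) = (F q - F p) * G q + F p * (G q - G p)"
     using fp gp by (simp add: set_integral_add)
    also have "\<dots> = F q * G q - F p * G p" by (simp add: left_diff_distrib right_diff_distrib)
    finally show ?thesis using set_integral_diff(2)[OF i2 i1] by simp
   qed
   have "\<bar>LBINT x:{p..q}. f x * G q + F p * g x - (f x * G x + F x * g x)\<bar> <= (LBINT x:{p..q}. \<bar>f x * G q + F p * g x - (f x * G x + F x * g x)\<bar>)"
    using i1 i2 by (intro set_integral_abs_le) auto
   also have "\<dots> <= (LBINT y:{p..q}. \<eta> * (\<bar>f y\<bar> + \<bar>g y\<bar>))"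
   proof (rule set_integral_mono)
    fix y assume y: "y \<in> {p..q}"
    have "\<bar>G q - G y\<bar> <= \<eta>" "\<bar>F p - F y\<bar> <= \<eta>"
     using near[OF y] near[of p] near[of q] pq by (auto simp: abs_if split: if_splits)
    then have "\<bar>f y\<bar> * \<bar>G q - G y\<bar> <= \<bar>f y\<bar> * \<eta>" "\<bar>g y\<bar> * \<bar>F p - F y\<bar> <= \<bar>g y\<bar> * \<eta>"
     by (auto intro!: mult_left_mono)
    moreover have "f y * G q + F p * g y - (f y * G y + F y * g y) = f y * (G q - G y) + g y * (F p - F y)"
     by (simp add: algebra_simps)
    ultimately show "\<bar>f y * G q + F p * g y - (f y * G y + F y * g y)\<bar> <= \<eta> * (\<bar>f y\<bar> + \<bar>g y\<bar>)"
     using abs_triangle_ineq[of "f y * (G q - G y)" "g y * (F p - F y)"]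
     unfolding abs_mult by (simp only: distrib_left) (simp only: mult.commute[of \<eta>])
   qed (use i1 i2 fp gp in \<open>auto intro!: set_integrable_abs\<close>)
   finally show "\<bar>F q * G q - F p * G p - (LBINT x:{p..q}. f x * G x + F x * g x)\<bar> <= \<eta> * (LBINT x:{p..q}. \<bar>f x\<bar> + \<bar>g x\<bar>)"
    unfolding eq by simp
  qed (use d1 d2 in auto)
 qed (use cd int Fi Gi in \<open>auto intro!: set_integrable_abs\<close>)
qed

lemma prim_on_local:
 assumes "!!x. x \<in> S ==> \<exists>e>0. prim_on ({x-e<..<x+e} \<inter> S) F f"
 shows "prim_on S F f"
 unfolding prim_on_def
proof (intro allI impI)
 fix c d :: real assume cd: "c <= d" "{c..d} <= S"
 have "c <= c & d <= d --> L1_on {c..d} f & F d - F c = (LBINT x:{c..d}. f x)"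
  using cd(1)
 proof (induction rule: Bolzano[where P="%p q. c <= p & q <= d --> L1_on {p..q} f & F q - F p = (LBINT x:{p..q}. f x)"])
  case (trans p q r)
  show ?case
  proof
   assume a: "c <= p & r <= d"
   have "{p..r} = {p..q} \<union> {q..r}" using trans by auto
   then have i: "L1_on {p..r} f"
    using trans a by (auto intro!: set_integrable_Un)
   then show "L1_on {p..r} f & F r - F p = (LBINT x:{p..r}. f x)"
    using LBINT_Icc_split[OF i, of q] trans a by auto
  qed
 next
  case (local x)
  then obtain e where "e > 0" "prim_on ({x-e<..<x+e} \<inter> S) F f" using assms cd by force
  then show ?case
  proof (intro exI[of _ e] conjI allI impI)
   fix p q assume *: "p <= x & x <= q & q - p < e" "c <= p & q <= d"
   have "{p..q} <= {x-e<..<x+e} \<inter> S"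
    using * cd by (auto intro!: subsetD[OF cd(2)])
   then show "L1_on {p..q} f" "F q - F p = (LBINT x:{p..q}. f x)"
    using prim_onD[OF \<open>prim_on ({x-e<..<x+e} \<inter> S) F f\<close>] * by auto
  qed
 qed
 then show "L1_on {c..d} f & F d - F c = (LBINT x:{c..d}. f x)" by simp
qed

lemma prim_on_deriv:
 assumes "!!x. x \<in> S ==> (F has_real_derivative f x) (at x)" "continuous_on S f"
 shows "prim_on S F f"
 unfolding prim_on_def
proof (intro allI impI)
 fix c d :: real assume cd: "c <= d" "{c..d} <= S"
 have cf: "continuous_on {c..d} f" using assms(2) cd continuous_on_subset by blast
 have "(LBINT x:{c..d}. f x) = F d - F c"
  unfolding set_lebesgue_integral_def
 proof (rule integral_FTC_atLeastAtMost[OF cd(1) _ cf])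
  fix x assume "c <= x" "x <= d"
  then have "(F has_real_derivative f x) (at x)" using assms(1) cd by auto
  then show "(F has_vector_derivative f x) (at x within {c..d})"
   by (simp add: has_real_derivative_iff_has_vector_derivative has_vector_derivative_at_within)
 qed
 then show "L1_on {c..d} f & F d - F c = (LBINT x:{c..d}. f x)"
  using borel_integrable_atLeastAtMost'[OF cf] by simp
qed

lemma prim_on_cong_AE:
 assumes F: "prim_on S F f" and g: "AE x\<in>S in lborel. f x = g x"
  and m: "!!c d. c <= d ==> {c..d} <= S ==> meas_on {c..d} g"
 shows "prim_on S F g"
 unfolding prim_on_def
proof (intro allI impI)
 fix c d :: real assume cd: "c <= d" "{c..d} <= S"
 have fm: "(%x. indicator {c..d} x *\<^sub>R f x) \<in> borel_measurable lborel" "integrable lborel (%x. indicator {c..d} x *\<^sub>R f x)"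
  using prim_onD(1)[OF F cd] by (auto simp: set_integrable_def)
 have gm: "(%x. indicator {c..d} x *\<^sub>R g x) \<in> borel_measurable lborel"
  using m[OF cd] by (simp add: set_borel_measurable_def)
 have ae: "AE x in lborel. indicator {c..d} x *\<^sub>R f x = indicator {c..d} x *\<^sub>R g x"
  using g by eventually_elim (use cd in \<open>auto simp: indicator_def\<close>)
 have "integrable lborel (%x. indicator {c..d} x *\<^sub>R g x)"
  by (rule integrable_cong_AE_imp[OF fm(2) gm]) (use ae in \<open>auto elim: eventually_mono\<close>)
 moreover have "(LBINT x:{c..d}. f x) = (LBINT x:{c..d}. g x)"
  unfolding set_lebesgue_integral_def by (rule integral_cong_AE[OF fm(1) gm ae])
 ultimately show "L1_on {c..d} g & F d - F c = (LBINT x:{c..d}. g x)"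
  using prim_onD(2)[OF F cd] by (simp add: set_integrable_def)
qed

lemma prim_on_add: "prim_on S F f ==> prim_on S G g ==> prim_on S (%x. F x + G x) (%x. f x + g x)"
 unfolding prim_on_def by (fastforce simp: set_integral_add)

lemma prim_on_cmult: "prim_on S F f ==> prim_on S (%x. a * F x) (%x. a * f x)"
 unfolding prim_on_def by (simp add: right_diff_distrib[symmetric] del: right_diff_distrib_numeral)

lemma prim_on_continuous:
 assumes F: "prim_on S F f" and S: "open S"
 shows "continuous_on S F"
proof (rule continuous_at_imp_continuous_on, rule ballI)
 fix x assume "x \<in> S"
 then obtain e where e: "e > 0" "cball x e <= S"
  using S open_contains_cball by blast
 have sub: "{x-e..x+e} <= S" using e by (simp add: cball_eq_atLeastAtMost)
 have "continuous_on {x-e..x+e} (%y. F (x-e) + (LBINT z:{x-e..y}. f z))"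
 proof (intro continuous_intros)
  have i: "L1_on {x-e..x+e} f" using prim_onD(1)[OF F _ sub] e by simp
  then have "f integrable_on {x-e..x+e}" by (rule set_borel_integral_eq_integral)
  then have "continuous_on {x-e..x+e} (%y. integral {x-e..y} f)"
   by (rule indefinite_integral_continuous_1)
  moreover have "(LBINT z:{x-e..y}. f z) = integral {x-e..y} f" if "y \<in> {x-e..x+e}" for y
   by (rule set_borel_integral_eq_integral[OF set_integrable_subset[OF i]]) (use that in auto)
  ultimately show "continuous_on {x-e..x+e} (%y. LBINT z:{x-e..y}. f z)"
   by (subst continuous_on_cong[OF refl]) auto
 qed
 moreover have "F (x-e) + (LBINT z:{x-e..y}. f z) = F y" if "y \<in> {x-e..x+e}" for y
  using prim_onD(2)[OF F, of "x-e" y] that sub by force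
 ultimately have "continuous_on {x-e..x+e} F" by (subst (asm) continuous_on_cong[OF refl]) auto
 then show "isCont F x"
  by (rule continuous_on_interior) (use e in \<open>simp add: interior_atLeastAtMost_real\<close>)
qed

lemma prim_on_has_deriv:
 assumes F: "prim_on S F f" and S: "open S" and f: "continuous_on S f" and x: "x \<in> S"
 shows "(F has_real_derivative f x) (at x)"
proof -
 obtain e where e: "e > 0" "cball x e <= S"
  using S x open_contains_cball by blast
 have sub: "{x-e..x+e} <= S" using e by (simp add: cball_eq_atLeastAtMost)
 have cf: "continuous_on {x-e..x+e} f" using f sub continuous_on_subset by blast
 have i: "L1_on {x-e..x+e} f" using prim_onD(1)[OF F _ sub] e by simp
 have "((%y. integral {x-e..y} f) has_real_derivative f x) (at x within {x-e..x+e})"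
  by (rule integral_has_real_derivative[OF cf]) (use e in auto)
 then have "((%y. integral {x-e..y} f) has_real_derivative f x) (at x)"
  by (simp add: at_within_Icc_at e)
 then have "((%y. F (x-e) + integral {x-e..y} f) has_real_derivative f x) (at x)"
  by (auto intro!: derivative_eq_intros)
 then show ?thesis
 proof (rule DERIV_cong_ev[THEN iffD1, rotated 3, OF _ refl _ refl])
  have "eventually (%y. y \<in> {x-e<..<x+e}) (nhds x)"
   by (rule eventually_nhds_in_open) (use e in auto)
  then show "eventually (%y. F (x-e) + integral {x-e..y} f = F y) (nhds x)"
  proof eventually_elim
   case (elim y)
   have "(LBINT z:{x-e..y}. f z) = integral {x-e..y} f"
    by (rule set_borel_integral_eq_integral[OF set_integrable_subset[OF i]]) (use elim in auto)
   then show ?case using prim_onD(2)[OF F, of "x-e" y] elim sub by force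
  qed
 qed
qed

text \<open>The improper fundamental theorem: only the one-sided limits of F at the end points
  enter. Each half is exhausted from an interior point m.\<close>

lemma prim_on_open_interval_limits:
 fixes a b :: real
 assumes ab: "a < b" and F: "prim_on {a<..<b} F f" and f: "L1_on {a<..<b} f"
  and la: "(F \<longlongrightarrow> A) (at_right a)" and lb: "(F \<longlongrightarrow> B) (at_left b)"
 shows "(LBINT x:{a<..<b}. f x) = B - A"
proof -
 define m where "m = (a + b) / 2"
 have m: "a < m" "m < b" using ab by (auto simp: m_def)
 have f1: "L1_on {a<..m} f" and f2: "L1_on {m..<b} f"
  by (rule set_integrable_subset[OF f]; use m in auto)+
 have "((%c. LBINT x:{c..m}. f x) \<longlongrightarrow> (LBINT x:{a<..m}. f x)) (at_right a)"
  by (rule tendsto_set_lebesgue_integral_at_right[OF m(1) _ f1]) auto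
 moreover have "((%c. LBINT x:{c..m}. f x) \<longlongrightarrow> F m - A) (at_right a)"
 proof (rule Lim_transform_eventually[OF tendsto_diff[OF tendsto_const la]])
  have "eventually (%c. c \<in> {a<..<m}) (at_right a)"
   using m(1) by (rule eventually_at_right_real)
  then show "eventually (%c. F m - F c = (LBINT x:{c..m}. f x)) (at_right a)"
  proof eventually_elim
   case (elim c)
   show ?case by (rule prim_onD(2)[OF F]) (use m elim in auto)
  qed
 qed
 ultimately have 1: "(LBINT x:{a<..m}. f x) = F m - A"
  by (rule tendsto_unique[rotated]) simp
 have "((%c. LBINT x:{m..c}. f x) \<longlongrightarrow> (LBINT x:{m..<b}. f x)) (at_left b)"
  by (rule tendsto_set_lebesgue_integral_at_left[OF m(2) _ f2]) auto
 moreover have "((%c. LBINT x:{m..c}. f x) \<longlongrightarrow> B - F m) (at_left b)"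
 proof (rule Lim_transform_eventually[OF tendsto_diff[OF lb tendsto_const]])
  have "eventually (%c. c \<in> {m<..<b}) (at_left b)"
   using m by (intro eventually_at_left_real) auto
  then show "eventually (%c. F c - F m = (LBINT x:{m..c}. f x)) (at_left b)"
  proof eventually_elim
   case (elim c)
   show ?case by (rule prim_onD(2)[OF F]) (use m elim in auto)
  qed
 qed
 ultimately have 2: "(LBINT x:{m..<b}. f x) = B - F m"
  by (rule tendsto_unique[rotated]) simp
 have "{a<..<b} = {a<..m} \<union> {m..<b}" using m by auto
 moreover have "AE x in lborel. \<not> (x \<in> {a<..m} & x \<in> {m..<b})"
  using AE_lborel_singleton[of m] by eventually_elim auto
 ultimately have "(LBINT x:{a<..<b}. f x) = (LBINT x:{a<..m}. f x) + (LBINT x:{m..<b}. f x)"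
  using set_integral_Un_AE[of "{a<..m}" "{m..<b}" lborel f] f1 f2 by auto
 then show ?thesis using 1 2 by simp
qed

section \<open>The fundamental lemma of the calculus of variations\<close>

text \<open>Lebesgue differentiation with one-sided windows; it is the version for cubes that have x
  as their lower corner, in dimension one.\<close>

lemma AE_right_average_tendsto:
 fixes f :: "real => real"
 assumes f: "integrable lborel f"
 shows "AE x in lborel. ((%h. (LBINT z:{x..x+h}. f z) / h) \<longlongrightarrow> f x) (at_right 0)"
proof -
 have fi: "L1_on {c..d} f" for c d
  using f integrable_mult_indicator[of "{c..d}" lborel f] by (simp add: set_integrable_def)
 have "f integrable_on cbox c d" for c d
  using set_borel_integral_eq_integral(1)[OF fi] by (simp add: cbox_interval)
 from integrable_ccontinuous_explicit[OF this] obtain N where N: "negligible N"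
  "!!x e. x \<notin> N ==> 0 < e ==> \<exists>d>0. \<forall>h. 0 < h & h < d -->
   norm (integral (cbox x (x + h *\<^sub>R One)) f /\<^sub>R h ^ DIM(real) - f x) < e"
  by blast
 have "AE x in lebesgue. x \<notin> N"
  using N(1) by (intro AE_not_in) (simp add: negligible_iff_null_sets)
 then have "AE x in lborel. x \<notin> N"
  by (simp add: AE_completion_iff)
 then show ?thesis
 proof eventually_elim
  case (elim x)
  show ?case
  proof (rule tendstoI)
   fix e :: real assume "e > 0"
   from N(2)[OF elim this] obtain d where d: "d > 0" "!!h. 0 < h ==> h < d ==>
    norm (integral (cbox x (x + h *\<^sub>R One)) f /\<^sub>R h ^ DIM(real) - f x) < e"
    by blast
   have "dist ((LBINT z:{x..x+h}. f z) / h) (f x) < e" if "0 < h" "h < d" for h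
    using d(2)[OF that] set_borel_integral_eq_integral(2)[OF fi[of x "x+h"]]
    by (simp add: dist_real_def cbox_interval divide_inverse mult.commute)
   then show "\<forall>\<^sub>F h in at_right 0. dist ((LBINT z:{x..x+h}. f z) / h) (f x) < e"
    unfolding eventually_at_right_field using d(1) by auto
  qed
 qed
qed

lemma LBINT_Icc_eq_Ioo: "(LBINT x:{c..d}. f x) = (LBINT x:{c<..<d::real}. (f x::real))"
 by (rule set_integral_discrete_difference[where X="{c, d}"]) auto

lemma AE_nonneg_if_intervals:
 fixes w :: "real => real"
 assumes w: "L1_on {a<..<b} w"
  and pos: "!!p q. a < p ==> p < q ==> q < b ==> 0 <= (LBINT x:{p<..<q}. w x)"
 shows "AE x\<in>{a<..<b} in lborel. 0 <= w x"
proof -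
 define v where "v = (%x. indicator {a<..<b} x * w x)"
 have v: "integrable lborel v" using w by (simp add: set_integrable_def v_def)
 from AE_right_average_tendsto[OF v] show ?thesis
 proof eventually_elim
  case (elim x)
  show ?case
  proof
   assume x: "x \<in> {a<..<b}"
   have "0 <= v x"
   proof (rule tendsto_lowerbound[OF elim])
    have "eventually (%h. h \<in> {0<..<b-x}) (at_right 0)"
     using x by (intro eventually_at_right_real) auto
    then show "\<forall>\<^sub>F h in at_right 0. 0 <= (LBINT z:{x..x+h}. v z) / h"
    proof eventually_elim
     case (elim h)
     have "(LBINT z:{x..x+h}. v z) = (LBINT z:{x<..<x+h}. w z)"
      unfolding LBINT_Icc_eq_Ioo using x elim
      by (intro set_lebesgue_integral_cong) (auto simp: v_def)
     then show ?case using pos[of x "x+h"] x elim by simp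
    qed
   qed simp
   then show "0 <= w x" using x by (simp add: v_def)
  qed
 qed
qed

lemma AE_zero_if_intervals:
 fixes w :: "real => real"
 assumes w: "L1_on {a<..<b} w"
  and zero: "!!p q. a < p ==> p < q ==> q < b ==> (LBINT x:{p<..<q}. w x) = 0"
 shows "AE x\<in>{a<..<b} in lborel. w x = 0"
proof -
 have "AE x\<in>{a<..<b} in lborel. 0 <= w x"
  by (rule AE_nonneg_if_intervals[OF w]) (simp add: zero)
 moreover have "AE x\<in>{a<..<b} in lborel. 0 <= - w x"
 proof (rule AE_nonneg_if_intervals)
  show "L1_on {a<..<b} (%x. - w x)" using set_integrable_mult_right[of "-1" _ _ w] w by simp
  fix p q assume "a < p" "p < q" "q < b"
  then have "L1_on {p<..<q} w" by (intro set_integrable_subset[OF w]) auto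
  then show "0 <= (LBINT x:{p<..<q}. - w x)"
   using zero[of p q] \<open>a < p\<close> \<open>p < q\<close> \<open>q < b\<close> by (simp add: set_integral_uminus)
 qed
 ultimately show ?thesis by eventually_elim auto
qed

lemma bump_integral_tendsto:
 fixes w :: "real => real"
 assumes w: "L1_on A w" and A: "A \<in> sets lborel" "{p<..<q} <= A"
 shows "(%j. LBINT x:A. w x * bump p q j x) ----> (LBINT x:{p<..<q}. w x)"
  and "L1_on A (%x. w x * bump p q j x)"
proof -
 have m: "(%x. indicator A x *\<^sub>R w x) \<in> borel_measurable lborel" and i: "integrable lborel (%x. norm (indicator A x *\<^sub>R w x))"
  using w by (auto simp: set_integrable_def)
 have bm: "bump p q j \<in> borel_measurable lborel" for j
  using smooth_measurable[OF smooth_bump] by simp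
 have m2: "(%x. indicator A x *\<^sub>R (w x * bump p q j x)) \<in> borel_measurable lborel" for j
  using borel_measurable_times[OF m bm[of j]] by (simp add: mult.assoc)
 have b: "AE x in lborel. norm (indicator A x *\<^sub>R (w x * bump p q j x)) <= norm (indicator A x *\<^sub>R w x)" for j
  using bump_nonneg[of p q j] bump_le_1[of p q j]
  by (intro AE_I2) (auto simp: abs_mult indicator_def intro: mult_left_le)
 have "(%j. LBINT x:A. w x * bump p q j x) ----> (\<integral>x. indicator {p<..<q} x *\<^sub>R w x \<partial>lborel)"
  unfolding set_lebesgue_integral_def
 proof (rule integral_dominated_convergence[OF _ m2 i _ b])
  have "L1_on {p<..<q} w" by (rule set_integrable_subset[OF w]) (use A in auto)
  then show "(%x. indicator {p<..<q} x *\<^sub>R w x) \<in> borel_measurable lborel"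
   by (auto simp: set_integrable_def)
  show "AE x in lborel. (%j. indicator A x *\<^sub>R (w x * bump p q j x)) ----> indicator {p<..<q} x *\<^sub>R w x"
  proof (intro AE_I2)
   fix x
   have "(%j. indicator A x *\<^sub>R (w x * bump p q j x)) ----> indicator A x *\<^sub>R (w x * indicator {p<..<q} x)"
    by (intro tendsto_intros bump_tendsto)
   also have "indicator A x *\<^sub>R (w x * indicator {p<..<q} x) = indicator {p<..<q} x *\<^sub>R w x"
    using A(2) by (auto simp: indicator_def)
   finally show "(%j. indicator A x *\<^sub>R (w x * bump p q j x)) ----> indicator {p<..<q} x *\<^sub>R w x" .
  qed
 qed
 then show "(%j. LBINT x:A. w x * bump p q j x) ----> (LBINT x:{p<..<q}. w x)"
  by (simp add: set_lebesgue_integral_def)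
 show "L1_on A (%x. w x * bump p q j x)"
  unfolding set_integrable_def
  by (rule Bochner_Integration.integrable_bound[OF i m2]) (use b[of j] in auto)
qed

lemma smooth_antiderivative:
 assumes "smooth \<theta>"
 obtains \<Phi> where "smooth \<Phi>" "!!x. (\<Phi> has_real_derivative \<theta> x) (at x)" "\<Phi> c = 0"
proof -
 have "\<exists>F. \<forall>x::real. -\<infinity> < ereal x --> ereal x < \<infinity> --> (F has_vector_derivative \<theta> x) (at x)"
  by (rule einterval_antiderivative)
   (use DERIV_isCont[OF smooth_has_deriv[OF assms]] in auto)
 then obtain F where F: "!!x. (F has_real_derivative \<theta> x) (at x)"
  by (auto simp: has_real_derivative_iff_has_vector_derivative)
 have "((%x. F x - F c) has_real_derivative \<theta> x) (at x)" for x
  using F[of x] by (auto intro!: derivative_eq_intros)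
 then show thesis
  using smoothI[OF _ assms] by (intro that[of "%x. F x - F c"]) auto
qed

lemma set_integral_reduce:
 assumes "A <= B" "!!x. x \<in> B - A ==> f x = (0::real)"
 shows "(LINT x:B|M. f x) = (LINT x:A|M. f x)"
 unfolding set_lebesgue_integral_def
 by (rule Bochner_Integration.integral_cong) (use assms in \<open>auto simp: indicator_def\<close>)

lemma prim_on_indefinite:
 fixes g :: "real => real"
 assumes gi: "L1_on {a..b} g"
 shows "prim_on {a..b} (%x. LBINT z:{a..x}. g z) g" and "continuous_on {a..b} (%x. LBINT z:{a..x}. g z)"
proof -
 show "prim_on {a..b} (%x. LBINT z:{a..x}. g z) g"
  unfolding prim_on_def
 proof (intro allI impI)
  fix c d assume *: "c <= d" "{c..d} <= {a..b}"
  then have **: "a <= c" "d <= b" by auto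
  have i: "L1_on {c..d} g" "L1_on {a..d} g"
   by (rule set_integrable_subset[OF gi]; use ** * in auto)+
  then show "L1_on {c..d} g & (LBINT z:{a..d}. g z) - (LBINT z:{a..c}. g z) = (LBINT x:{c..d}. g x)"
   using LBINT_Icc_split[OF i(2), of c] * ** by simp
 qed
 have "continuous_on {a..b} (%y. integral {a..y} g)"
  by (intro indefinite_integral_continuous_1 set_borel_integral_eq_integral gi)
 moreover have "(LBINT z:{a..y}. g z) = integral {a..y} g" if "y \<in> {a..b}" for y
  using that by (intro set_borel_integral_eq_integral set_integrable_subset[OF gi]) auto
 ultimately show "continuous_on {a..b} (%x. LBINT z:{a..x}. g z)" by (subst continuous_on_cong[OF refl]) auto
qed

text \<open>The du Bois-Reymond argument: with F the primitive of g, the difference w = f - F is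
  orthogonal to the derivatives of test functions, hence to all smooth functions of mean zero
  supported in the interval, hence constant almost everywhere.\<close>

lemma weak_deriv_on_Icc:
 assumes wd: "weak_deriv_on S f g" and ab: "a < b" "{a..b} <= S"
 obtains C where "AE x\<in>{a<..<b} in lborel. f x = C + (LBINT z:{a..x}. g z)"
proof -
 define F where "F x = (LBINT z:{a..x}. g z)" for x
 have fi: "L1_on {a..b} f" and gi: "L1_on {a..b} g"
  using wd ab by (auto simp: weak_deriv_on_def)
 note F = prim_on_indefinite(1)[OF gi, folded F_def] and cF = prim_on_indefinite(2)[OF gi, folded F_def]
 define w where "w x = f x - F x" for x
 have wi: "L1_on {a..b} w"
  unfolding w_def by (intro set_integral_diff fi borel_integrable_atLeastAtMost' cF)
 \<comment> \<open>\<open>{a..b}\<close> is itself a compact subset of S, so \<phi> only has to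
   vanish outside it; no margin is required.\<close>
 have key: "(LBINT x:{a..b}. w x * deriv \<phi> x) = 0" if \<phi>: "smooth \<phi>" "!!x. x \<notin> {a..b} ==> \<phi> x = 0" "\<phi> a = 0" "\<phi> b = 0" for \<phi>
 proof -
  have \<phi>t: "\<phi> \<in> test_fun S" using \<phi> ab by (auto simp: test_fun_def intro!: exI[of _ "{a..b}"])
  have d0: "deriv \<phi> x = 0" if "x \<notin> {a..b}" for x
   using test_fun_deriv_outside[of "{a..b}" \<phi>] \<phi> that by auto
  have "(LBINT x:S. f x * deriv \<phi> x) = - (LBINT x:S. g x * \<phi> x)"
   using wd \<phi>t by (auto simp: weak_deriv_on_def)
  then have 1: "(LBINT x:{a..b}. f x * deriv \<phi> x) = - (LBINT x:{a..b}. g x * \<phi> x)"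
   using set_integral_reduce[OF ab(2), of "%x. f x * deriv \<phi> x" lborel] set_integral_reduce[OF ab(2), of "%x. g x * \<phi> x" lborel] d0 \<phi>(2)
   by auto
  have c\<phi>: "continuous_on A \<phi>" "continuous_on A (deriv \<phi>)" for A
   using \<phi>(1) smooth_continuous smooth_deriv by blast+
  have "prim_on {a..b} (%x. F x * \<phi> x) (%x. g x * \<phi> x + F x * deriv \<phi> x)"
   by (rule prim_on_mult[OF F _ cF c\<phi>(1)]) (intro prim_on_deriv smooth_has_deriv \<phi> c\<phi>)
  from prim_onD(2)[OF this, of a b] ab \<phi>(3,4)
  have "(LBINT x:{a..b}. g x * \<phi> x + F x * deriv \<phi> x) = 0" by simp
  moreover have i: "L1_on {a..b} (%x. g x * \<phi> x)" "L1_on {a..b} (%x. F x * deriv \<phi> x)"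
   "L1_on {a..b} (%x. f x * deriv \<phi> x)"
   by (intro set_integrable_continuous_mult gi fi c\<phi> borel_integrable_atLeastAtMost' cF)+
  ultimately have 2: "(LBINT x:{a..b}. g x * \<phi> x) + (LBINT x:{a..b}. F x * deriv \<phi> x) = 0"
   by (simp add: set_integral_add)
  have "(LBINT x:{a..b}. w x * deriv \<phi> x) = (LBINT x:{a..b}. f x * deriv \<phi> x) - (LBINT x:{a..b}. F x * deriv \<phi> x)"
   using i by (simp add: w_def left_diff_distrib set_integral_diff)
  then show ?thesis using 1 2 by simp
 qed
 define \<psi>0 where "\<psi>0 = bump a b 1"
 have s0: "smooth \<psi>0" by (simp add: \<psi>0_def smooth_bump)
 have i0: "L1_on {a..b} \<psi>0"
  by (intro borel_integrable_atLeastAtMost' smooth_continuous s0)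
 define I0 where "I0 = (LBINT x:{a..b}. \<psi>0 x)"
 have "I0 \<noteq> 0"
 proof
  assume "I0 = 0"
  have "(\<integral>x. indicator {a..b} x * \<psi>0 x \<partial>lborel) = 0"
   using \<open>I0 = 0\<close> by (simp add: I0_def set_lebesgue_integral_def)
  then have "AE x in lborel. indicator {a..b} x * \<psi>0 x = 0"
   using i0 bump_nonneg
   by (subst (asm) integral_nonneg_eq_0_iff_AE) (auto simp: set_integrable_def \<psi>0_def)
  then have "AE x in lborel. x \<notin> {a<..<b}"
   by eventually_elim (use bump_pos[of _ a b 1] in \<open>force simp: \<psi>0_def indicator_def\<close>)
  then have "{a<..<b} \<in> null_sets lborel"
   by (subst AE_iff_null_sets) auto
  then show False using ab by (simp add: null_sets_def)
 qed
 define C where "C = (LBINT x:{a..b}. w x * \<psi>0 x) / I0"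
 have "AE x\<in>{a<..<b} in lborel. w x - C = 0"
 proof (rule AE_zero_if_intervals)
  have wC: "L1_on {a..b} (%x. w x - C)"
   by (intro set_integral_diff wi borel_integrable_atLeastAtMost') simp
  then show "L1_on {a<..<b} (%x. w x - C)"
   by (rule set_integrable_subset) auto
  fix p q assume pq: "a < p" "p < q" "q < b"
  have "(LBINT x:{a..b}. (w x - C) * bump p q j x) = 0" for j
  proof -
   let ?\<psi> = "bump p q j"
   have i1: "L1_on {a..b} ?\<psi>"
    by (intro borel_integrable_atLeastAtMost' smooth_continuous smooth_bump)
   \<comment> \<open>Subtracting c times \<open>\<psi>0\<close> makes the mean zero, so that the
     primitive of \<theta> returns to 0 at b and stays there.\<close>
   define c where "c = (LBINT x:{a..b}. ?\<psi> x) / I0"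
   define \<theta> where "\<theta> x = ?\<psi> x - c * \<psi>0 x" for x
   have s\<theta>: "smooth \<theta>"
    unfolding \<theta>_def by (intro smooth_diff smooth_mult smooth_const s0 smooth_bump)
   obtain \<Phi> where \<Phi>: "smooth \<Phi>" "!!x. (\<Phi> has_real_derivative \<theta> x) (at x)" "\<Phi> a = 0"
    using smooth_antiderivative[OF s\<theta>] by blast
   have \<theta>0: "\<theta> x = 0" if "x \<notin> {a<..<b}" for x
    using that pq by (auto simp: \<theta>_def \<psi>0_def bump_outside)
   have p\<Phi>: "prim_on UNIV \<Phi> \<theta>" by (intro prim_on_deriv \<Phi> smooth_continuous s\<theta>)
   have "(LBINT x:{a..b}. \<theta> x) = 0"
    using i0 i1 \<open>I0 \<noteq> 0\<close> by (simp add: \<theta>_def set_integral_diff c_def I0_def[symmetric])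
   with prim_onD(2)[OF p\<Phi>, of a b] \<Phi>(3) ab have \<Phi>b: "\<Phi> b = 0" by simp
   have \<Phi>0: "\<Phi> x = 0" if "x \<notin> {a..b}" for x
   proof -
    consider "x < a" | "x > b" using \<open>x \<notin> {a..b}\<close> by force
    then show ?thesis
    proof cases
     case 1
     have "(LBINT y:{x..a}. \<theta> y) = (LBINT y:{x..a}. 0)"
      by (rule set_lebesgue_integral_cong) (use \<theta>0 in auto)
     then show ?thesis using prim_onD(2)[OF p\<Phi>, of x a] 1 \<Phi>(3) by simp
    next
     case 2
     have "(LBINT y:{b..x}. \<theta> y) = (LBINT y:{b..x}. 0)"
      by (rule set_lebesgue_integral_cong) (use \<theta>0 in auto)
     then show ?thesis using prim_onD(2)[OF p\<Phi>, of b x] 2 \<Phi>b by simp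
    qed
   qed
   have "deriv \<Phi> = \<theta>" using \<Phi>(2) DERIV_imp_deriv by blast
   then have 0: "(LBINT x:{a..b}. w x * \<theta> x) = 0"
    using key[OF \<Phi>(1) \<Phi>0 \<Phi>(3) \<Phi>b] by simp
   have i2: "L1_on {a..b} (%x. w x * ?\<psi> x)" "L1_on {a..b} (%x. w x * \<psi>0 x)"
    by (intro set_integrable_continuous_mult wi smooth_continuous s0 smooth_bump)+
   have "(LBINT x:{a..b}. w x * \<theta> x) = (LBINT x:{a..b}. w x * ?\<psi> x - c * (w x * \<psi>0 x))"
    by (simp add: \<theta>_def algebra_simps)
   also have "\<dots> = (LBINT x:{a..b}. w x * ?\<psi> x) - c * (LBINT x:{a..b}. w x * \<psi>0 x)"
    using i2 by (simp add: set_integral_diff)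
   also have "c * (LBINT x:{a..b}. w x * \<psi>0 x) = C * (LBINT x:{a..b}. ?\<psi> x)"
    by (simp add: c_def C_def)
   also have "(LBINT x:{a..b}. w x * ?\<psi> x) - C * (LBINT x:{a..b}. ?\<psi> x) = (LBINT x:{a..b}. w x * ?\<psi> x - C * ?\<psi> x)"
    using i1 i2 by (simp add: set_integral_diff)
   finally show ?thesis using 0 by (simp add: left_diff_distrib)
  qed
  moreover have "(%j. LBINT x:{a..b}. (w x - C) * bump p q j x) ----> (LBINT x:{p<..<q}. w x - C)"
   by (rule bump_integral_tendsto(1)[OF wC]) (use pq in auto)
  ultimately show "(LBINT x:{p<..<q}. w x - C) = 0"
   by (simp add: LIMSEQ_const_iff)
 qed
 then show thesis
  by (intro that[of C]) (auto simp: w_def F_def algebra_simps)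
qed

lemma set_integral_cong_AE_integrable:
 fixes f g :: "_ => real"
 assumes "set_integrable M A f" "set_integrable M A g" "AE x in M. x \<in> A --> f x = g x"
 shows "(LINT x:A|M. f x) = (LINT x:A|M. g x)"
 unfolding set_lebesgue_integral_def
proof (rule integral_cong_AE)
 show "AE x in M. indicator A x *\<^sub>R f x = indicator A x *\<^sub>R g x"
  using assms(3) by eventually_elim (auto simp: indicator_def)
qed (use assms in \<open>auto simp: set_integrable_def\<close>)

lemma weak_deriv_on_prim:
 assumes S: "open S" and wd: "weak_deriv_on S f g"
 obtains F where "prim_on S F g" "AE x\<in>S in lborel. f x = F x"
proof -
 \<comment> \<open>The limit of the right averages of f does not depend on an interval, so the local
   representatives, each with its own constant, agree with it and need no gluing.\<close>
 define F where "F x = Lim (at_right 0) (%h. (LBINT z:{x..x+h}. f z) / h)" for x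
 have F_eq: "F x = C + G x" if x: "x \<in> {a<..<b}" and AE: "AE x\<in>{a<..<b} in lborel. f x = C + G x"
  and G: "continuous_on {a..b} G" and fi: "L1_on {a..b} f" for a b C G x
 proof -
  let ?K = "%z. C + G z"
  let ?H = "%t. integral {a..t} ?K"
  have cK: "continuous_on {a..b} ?K" by (intro continuous_intros G)
  have "(?H has_real_derivative ?K x) (at x within {a..b})"
   by (rule integral_has_real_derivative[OF cK]) (use x in auto)
  then have "(?H has_real_derivative ?K x) (at x)"
   using x by (simp add: at_within_Icc_at)
  then have "((%h. (?H (x+h) - ?H x) / h) \<longlongrightarrow> ?K x) (at_right 0)"
   by (auto simp: DERIV_def filterlim_at_split)
  moreover have "\<forall>\<^sub>F h in at_right 0. (?H (x+h) - ?H x) / h = (LBINT z:{x..x+h}. f z) / h"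
  proof -
   have "eventually (%h. h \<in> {0<..<b-x}) (at_right 0)"
    using x by (intro eventually_at_right_real) auto
   then show ?thesis
   proof eventually_elim
    case (elim h)
    have sub: "{x..x+h} <= {a<..<b}" using x elim by auto
    have i: "L1_on {x..x+h} ?K" "L1_on {x..x+h} f"
     by (intro borel_integrable_atLeastAtMost' continuous_on_subset[OF cK], use sub in force)
      (rule set_integrable_subset[OF fi], use sub in force, use sub in force)
    have "?K integrable_on {a..x+h}"
     by (intro integrable_continuous_interval continuous_on_subset[OF cK]) (use x elim in auto)
    then have "?H x + integral {x..x+h} ?K = ?H (x+h)"
     by (intro Henstock_Kurzweil_Integration.integral_combine) (use x elim in auto)
    moreover have "(LBINT z:{x..x+h}. f z) = (LBINT z:{x..x+h}. ?K z)"
     by (rule set_integral_cong_AE_integrable[OF i(2,1)])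
      (use AE sub in \<open>auto elim!: eventually_mono\<close>)
    ultimately show ?case using set_borel_integral_eq_integral(2)[OF i(1)] by simp
   qed
  qed
  ultimately have "((%h. (LBINT z:{x..x+h}. f z) / h) \<longlongrightarrow> ?K x) (at_right 0)"
   by (rule Lim_transform_eventually)
  then show ?thesis unfolding F_def by (intro tendsto_Lim) auto
 qed
 have loc: "\<exists>C. \<forall>x\<in>{a<..<b}. F x = C + (LBINT z:{a..x}. g z)" and locAE: "AE x\<in>{a<..<b} in lborel. f x = F x"
  if ab: "a < b" "{a..b} <= S" for a b
 proof -
  obtain C where C: "AE x\<in>{a<..<b} in lborel. f x = C + (LBINT z:{a..x}. g z)"
   using weak_deriv_on_Icc[OF wd ab] .
  have fi: "L1_on {a..b} f" and gi: "L1_on {a..b} g"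
   using wd ab by (auto simp: weak_deriv_on_def)
  have "continuous_on {a..b} (%y. integral {a..y} g)"
   by (intro indefinite_integral_continuous_1 set_borel_integral_eq_integral gi)
  moreover have "(LBINT z:{a..y}. g z) = integral {a..y} g" if "y \<in> {a..b}" for y
   using that by (intro set_borel_integral_eq_integral set_integrable_subset[OF gi]) auto
  ultimately have cG: "continuous_on {a..b} (%y. LBINT z:{a..y}. g z)"
   by (subst continuous_on_cong[OF refl]) auto
  note eq = F_eq[OF _ C cG fi]
  show "\<exists>C. \<forall>x\<in>{a<..<b}. F x = C + (LBINT z:{a..x}. g z)" using eq by blast
  show "AE x\<in>{a<..<b} in lborel. f x = F x"
   using C by eventually_elim (use eq in auto)
 qed
 show thesis
 proof (rule that[of F])
  show "prim_on S F g"
   unfolding prim_on_def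
  proof (intro allI impI)
   fix c d assume cd: "c <= d" "{c..d} <= S"
   then have "c \<in> S" "d \<in> S" by auto
   then obtain e e' where e: "e > 0" "cball c e <= S" and e': "e' > 0" "cball d e' <= S"
    using S open_contains_cball by metis
   have sub: "{c-e..d+e'} <= S"
   proof
    fix x assume x: "x \<in> {c-e..d+e'}"
    consider "x \<in> cball c e" | "x \<in> {c..d}" | "x \<in> cball d e'"
     using x cd by (simp add: cball_eq_atLeastAtMost) linarith
    then show "x \<in> S" using cd e e' by cases blast+
   qed
   obtain C where C: "!!x. x \<in> {c-e<..<d+e'} ==> F x = C + (LBINT z:{c-e..x}. g z)"
    using loc[OF _ sub] e e' cd by force
   have i: "L1_on {c-e..d} g" and i2: "L1_on {c..d} g"
   proof -
    have "L1_on {c-e..d+e'} g"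
     using wd sub by (auto simp: weak_deriv_on_def)
    then show "L1_on {c-e..d} g" "L1_on {c..d} g"
     using e e' cd by (auto elim!: set_integrable_subset)
   qed
   show "L1_on {c..d} g & F d - F c = (LBINT x:{c..d}. g x)"
    using C[of c] C[of d] LBINT_Icc_split[OF i, of c] i2 e e' cd by auto
  qed
  \<comment> \<open>Countably many rational intervals cover S, so the local almost-everywhere
    identities combine.\<close>
  have "AE x in lborel. \<forall>p\<in>\<rat>. \<forall>q\<in>\<rat>. p < q --> {p..q} <= S --> x \<in> {p<..<q} --> f x = F x"
  proof (intro AE_ball_countable[THEN iffD2] countable_rat ballI)
   fix p q :: real
   show "AE x in lborel. p < q --> {p..q} <= S --> x \<in> {p<..<q} --> f x = F x"
    using locAE[of p q] by (cases "p < q & {p..q} <= S") auto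
  qed
  then show "AE x\<in>S in lborel. f x = F x"
  proof eventually_elim
   case (elim x)
   show ?case
   proof
    assume "x \<in> S"
    then obtain e where e: "e > 0" "cball x e <= S"
     using S open_contains_cball by metis
    obtain p where p: "p \<in> \<rat>" "x - e < p" "p < x" using Rats_dense_in_real[of "x-e" x] e by auto
    obtain q where q: "q \<in> \<rat>" "x < q" "q < x + e" using Rats_dense_in_real[of x "x+e"] e by auto
    have "{p..q} <= cball x e" using p q by (auto simp: cball_def dist_real_def abs_if)
    then show "f x = F x" using elim p q e by auto
   qed
  qed
 qed
qed

lemma continuous_AE_eq_imp_eq:
 fixes f g :: "real => real"
 assumes S: "open S" and f: "continuous_on S f" and g: "continuous_on S g"
  and ae: "AE x\<in>S in lborel. f x = g x" and x: "x \<in> S"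
 shows "f x = g x"
proof (rule ccontr)
 assume ne: "f x \<noteq> g x"
 define U where "U = {y \<in> S. f y - g y \<noteq> 0}"
 have "continuous_on S (%y. f y - g y)" by (intro continuous_intros f g)
 then have "open ((%y. f y - g y) -` (- {0}) \<inter> S)"
  using S by (subst (asm) continuous_on_open_vimage) auto
 moreover have "(%y. f y - g y) -` (- {0}) \<inter> S = U" by (auto simp: U_def)
 ultimately have U: "open U" by simp
 have "AE x in lborel. x \<notin> U" using ae by eventually_elim (auto simp: U_def)
 then have "AE x in lebesgue. x \<notin> U" by (simp add: AE_completion_iff)
 then have "negligible U"
  unfolding negligible_iff_null_sets by (subst (asm) AE_iff_null_sets[symmetric]) (use U in auto)
 then show False
  using open_not_negligible[OF U] x ne by (auto simp: U_def)
qed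

section \<open>The entropy \<open>B\<close>\<close>

lemma abs_mult_le_sum_squares: "\<bar>x * y\<bar> <= (x^2 + y^2) / 2" for x y :: real
 using sum_squares_bound[of "\<bar>x\<bar>" "\<bar>y\<bar>"] by (simp add: abs_mult)

lemma powr_set_integrable_0:
 assumes "p > -1" "d > 0"
 shows "L1_on {0<..<d::real} (%v. v powr p)"
proof -
 have "L1_on (einterval (ereal 0) (ereal d)) (%v. v powr p)"
 proof (rule interval_integral_FTC_nonneg(1)[where F="%v. v powr (p + 1) / (p + 1)" and A=0 and B="d powr (p + 1) / (p + 1)"])
  fix x :: real assume "ereal 0 < ereal x" "ereal x < ereal d"
  then have x: "x > 0" by simp
  show "((%v. v powr (p + 1) / (p + 1)) has_real_derivative x powr p) (at x)"
   using DERIV_cdivide[OF has_real_derivative_powr[OF x, of "p + 1"], of "p + 1"] assms by simp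
  show "isCont (%v. v powr p) x" using x by (intro continuous_intros) auto
 next
  have "((%v. v powr (p + 1) / (p + 1)) \<longlongrightarrow> 0 powr (p + 1) / (p + 1)) (at_right 0)"
   using assms by (intro tendsto_intros) (auto simp: eventually_at_right_less eventually_at_filter)
  then show "(((%v. v powr (p + 1) / (p + 1)) \<circ> real_of_ereal) \<longlongrightarrow> 0) (at_right (ereal 0))"
   by (simp add: ereal_tendsto_simps)
  have "((%v. v powr (p + 1) / (p + 1)) \<longlongrightarrow> d powr (p + 1) / (p + 1)) (at_left d)"
   using assms by (intro tendsto_intros) auto
  then show "(((%v. v powr (p + 1) / (p + 1)) \<circ> real_of_ereal) \<longlongrightarrow> d powr (p + 1) / (p + 1)) (at_left (ereal d))"
   by (simp add: ereal_tendsto_simps)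
 qed (use assms in auto)
 then show ?thesis by simp
qed

lemma powr_integral_to_infinity:
 fixes r :: real
 assumes "p < -1" "r > 0"
 shows "L1_on {r<..} (%v. v powr p)"
  and "(LBINT v:{r<..}. v powr p) = - (r powr (p + 1) / (p + 1))"
proof -
 let ?F = "%v. v powr (p + 1) / (p + 1)"
 have d: "(?F has_real_derivative x powr p) (at x)" and c: "isCont (%v. v powr p) x" if "ereal r < ereal x" for x
 proof -
  have x: "x > 0" using that assms by simp
  show "(?F has_real_derivative x powr p) (at x)"
   using DERIV_cdivide[OF has_real_derivative_powr[OF x, of "p + 1"], of "p + 1"] assms by simp
  show "isCont (%v. v powr p) x" using x by (intro continuous_intros) auto
 qed
 have "(?F \<longlongrightarrow> r powr (p + 1) / (p + 1)) (at_right r)"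
  using assms by (intro tendsto_intros) auto
 then have A: "((?F \<circ> real_of_ereal) \<longlongrightarrow> r powr (p + 1) / (p + 1)) (at_right (ereal r))"
  by (simp add: ereal_tendsto_simps)
 have "((%v. v powr (p + 1)) \<longlongrightarrow> 0) at_top"
  using assms by (intro tendsto_neg_powr filterlim_ident) auto
 from tendsto_divide[OF this tendsto_const[of "p+1"]]
 have "(?F \<longlongrightarrow> 0) at_top" using assms by simp
 then have B: "((?F \<circ> real_of_ereal) \<longlongrightarrow> 0) (at_left \<infinity>)"
  by (simp add: ereal_tendsto_simps)
 have r: "ereal r < \<infinity>" by simp
 have nn: "AE x in lborel. ereal r < ereal x --> ereal x < \<infinity> --> 0 <= x powr p" by simp
 note * = interval_integral_FTC_nonneg[OF r d c nn A B]
 from *(1) show "L1_on {r<..} (%v. v powr p)" by simp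
 from *(2) show "(LBINT v:{r<..}. v powr p) = - (r powr (p + 1) / (p + 1))"
  by (simp add: interval_lebesgue_integral_def)
qed

text \<open>The inner integral in \<open>B_fun\<close>, that is, B'.\<close>

definition B_slope :: "real => real => real" where
 "B_slope n r = (LBINT v:{r<..}. 1 / (v powr (n - 1) + v^2))"

context
 fixes n :: real
 assumes n: "0 < n" "n < 3"
begin

text \<open>The bound v^(-2) is for large v, the bound v^(1-n) for small v. With y = v^(n-3) the
  last bound is 1 - y^2 <= 1; it says that the kernel deviates from v^(-2) by at most v^(n-5), which
  can be integrated twice up to infinity because n < 3.\<close>

lemma kernel_bounds:
 assumes "v > (0::real)"
 shows "0 < 1 / (v powr (n - 1) + v^2)" "1 / (v powr (n - 1) + v^2) <= v powr (-2)"
  "1 / (v powr (n - 1) + v^2) <= v powr (1 - n)"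
  "1 / (v powr (n - 1) + v^2) >= v powr (-2) - v powr (n - 5)"
proof -
 have pos: "v powr (n - 1) > 0" "v^2 > 0" using assms by auto
 from add_pos_pos[OF this] show "0 < 1 / (v powr (n - 1) + v^2)" by simp
 have m2: "v powr (-2) = 1 / v^2" using assms powr_minus_divide[of v 2] by simp
 show "1 / (v powr (n - 1) + v^2) <= v powr (-2)"
  unfolding m2 using pos add_pos_pos[OF pos] by (intro divide_left_mono mult_pos_pos) auto
 have "v powr (1 - n) = 1 / v powr (n - 1)"
  using powr_minus_divide[of v "n - 1"] by simp
 then show "1 / (v powr (n - 1) + v^2) <= v powr (1 - n)"
  using pos add_pos_pos[OF pos] by (auto intro!: divide_left_mono mult_pos_pos)
 have "v powr (n - 5) = v powr (n - 1) * v powr (-2) * v powr (-2)"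
  by (simp flip: powr_add)
 then have "(v powr (-2) - v powr (n - 5)) * (v powr (n - 1) + v^2) = 1 - (v powr (n - 1) / v^2)^2"
  unfolding m2 using pos by (simp add: power2_eq_square field_simps)
 also have "\<dots> <= 1" by simp
 finally show "1 / (v powr (n - 1) + v^2) >= v powr (-2) - v powr (n - 5)"
  unfolding pos_le_divide_eq[OF add_pos_pos[OF pos]] .
qed

lemma kernel_measurable: "(%v. 1 / (v powr (n - 1) + v^2)) \<in> borel_measurable borel"
 by measurable

lemma kernel_integrable:
 assumes "r > 0"
 shows "L1_on {r<..} (%v. 1 / (v powr (n - 1) + v^2))"
proof (rule set_integrable_bound[OF powr_integral_to_infinity(1)[of "-2" r]])
 show "meas_on {r<..} (%v. 1 / (v powr (n - 1) + v^2))"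
  unfolding set_borel_measurable_def using kernel_measurable by measurable
 show "AE x\<in>{r<..} in lborel. norm (1 / (x powr (n - 1) + x^2)) <= norm (x powr - 2)"
  using assms kernel_bounds by (auto intro!: AE_I2)
qed (use assms in auto)

lemma B_slope_nonneg: "r >= 0 ==> B_slope n r >= 0"
 unfolding B_slope_def set_lebesgue_integral_def
 by (intro integral_nonneg_AE) (auto simp: indicator_def)

lemma B_slope_le:
 assumes "r > 0"
 shows "B_slope n r <= 1 / r"
proof -
 have "B_slope n r <= (LBINT v:{r<..}. v powr (-2))"
  unfolding B_slope_def using assms
  by (intro set_integral_mono kernel_integrable powr_integral_to_infinity kernel_bounds) auto
 also have "\<dots> = 1 / r"
  using powr_integral_to_infinity(2)[of "-2" r] assms by (simp add: powr_minus_divide)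
 finally show ?thesis .
qed

lemma B_slope_ge:
 assumes "r > 0"
 shows "B_slope n r >= 1 / r - r powr (n - 4) / (4 - n)"
proof -
 have i: "L1_on {r<..} (%v. v powr (-2))" "L1_on {r<..} (%v. v powr (n - 5))"
  using assms n by (auto intro!: powr_integral_to_infinity)
 have "(LBINT v:{r<..}. v powr (-2) - v powr (n - 5)) <= B_slope n r"
  unfolding B_slope_def using assms i
  by (intro set_integral_mono kernel_integrable kernel_bounds set_integral_diff) auto
 moreover have "(LBINT v:{r<..}. v powr (-2) - v powr (n - 5)) = 1 / r - r powr (n - 4) / (4 - n)"
 proof -
  have "(LBINT v:{r<..}. v powr (-2)) = 1 / r"
   using powr_integral_to_infinity(2)[of "-2" r] assms by (simp add: powr_minus_divide)
  moreover have "(LBINT v:{r<..}. v powr (n - 5)) = r powr (n - 4) / (4 - n)"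
  proof -
   have "n - 5 + 1 = n - 4" by simp
   then show ?thesis
    using powr_integral_to_infinity(2)[of "n - 5" r] assms n
    by (simp add: minus_divide_right)
  qed
  ultimately show ?thesis using i by (simp add: set_integral_diff)
 qed
 ultimately show ?thesis by simp
qed

lemma prim_on_B_slope: "prim_on {0<..} (B_slope n) (%v. - (1 / (v powr (n - 1) + v^2)))"
 unfolding prim_on_def
proof (intro allI impI)
 fix c d :: real assume cd: "c <= d" "{c..d} <= {0<..}"
 then have c: "c > 0" by auto
 let ?g = "%v. 1 / (v powr (n - 1) + v^2)"
 have i: "L1_on {c<..d} ?g" "L1_on {d<..} ?g"
  using kernel_integrable[OF c] by (auto elim!: set_integrable_subset simp: cd)
 have split: "{c<..} = {c<..d} \<union> {d<..}" "{c<..d} \<inter> {d<..} = {}" using cd by auto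
 have "(LBINT v:{c<..}. ?g v) = (LBINT v:{c<..d}. ?g v) + (LBINT v:{d<..}. ?g v)"
  unfolding split(1) by (rule set_integral_Un[OF split(2) i])
 moreover have eq: "(LBINT v:{c..d}. ?g v) = (LBINT v:{c<..d}. ?g v)"
  by (rule set_integral_discrete_difference[where X="{c}"]) auto
 have ic: "L1_on {c..d} ?g"
  using i(1) by (subst set_integrable_discrete_difference[where X="{c}" and B="{c<..d}"]) auto
 moreover note set_integral_uminus[OF ic]
 moreover have "L1_on {c..d} (%v. - ?g v)"
  using set_integrable_mult_right[of "-1" _ _ ?g] ic by simp
 ultimately show "L1_on {c..d} (%v. - ?g v) & B_slope n d - B_slope n c = (LBINT v:{c..d}. - ?g v)"
  using eq by (simp add: B_slope_def)
qed

lemma continuous_on_B_slope: "continuous_on {0<..} (B_slope n)"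
 by (rule prim_on_continuous[OF prim_on_B_slope]) auto

text \<open>The exponent max(0, (n-1)/2) meets three demands. Because n < 3, \<gamma> + 1 - n > -1,
  which makes v^\<gamma> times the kernel integrable at 0, and \<gamma> < 1, which makes B'
  integrable at 0. Moreover 2 \<gamma> <= n, which bounds (B')^2 s^n near 0 in
  \<open>flux_weight_bound\<close>.\<close>

lemma B_slope_singularity:
 obtains C \<gamma> where "0 <= \<gamma>" "\<gamma> < 1" "2 * \<gamma> <= n" "C > 0" "!!r. r > 0 ==> B_slope n r <= C * r powr (-\<gamma>)"
proof -
 define \<gamma> where "\<gamma> = max 0 ((n - 1) / 2)"
 have \<gamma>: "0 <= \<gamma>" "\<gamma> < 1" "2 * \<gamma> <= n" "\<gamma> + 1 - n > -1" "\<gamma> - 2 < -1"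
  using n by (auto simp: \<gamma>_def max_def field_simps)
 let ?g = "%v. 1 / (v powr (n - 1) + v^2)"
 let ?h = "%v. v powr \<gamma> * ?g v"
 have m: "meas_on A ?h" if "A \<in> sets borel" for A
  unfolding set_borel_measurable_def using kernel_measurable that by measurable
 have 1: "L1_on {0<..<1} ?h"
 proof (rule set_integrable_bound[OF powr_set_integrable_0[OF \<gamma>(4)] m])
  show "AE x\<in>{0<..<1} in lborel. norm (x powr \<gamma> * ?g x) <= norm (x powr (\<gamma> + 1 - n))"
  proof (intro AE_I2 impI)
   fix x :: real assume "x \<in> {0<..<1}"
   then show "norm (x powr \<gamma> * ?g x) <= norm (x powr (\<gamma> + 1 - n))"
    using mult_left_mono[OF kernel_bounds(3)[of x], of "x powr \<gamma>"] kernel_bounds(1)[of x]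
    by (simp add: powr_add[symmetric] abs_mult add_diff_eq)
  qed
 qed auto
 have 2: "L1_on {1/2<..} ?h"
 proof (rule set_integrable_bound[OF powr_integral_to_infinity(1)[OF \<gamma>(5), of "1/2"] m])
  show "AE x\<in>{1/2<..} in lborel. norm (x powr \<gamma> * ?g x) <= norm (x powr (\<gamma> - 2))"
  proof (intro AE_I2 impI)
   fix x :: real assume "x \<in> {1/2<..}"
   then show "norm (x powr \<gamma> * ?g x) <= norm (x powr (\<gamma> - 2))"
    using mult_left_mono[OF kernel_bounds(2)[of x], of "x powr \<gamma>"] kernel_bounds(1)[of x]
    by (simp add: powr_add[symmetric] abs_mult add_diff_eq)
  qed
 qed auto
 have split: "{0<..} = {0<..<1} \<union> {(1/2::real)<..}" by auto
 have i: "L1_on {0<..} ?h"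
  unfolding split by (rule set_integrable_Un[OF 1 2]) auto
 define C where "C = 1 + (LBINT v:{0<..}. ?h v)"
 have C0: "(LBINT v:{0<..}. ?h v) >= 0"
  unfolding set_lebesgue_integral_def by (intro integral_nonneg_AE) (auto simp: indicator_def)
 have "B_slope n r <= C * r powr (-\<gamma>)" if r: "r > 0" for r
 proof -
  have ir: "L1_on {r<..} ?h" by (rule set_integrable_subset[OF i]) (use r in auto)
  have "B_slope n r <= (LBINT v:{r<..}. r powr (-\<gamma>) * ?h v)"
   unfolding B_slope_def
  proof (intro set_integral_mono kernel_integrable r)
   fix v assume v: "v \<in> {r<..}"
   have "r powr \<gamma> <= v powr \<gamma>" using v r \<gamma> by (intro powr_mono2) auto
   then have "1 <= r powr (-\<gamma>) * v powr \<gamma>" using r by (simp add: powr_minus field_simps)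
   then show "?g v <= r powr (-\<gamma>) * ?h v"
    using mult_right_mono[of 1 "r powr (-\<gamma>) * v powr \<gamma>" "?g v"] kernel_bounds(1)[of v] v r by simp
  qed (intro set_integrable_mult_right ir)
  also have "\<dots> = r powr (-\<gamma>) * (LBINT v:{r<..}. ?h v)" by (rule set_integral_mult_right)
  also have "\<dots> = (LBINT v:{r<..}. ?h v) * r powr (-\<gamma>)" by (rule mult.commute)
  also have "\<dots> <= (LBINT v:{0<..}. ?h v) * r powr (-\<gamma>)"
  proof (intro mult_right_mono)
   show "(LBINT v:{r<..}. ?h v) <= (LBINT v:{0<..}. ?h v)"
    unfolding set_lebesgue_integral_def using i ir r
    by (intro integral_mono) (auto simp: set_integrable_def indicator_def)
  qed simp
  also have "\<dots> <= C * r powr (-\<gamma>)" by (intro mult_right_mono) (auto simp: C_def)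
  finally show ?thesis .
 qed
 then show thesis using \<gamma> C0 by (intro that[of \<gamma> C]) (auto simp: C_def)
qed

lemma prim_on_B: "prim_on {0..} (B_fun n) (B_slope n)"
 unfolding prim_on_def
proof (intro allI impI)
 fix c d :: real assume cd: "c <= d" "{c..d} <= {0..}"
 then have c: "c >= 0" by auto
 obtain C \<gamma> where C: "0 <= \<gamma>" "\<gamma> < 1" "C > 0" "!!r. r > 0 ==> B_slope n r <= C * r powr (-\<gamma>)"
  using B_slope_singularity by metis
 have i: "L1_on {0<..<d+1} (B_slope n)"
 proof (rule set_integrable_bound)
  show "L1_on {0<..<d+1} (%v. C * v powr (-\<gamma>))"
   using C cd c by (intro set_integrable_mult_right powr_set_integrable_0) auto
  show "meas_on {0<..<d+1} (B_slope n)"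
   unfolding set_borel_measurable_def
  proof -
   have "continuous_on {0<..<d+1} (B_slope n)"
    by (rule continuous_on_subset[OF continuous_on_B_slope]) auto
   from borel_measurable_continuous_on_indicator[OF _ this]
   show "(%x. indicator {0<..<d+1} x *\<^sub>R B_slope n x) \<in> borel_measurable lborel" by simp
  qed
  show "AE x\<in>{0<..<d+1} in lborel. norm (B_slope n x) <= norm (C * x powr (-\<gamma>))"
   using C B_slope_nonneg by (intro AE_I2) auto
 qed
 have ic: "L1_on {c<..<d} (B_slope n)" "L1_on {0<..<c} (B_slope n)" "L1_on {0<..<d} (B_slope n)"
  by (rule set_integrable_subset[OF i]; use cd c in auto)+
 have 1: "L1_on {c..d} (B_slope n)"
  using ic(1) by (subst set_integrable_discrete_difference[where X="{c, d}" and B="{c<..<d}"]) auto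
 have "B_fun n d = (LBINT x:{0..d}. B_slope n x)" "B_fun n c = (LBINT x:{0..c}. B_slope n x)"
  unfolding LBINT_Icc_eq_Ioo by (simp_all add: B_fun_def B_slope_def[abs_def])
 moreover have "L1_on {0..d} (B_slope n)"
  using ic(3) by (subst set_integrable_discrete_difference[where X="{0, d}" and B="{0<..<d}"]) auto
 from LBINT_Icc_split[OF this, of c]
 have "(LBINT x:{0..d}. B_slope n x) = (LBINT x:{0..c}. B_slope n x) + (LBINT x:{c..d}. B_slope n x)"
  using c cd by auto
 ultimately show "L1_on {c..d} (B_slope n) & B_fun n d - B_fun n c = (LBINT x:{c..d}. B_slope n x)"
  using 1 by simp
qed

lemma B_fun_0: "s <= 0 ==> B_fun n s = 0"
 by (simp add: B_fun_def set_lebesgue_integral_def)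

lemma B_fun_mono:
 assumes "s <= s'"
 shows "B_fun n s <= B_fun n s'"
proof -
 have *: "B_fun n s <= B_fun n s'" if "0 <= s" "s <= s'" for s s'
 proof -
  have "0 <= (LBINT x:{s..s'}. B_slope n x)"
   unfolding set_lebesgue_integral_def using B_slope_nonneg that
   by (intro integral_nonneg_AE) (auto simp: indicator_def)
  then show ?thesis using prim_onD(2)[OF prim_on_B, of s s'] that by auto
 qed
 show ?thesis
  using *[of 0 s'] *[of s s'] B_fun_0[of s] B_fun_0[of 0] B_fun_0[of s'] assms
  by (cases "0 <= s"; cases "0 <= s'") auto
qed

lemma B_fun_nonneg: "B_fun n s >= 0"
 using B_fun_mono[of "min s 0" s] B_fun_0[of "min s 0"] by simp

lemma continuous_on_B: "continuous_on UNIV (B_fun n)"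
proof -
 have "continuous_on {0..d} (B_fun n)" for d :: real
 proof (cases "d >= 0")
  case True
  have i: "L1_on {0..d} (B_slope n)" using prim_onD(1)[OF prim_on_B, of 0 d] True by auto
  have "continuous_on {0..d} (%y. integral {0..y} (B_slope n))"
   by (intro indefinite_integral_continuous_1 set_borel_integral_eq_integral i)
  moreover have "integral {0..y} (B_slope n) = B_fun n y" if "y \<in> {0..d}" for y
  proof -
   have "(LBINT x:{0..y}. B_slope n x) = integral {0..y} (B_slope n)"
    using that by (intro set_borel_integral_eq_integral set_integrable_subset[OF i]) auto
   then show ?thesis using prim_onD(2)[OF prim_on_B, of 0 y] that B_fun_0[of 0] by auto
  qed
  ultimately show ?thesis by (subst (asm) continuous_on_cong[OF refl]) auto
 qed auto
 then have "isCont (B_fun n) x" if "x > 0" for x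
  using continuous_on_interior[of "{0..x+1}" "B_fun n" x] that by auto
 moreover have "isCont (B_fun n) x" if "x < 0" for x
 proof -
  have "eventually (%y. y \<in> {..<0}) (nhds x)" by (rule eventually_nhds_in_open) (use that in auto)
  then have "eventually (%y. B_fun n y = 0) (nhds x)" by eventually_elim (simp add: B_fun_0)
  then show ?thesis using isCont_cong[of "B_fun n" "%_. 0" x] by simp
 qed
 moreover have "isCont (B_fun n) 0"
 proof -
  have "(B_fun n \<longlongrightarrow> B_fun n 0) (at_left 0)"
   by (rule Lim_transform_eventually[OF tendsto_const]) (auto simp: eventually_at_filter B_fun_0)
  moreover have "(B_fun n \<longlongrightarrow> B_fun n 0) (at 0 within {0..1})"
   using \<open>!!d. continuous_on {0..d} (B_fun n)\<close>[of 1] by (auto simp: continuous_on)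
  then have "(B_fun n \<longlongrightarrow> B_fun n 0) (at_right 0)"
   by (simp add: at_within_Icc_at_right)
  ultimately show ?thesis
   by (simp add: isCont_def filterlim_split_at)
 qed
 ultimately show ?thesis
  by (metis continuous_at_imp_continuous_on linorder_neqE_linordered_idom)
qed

lemma B_fun_has_deriv:
 assumes "s > 0"
 shows "(B_fun n has_real_derivative B_slope n s) (at s)"
 by (rule prim_on_has_deriv[OF prim_on_subset[OF prim_on_B] _ continuous_on_B_slope]) (use assms in auto)

text \<open>Integrates B' <= 1/r. Together with \<open>B_fun_lower\<close> this is B(s) = ln s +
  O(1), the reason for the division by |ln eps|: B(s/eps)/|ln eps| tends to 1 for each s >
  0.\<close>

lemma B_fun_upper:
 assumes "s >= 1"
 shows "B_fun n s <= B_fun n 1 + ln s"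
proof -
 have "B_fun n s - ln s <= B_fun n 1 - ln 1"
 proof (rule DERIV_nonpos_imp_nonincreasing[OF assms])
  fix x :: real assume "1 <= x" "x <= s"
  then have "((%x. B_fun n x - ln x) has_real_derivative B_slope n x - 1 / x) (at x)"
   by (intro DERIV_diff B_fun_has_deriv) (auto intro!: derivative_eq_intros)
  then show "\<exists>y. ((%x. B_fun n x - ln x) has_real_derivative y) (at x) & y <= 0"
   using B_slope_le[of x] \<open>1 <= x\<close> by auto
 qed
 then show ?thesis by simp
qed

text \<open>The constant is the integral over r > 1 of r^(n-4)/(4-n), the deviation of B' from 1/r
  in \<open>B_slope_ge\<close>; it is finite since n < 3.\<close>

lemma B_fun_lower:
 assumes "s >= 1"
 shows "B_fun n s >= ln s - 1 / ((4 - n) * (3 - n))"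
proof -
 let ?F = "%x. B_fun n x - ln x - x powr (n - 3) / ((4 - n) * (3 - n))"
 have "?F s >= ?F 1"
 proof (rule DERIV_nonneg_imp_nondecreasing[OF assms])
  fix x :: real assume x: "1 <= x" "x <= s"
  have "(n - 3) * y / ((4 - n) * (3 - n)) = - (y / (4 - n))" for y
  proof -
   have "(n - 3) * y = (- y) * (3 - n)" by (simp add: algebra_simps)
   then have "(n - 3) * y / ((4 - n) * (3 - n)) = ((- y) * (3 - n)) / ((4 - n) * (3 - n))" by simp
   also have "\<dots> = (- y) / (4 - n)" by (rule mult_divide_mult_cancel_right) (use n in auto)
   finally show ?thesis by simp
  qed
  then have "((%x. x powr (n - 3) / ((4 - n) * (3 - n))) has_real_derivative - (x powr (n - 4) / (4 - n))) (at x)"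
   using DERIV_cdivide[OF has_real_derivative_powr[of x "n - 3"], of "(4 - n) * (3 - n)"] x by simp
  then have "(?F has_real_derivative B_slope n x - 1 / x - (- (x powr (n - 4) / (4 - n)))) (at x)"
   using x by (intro DERIV_diff B_fun_has_deriv) (auto intro!: derivative_eq_intros)
  then show "\<exists>y. (?F has_real_derivative y) (at x) & 0 <= y"
   using B_slope_ge[of x] x by (intro exI conjI) auto
 qed
 moreover have "s powr (n - 3) / ((4 - n) * (3 - n)) >= 0"
  using n by auto
 ultimately show ?thesis using B_fun_nonneg[of 1] by simp
qed

section \<open>The rescaled entropy at a fixed small eps\<close>

context
 fixes \<epsilon> :: real
 assumes eps: "0 < \<epsilon>" "\<epsilon> < 1"
begin

lemma ln_eps: "\<bar>ln \<epsilon>\<bar> = - ln \<epsilon>" "\<bar>ln \<epsilon>\<bar> > 0"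
 using eps ln_less_zero[of \<epsilon>] by auto

lemma B_eps_nonneg: "B_eps n \<epsilon> s >= 0"
 by (simp add: B_eps_def B_fun_nonneg)

lemma B_eps_mono: "s <= s' ==> B_eps n \<epsilon> s <= B_eps n \<epsilon> s'"
 unfolding B_eps_def using eps by (intro divide_right_mono B_fun_mono) auto

lemma B_eps_0: "B_eps n \<epsilon> 0 = 0"
 by (simp add: B_eps_def B_fun_0)

lemma continuous_on_B_eps: "continuous_on A (B_eps n \<epsilon>)"
 unfolding B_eps_def[abs_def] using ln_eps(2) eps
 by (intro continuous_on_divide continuous_on_compose2[OF continuous_on_B] continuous_intros) auto

text \<open>For bounded u, rho^eps exceeds 1 by at most O(1/|ln eps|). With the next two lemmas it
  is O(1/|ln eps|) where u <= eps and at least 1 - O(1/|ln eps|) where u is above a fixed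
  level.\<close>

lemma B_eps_upper:
 assumes "s <= M" "M >= 1"
 shows "B_eps n \<epsilon> s <= 1 + (B_fun n 1 + ln M) / \<bar>ln \<epsilon>\<bar>"
proof -
 have "1 <= M / \<epsilon>" using assms eps by (simp add: field_simps)
 from B_fun_upper[OF this] have "B_fun n (M / \<epsilon>) <= B_fun n 1 + ln M + \<bar>ln \<epsilon>\<bar>"
  using assms eps ln_eps(1) by (simp add: ln_div)
 then have "B_eps n \<epsilon> M <= (B_fun n 1 + ln M + \<bar>ln \<epsilon>\<bar>) / \<bar>ln \<epsilon>\<bar>"
  unfolding B_eps_def by (rule divide_right_mono) simp
 also have "\<dots> = 1 + (B_fun n 1 + ln M) / \<bar>ln \<epsilon>\<bar>"
  using ln_eps(2) by (simp add: field_simps)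
 finally show ?thesis using B_eps_mono[OF assms(1)] by simp
qed

lemma B_eps_small: "s <= \<epsilon> ==> B_eps n \<epsilon> s <= B_fun n 1 / \<bar>ln \<epsilon>\<bar>"
 using B_eps_mono[of s \<epsilon>] eps by (simp add: B_eps_def)

lemma B_eps_lower:
 assumes "\<delta> >= \<epsilon>"
 shows "B_eps n \<epsilon> \<delta> >= 1 + (ln \<delta> - 1 / ((4 - n) * (3 - n))) / \<bar>ln \<epsilon>\<bar>"
proof -
 have "1 <= \<delta> / \<epsilon>" using assms eps by (simp add: field_simps)
 from B_fun_lower[OF this] have "ln \<delta> + \<bar>ln \<epsilon>\<bar> - 1 / ((4 - n) * (3 - n)) <= B_fun n (\<delta> / \<epsilon>)"
  using assms eps ln_eps(1) by (simp add: ln_div)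
 then have "(ln \<delta> + \<bar>ln \<epsilon>\<bar> - 1 / ((4 - n) * (3 - n))) / \<bar>ln \<epsilon>\<bar> <= B_eps n \<epsilon> \<delta>"
  unfolding B_eps_def by (rule divide_right_mono) simp
 moreover have "(ln \<delta> + \<bar>ln \<epsilon>\<bar> - 1 / ((4 - n) * (3 - n))) / \<bar>ln \<epsilon>\<bar> = 1 + (ln \<delta> - 1 / ((4 - n) * (3 - n))) / \<bar>ln \<epsilon>\<bar>"
  using ln_eps(2) by (simp add: add_divide_distrib diff_divide_distrib)
 ultimately show ?thesis by simp
qed

lemma deriv_B_eps:
 assumes "s > 0"
 shows "deriv (B_eps n \<epsilon>) s = B_slope n (s / \<epsilon>) / (\<epsilon> * \<bar>ln \<epsilon>\<bar>)"
proof -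
 have "((%s. B_fun n (s / \<epsilon>) / \<bar>ln \<epsilon>\<bar>) has_real_derivative B_slope n (s / \<epsilon>) * (1 / \<epsilon>) / \<bar>ln \<epsilon>\<bar>) (at s)"
  using assms eps by (intro DERIV_cdivide DERIV_chain2[OF B_fun_has_deriv]) (auto intro!: derivative_eq_intros)
 then show ?thesis
  by (auto simp: B_eps_def[abs_def] dest!: DERIV_imp_deriv)
qed

end

lemma mobility_nonneg: "0 <= u ==> 0 < \<epsilon> ==> 0 <= mobility n \<epsilon> u"
 by (simp add: mobility_def)

text \<open>In s = u/eps the mobility is eps^3 (s^n + s^3). For s <= 1 the bound of B' with 2
  \<gamma> <= n suffices; for s > 1, B' <= 1/s leaves 2 s eps = 2 u. The bound is uniform in
  eps.\<close>

lemma flux_weight_bound: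
 obtains C where "C >= 0"
  "!!\<epsilon> u M. 0 < \<epsilon> ==> \<epsilon> < 1 ==> 0 < u ==> u <= M ==>
   (B_slope n (u / \<epsilon>))^2 * mobility n \<epsilon> u / \<epsilon>^2 <= C + 2 * M"
proof -
 obtain C \<gamma> where C: "0 <= \<gamma>" "\<gamma> < 1" "2 * \<gamma> <= n" "C > 0" "!!r. r > 0 ==> B_slope n r <= C * r powr (-\<gamma>)"
  using B_slope_singularity by metis
 have "(B_slope n (u / \<epsilon>))^2 * mobility n \<epsilon> u / \<epsilon>^2 <= 2 * C^2 + 2 * M"
  if e: "0 < \<epsilon>" "\<epsilon> < 1" and u: "0 < u" "u <= M" for \<epsilon> u M
 proof -
  define s where "s = u / \<epsilon>"
  have s: "s > 0" "u = s * \<epsilon>" using e u by (auto simp: s_def)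
  have "mobility n \<epsilon> u = \<epsilon> powr (3 - n) * (s powr n * \<epsilon> powr n) + s ^ 3 * \<epsilon> ^ 3"
   unfolding mobility_def s(2) using s e by (simp add: powr_mult power_mult_distrib)
  also have "\<epsilon> powr (3 - n) * (s powr n * \<epsilon> powr n) = s powr n * \<epsilon> powr 3"
   by (simp add: powr_add[symmetric] mult.left_commute)
  also have "\<epsilon> powr 3 = \<epsilon> ^ 3" using e by simp
  finally have m: "mobility n \<epsilon> u = \<epsilon> ^ 3 * (s powr n + s ^ 3)"
   by (simp add: algebra_simps)
  have eq: "(B_slope n (u / \<epsilon>))^2 * mobility n \<epsilon> u / \<epsilon>^2 = \<epsilon> * ((B_slope n s)^2 * (s powr n + s ^ 3))"
   unfolding m s_def[symmetric] using e by (simp add: power2_eq_square power3_eq_cube)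
  show ?thesis
  proof (cases "s <= 1")
   case True
   have "(B_slope n s)^2 <= (C * s powr (-\<gamma>))^2"
    using C(5)[OF s(1)] B_slope_nonneg[of s] s by (intro power_mono) auto
   also have "\<dots> = C^2 * s powr (- (2 * \<gamma>))"
    by (simp add: power_mult_distrib power2_eq_square powr_add[symmetric])
   finally have "(B_slope n s)^2 * (s powr n + s ^ 3) <= C^2 * s powr (- (2 * \<gamma>)) * (s powr n + s ^ 3)"
    using s by (intro mult_right_mono) auto
   also have "\<dots> = C^2 * (s powr (n - 2 * \<gamma>) + s powr (3 - 2 * \<gamma>))"
    using s by (simp add: powr_diff powr_minus field_simps)
   also have "\<dots> <= C^2 * (1 + 1)"
    using C True s by (intro mult_left_mono add_mono powr_le1) auto
   finally have "\<epsilon> * ((B_slope n s)^2 * (s powr n + s ^ 3)) <= 1 * (C^2 * (1 + 1))"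
    by (intro mult_mono[OF less_imp_le[OF e(2)]]) (use e s in auto)
   then show ?thesis unfolding eq using u by simp
  next
   case False
   have "(B_slope n s)^2 <= (1 / s)^2"
    using B_slope_le[OF s(1)] B_slope_nonneg[of s] s by (intro power_mono) auto
   moreover have "s powr n <= s powr 3" using False n by (intro powr_mono) auto
   then have "s powr n + s ^ 3 <= 2 * s ^ 3" using s by simp
   ultimately have "(B_slope n s)^2 * (s powr n + s ^ 3) <= (1 / s)^2 * (2 * s ^ 3)"
    using s by (intro mult_mono) auto
   also have "\<dots> = 2 * s" using s by (simp add: power2_eq_square power3_eq_cube)
   finally have "(B_slope n s)^2 * (s powr n + s ^ 3) <= 2 * s" .
   then have "\<epsilon> * ((B_slope n s)^2 * (s powr n + s ^ 3)) <= \<epsilon> * (2 * s)"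
    using e by (intro mult_left_mono) auto
   also have "\<epsilon> * (2 * s) = 2 * u" using s(2) by simp
   finally show ?thesis unfolding eq using u zero_le_power2[of C] by linarith
  qed
 qed
 then show thesis by (intro that[of "2 * C^2"]) auto
qed

text \<open>The factor |ln eps| of R cancels against the one in (B^eps)', leaving (B'/eps) m u_xxx
  with m the mobility. Young's inequality pairs sqrt(|ln eps| m) u_xxx, whose square is the
  dissipation density, with sqrt(m) B'/eps, and a factor 1/sqrt |ln eps| remains. So the flux
  disappears in the limit. Where u = 0, the factor u makes R vanish whatever value
  \<open>deriv\<close> has there.\<close>

lemma R_eps_bound:
 obtains C where "C >= 0"
  "!!\<epsilon> M u uxxx t x. 0 < \<epsilon> ==> \<epsilon> < 1 ==> 0 <= u t x ==> u t x <= M ==>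
   \<bar>R_eps n \<epsilon> u uxxx t x\<bar> <= (\<bar>ln \<epsilon>\<bar> * mobility n \<epsilon> (u t x) * (uxxx t x)^2 + C + 2 * M) / (2 * sqrt \<bar>ln \<epsilon>\<bar>)"
proof -
 obtain C where C: "C >= 0"
  "!!\<epsilon> u M. 0 < \<epsilon> ==> \<epsilon> < 1 ==> 0 < u ==> u <= M ==>
   (B_slope n (u / \<epsilon>))^2 * mobility n \<epsilon> u / \<epsilon>^2 <= C + 2 * M"
  using flux_weight_bound by metis
 have "\<bar>R_eps n \<epsilon> u uxxx t x\<bar> <= (\<bar>ln \<epsilon>\<bar> * mobility n \<epsilon> (u t x) * (uxxx t x)^2 + C + 2 * M) / (2 * sqrt \<bar>ln \<epsilon>\<bar>)"
  if e: "0 < \<epsilon>" "\<epsilon> < 1" and u: "0 <= u t x" "u t x <= M" for \<epsilon> M and u uxxx :: "real => real => real" and t x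
 proof -
  define L where "L = \<bar>ln \<epsilon>\<bar>"
  have L: "L > 0" using ln_eps(2)[OF e] by (simp add: L_def)
  have m0: "mobility n \<epsilon> (u t x) >= 0" using mobility_nonneg u e by blast
  show ?thesis
  proof (cases "u t x = 0")
   case True
   then show ?thesis using m0 C(1) u L by (simp add: R_eps_def L_def[symmetric])
  next
   case False
   then have u0: "u t x > 0" using u by simp
   define m where "m = mobility n \<epsilon> (u t x)"
   define \<beta> where "\<beta> = B_slope n (u t x / \<epsilon>)"
   have pm: "(\<epsilon> powr (3 - n) * u t x powr (n - 1) + (u t x)^2) * u t x = m"
   proof -
    have "u t x powr (n - 1) * u t x = u t x powr n"
     using u0 powr_add[of "u t x" "n - 1" 1] by simp
    then show ?thesis by (simp add: m_def mobility_def algebra_simps power2_eq_square power3_eq_cube)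
   qed
   have "R_eps n \<epsilon> u uxxx t x = - (L * (\<beta> / (\<epsilon> * L)) * ((\<epsilon> powr (3 - n) * u t x powr (n - 1) + (u t x)^2) * u t x) * uxxx t x)"
    unfolding R_eps_def deriv_B_eps[OF e u0] \<beta>_def L_def by (simp only: mult_minus_left mult.assoc)
   also have "\<dots> = - (\<beta> / \<epsilon> * m * uxxx t x)"
    unfolding pm using L by simp
   finally have "\<bar>R_eps n \<epsilon> u uxxx t x\<bar> = \<bar>\<beta> / \<epsilon> * m * uxxx t x\<bar>" by simp
   also have "\<dots> = \<bar>(sqrt (L * m) * uxxx t x) * (sqrt m * \<beta> / \<epsilon>)\<bar> / sqrt L"
    using L m0 by (simp add: m_def[symmetric] abs_mult real_sqrt_mult)
   also have "\<dots> <= ((sqrt (L * m) * uxxx t x)^2 + (sqrt m * \<beta> / \<epsilon>)^2) / 2 / sqrt L"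
   proof (rule divide_right_mono)
    show "\<bar>(sqrt (L * m) * uxxx t x) * (sqrt m * \<beta> / \<epsilon>)\<bar> <= ((sqrt (L * m) * uxxx t x)^2 + (sqrt m * \<beta> / \<epsilon>)^2) / 2"
     by (rule abs_mult_le_sum_squares)
   qed (use L in simp)
   also have "(sqrt (L * m) * uxxx t x)^2 = L * m * (uxxx t x)^2"
    using L m0 by (simp add: power_mult_distrib m_def[symmetric])
   also have "(sqrt m * \<beta> / \<epsilon>)^2 = \<beta>^2 * m / \<epsilon>^2"
    using m0 by (simp add: power_mult_distrib power_divide m_def[symmetric])
   also have "(L * m * (uxxx t x)^2 + \<beta>^2 * m / \<epsilon>^2) / 2 / sqrt L <= (L * m * (uxxx t x)^2 + (C + 2 * M)) / 2 / sqrt L"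
    using C(2)[OF e u0 u(2)] L by (intro divide_right_mono add_mono) (auto simp: \<beta>_def m_def)
   finally show ?thesis by (simp add: m_def L_def add.assoc)
  qed
 qed
 then show thesis using C(1) that by blast
qed

end

section \<open>Limits of integrals and a one-dimensional inequality\<close>

lemma Fatou_integrable:
 fixes f :: "nat => 'a => real"
 assumes f: "!!n. integrable M (f n)" and f0: "!!n. AE x in M. 0 <= f n x"
  and lim: "AE x in M. (%n. f n x) ----> g x" and g: "g \<in> borel_measurable M"
  and C: "!!n. (\<integral>x. f n x \<partial>M) <= C n" "C ----> c"
 shows "integrable M g" "(\<integral>x. g x \<partial>M) <= c"
proof -
 have f0': "AE x in M. \<forall>n. 0 <= f n x" using f0 by (simp add: AE_all_countable)
 have g0: "AE x in M. 0 <= g x"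
  using f0' lim by eventually_elim (auto intro: LIMSEQ_le_const)
 have "(\<integral>\<^sup>+x. ennreal (g x) \<partial>M) = (\<integral>\<^sup>+x. liminf (%n. ennreal (f n x)) \<partial>M)"
 proof (rule nn_integral_cong_AE)
  show "AE x in M. ennreal (g x) = liminf (%n. ennreal (f n x))"
   using lim
  proof eventually_elim
   case (elim x)
   then have "(%n. ennreal (f n x)) ----> ennreal (g x)" by (intro tendsto_ennrealI)
   then show ?case by (simp add: lim_imp_Liminf)
  qed
 qed
 also have "\<dots> <= liminf (%n. \<integral>\<^sup>+x. ennreal (f n x) \<partial>M)"
  using f by (intro nn_integral_liminf) auto
 also have "\<dots> <= liminf (%n. ennreal (C n))"
 proof (rule Liminf_mono, rule always_eventually, rule allI)
  fix n
  have "(\<integral>\<^sup>+x. ennreal (f n x) \<partial>M) = ennreal (\<integral>x. f n x \<partial>M)"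
   by (rule nn_integral_eq_integral[OF f f0])
  also have "\<dots> <= ennreal (C n)" using C(1) by (rule ennreal_leI)
  finally show "(\<integral>\<^sup>+x. ennreal (f n x) \<partial>M) <= ennreal (C n)" .
 qed
 also have "\<dots> = ennreal c"
  using C(2) by (intro lim_imp_Liminf tendsto_ennrealI) auto
 finally have le: "(\<integral>\<^sup>+x. ennreal (g x) \<partial>M) <= ennreal c" .
 then have "(\<integral>\<^sup>+x. ennreal (g x) \<partial>M) < \<infinity>" using le_less_trans by fastforce
 then show gi: "integrable M g" using g g0 by (simp add: integrableI_nonneg)
 have "0 <= (\<integral>x. f n x \<partial>M)" for n by (rule integral_nonneg_AE[OF f0])
 then have "0 <= C n" for n using C(1)[of n] by (meson order_trans)
 then have c0: "0 <= c" using C(2) by (auto intro: LIMSEQ_le_const)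
 have "ennreal (\<integral>x. g x \<partial>M) <= ennreal c"
  using le nn_integral_eq_integral[OF gi g0] by simp
 then show "(\<integral>x. g x \<partial>M) <= c" using c0 by (simp add: ennreal_le_iff)
qed

lemma interval_exhaustion:
 fixes a b :: real
 assumes "a < b"
 obtains c d :: "nat => real" where "!!n. a < c n" "!!n. c n < d n" "!!n. d n < b"
  "c ----> a" "d ----> b" "!!x. x \<in> {a<..<b} ==> eventually (%n. x \<in> {c n..d n}) sequentially"
proof -
 define h where "h n = (b - a) / 4 * (1 / real (Suc n))" for n
 have h: "0 < h n" "h n <= (b - a) / 4" for n
 proof -
  show "0 < h n" using assms by (simp add: h_def)
  have "(b - a) / 4 * (1 / real (Suc n)) <= (b - a) / 4 * 1"
   using assms by (intro mult_left_mono) auto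
  then show "h n <= (b - a) / 4" by (simp add: h_def)
 qed
 have h0: "h ----> 0"
  unfolding h_def using tendsto_mult[OF tendsto_const[of "(b - a) / 4"] LIMSEQ_inverse_real_of_nat]
  by (simp add: inverse_eq_divide)
 show thesis
 proof (rule that[of "%n. a + h n" "%n. b - h n"])
  show c: "(%n. a + h n) ----> a" using tendsto_add[OF tendsto_const h0, of a] by simp
  show d: "(%n. b - h n) ----> b" using tendsto_diff[OF tendsto_const h0, of b] by simp
  fix x assume "x \<in> {a<..<b}"
  then have "eventually (%n. a + h n < x) sequentially" "eventually (%n. x < b - h n) sequentially"
   using order_tendstoD(2)[OF c, of x] order_tendstoD(1)[OF d, of x] by auto
  then show "eventually (%n. x \<in> {a + h n..b - h n}) sequentially"
   by eventually_elim auto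
 next
  fix n show "a < a + h n" "a + h n < b - h n" "b - h n < b"
   using h[of n] assms by auto
 qed
qed

lemma set_integral_interval_exhaustion:
 fixes f :: "real => real"
 assumes f: "L1_on {a<..<b} f"
  and cd: "!!n. a < c n" "!!n. d n < b" "!!x. x \<in> {a<..<b} ==> eventually (%n. x \<in> {c n..d n}) sequentially"
 shows "(%n. LBINT x:{c n..d n}. f x) ----> (LBINT x:{a<..<b}. f x)"
 unfolding set_lebesgue_integral_def
proof (rule integral_dominated_convergence[where w="%x. norm (indicator {a<..<b} x *\<^sub>R f x)"])
 have sub: "{c n..d n} <= {a<..<b}" for n using cd(1,2)[of n] by auto
 show "(%x. indicator {c n..d n} x *\<^sub>R f x) \<in> borel_measurable lborel" for n
  using set_integrable_subset[OF f _ sub[of n]] by (auto simp: set_integrable_def)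
 show "AE x in lborel. (%n. indicator {c n..d n} x *\<^sub>R f x) ----> indicator {a<..<b} x *\<^sub>R f x"
 proof (intro AE_I2)
  fix x
  show "(%n. indicator {c n..d n} x *\<^sub>R f x) ----> indicator {a<..<b} x *\<^sub>R f x"
  proof (rule tendsto_eventually, cases "x \<in> {a<..<b}")
   case True
   from cd(3)[OF True] show "EV n. indicator {c n..d n} x *\<^sub>R f x = indicator {a<..<b} x *\<^sub>R f x"
    by eventually_elim (use True in auto)
  next
   case False
   then have "x \<notin> {c n..d n}" for n using sub[of n] by blast
   then show "EV n. indicator {c n..d n} x *\<^sub>R f x = indicator {a<..<b} x *\<^sub>R f x"
    using False by auto
  qed
 qed
 show "AE x in lborel. norm (indicator {c n..d n} x *\<^sub>R f x) <= norm (indicator {a<..<b} x *\<^sub>R f x)" for n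
  using sub[of n] by (intro AE_I2) (auto simp: indicator_def)
qed (use f in \<open>auto simp: set_integrable_def\<close>)

text \<open>g need not be integrable up to the end points. On exhausting compact intervals the
  integral of f is at most an increment of G plus the integral of h, and Fatou's lemma gives both
  the integrability of f and the bound.\<close>

lemma prim_on_limits_bound:
 fixes a b :: real
 assumes ab: "a < b" and G: "prim_on {a<..<b} G g"
  and f: "meas_on {a<..<b} f" and f0: "!!x. x \<in> {a<..<b} ==> 0 <= f x"
  and le: "!!x. x \<in> {a<..<b} ==> f x <= g x + h x"
  and h: "L1_on {a<..<b} h"
  and la: "(G \<longlongrightarrow> A) (at_right a)" and lb: "(G \<longlongrightarrow> B) (at_left b)"
 shows "L1_on {a<..<b} f" "(LBINT x:{a<..<b}. f x) <= B - A + (LBINT x:{a<..<b}. h x)"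
proof -
 obtain c d where cd: "!!n. a < c n" "!!n. c n < d n" "!!n. d n < b"
  "c ----> a" "d ----> b" "!!x. x \<in> {a<..<b} ==> eventually (%n. x \<in> {c n..d n}) sequentially"
  by (rule interval_exhaustion[OF ab], rule that)
 have sub: "{c n..d n} <= {a<..<b}" for n using cd(1)[of n] cd(3)[of n] by auto
 have fin: "L1_on {c n..d n} f & (LBINT x:{c n..d n}. f x) <= G (d n) - G (c n) + (LBINT x:{c n..d n}. h x)" for n
 proof -
  have gi: "L1_on {c n..d n} g" "G (d n) - G (c n) = (LBINT x:{c n..d n}. g x)"
   using prim_onD[OF G _ sub] cd(2)[of n] by auto
  have hi: "L1_on {c n..d n} h" using set_integrable_subset[OF h _ sub] by simp
  have fm: "meas_on {c n..d n} f" using set_borel_measurable_subset[OF f _ sub] by simp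
  have bd: "norm (f x) <= norm (g x + h x)" if "x \<in> {c n..d n}" for x
   using f0[OF subsetD[OF sub that]] le[OF subsetD[OF sub that]] by auto
  have fi: "L1_on {c n..d n} f"
   by (rule set_integrable_bound[OF set_integral_add(1)[OF gi(1) hi] fm]) (use bd in auto)
  moreover have "(LBINT x:{c n..d n}. f x) <= (LBINT x:{c n..d n}. g x + h x)"
   using le sub by (intro set_integral_mono fi set_integral_add(1) gi hi) blast
  ultimately show ?thesis using gi hi by (simp add: set_integral_add)
 qed
 have lim: "(%n. G (d n) - G (c n) + (LBINT x:{c n..d n}. h x)) ----> B - A + (LBINT x:{a<..<b}. h x)"
 proof (intro tendsto_add tendsto_diff set_integral_interval_exhaustion[OF h cd(1,3,6)])
  have "filterlim d (at_left b) sequentially"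
   using cd(3,5) by (auto simp: filterlim_at less_imp_neq)
  then show "(%n. G (d n)) ----> B" by (rule filterlim_compose[OF lb])
  have "filterlim c (at_right a) sequentially"
   using cd(1,4) by (auto simp: filterlim_at less_imp_neq[THEN not_sym])
  then show "(%n. G (c n)) ----> A" by (rule filterlim_compose[OF la])
 qed
 have fin1: "integrable lborel (%x. indicator {c n..d n} x *\<^sub>R f x)"
  "(\<integral>x. indicator {c n..d n} x *\<^sub>R f x \<partial>lborel) <= G (d n) - G (c n) + (LBINT x:{c n..d n}. h x)" for n
  using fin[of n] by (auto simp: set_integrable_def set_lebesgue_integral_def)
 have nn: "AE x in lborel. 0 <= indicator {c n..d n} x *\<^sub>R f x" for n
  using f0 sub[of n] by (intro AE_I2) (auto simp: indicator_def subset_iff)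
 have pt: "AE x in lborel. (%n. indicator {c n..d n} x *\<^sub>R f x) ----> indicator {a<..<b} x *\<^sub>R f x"
 proof (intro AE_I2)
  fix x
  show "(%n. indicator {c n..d n} x *\<^sub>R f x) ----> indicator {a<..<b} x *\<^sub>R f x"
  proof (rule tendsto_eventually, cases "x \<in> {a<..<b}")
   case True
   from cd(6)[OF True] show "EV n. indicator {c n..d n} x *\<^sub>R f x = indicator {a<..<b} x *\<^sub>R f x"
    by eventually_elim (use True in auto)
  next
   case False
   then have "x \<notin> {c n..d n}" for n using sub[of n] by blast
   then show "EV n. indicator {c n..d n} x *\<^sub>R f x = indicator {a<..<b} x *\<^sub>R f x"
    using False by auto
  qed
 qed
 have fm: "(%x. indicator {a<..<b} x *\<^sub>R f x) \<in> borel_measurable lborel"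
  using f by (simp add: set_borel_measurable_def)
 show "L1_on {a<..<b} f" "(LBINT x:{a<..<b}. f x) <= B - A + (LBINT x:{a<..<b}. h x)"
  unfolding set_integrable_def set_lebesgue_integral_def[of _ _ f]
  using Fatou_integrable[OF fin1(1) nn pt fm fin1(2) lim] by auto
qed

lemma Cauchy_Schwarz_set_integral:
 fixes f g :: "'a => real"
 assumes f: "set_borel_measurable M A f" and g: "set_borel_measurable M A g"
  and f2: "set_integrable M A (%x. (f x)^2)" and g2: "set_integrable M A (%x. (g x)^2)"
 shows "set_integrable M A (%x. f x * g x)"
  and "(LINT x:A|M. f x * g x)^2 <= (LINT x:A|M. (f x)^2) * (LINT x:A|M. (g x)^2)"
proof -
 have m: "set_borel_measurable M A (%x. f x * g x)"
  using borel_measurable_times[OF f[unfolded set_borel_measurable_def] g[unfolded set_borel_measurable_def]]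
  unfolding set_borel_measurable_def
  by (rule measurable_cong[THEN iffD1, rotated]) (auto simp: indicator_def)
 show fg: "set_integrable M A (%x. f x * g x)"
 proof (rule set_integrable_bound[OF _ m])
  show "set_integrable M A (%x. ((f x)^2 + (g x)^2) / 2)" using f2 g2 by simp
  show "AE x in M. x \<in> A --> norm (f x * g x) <= norm (((f x)^2 + (g x)^2) / 2)"
   using abs_mult_le_sum_squares by (auto intro!: AE_I2 order_trans[OF abs_mult_le_sum_squares])
 qed
 define F where "F = (LINT x:A|M. (f x)^2)"
 define H where "H = (LINT x:A|M. (g x)^2)"
 define P where "P = (LINT x:A|M. f x * g x)"
 have quad: "0 <= F * s^2 + 2 * s * t * P + H * t^2" for s t :: real
 proof -
  have "0 <= (LINT x:A|M. (s * f x + t * g x)^2)"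
   unfolding set_lebesgue_integral_def by (intro integral_nonneg_AE) (auto simp: indicator_def)
  also have "(LINT x:A|M. (s * f x + t * g x)^2) = (LINT x:A|M. s^2 * (f x)^2 + (2 * s * t * (f x * g x) + t^2 * (g x)^2))"
   by (simp add: power2_sum power_mult_distrib algebra_simps)
  also have "\<dots> = s^2 * F + (2 * s * t * P + t^2 * H)"
  proof -
   have "(LINT x:A|M. 2 * s * t * (f x * g x) + t^2 * (g x)^2) = 2 * s * t * P + t^2 * H"
    unfolding P_def H_def
    by (subst set_integral_add(2)) (use fg g2 in \<open>auto simp only: set_integral_mult_right intro!: set_integrable_mult_right\<close>)
   moreover have "set_integrable M A (%x. 2 * s * t * (f x * g x) + t^2 * (g x)^2)"
    by (intro set_integral_add(1) set_integrable_mult_right fg g2)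
   ultimately show ?thesis
    unfolding F_def
    by (subst set_integral_add(2)) (use f2 in \<open>auto simp only: set_integral_mult_right intro!: set_integrable_mult_right\<close>)
  qed
  finally show ?thesis by (simp add: algebra_simps)
 qed
 have F0: "F >= 0" "H >= 0"
  unfolding F_def H_def set_lebesgue_integral_def by (intro integral_nonneg_AE; auto simp: indicator_def)+
 have "P^2 <= F * H"
 proof (cases "F = 0")
  case True
  have "P = 0"
  proof (rule ccontr)
   assume "P \<noteq> 0"
   \<comment> \<open>For F = 0 the quadratic form is affine in s, and this s gives it the value
     -1.\<close>
   then show False
    using quad[of "- (H + 1) / (2 * P)" 1] True F0 by (simp add: field_simps)
  qed
  then show ?thesis using True by simp
 next
  case False
  then have "F > 0" using F0 by simp
  have "0 <= F * P^2 + 2 * P * (- F) * P + H * F^2" using quad[of P "- F"] by (simp add: power2_eq_square)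
  then have "0 <= F * (F * H - P^2)" by (simp add: power2_eq_square algebra_simps)
  then show ?thesis using \<open>F > 0\<close> by (simp add: zero_le_mult_iff)
 qed
 then show "(LINT x:A|M. f x * g x)^2 <= (LINT x:A|M. (f x)^2) * (LINT x:A|M. (g x)^2)"
  by (simp add: F_def H_def P_def)
qed

text \<open>The measure of \<open>{f > 0}\<close> to the left of \<open>x\<close>, shifted by \<open>q\<close>, plays the role of the
 primitive of 1 on the support and makes a decomposition into components unnecessary.\<close>

lemma integral_le_support_energy:
 fixes f g :: "real => real"
 assumes cd: "c < d" and f: "prim_on {c<..<d} f g" and cf: "continuous_on {c..d} f"
  and f0: "!!x. x \<in> {c..d} ==> 0 <= f x" and gm: "meas_on {c<..<d} g"
  and g2: "L1_on {c<..<d} (%x. (g x)^2)" and g0: "!!x. x \<in> {c<..<d} ==> f x = 0 ==> g x = 0"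
  and l: "l = measure lborel {x\<in>{c<..<d}. f x > 0}" and bd: "(l - q) * f d + q * f c = 0"
 shows "(LBINT x:{c<..<d}. f x)^2 <= ((l - q) ^ 3 + q ^ 3) / 3 * (LBINT x:{c<..<d}. (g x)^2)"
proof -
 define P where "P = {x\<in>{c<..<d}. f x > 0}"
 have cfo: "continuous_on {c<..<d} f" by (rule continuous_on_subset[OF cf]) auto
 have Pb: "P \<in> sets borel"
 proof -
  have "open (f -` {0<..} \<inter> {c<..<d})"
   using cfo by (subst (asm) continuous_on_open_vimage) auto
  moreover have "f -` {0<..} \<inter> {c<..<d} = P" by (auto simp: P_def)
  ultimately show ?thesis by auto
 qed
 have Pi: "L1_on {c..d} (indicator P :: real => real)"
 proof (rule set_integrable_bound[OF borel_integrable_atLeastAtMost'[of c d "%_. 1"]])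
  show "meas_on {c..d} (indicat_real P)" using Pb by (simp add: set_borel_measurable_def)
  show "AE x\<in>{c..d} in lborel. norm (indicat_real P x) <= norm (1 :: real)" by simp
 qed auto
 define m where "m x = (LBINT z:{c..x}. indicator P z) - q" for x
 have pm: "prim_on {c<..<d} m (indicator P)"
 proof (rule prim_on_subset[of "{c..d}"])
  show "prim_on {c..d} m (indicator P)" using prim_on_indefinite(1)[OF Pi] by (simp add: prim_on_def m_def)
 qed auto
 have cmc: "continuous_on {c..d} m" unfolding m_def by (intro continuous_intros prim_on_indefinite(2)[OF Pi])
 have cm: "continuous_on {c<..<d} m" by (rule continuous_on_subset[OF cmc]) auto
 have "(LBINT z:{c..c}. indicat_real P z) = (LBINT z:{}. indicator P z)"
  unfolding set_lebesgue_integral_def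
  by (rule integral_discrete_difference[where X="{c}"]) auto
 then have mc: "m c = - q" by (simp add: m_def set_lebesgue_integral_def)
 have "(%x. indicat_real {c..d} x *\<^sub>R indicat_real P x) = indicator P" by (auto simp: P_def indicator_def fun_eq_iff)
 then have md: "m d = l - q" by (simp add: m_def set_lebesgue_integral_def l P_def)
 have m_c: "(m \<longlongrightarrow> - q) (at_right c)" and m_d: "(m \<longlongrightarrow> l - q) (at_left d)"
  and f_c: "(f \<longlongrightarrow> f c) (at_right c)" and f_d: "(f \<longlongrightarrow> f d) (at_left d)"
  using continuous_on_Icc_at_rightD[OF cmc cd] continuous_on_Icc_at_leftD[OF cmc cd]
   continuous_on_Icc_at_rightD[OF cf cd] continuous_on_Icc_at_leftD[OF cf cd] unfolding mc md by auto
 have fi: "L1_on {c<..<d} f"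
  using borel_integrable_atLeastAtMost'[OF cf] by (rule set_integrable_subset) auto
 have m3: "prim_on {c<..<d} (%x. (m x) ^ 3) (%x. 3 * (m x)^2 * indicator P x)"
 proof (rule prim_on_chain[OF pm, of "%y. y ^ 3" "%y. 3 * y^2"])
  show "is_interval (m ` {c<..<d})"
   using connected_continuous_image[OF cm connected_Ioo] by (simp add: is_interval_connected_1)
  show "continuous_on {c<..<d} m" by (rule cm)
 qed (auto intro!: derivative_eq_intros continuous_intros)
 have mm: "meas_on {c<..<d} m"
  using borel_measurable_continuous_on_indicator[OF _ cm] by (simp add: set_borel_measurable_def)
 have wm: "meas_on {c<..<d} (%x. m x * indicator P x)"
  using borel_measurable_times[OF mm[unfolded set_borel_measurable_def], of "indicator P"] Pb
  by (simp add: set_borel_measurable_def mult.assoc)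
 have w2m: "meas_on {c<..<d} (%x. (m x * indicator P x)^2)"
  using borel_measurable_power[OF wm[unfolded set_borel_measurable_def], of 2]
  unfolding set_borel_measurable_def
  by (rule measurable_cong[THEN iffD1, rotated]) (auto simp: indicator_def)
 have T1: "((%x. 1 / 3 * m x ^ 3) \<longlongrightarrow> 1 / 3 * (- q) ^ 3) (at_right c)"
  by (intro tendsto_intros m_c)
 have T2: "((%x. 1 / 3 * m x ^ 3) \<longlongrightarrow> 1 / 3 * (l - q) ^ 3) (at_left d)"
  by (intro tendsto_intros m_d)
 have nn: "0 <= (m x * indicator P x)^2" for x by simp
 have le: "(m x * indicator P x)^2 <= 1 / 3 * (3 * (m x)^2 * indicator P x) + 0" for x
  by (simp add: indicator_def)
 have i0: "L1_on {c<..<d} (%x. 0 :: real)" by (simp add: set_integrable_def)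
 \<comment> \<open>m^3/3 is a primitive of m^2 on the support, so the weight is ((l - q)^3 + q^3)/3:
   it is l^3/3 for q = 0 and q = l, and minimal, l^3/12, for q = l/2. The hypothesis
   \<open>bd\<close> removes the boundary terms: q = 0 requires f d = 0, q = l requires f c = 0, and
   q = l/2 both.\<close>
 note w2 = prim_on_limits_bound[OF cd prim_on_cmult[OF m3, of "1/3"] w2m nn le i0 T1 T2]
 have gP: "g x * indicator P x = g x" if "x \<in> {c<..<d}" for x
  using g0[OF that] f0[of x] that by (cases "f x = 0") (auto simp: P_def indicator_def less_le)
 note CS = Cauchy_Schwarz_set_integral[OF wm gm w2(1) g2]
 have mf: "prim_on {c<..<d} (%x. m x * f x) (%x. indicator P x * f x + m x * g x)"
  by (rule prim_on_mult[OF pm f cm cfo])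
 have eqf: "indicator P x * f x + m x * g x = f x + m x * indicator P x * g x" if "x \<in> {c<..<d}" for x
  using gP[OF that] f0[of x] that by (auto simp: P_def indicator_def less_le)
 have tot: "L1_on {c<..<d} (%x. f x + m x * indicator P x * g x)"
  by (rule set_integral_add(1)[OF fi CS(1)])
 have "(LBINT x:{c<..<d}. indicator P x * f x + m x * g x) = (l - q) * f d - (- q) * f c"
 proof (rule prim_on_open_interval_limits[OF cd mf])
  show "L1_on {c<..<d} (%x. indicator P x * f x + m x * g x)"
   using tot by (rule set_integrable_cong[THEN iffD1, rotated -1]) (use eqf in auto)
 qed (intro tendsto_mult m_c m_d f_c f_d)+
 moreover have "(LBINT x:{c<..<d}. indicator P x * f x + m x * g x) = (LBINT x:{c<..<d}. f x + m x * indicator P x * g x)"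
  by (rule set_lebesgue_integral_cong) (use eqf in auto)
 ultimately have "(LBINT x:{c<..<d}. f x) + (LBINT x:{c<..<d}. m x * indicator P x * g x) = 0"
  using set_integral_add(2)[OF fi CS(1)] bd by simp
 then have "(LBINT x:{c<..<d}. f x)^2 = (LBINT x:{c<..<d}. m x * indicator P x * g x)^2"
  by (simp add: power2_eq_iff add_eq_0_iff)
 also have "\<dots> <= (LBINT x:{c<..<d}. (m x * indicator P x)^2) * (LBINT x:{c<..<d}. (g x)^2)"
  by (rule CS(2))
 also have "\<dots> <= ((l - q) ^ 3 + q ^ 3) / 3 * (LBINT x:{c<..<d}. (g x)^2)"
 proof (rule mult_right_mono)
  show "(LBINT x:{c<..<d}. (m x * indicator P x)^2) <= ((l - q) ^ 3 + q ^ 3) / 3"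
   using w2(2) by (simp add: power3_eq_cube field_simps)
  show "0 <= (LBINT x:{c<..<d}. (g x)^2)"
   unfolding set_lebesgue_integral_def by (intro integral_nonneg_AE) (auto simp: indicator_def)
 qed
 finally show ?thesis .
qed

section \<open>A convex truncation\<close>

lemma DERIV_max_0:
 assumes f: "!!y. (f has_real_derivative f' y) (at y)" and 0: "f' 0 = 0"
 shows "((%y. f (max 0 y)) has_real_derivative f' (max 0 y)) (at y)"
proof -
 consider "y < 0" | "y > 0" | "y = 0" by linarith
 then show ?thesis
 proof cases
  case 1
  have "eventually (%z. z \<in> {..<0}) (nhds y)" by (rule eventually_nhds_in_open) (use 1 in auto)
  then have "eventually (%z. f (max 0 z) = f 0) (nhds y)" by eventually_elim (auto simp: max_def)
  then show ?thesis
   using DERIV_cong_ev[of y y "%z. f (max 0 z)" "%_. f 0" 0 0] 1 0 by (simp add: max_def)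
 next
  case 2
  have "eventually (%z. z \<in> {0<..}) (nhds y)" by (rule eventually_nhds_in_open) (use 2 in auto)
  then have "eventually (%z. f (max 0 z) = f z) (nhds y)" by eventually_elim (auto simp: max_def)
  then show ?thesis
   using DERIV_cong_ev[of y y "%z. f (max 0 z)" f "f' y" "f' y"] 2 f by (simp add: max_def)
 next
  case 3
  have "((%h. (f h - f 0) / h) \<longlongrightarrow> 0) (at 0)"
   using f[of 0] 0 by (simp add: DERIV_def)
  then have "((%h. (f (max 0 h) - f 0) / h) \<longlongrightarrow> 0) (at 0)"
  proof (rule Lim_null_comparison[rotated, OF tendsto_rabs_zero])
   have "norm ((f (max 0 h) - f 0) / h) <= \<bar>(f h - f 0) / h\<bar>" for h
    by (cases "0 <= h") (simp_all add: max_def del: abs_divide)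
   then show "\<forall>\<^sub>F h in at 0. norm ((f (max 0 h) - f 0) / h) <= \<bar>(f h - f 0) / h\<bar>"
    by simp
  qed
  then show ?thesis using 3 0 by (simp add: DERIV_def)
 qed
qed

text \<open>The truncation is \<delta> (y - arctan y) with y the positive part of s/\<delta> - 1.
  Its derivative y^2/(1 + y^2) increases from 0 towards 1, so it is convex with slope at most 1. It
  is C^2, vanishes for s <= \<delta>, and falls short of s by at most a multiple of
  \<delta>.\<close>

definition cutoff_arg :: "real => real => real" where "cutoff_arg \<delta> s = max 0 (s / \<delta> - 1)"
definition cutoff :: "real => real => real" where "cutoff \<delta> s = \<delta> * (cutoff_arg \<delta> s - arctan (cutoff_arg \<delta> s))"
definition cutoff1 :: "real => real => real" where "cutoff1 \<delta> s = (cutoff_arg \<delta> s)^2 / (1 + (cutoff_arg \<delta> s)^2)"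
definition cutoff2 :: "real => real => real" where "cutoff2 \<delta> s = 2 * cutoff_arg \<delta> s / (1 + (cutoff_arg \<delta> s)^2)^2 / \<delta>"

lemma one_plus_square_pos: "1 + x^2 > (0::real)"
 by (rule add_pos_nonneg) auto

context
 fixes \<delta> :: real
 assumes \<delta>: "\<delta> > 0"
begin

lemma cutoff_deriv: "(cutoff \<delta> has_real_derivative cutoff1 \<delta> s) (at s)"
proof -
 have F: "((%y. max 0 y - arctan (max 0 y)) has_real_derivative (max 0 y)^2 / (1 + (max 0 y)^2)) (at y)" for y
 proof (rule DERIV_max_0[of "%y. y - arctan y" "%y. y^2 / (1 + y^2)"])
  fix y :: real
  have "((%y. y - arctan y) has_real_derivative 1 - inverse (1 + y^2)) (at y)"
   by (auto intro!: derivative_eq_intros)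
  moreover have "1 - inverse (1 + y^2) = y^2 / (1 + y^2)"
   using one_plus_square_pos[of y] by (simp add: field_simps)
  ultimately show "((%y. y - arctan y) has_real_derivative y^2 / (1 + y^2)) (at y)" by simp
 qed simp
 have "((%s. max 0 (s / \<delta> - 1) - arctan (max 0 (s / \<delta> - 1))) has_real_derivative cutoff1 \<delta> s * (1 / \<delta>)) (at s)"
  unfolding cutoff1_def cutoff_arg_def
 proof (rule DERIV_chain2[where f="%y. max 0 y - arctan (max 0 y)" and g="%s. s / \<delta> - 1", OF F])
  show "((%s. s / \<delta> - 1) has_real_derivative 1 / \<delta>) (at s)"
   using \<delta> by (auto intro!: derivative_eq_intros)
 qed
 from DERIV_cmult[OF this, of \<delta>] show ?thesis
  using \<delta> by (simp add: cutoff_def[abs_def] cutoff_arg_def)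
qed

lemma cutoff1_deriv: "(cutoff1 \<delta> has_real_derivative cutoff2 \<delta> s) (at s)"
proof -
 have F: "((%y. (max 0 y)^2 / (1 + (max 0 y)^2)) has_real_derivative 2 * max 0 y / (1 + (max 0 y)^2)^2) (at y)" for y
 proof (rule DERIV_max_0[of "%y. y^2 / (1 + y^2)" "%y. 2 * y / (1 + y^2)^2"])
  fix y :: real
  have "((%y. y^2 / (1 + y^2)) has_real_derivative (2 * y * (1 + y^2) - y^2 * (2 * y)) / ((1 + y^2) * (1 + y^2))) (at y)"
   using one_plus_square_pos[of y] by (auto intro!: derivative_eq_intros)
  moreover have "2 * y * (1 + y^2) - y^2 * (2 * y) = 2 * y" by (simp add: algebra_simps)
  ultimately show "((%y. y^2 / (1 + y^2)) has_real_derivative 2 * y / (1 + y^2)^2) (at y)"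
   by (simp add: power2_eq_square)
 qed simp
 have "((%s. (max 0 (s / \<delta> - 1))^2 / (1 + (max 0 (s / \<delta> - 1))^2)) has_real_derivative
   2 * max 0 (s / \<delta> - 1) / (1 + (max 0 (s / \<delta> - 1))^2)^2 * (1 / \<delta>)) (at s)"
 proof (rule DERIV_chain2[where f="%y. (max 0 y)^2 / (1 + (max 0 y)^2)" and g="%s. s / \<delta> - 1", OF F])
  show "((%s. s / \<delta> - 1) has_real_derivative 1 / \<delta>) (at s)"
   using \<delta> by (auto intro!: derivative_eq_intros)
 qed
 then have "((%s. (max 0 (s / \<delta> - 1))^2 / (1 + (max 0 (s / \<delta> - 1))^2)) has_real_derivative cutoff2 \<delta> s) (at s)"
  by (simp add: cutoff2_def cutoff_arg_def)
 then show ?thesis by (simp add: cutoff1_def[abs_def] cutoff_arg_def)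
qed

lemma continuous_on_cut: "continuous_on A (cutoff \<delta>)" and continuous_on_cut1: "continuous_on A (cutoff1 \<delta>)"
 using cutoff_deriv cutoff1_deriv by (meson DERIV_isCont continuous_at_imp_continuous_on)+

lemma continuous_on_cut2: "continuous_on A (cutoff2 \<delta>)"
proof -
 have "(1 + (cutoff_arg \<delta> s)^2)^2 \<noteq> 0" for s
  using one_plus_square_pos[of "cutoff_arg \<delta> s"] by simp
 then show ?thesis
  unfolding cutoff2_def[abs_def] using \<delta>
  by (intro continuous_on_divide continuous_intros) (auto simp: cutoff_arg_def[abs_def] intro!: continuous_intros)
qed

lemma cutoff_measurable [measurable]: "cutoff \<delta> \<in> borel_measurable borel" "cutoff1 \<delta> \<in> borel_measurable borel" "cutoff2 \<delta> \<in> borel_measurable borel"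
 by (intro borel_measurable_continuous_onI continuous_on_cut continuous_on_cut1 continuous_on_cut2)+

lemma cutoff_arg_nonneg: "cutoff_arg \<delta> s >= 0"
 by (simp add: cutoff_arg_def)

lemma cutoff_zero: "s <= \<delta> ==> cutoff \<delta> s = 0" "s <= \<delta> ==> cutoff1 \<delta> s = 0" "s <= \<delta> ==> cutoff2 \<delta> s = 0"
proof -
 assume "s <= \<delta>"
 then have "cutoff_arg \<delta> s = 0" using \<delta> by (simp add: cutoff_arg_def max_def divide_le_eq)
 then show "cutoff \<delta> s = 0" "cutoff1 \<delta> s = 0" "cutoff2 \<delta> s = 0" by (simp_all add: cutoff_def cutoff1_def cutoff2_def)
qed

lemma cutoff1_bounds: "0 <= cutoff1 \<delta> s" "cutoff1 \<delta> s <= 1"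
 using one_plus_square_pos[of "cutoff_arg \<delta> s"] by (auto simp: cutoff1_def)

lemma cutoff2_nonneg: "0 <= cutoff2 \<delta> s"
 using cutoff_arg_nonneg[of s] \<delta> by (simp add: cutoff2_def)

lemma cutoff_mono: "s <= s' ==> cutoff \<delta> s <= cutoff \<delta> s'"
 by (rule DERIV_nonneg_imp_nondecreasing) (use cutoff_deriv cutoff1_bounds in blast)+

lemma cutoff_nonneg: "0 <= cutoff \<delta> s"
 using cutoff_mono[of "min s \<delta>" s] cutoff_zero(1)[of "min s \<delta>"] by simp

lemma cutoff_pos: "s > \<delta> ==> cutoff \<delta> s > 0"
proof -
 assume s: "s > \<delta>"
 have "cutoff \<delta> \<delta> < cutoff \<delta> s"
 proof (rule DERIV_pos_imp_increasing_open[OF s _ continuous_on_cut])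
  fix x assume "\<delta> < x" "x < s"
  then have "cutoff_arg \<delta> x > 0" using \<delta> by (simp add: cutoff_arg_def less_divide_eq)
  then have "cutoff1 \<delta> x > 0" using one_plus_square_pos[of "cutoff_arg \<delta> x"] by (simp add: cutoff1_def)
  then show "\<exists>y. (cutoff \<delta> has_real_derivative y) (at x) & y > 0" using cutoff_deriv by blast
 qed
 then show ?thesis using cutoff_zero(1)[of \<delta>] by simp
qed

lemma cutoff_le: "0 <= s ==> cutoff \<delta> s <= s"
proof -
 assume s: "0 <= s"
 have "s - cutoff \<delta> s >= 0 - cutoff \<delta> 0"
 proof (rule DERIV_nonneg_imp_nondecreasing[OF s])
  fix x
  show "\<exists>y. ((%s. s - cutoff \<delta> s) has_real_derivative y) (at x) & 0 <= y"
   using cutoff1_bounds(2)[of x] by (intro exI[of _ "1 - cutoff1 \<delta> x"] conjI DERIV_diff DERIV_ident cutoff_deriv) auto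
 qed
 then show ?thesis using cutoff_zero(1)[of 0] \<delta> by simp
qed

lemma cutoff_defect: "s - cutoff \<delta> s <= 3 * \<delta>"
proof (cases "s <= \<delta>")
 case True
 then show ?thesis using cutoff_zero(1)[OF True] \<delta> by simp
next
 case False
 then have "cutoff_arg \<delta> s = s / \<delta> - 1" using \<delta> by (simp add: cutoff_arg_def max_def field_simps)
 then have "\<delta> * cutoff_arg \<delta> s = s - \<delta>" using \<delta> by (simp add: right_diff_distrib)
 then have "s - cutoff \<delta> s = \<delta> + \<delta> * arctan (cutoff_arg \<delta> s)"
  by (simp add: cutoff_def right_diff_distrib)
 also have "\<dots> <= \<delta> + \<delta> * 2"
  using \<delta> arctan_ubound[of "cutoff_arg \<delta> s"] pi_less_4 by (intro add_left_mono mult_left_mono) auto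
 finally show ?thesis by simp
qed

text \<open>The purpose of the truncation: (k(u) u_xxx)^2 is paid for by the dissipation density u^3
  u_xxx^2 at the price 1/\<delta>.\<close>

lemma cutoff_square_le: "0 <= s ==> (cutoff \<delta> s)^2 <= s ^ 3 / \<delta>"
proof (cases "s <= \<delta>")
 case True
 assume "0 <= s"
 then show ?thesis using cutoff_zero(1)[OF True] \<delta> by simp
next
 case False
 assume s: "0 <= s"
 have "(cutoff \<delta> s)^2 <= s^2" using cutoff_le[OF s] cutoff_nonneg[of s] by (intro power_mono) auto
 also have "\<dots> <= s^2 * (s / \<delta>)"
  using False \<delta> mult_left_mono[of 1 "s / \<delta>" "s^2"] by simp
 finally show ?thesis by (simp add: power2_eq_square power3_eq_cube)
qed

end

text \<open>Lowering the level increases k and k', so the differences between the levels \<tau> and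
  \<delta> are nonnegative weights; \<open>cubic_aux\<close> uses them.\<close>

lemma cutoff1_antimono:
 assumes "0 < \<tau>" "\<tau> <= \<delta>" "0 <= s"
 shows "cutoff1 \<delta> s <= cutoff1 \<tau> s"
proof -
 have "s / \<delta> <= s / \<tau>" using assms by (intro divide_left_mono) auto
 then have le: "(cutoff_arg \<delta> s)^2 <= (cutoff_arg \<tau> s)^2"
  by (intro power_mono) (auto simp: cutoff_arg_def)
 have eq: "cutoff1 d s = 1 - 1 / (1 + (cutoff_arg d s)^2)" for d
  using one_plus_square_pos[of "cutoff_arg d s"] by (simp add: cutoff1_def field_simps)
 show ?thesis
  unfolding eq using le one_plus_square_pos[of "cutoff_arg \<delta> s"]
  by (intro diff_left_mono divide_left_mono mult_pos_pos one_plus_square_pos) auto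
qed

lemma cutoff_antimono:
 assumes "0 < \<tau>" "\<tau> <= \<delta>" "0 <= s"
 shows "cutoff \<delta> s <= cutoff \<tau> s"
proof -
 have "cutoff \<tau> 0 - cutoff \<delta> 0 <= cutoff \<tau> s - cutoff \<delta> s"
 proof (rule DERIV_nonneg_imp_nondecreasing[OF assms(3)])
  fix x assume "0 <= x" "x <= s"
  then show "\<exists>y. ((%s. cutoff \<tau> s - cutoff \<delta> s) has_real_derivative y) (at x) & 0 <= y"
   using cutoff1_antimono[OF assms(1,2)] assms
   by (intro exI[of _ "cutoff1 \<tau> x - cutoff1 \<delta> x"] conjI DERIV_diff cutoff_deriv) auto
 qed
 then show ?thesis using cutoff_zero(1)[of \<tau> 0] cutoff_zero(1)[of \<delta> 0] assms by simp
qed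

lemma cutoff1_tendsto_1:
 assumes "\<delta> > 0" "s > 0"
 shows "(%n. cutoff1 (\<delta> / real (Suc n)) s) ----> 1"
proof -
 have "filterlim (%n. real (Suc n) * (s / \<delta>) - 1) at_top sequentially"
  using assms by real_asymp
 have lb: "(%n. 1 - 1 / (1 + (real (Suc n) * (s / \<delta>) - 1)^2)) ----> 1"
  using assms by real_asymp
 show ?thesis
 proof (rule tendsto_sandwich[OF _ _ lb tendsto_const])
  obtain N where N: "real N >= \<delta> / s" using real_arch_simple by blast
  show "EV n. 1 - 1 / (1 + (real (Suc n) * (s / \<delta>) - 1)^2) <= cutoff1 (\<delta> / real (Suc n)) s"
  proof (rule eventually_sequentiallyI[of N])
   fix n assume "n >= N"
   then have "real (Suc n) >= \<delta> / s" using N by linarith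
   define X where "X = real (Suc n) * (s / \<delta>)"
   have "X >= 1" using \<open>real (Suc n) >= \<delta> / s\<close> assms by (simp add: X_def field_simps)
   moreover have "s / (\<delta> / real (Suc n)) = X" using assms by (simp add: X_def)
   ultimately have "cutoff_arg (\<delta> / real (Suc n)) s = X - 1"
    unfolding cutoff_arg_def by (simp only: max_def) simp
   then show "1 - 1 / (1 + (real (Suc n) * (s / \<delta>) - 1)^2) <= cutoff1 (\<delta> / real (Suc n)) s"
    unfolding X_def[symmetric] using one_plus_square_pos[of "X - 1"]
    by (simp only: cutoff1_def) (simp add: field_simps)
  qed
  show "EV n. cutoff1 (\<delta> / real (Suc n)) s <= 1"
   using assms cutoff1_bounds(2) by (auto intro!: always_eventually)
 qed
qed

section \<open>A single time slice\<close>

text \<open>One time slice with everywhere defined representatives: V, W, Z are the first three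
  derivatives of u. W is only absolutely continuous, so Z enters through \<open>prim_on\<close>. The
  derivative relations are available on {u > 0} only, while V is known to vanish on {u = 0}.
  \<open>E\<close>, \<open>D\<close>, \<open>A3\<close> below are twice the energy, the entropy
  dissipation and the u^3 part of the flux dissipation.\<close>

locale regular_slice =
 fixes a b :: real and u V W Z :: "real => real"
 assumes ab: "a < b"
  and u_cont: "continuous_on UNIV u"
  and u_nonneg: "!!x. 0 <= u x"
  and u_deriv: "!!x. x \<in> {a<..<b} ==> u x > 0 ==> (u has_real_derivative V x) (at x)"
  and V_deriv: "!!x. x \<in> {a<..<b} ==> u x > 0 ==> (V has_real_derivative W x) (at x)"
  and W_prim: "prim_on {x\<in>{a<..<b}. u x > 0} W Z"
  and V_off: "!!x. x \<in> {a<..<b} ==> u x = 0 ==> V x = 0"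
  and meas [measurable]: "V \<in> borel_measurable borel" "W \<in> borel_measurable borel" "Z \<in> borel_measurable borel"
  and du: "!!e. e \<in> {a, b} ==> (u has_real_derivative 0) (at e within {a..b})"
  and E_int: "L1_on {a<..<b} (%x. (V x)^2)"
  and D_int: "L1_on {a<..<b} (%x. u x * (W x)^2)"
  and A_int: "L1_on {a<..<b} (%x. (u x) ^ 3 * (Z x)^2)"
begin

abbreviation "S \<equiv> {x\<in>{a<..<b}. u x > 0}"
definition "E = (LBINT x:{a<..<b}. (V x)^2)"
definition "D = (LBINT x:{a<..<b}. u x * (W x)^2)"
definition "A3 = (LBINT x:{a<..<b}. (u x) ^ 3 * (Z x)^2)"

lemma u_meas [measurable]: "u \<in> borel_measurable borel"
 by (rule borel_measurable_continuous_onI[OF u_cont])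

lemma u_isCont: "isCont u x"
 using u_cont by (simp add: continuous_on_eq_continuous_at)

lemma open_S: "open S"
proof -
 have "open (u -` {0<..})" using u_cont by (intro open_vimage) auto
 then have "open ({a<..<b} \<inter> u -` {0<..})" by auto
 moreover have "{a<..<b} \<inter> u -` {0<..} = S" by auto
 ultimately show ?thesis by simp
qed

lemma V_cont: "continuous_on S V"
 using V_deriv by (intro continuous_at_imp_continuous_on) (auto intro: DERIV_isCont)

lemma W_cont: "continuous_on S W"
 by (rule prim_on_continuous[OF W_prim open_S])

text \<open>Near an end point with u(e) > 0, u is bounded below, so the weight u^3 makes Z
  integrable; hence W is bounded and V is Lipschitz there. The mean value theorem gives points where
  V equals a difference quotient of u at e, which tends to 0 by the condition u'(e) = 0, and the
  Lipschitz bound carries this to all nearby points.\<close>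

lemma endpoint:
 assumes e: "e \<in> {a, b}" and pos: "u e > 0"
 shows "(V \<longlongrightarrow> 0) (at e within {a..b})" "\<exists>K. eventually (%x. \<bar>W x\<bar> <= K) (at e within {a..b})"
proof -
 define c where "c = u e / 2"
 have c: "c > 0" "c < u e" using pos by (auto simp: c_def)
 obtain r where r: "r > 0" "!!x. \<bar>x - e\<bar> < r ==> u x > c"
 proof -
  obtain r where "r > 0" "\<forall>x. dist x e < r --> dist (u x) (u e) < u e - c"
   using u_isCont[of e] c unfolding continuous_at_eps_delta by (metis diff_gt_0_iff_gt)
  then show thesis by (intro that[of r]) (auto simp: dist_real_def abs_if split: if_splits)
 qed
 define T where "T = {x\<in>{a<..<b}. \<bar>x - e\<bar> < r}"
 have T_eq: "T = {max a (e - r)<..<min b (e + r)}" by (auto simp: T_def abs_if)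
 have Tm: "T \<in> sets lborel" unfolding T_eq by simp
 have TS: "T <= S" using r(2) c by (force simp: T_def)
 have evT: "eventually (%x. x \<in> T) (at e within {a..b})"
  unfolding eventually_at using r(1) ab e by (intro exI[of _ "min r (b - a)"]) (auto simp: T_def dist_real_def)
 obtain x0 where x0: "x0 \<in> T"
 proof -
  have "at e within {a..b} \<noteq> bot"
   using e ab by (auto simp: at_within_Icc_at_right at_within_Icc_at_left)
  then show thesis using eventually_happens'[OF _ evT] that by blast
 qed
 have Ti: "L1_on T (%x. \<bar>Z x\<bar>)"
 proof (rule set_integrable_bound)
  have "L1_on T (%x. 1 :: real)"
   by (rule set_integrable_subset[OF borel_integrable_atLeastAtMost'[of a b]]) (use Tm in \<open>auto simp: T_def\<close>)
  moreover have "L1_on T (%x. (u x) ^ 3 * (Z x)^2)"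
   by (rule set_integrable_subset[OF A_int Tm]) (auto simp: T_def)
  ultimately show "L1_on T (%x. 1 + (u x) ^ 3 * (Z x)^2 / c ^ 3)"
   by (intro set_integral_add set_integrable_divide)
  show "meas_on T (%x. \<bar>Z x\<bar>)"
   unfolding set_borel_measurable_def T_eq by measurable
  show "AE x\<in>T in lborel. norm \<bar>Z x\<bar> <= norm (1 + (u x) ^ 3 * (Z x)^2 / c ^ 3)"
  proof (intro AE_I2 impI)
   fix x assume "x \<in> T"
   then have "u x > c" using r(2) by (auto simp: T_def)
   then have "c ^ 3 <= (u x) ^ 3" using c by (intro power_mono) auto
   then have "1 * (Z x)^2 <= (u x) ^ 3 / c ^ 3 * (Z x)^2" using c by (intro mult_right_mono) auto
   moreover have "\<bar>Z x\<bar> <= 1 + (Z x)^2"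
    using abs_mult_le_sum_squares[of "Z x" 1] by simp
   ultimately show "norm \<bar>Z x\<bar> <= norm (1 + (u x) ^ 3 * (Z x)^2 / c ^ 3)" by simp
  qed
 qed
 define K where "K = \<bar>W x0\<bar> + (LBINT x:T. \<bar>Z x\<bar>)"
 have incr: "\<bar>W y - W x\<bar> <= (LBINT x:T. \<bar>Z x\<bar>)" if "x \<in> T" "y \<in> T" "x <= y" for x y
 proof -
  have sub: "{x..y} <= T" using that by (auto simp: T_eq)
  have WZ: "L1_on {x..y} Z" "W y - W x = (LBINT s:{x..y}. Z s)"
   using prim_onD[OF W_prim that(3)] sub TS by (meson subset_trans)+
  have "\<bar>W y - W x\<bar> <= (LBINT s:{x..y}. \<bar>Z s\<bar>)"
   unfolding WZ(2) by (rule set_integral_abs_le[OF WZ(1)])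
  also have "\<dots> <= (LBINT x:T. \<bar>Z x\<bar>)"
   unfolding set_lebesgue_integral_def
   by (rule integral_mono) (use sub Ti set_integrable_abs[OF WZ(1)] in \<open>auto simp: set_integrable_def indicator_def\<close>)
  finally show ?thesis .
 qed
 have WK: "\<bar>W x\<bar> <= K" if "x \<in> T" for x
  using incr[OF that x0] incr[OF x0 that] unfolding K_def by linarith
 have K0: "0 <= K" using WK[OF x0] by linarith
 show "\<exists>K. eventually (%x. \<bar>W x\<bar> <= K) (at e within {a..b})"
  using evT WK by (intro exI[of _ K]) (auto elim: eventually_mono)
 have VL: "\<bar>V x - V y\<bar> <= K * \<bar>x - y\<bar>" if "x \<in> T" "y \<in> T" for x y
 proof -
  have "norm (V x - V y) <= K * norm (x - y)"
  proof (rule field_differentiable_bound[of T V W])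
   show "convex T" by (simp add: T_eq)
   show "(V has_field_derivative W z) (at z within T)" if "z \<in> T" for z
    by (rule has_field_derivative_at_within[OF V_deriv]) (use TS that in auto)
  qed (use WK that in auto)
  then show ?thesis by simp
 qed
 show "(V \<longlongrightarrow> 0) (at e within {a..b})"
 proof (rule tendstoI)
  fix \<eta> :: real assume \<eta>: "\<eta> > 0"
  have "((%x. (u x - u e) / (x - e)) \<longlongrightarrow> 0) (at e within {a..b})"
   using du[OF e] by (simp add: has_field_derivative_iff)
  from tendstoD[OF this, of "\<eta> / 2"] \<eta>
  obtain r2 where r2: "r2 > 0" "!!x. x \<in> {a..b} ==> x \<noteq> e ==> \<bar>x - e\<bar> < r2 ==> \<bar>(u x - u e) / (x - e)\<bar> < \<eta> / 2"
   unfolding eventually_at dist_real_def by auto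
  define \<rho> where "\<rho> = min r2 (\<eta> / (2 * (K + 1)))"
  have \<rho>: "\<rho> > 0" using r2 \<eta> K0 by (simp add: \<rho>_def)
  have small: "\<bar>V x\<bar> < \<eta>" if x: "x \<in> T" "\<bar>x - e\<bar> < \<rho>" for x
  proof -
   have xe: "x \<noteq> e" using x e by (auto simp: T_def)
   have inT: "y \<in> T" if "y \<in> {min x e<..<max x e}" for y
    using x(1) that e unfolding T_def by (auto simp: min_def max_def abs_if split: if_splits)
   obtain \<xi> where xi: "\<xi> \<in> T" "V \<xi> = (u x - u e) / (x - e)" "\<bar>x - \<xi>\<bar> <= \<bar>x - e\<bar>"
   proof -
    have cu: "continuous_on {min x e..max x e} u" using u_cont continuous_on_subset by blast
    have "\<exists>l z. min x e < z & z < max x e & (u has_real_derivative l) (at z) & u (max x e) - u (min x e) = (max x e - min x e) * l"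
    proof (rule MVT)
     show "min x e < max x e" using xe by auto
     fix z assume "min x e < z" "z < max x e"
     then have "z \<in> T" using inT by auto
     then have "(u has_real_derivative V z) (at z)" using u_deriv TS by auto
     then show "u differentiable (at z)" by (auto simp: real_differentiable_def)
    qed (rule cu)
    then obtain l z where z: "min x e < z" "z < max x e" "(u has_real_derivative l) (at z)"
     "u (max x e) - u (min x e) = (max x e - min x e) * l" by blast
    have zT: "z \<in> T" using z inT by auto
    have "l = V z" using z(3) u_deriv[of z] TS zT DERIV_unique by blast
    moreover have "l = (u x - u e) / (x - e)"
     using z(4) xe by (auto simp: min_def max_def field_simps split: if_splits)
    ultimately show thesis using z zT by (intro that[of z]) (auto simp: min_def max_def abs_if split: if_splits)
   qed
   have "\<bar>V x\<bar> <= \<bar>V \<xi>\<bar> + K * \<bar>x - \<xi>\<bar>" using VL[OF x(1) xi(1)] by linarith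
   also have "\<bar>V \<xi>\<bar> < \<eta> / 2"
    unfolding xi(2) using x by (intro r2(2) xe) (auto simp: T_def \<rho>_def)
   also have "K * \<bar>x - \<xi>\<bar> <= K * (\<eta> / (2 * (K + 1)))"
    using xi(3) x(2) K0 by (intro mult_left_mono) (auto simp: \<rho>_def)
   also have "\<dots> <= \<eta> / 2" using K0 \<eta> by (simp add: field_simps)
   finally show ?thesis by simp
  qed
  have "eventually (%x. \<bar>x - e\<bar> < \<rho>) (at e within {a..b})"
   unfolding eventually_at dist_real_def using \<rho> by auto
  with evT show "eventually (%x. dist (V x) 0 < \<eta>) (at e within {a..b})"
   by eventually_elim (use small in \<open>auto simp: dist_real_def\<close>)
 qed
qed

text \<open>The boundary terms of the integrations by parts all contain a truncation and a factor V.
  If u(e) = 0, the truncation makes them vanish near e; if u(e) > 0, V tends to 0 while W stays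
  bounded, by \<open>endpoint\<close>.\<close>

lemma boundary_limit:
 assumes e: "e \<in> {a, b}" and \<delta>: "\<delta> > 0" and zero: "!!x. x \<in> {a<..<b} ==> u x <= \<delta> ==> G x = 0"
  and bound: "!!x. x \<in> {a<..<b} ==> \<bar>G x\<bar> <= C * (1 + \<bar>W x\<bar> + \<bar>V x\<bar> + (V x)^2) * \<bar>V x\<bar>"
 shows "(G \<longlongrightarrow> 0) (at e within {a..b})"
proof -
 have ev: "eventually (%x. x \<in> {a<..<b}) (at e within {a..b})"
  unfolding eventually_at using ab e by (intro exI[of _ "b - a"]) (auto simp: dist_real_def)
 show ?thesis
 proof (cases "u e = 0")
  case True
  have "(u \<longlongrightarrow> u e) (at e within {a..b})"
   using u_isCont[of e] by (auto simp: isCont_def intro: tendsto_within_subset)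
  from order_tendstoD(2)[OF this, of \<delta>] True \<delta>
  have "eventually (%x. u x < \<delta>) (at e within {a..b})" by simp
  with ev have "eventually (%x. 0 = G x) (at e within {a..b})"
   by eventually_elim (simp add: zero)
  then show ?thesis by (rule Lim_transform_eventually[OF tendsto_const])
 next
  case False
  then have pos: "u e > 0" using u_nonneg[of e] by simp
  obtain K where K: "eventually (%x. \<bar>W x\<bar> <= K) (at e within {a..b})" using endpoint(2)[OF e pos] by blast
  note V0 = endpoint(1)[OF e pos]
  have "((%x. \<bar>C\<bar> * (1 + \<bar>K\<bar> + \<bar>V x\<bar> + (V x)^2) * \<bar>V x\<bar>) \<longlongrightarrow> \<bar>C\<bar> * (1 + \<bar>K\<bar> + \<bar>0\<bar> + 0^2) * \<bar>0\<bar>) (at e within {a..b})"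
   by (intro tendsto_intros V0)
  then have lim: "((%x. \<bar>C\<bar> * (1 + \<bar>K\<bar> + \<bar>V x\<bar> + (V x)^2) * \<bar>V x\<bar>) \<longlongrightarrow> 0) (at e within {a..b})" by simp
  have "eventually (%x. norm (G x) <= \<bar>C\<bar> * (1 + \<bar>K\<bar> + \<bar>V x\<bar> + (V x)^2) * \<bar>V x\<bar>) (at e within {a..b})"
   using ev K
  proof eventually_elim
   case (elim x)
   have "\<bar>G x\<bar> <= C * (1 + \<bar>W x\<bar> + \<bar>V x\<bar> + (V x)^2) * \<bar>V x\<bar>" by (rule bound[OF elim(1)])
   also have "\<dots> <= \<bar>C\<bar> * (1 + \<bar>K\<bar> + \<bar>V x\<bar> + (V x)^2) * \<bar>V x\<bar>"
    using elim(2) by (intro mult_right_mono mult_mono) auto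
   finally show ?case by simp
  qed
  then show ?thesis using lim by (rule Lim_null_comparison)
 qed
qed

lemma boundary_limits:
 assumes "\<delta> > 0" "!!x. x \<in> {a<..<b} ==> u x <= \<delta> ==> G x = 0"
  "!!x. x \<in> {a<..<b} ==> \<bar>G x\<bar> <= C * (1 + \<bar>W x\<bar> + \<bar>V x\<bar> + (V x)^2) * \<bar>V x\<bar>"
 shows "(G \<longlongrightarrow> 0) (at_right a)" "(G \<longlongrightarrow> 0) (at_left b)"
 using boundary_limit[OF _ assms, of a] boundary_limit[OF _ assms, of b] ab
 by (auto simp: at_within_Icc_at_right at_within_Icc_at_left)

text \<open>The open sets {u > 0} and {u < \<delta>} cover the interval, and on the second both G
  and g vanish. This is how identities that are available on {u > 0} only become identities on the
  whole interval.\<close>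

lemma prim_on_patch:
 assumes \<delta>: "\<delta> > 0" and G: "prim_on S G g"
  and zero: "!!x. x \<in> {a<..<b} ==> u x <= \<delta> ==> G x = 0" "!!x. x \<in> {a<..<b} ==> u x <= \<delta> ==> g x = 0"
 shows "prim_on {a<..<b} G g"
proof (rule prim_on_local)
 fix x assume x: "x \<in> {a<..<b}"
 show "\<exists>e>0. prim_on ({x-e<..<x+e} \<inter> {a<..<b}) G g"
 proof (cases "u x > 0")
  case True
  then obtain e where "e > 0" "ball x e <= S" using open_S x openE[of S x] by auto
  then show ?thesis
   by (intro exI[of _ e] conjI prim_on_subset[OF G]) (auto simp: ball_eq_greaterThanLessThan)
 next
  case False
  then have "u x < \<delta>" using u_nonneg[of x] \<delta> by simp
  moreover have "open (u -` {..<\<delta>})" using u_cont by (intro open_vimage) auto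
  ultimately obtain e where e: "e > 0" "ball x e <= u -` {..<\<delta>}" using openE[of "u -` {..<\<delta>}" x] by auto
  have z: "G y = 0" "g y = 0" if "y \<in> {x-e<..<x+e} \<inter> {a<..<b}" for y
  proof -
   have "y \<in> ball x e" using that by (simp add: ball_eq_greaterThanLessThan)
   then have "u y <= \<delta>" using e(2) by auto
   then show "G y = 0" "g y = 0" using zero that by auto
  qed
  have "prim_on ({x-e<..<x+e} \<inter> {a<..<b}) G g"
   unfolding prim_on_def
  proof (intro allI impI)
   fix c d :: real assume cd: "c <= d" "{c..d} <= {x-e<..<x+e} \<inter> {a<..<b}"
   have "L1_on {c..d} g = L1_on {c..d} (%_. 0 :: real)"
    by (rule set_integrable_cong) (use z cd in auto)
   moreover have "(LBINT x:{c..d}. g x) = (LBINT x:{c..d}. 0)"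
    by (rule set_lebesgue_integral_cong) (use z cd in auto)
   moreover have "G c = 0" "G d = 0" using z cd by auto
   ultimately show "L1_on {c..d} g & G d - G c = (LBINT x:{c..d}. g x)"
    by (simp add: set_integrable_def)
  qed
  then show ?thesis using e(1) by blast
 qed
qed

lemma u_bounded:
 obtains M where "M >= 1" "!!x. x \<in> {a<..<b} ==> u x <= M"
proof -
 have "bounded (u ` {a..b})"
  by (intro compact_imp_bounded compact_continuous_image continuous_on_subset[OF u_cont]) auto
 then obtain M where "\<forall>y\<in>u ` {a..b}. norm y <= M" unfolding bounded_iff by blast
 then have "u x <= max 1 M" if "x \<in> {a<..<b}" for x
 proof -
  have "u x \<in> u ` {a..b}" using that by auto
  then have "norm (u x) <= M" using \<open>\<forall>y\<in>u ` {a..b}. norm y <= M\<close> by blast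
  then have "u x <= M" by simp
  then show ?thesis by (simp add: le_max_iff_disj)
 qed
 then show thesis by (intro that[of "max 1 M"]) auto
qed

lemma cutoff_u_deriv:
 assumes "\<delta> > 0" "x \<in> S"
 shows "((%x. cutoff \<delta> (u x)) has_real_derivative cutoff1 \<delta> (u x) * V x) (at x)"
  "((%x. cutoff1 \<delta> (u x)) has_real_derivative cutoff2 \<delta> (u x) * V x) (at x)"
 using assms u_deriv by (auto intro!: DERIV_chain2[OF cutoff_deriv] DERIV_chain2[OF cutoff1_deriv])

lemma cutoff_u_cont:
 assumes "\<delta> > 0"
 shows "continuous_on A (%x. cutoff \<delta> (u x))" "continuous_on A (%x. cutoff1 \<delta> (u x))" "continuous_on A (%x. cutoff2 \<delta> (u x))"
 using assms by (auto intro!: continuous_on_compose2[OF continuous_on_cut] continuous_on_compose2[OF continuous_on_cut1]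
  continuous_on_compose2[OF continuous_on_cut2] continuous_on_subset[OF u_cont])

lemma D_nonneg: "D >= 0"
 unfolding D_def set_lebesgue_integral_def
 by (intro integral_nonneg_AE) (auto simp: u_nonneg indicator_def)

lemma set_integrable_bound_slice:
 fixes f h :: "real => real"
 assumes "L1_on {a<..<b} h" "f \<in> borel_measurable borel" "!!x. x \<in> {a<..<b} ==> \<bar>f x\<bar> <= h x"
 shows "L1_on {a<..<b} f"
proof (rule set_integrable_bound[OF assms(1)])
 show "meas_on {a<..<b} f"
  unfolding set_borel_measurable_def using assms(2) by measurable
 show "AE x\<in>{a<..<b} in lborel. norm (f x) <= norm (h x)"
  using assms(3) by (intro AE_I2) force
qed

text \<open>With h the difference of the truncations at levels \<tau> and \<delta>, the derivative
  of h(u) |V| V is h'(u) |V|^3 + 2 h(u) |V| W. Since 0 <= h <= min(u, 3 \<delta>), h^2 <= 3 \<delta>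
  u, and the second term is at most sqrt(\<delta>) (u W^2 + 3 V^2), uniformly in \<tau>.\<close>

lemma cubic_aux:
 assumes \<tau>: "0 < \<tau>" "\<tau> <= \<delta>"
 shows "L1_on {a<..<b} (%x. (cutoff1 \<tau> (u x) - cutoff1 \<delta> (u x)) * \<bar>V x\<bar> ^ 3)"
  and "(LBINT x:{a<..<b}. (cutoff1 \<tau> (u x) - cutoff1 \<delta> (u x)) * \<bar>V x\<bar> ^ 3) <= sqrt \<delta> * (D + 3 * E)"
proof -
 have \<delta>: "\<delta> > 0" using \<tau> by simp
 let ?h = "%x. cutoff \<tau> (u x) - cutoff \<delta> (u x)" and ?h1 = "%x. cutoff1 \<tau> (u x) - cutoff1 \<delta> (u x)"
 let ?G = "%x. ?h x * (\<bar>V x\<bar> * V x)"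
 let ?g = "%x. ?h1 x * V x * (\<bar>V x\<bar> * V x) + ?h x * (2 * \<bar>V x\<bar> * W x)"
 have absV: "((%y. \<bar>y\<bar> * y) has_real_derivative 2 * \<bar>y\<bar>) (at y)" for y :: real
 proof -
  consider "y < 0" | "y > 0" | "y = 0" by linarith
  then show ?thesis
  proof cases
   case 1
   have "eventually (%z. z \<in> {..<0}) (nhds y)" by (rule eventually_nhds_in_open) (use 1 in auto)
   then have ev: "eventually (%z. \<bar>z\<bar> * z = - z\<^sup>2) (nhds y)" by eventually_elim (auto simp: power2_eq_square)
   have "((%z. - z\<^sup>2) has_real_derivative 2 * \<bar>y\<bar>) (at y)" using 1 by (auto intro!: derivative_eq_intros)
   then show ?thesis using DERIV_cong_ev[OF refl ev refl] by simp
  next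
   case 2
   have "eventually (%z. z \<in> {0<..}) (nhds y)" by (rule eventually_nhds_in_open) (use 2 in auto)
   then have ev: "eventually (%z. \<bar>z\<bar> * z = z^2) (nhds y)" by eventually_elim (auto simp: power2_eq_square)
   have "((%z. z^2) has_real_derivative 2 * \<bar>y\<bar>) (at y)" using 2 by (auto intro!: derivative_eq_intros)
   then show ?thesis using DERIV_cong_ev[OF refl ev refl] by simp
  next
   case 3
   have "((%h::real. \<bar>h\<bar> * h / h) \<longlongrightarrow> 0) (at 0)"
    by (rule Lim_transform_eventually[of abs]) (auto simp: eventually_at_filter intro!: tendsto_rabs_zero)
   then show ?thesis using 3 by (simp add: DERIV_def)
  qed
 qed
 have d: "(?G has_real_derivative ?g x) (at x)" if x: "x \<in> S" for x
 proof -
  have 1: "(?h has_real_derivative ?h1 x * V x) (at x)"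
   using DERIV_diff[OF cutoff_u_deriv(1)[OF \<tau>(1) x] cutoff_u_deriv(1)[OF \<delta> x]] by (simp add: left_diff_distrib)
  have 2: "((%x. \<bar>V x\<bar> * V x) has_real_derivative 2 * \<bar>V x\<bar> * W x) (at x)"
   using DERIV_chain2[OF absV V_deriv[of x]] x by auto
  show ?thesis using DERIV_mult[OF 1 2] by (simp add: algebra_simps)
 qed
 have "prim_on S ?G ?g"
  by (rule prim_on_deriv[OF d]) (assumption, intro continuous_intros cutoff_u_cont \<tau> \<delta> V_cont W_cont)
 then have G: "prim_on {a<..<b} ?G ?g"
  by (rule prim_on_patch[OF \<tau>(1)]) (use cutoff_zero \<tau> \<delta> in auto)
 obtain M where M: "M >= 1" "!!x. x \<in> {a<..<b} ==> u x <= M" by (rule u_bounded, rule that)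
 have h: "0 <= ?h x" "?h x <= 3 * \<delta>" "?h x <= u x" for x
  using cutoff_antimono[OF \<tau> u_nonneg, of x] cutoff_le[OF \<tau>(1) u_nonneg, of x] cutoff_defect[OF \<delta>, of "u x"] cutoff_nonneg[OF \<delta>, of "u x"] by auto
 have h1: "0 <= ?h1 x" for x using cutoff1_antimono[OF \<tau> u_nonneg, of x] by simp
 have bnd: "\<bar>?G x\<bar> <= 3 * \<delta> * (1 + \<bar>W x\<bar> + \<bar>V x\<bar> + (V x)^2) * \<bar>V x\<bar>" if "x \<in> {a<..<b}" for x
 proof -
  have "\<bar>?G x\<bar> = ?h x * \<bar>V x\<bar> * \<bar>V x\<bar>" using h(1)[of x] by (simp add: abs_mult)
  also have "\<dots> <= 3 * \<delta> * (1 + \<bar>W x\<bar> + \<bar>V x\<bar> + (V x)^2) * \<bar>V x\<bar>"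
   using h[of x] \<delta> by (intro mult_right_mono mult_mono) auto
  finally show ?thesis .
 qed
 have lims: "(?G \<longlongrightarrow> 0) (at_right a)" "(?G \<longlongrightarrow> 0) (at_left b)"
  by (rule boundary_limits[OF \<tau>(1) _ bnd]; use cutoff_zero \<tau> \<delta> in auto)+
 let ?f = "%x. ?h1 x * \<bar>V x\<bar> ^ 3" and ?r = "%x. sqrt \<delta> * (u x * (W x)^2) + sqrt \<delta> * 3 * (V x)^2"
 have rm: "L1_on {a<..<b} ?r"
  by (intro set_integral_add set_integrable_mult_right D_int E_int)
 have fm: "meas_on {a<..<b} ?f"
  unfolding set_borel_measurable_def using \<tau> \<delta> by measurable
 have le: "?f x <= ?g x + ?r x" if x: "x \<in> {a<..<b}" for x
 proof -
  have "\<bar>V x\<bar> ^ 3 = V x * (\<bar>V x\<bar> * V x)" by (simp add: power3_eq_cube abs_if)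
  then have 1: "?f x = ?g x - ?h x * (2 * \<bar>V x\<bar> * W x)" by (simp add: algebra_simps)
  have 2: "\<bar>?h x * (2 * \<bar>V x\<bar> * W x)\<bar> <= ?r x"
  proof (cases "u x = 0")
   case True
   then have "?h x = 0" using h[of x] by simp
   then show ?thesis using \<delta> u_nonneg[of x] by simp
  next
   case False
   then have u0: "u x > 0" using u_nonneg[of x] by simp
   \<comment> \<open>The weight s = \<delta>^(1/4) splits \<delta> = s^2 s^2 evenly, so that each of
     the two squares receives a factor sqrt(\<delta>).\<close>
   define s where "s = sqrt (sqrt \<delta>)"
   have s: "s > 0" "s^2 = sqrt \<delta>" using \<delta> by (auto simp: s_def)
   have s4: "s^2 * s^2 = \<delta>" using \<delta> s(2) by simp
   have "\<bar>?h x * (2 * \<bar>V x\<bar> * W x)\<bar> = 2 * \<bar>(s * sqrt (u x) * W x) * (?h x * \<bar>V x\<bar> / (s * sqrt (u x)))\<bar>"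
    using s u0 h(1)[of x] by (simp add: abs_mult)
   also have "\<dots> <= (s * sqrt (u x) * W x)^2 + (?h x * \<bar>V x\<bar> / (s * sqrt (u x)))^2"
    using abs_mult_le_sum_squares[of "s * sqrt (u x) * W x" "?h x * \<bar>V x\<bar> / (s * sqrt (u x))"] by simp
   also have "(s * sqrt (u x) * W x)^2 = sqrt \<delta> * (u x * (W x)^2)"
    using u0 s by (simp add: power_mult_distrib)
   also have "(?h x * \<bar>V x\<bar> / (s * sqrt (u x)))^2 = (?h x)^2 / (s^2 * u x) * (V x)^2"
    using u0 by (simp add: power_mult_distrib power_divide)
   also have "\<dots> <= (3 * s^2) * (V x)^2"
   proof (rule mult_right_mono)
    have "(?h x)^2 <= (3 * \<delta>) * u x" unfolding power2_eq_square using h[of x] \<delta> by (intro mult_mono) auto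
    also have "\<dots> = (3 * s^2) * (s^2 * u x)" by (simp add: s4[symmetric])
    finally have le: "(?h x)^2 <= (3 * s^2) * (s^2 * u x)" .
    have "0 < s^2 * u x" using s(1) u0 by simp
    from pos_divide_le_eq[OF this] le show "(?h x)^2 / (s^2 * u x) <= 3 * s^2" by blast
   qed simp
   finally show ?thesis using s by simp
  qed
  show ?thesis using 1 2 by linarith
 qed
 note L = prim_on_limits_bound[OF ab G fm _ le rm lims]
 have f0: "0 <= ?f x" for x using h1[of x] by simp
 show "L1_on {a<..<b} ?f" by (rule L(1)) (use f0 in auto)
 have "(LBINT x:{a<..<b}. ?f x) <= 0 - 0 + (LBINT x:{a<..<b}. ?r x)" by (rule L(2)) (use f0 in auto)
 also have "(LBINT x:{a<..<b}. ?r x) = (LBINT x:{a<..<b}. sqrt \<delta> * (u x * (W x)^2)) + (LBINT x:{a<..<b}. sqrt \<delta> * 3 * (V x)^2)"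
  by (intro set_integral_add(2) set_integrable_mult_right D_int E_int)
 also have "\<dots> = sqrt \<delta> * (D + 3 * E)"
  unfolding set_integral_mult_right E_def D_def by (simp add: algebra_simps)
 finally show "(LBINT x:{a<..<b}. ?f x) <= sqrt \<delta> * (D + 3 * E)" by simp
qed

text \<open>The lower level of \<open>cubic_aux\<close> tends to 0: its k' tends to 1 where u > 0,
  and V = 0 elsewhere. Fatou's lemma applies because the bound does not depend on the lower level.
  The result controls |u_x|^3 in the zone removed by the truncation.\<close>

lemma cubic:
 assumes \<delta>: "\<delta> > 0"
 shows "L1_on {a<..<b} (%x. (1 - cutoff1 \<delta> (u x)) * \<bar>V x\<bar> ^ 3)"
  and "(LBINT x:{a<..<b}. (1 - cutoff1 \<delta> (u x)) * \<bar>V x\<bar> ^ 3) <= sqrt \<delta> * (D + 3 * E)"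
proof -
 define \<tau> where "\<tau> n = \<delta> / real (Suc n)" for n
 have \<tau>: "0 < \<tau> n" "\<tau> n <= \<delta>" for n
  using \<delta> by (auto simp: \<tau>_def field_simps)
 let ?f = "%n x. indicator {a<..<b} x *\<^sub>R ((cutoff1 (\<tau> n) (u x) - cutoff1 \<delta> (u x)) * \<bar>V x\<bar> ^ 3)"
 have fi: "integrable lborel (?f n)" and fb: "(\<integral>x. ?f n x \<partial>lborel) <= sqrt \<delta> * (D + 3 * E)" for n
  using cubic_aux[OF \<tau>, of n] by (auto simp: set_integrable_def set_lebesgue_integral_def)
 have f0: "AE x in lborel. 0 <= ?f n x" for n
  using cutoff1_antimono[OF \<tau> u_nonneg] by (intro AE_I2) (auto simp: indicator_def)
 have lim: "AE x in lborel. (%n. ?f n x) ----> indicator {a<..<b} x *\<^sub>R ((1 - cutoff1 \<delta> (u x)) * \<bar>V x\<bar> ^ 3)"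
 proof (intro AE_I2)
  fix x
  show "(%n. ?f n x) ----> indicator {a<..<b} x *\<^sub>R ((1 - cutoff1 \<delta> (u x)) * \<bar>V x\<bar> ^ 3)"
  proof (cases "x \<in> {a<..<b} & u x > 0")
   case True
   then have "(%n. cutoff1 (\<tau> n) (u x)) ----> 1" unfolding \<tau>_def by (intro cutoff1_tendsto_1 \<delta>) auto
   then show ?thesis by (intro tendsto_intros)
  next
   case False
   then have "x \<notin> {a<..<b} \<or> V x = 0" using V_off[of x] u_nonneg[of x] by auto
   then show ?thesis by auto
  qed
 qed
 have gm: "(%x. indicator {a<..<b} x *\<^sub>R ((1 - cutoff1 \<delta> (u x)) * \<bar>V x\<bar> ^ 3)) \<in> borel_measurable lborel"
  using \<delta> by measurable
 show "L1_on {a<..<b} (%x. (1 - cutoff1 \<delta> (u x)) * \<bar>V x\<bar> ^ 3)"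
  "(LBINT x:{a<..<b}. (1 - cutoff1 \<delta> (u x)) * \<bar>V x\<bar> ^ 3) <= sqrt \<delta> * (D + 3 * E)"
  unfolding set_integrable_def set_lebesgue_integral_def
  using Fatou_integrable[OF fi f0 lim gm fb tendsto_const] by auto
qed

text \<open>At the level M >= sup u the slope k' vanishes on the whole slice, so
  \<open>cubic\<close> at that level concerns the full cubic integral.\<close>

lemma V3_int: "L1_on {a<..<b} (%x. \<bar>V x\<bar> ^ 3)"
proof -
 obtain M where M: "M >= 1" "!!x. x \<in> {a<..<b} ==> u x <= M" by (rule u_bounded, rule that)
 have "L1_on {a<..<b} (%x. (1 - cutoff1 M (u x)) * \<bar>V x\<bar> ^ 3)" using cubic(1)[of M] M by simp
 then show ?thesis
  by (rule set_integrable_cong[THEN iffD1, rotated -1]) (use M cutoff_zero(2)[of M] in auto)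
qed

end

section \<open>The defect inequality and the lower bounds for the dissipation on one slice\<close>

context regular_slice
begin

text \<open>\<open>?Q\<close> is chosen to cancel the terms k' V^2 W \<psi> and k V W \<psi>' in the
  derivative of k V W \<psi>; the coefficient 5/6 is 1/3 + 1/2. The derivative of the sum is the
  integrand minus k''(u) V^4 \<psi> / 3, and convexity of k is needed just for the sign of this
  term. Its integrability is not known beforehand, hence \<open>prim_on_limits_bound\<close> with
  the derivative negated.\<close>

lemma truncated_defect_inequality:
 assumes \<delta>: "\<delta> > 0" and B: "B >= 0"
  and \<psi>: "!!x. (\<psi> has_real_derivative \<psi>1 x) (at x)" "!!x. (\<psi>1 has_real_derivative \<psi>2 x) (at x)"
   "continuous_on UNIV \<psi>2" "!!x. x \<in> {a<..<b} ==> 0 <= \<psi> x"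
  and bd: "!!x. x \<in> {a<..<b} ==> \<bar>\<psi> x\<bar> <= B" "!!x. x \<in> {a<..<b} ==> \<bar>\<psi>1 x\<bar> <= B" "!!x. x \<in> {a<..<b} ==> \<bar>\<psi>2 x\<bar> <= B"
 shows "L1_on {a<..<b} (%x. cutoff \<delta> (u x) * (W x)^2 * \<psi> x + cutoff \<delta> (u x) * V x * Z x * \<psi> x
   - 5/6 * cutoff1 \<delta> (u x) * (V x) ^ 3 * \<psi>1 x - 1/2 * cutoff \<delta> (u x) * (V x)^2 * \<psi>2 x)" (is "set_integrable _ _ ?h")
  and "0 <= (LBINT x:{a<..<b}. cutoff \<delta> (u x) * (W x)^2 * \<psi> x + cutoff \<delta> (u x) * V x * Z x * \<psi> x
   - 5/6 * cutoff1 \<delta> (u x) * (V x) ^ 3 * \<psi>1 x - 1/2 * cutoff \<delta> (u x) * (V x)^2 * \<psi>2 x)"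
proof -
 have c\<psi>: "continuous_on A \<psi>" "continuous_on A \<psi>1" "continuous_on A \<psi>2" for A
  using \<psi>(1,2) by (auto intro!: continuous_at_imp_continuous_on DERIV_isCont continuous_on_subset[OF \<psi>(3)])
 have m\<psi> [measurable]: "\<psi> \<in> borel_measurable borel" "\<psi>1 \<in> borel_measurable borel" "\<psi>2 \<in> borel_measurable borel"
  by (intro borel_measurable_continuous_onI c\<psi>)+
 note [measurable] = cutoff_measurable[OF \<delta>]
 obtain M where M: "M >= 1" "!!x. x \<in> {a<..<b} ==> u x <= M" by (rule u_bounded, rule that)
 have k: "0 <= cutoff \<delta> (u x)" "cutoff \<delta> (u x) <= u x" "(cutoff \<delta> (u x))^2 <= (u x) ^ 3 / \<delta>"
  "0 <= cutoff1 \<delta> (u x)" "cutoff1 \<delta> (u x) <= 1" for x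
  using cutoff_nonneg cutoff_le cutoff_square_le cutoff1_bounds \<delta> u_nonneg by auto
 let ?P = "%x. cutoff \<delta> (u x) * V x * \<psi> x"
 let ?p = "%x. cutoff1 \<delta> (u x) * V x * V x * \<psi> x + cutoff \<delta> (u x) * W x * \<psi> x + cutoff \<delta> (u x) * V x * \<psi>1 x"
 let ?Q = "%x. - (cutoff1 \<delta> (u x) * (V x) ^ 3 * \<psi> x / 3) - cutoff \<delta> (u x) * (V x)^2 * \<psi>1 x / 2"
 let ?q = "%x. - ((cutoff2 \<delta> (u x) * V x * (V x) ^ 3 * \<psi> x + cutoff1 \<delta> (u x) * (3 * (V x)^2 * W x) * \<psi> x + cutoff1 \<delta> (u x) * (V x) ^ 3 * \<psi>1 x) / 3)
  - (cutoff1 \<delta> (u x) * V x * (V x)^2 * \<psi>1 x + cutoff \<delta> (u x) * (2 * V x * W x) * \<psi>1 x + cutoff \<delta> (u x) * (V x)^2 * \<psi>2 x) / 2"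
 let ?G = "%x. ?P x * W x + ?Q x"
 let ?g = "%x. (?p x * W x + ?P x * Z x) + ?q x"
 let ?f = "%x. cutoff2 \<delta> (u x) * (V x) ^ 4 * \<psi> x / 3"
 have cS: "continuous_on S (%x. cutoff \<delta> (u x))" "continuous_on S (%x. cutoff1 \<delta> (u x))" "continuous_on S (%x. cutoff2 \<delta> (u x))"
  by (intro cutoff_u_cont \<delta>)+
 have dP: "(?P has_real_derivative ?p x) (at x)" if x: "x \<in> S" for x
 proof -
  have V: "(V has_real_derivative W x) (at x)" using V_deriv x by auto
  from DERIV_mult[OF DERIV_mult[OF cutoff_u_deriv(1)[OF \<delta> x] V] \<psi>(1)]
  show ?thesis by (rule DERIV_cong) (simp add: algebra_simps)
 qed
 have dQ: "(?Q has_real_derivative ?q x) (at x)" if x: "x \<in> S" for x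
 proof -
  have V: "(V has_real_derivative W x) (at x)" using V_deriv x by auto
  have V3: "((%x. (V x) ^ 3) has_real_derivative 3 * (V x)^2 * W x) (at x)"
   using DERIV_power[OF V, of 3] by (rule DERIV_cong) simp
  have V2: "((%x. (V x)^2) has_real_derivative 2 * V x * W x) (at x)"
   using DERIV_power[OF V, of 2] by (rule DERIV_cong) simp
  show ?thesis
   by (rule DERIV_cong[OF DERIV_diff[OF DERIV_minus[OF DERIV_cdivide[OF DERIV_mult[OF DERIV_mult[OF cutoff_u_deriv(2)[OF \<delta> x] V3] \<psi>(1)], of 3]]
    DERIV_cdivide[OF DERIV_mult[OF DERIV_mult[OF cutoff_u_deriv(1)[OF \<delta> x] V2] \<psi>(2)], of 2]]])
    (simp add: algebra_simps)
 qed
 have pP: "prim_on S ?P ?p"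
  by (rule prim_on_deriv[OF dP]) (assumption, intro continuous_intros cS V_cont W_cont c\<psi>)
 have pQ: "prim_on S ?Q ?q"
  by (rule prim_on_deriv[OF dQ], assumption) (intro continuous_intros cS V_cont W_cont c\<psi>; simp)
 have cP: "continuous_on S ?P" by (intro continuous_intros cS V_cont c\<psi>)
 have "prim_on S ?G ?g"
  by (rule prim_on_add[OF prim_on_mult[OF pP W_prim cP W_cont] pQ])
 then have G: "prim_on {a<..<b} ?G ?g"
  by (rule prim_on_patch[OF \<delta>]) (use cutoff_zero[OF \<delta>] in auto)
 have bnd: "\<bar>?G x\<bar> <= (M + 1) * B * (1 + \<bar>W x\<bar> + \<bar>V x\<bar> + (V x)^2) * \<bar>V x\<bar>" if x: "x \<in> {a<..<b}" for x
 proof -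
  have kM: "cutoff \<delta> (u x) <= M" using k(2)[of x] M(2)[OF x] by simp
  have 1: "\<bar>?P x * W x\<bar> <= M * B * \<bar>W x\<bar> * \<bar>V x\<bar>"
  proof -
   have "\<bar>?P x * W x\<bar> = cutoff \<delta> (u x) * \<bar>\<psi> x\<bar> * (\<bar>W x\<bar> * \<bar>V x\<bar>)" using k(1)[of x] by (simp add: abs_mult)
   also have "\<dots> <= M * B * (\<bar>W x\<bar> * \<bar>V x\<bar>)"
    using kM k(1)[of x] bd(1)[OF x] M B by (intro mult_right_mono mult_mono) auto
   finally show ?thesis by (simp add: mult.assoc)
  qed
  have 2: "\<bar>cutoff1 \<delta> (u x) * (V x) ^ 3 * \<psi> x / 3\<bar> <= B * (V x)^2 * \<bar>V x\<bar>"
  proof -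
   have "\<bar>cutoff1 \<delta> (u x) * (V x) ^ 3 * \<psi> x / 3\<bar> = cutoff1 \<delta> (u x) * \<bar>\<psi> x\<bar> * ((V x)^2 * \<bar>V x\<bar>) / 3"
    using k(4)[of x] by (simp add: abs_mult power3_eq_cube power2_eq_square)
   also have "\<dots> <= 1 * B * ((V x)^2 * \<bar>V x\<bar>) / 1"
    using k(4,5)[of x] bd(1)[OF x] B by (intro frac_le mult_right_mono mult_mono) auto
   finally show ?thesis by (simp add: mult.assoc)
  qed
  have 3: "\<bar>cutoff \<delta> (u x) * (V x)^2 * \<psi>1 x / 2\<bar> <= M * B * \<bar>V x\<bar> * \<bar>V x\<bar>"
  proof -
   have "\<bar>cutoff \<delta> (u x) * (V x)^2 * \<psi>1 x / 2\<bar> = cutoff \<delta> (u x) * \<bar>\<psi>1 x\<bar> * (\<bar>V x\<bar> * \<bar>V x\<bar>) / 2"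
    using k(1)[of x] by (simp add: abs_mult power2_eq_square)
   also have "\<dots> <= M * B * (\<bar>V x\<bar> * \<bar>V x\<bar>) / 1"
    using kM k(1)[of x] bd(2)[OF x] M B by (intro frac_le mult_right_mono mult_mono) auto
   finally show ?thesis by (simp add: mult.assoc)
  qed
  have "\<bar>?G x\<bar> <= M * B * \<bar>W x\<bar> * \<bar>V x\<bar> + (B * (V x)^2 * \<bar>V x\<bar> + M * B * \<bar>V x\<bar> * \<bar>V x\<bar>)"
   using 1 2 3 by linarith
  also have "\<dots> <= (M + 1) * B * \<bar>W x\<bar> * \<bar>V x\<bar> + ((M + 1) * B * (V x)^2 * \<bar>V x\<bar> + (M + 1) * B * \<bar>V x\<bar> * \<bar>V x\<bar>) + (M + 1) * B * 1 * \<bar>V x\<bar>"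
  proof -
   have 1: "M * B <= (M + 1) * B" using B by (intro mult_right_mono) auto
   have 2: "B <= (M + 1) * B" using mult_right_mono[of 1 "M + 1" B] B M by simp
   have "M * B * \<bar>W x\<bar> * \<bar>V x\<bar> <= (M + 1) * B * \<bar>W x\<bar> * \<bar>V x\<bar>"
    by (rule mult_right_mono[OF mult_right_mono[OF 1 abs_ge_zero] abs_ge_zero])
   moreover have "B * (V x)^2 * \<bar>V x\<bar> <= (M + 1) * B * (V x)^2 * \<bar>V x\<bar>"
    by (rule mult_right_mono[OF mult_right_mono[OF 2 zero_le_power2] abs_ge_zero])
   moreover have "M * B * \<bar>V x\<bar> * \<bar>V x\<bar> <= (M + 1) * B * \<bar>V x\<bar> * \<bar>V x\<bar>"
    by (rule mult_right_mono[OF mult_right_mono[OF 1 abs_ge_zero] abs_ge_zero])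
   moreover have "0 <= (M + 1) * B * 1 * \<bar>V x\<bar>" using B M by simp
   ultimately show ?thesis by linarith
  qed
  also have "\<dots> = (M + 1) * B * (1 + \<bar>W x\<bar> + \<bar>V x\<bar> + (V x)^2) * \<bar>V x\<bar>" by (simp add: algebra_simps)
  finally show ?thesis .
 qed
 have zG: "?G x = 0" if "u x <= \<delta>" for x using cutoff_zero[OF \<delta> that] by simp
 have lims: "(?G \<longlongrightarrow> 0) (at_right a)" "(?G \<longlongrightarrow> 0) (at_left b)"
  by (rule boundary_limits[OF \<delta> zG bnd]; assumption)+
 note lims' = tendsto_mult_left[OF lims(1), of "-1"] tendsto_mult_left[OF lims(2), of "-1"]
 show hi: "L1_on {a<..<b} ?h"
 proof (intro set_integral_add set_integral_diff)
  show "L1_on {a<..<b} (%x. cutoff \<delta> (u x) * (W x)^2 * \<psi> x)"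
  proof (rule set_integrable_bound_slice)
   show "L1_on {a<..<b} (%x. B * (u x * (W x)^2))" by (intro set_integrable_mult_right D_int)
   fix x assume x: "x \<in> {a<..<b}"
   have "\<bar>cutoff \<delta> (u x) * (W x)^2 * \<psi> x\<bar> = \<bar>\<psi> x\<bar> * (cutoff \<delta> (u x) * (W x)^2)" using k(1)[of x] by (simp add: abs_mult)
   also have "\<dots> <= B * (u x * (W x)^2)"
    using k[of x] bd(1)[OF x] B by (intro mult_mono mult_right_mono) auto
   finally show "\<bar>cutoff \<delta> (u x) * (W x)^2 * \<psi> x\<bar> <= B * (u x * (W x)^2)" .
  qed measurable
  show "L1_on {a<..<b} (%x. cutoff \<delta> (u x) * V x * Z x * \<psi> x)"
  proof (rule set_integrable_bound_slice)
   show "L1_on {a<..<b} (%x. B * ((V x)^2 + (u x) ^ 3 * (Z x)^2 / \<delta>))"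
    by (intro set_integrable_mult_right set_integral_add E_int set_integrable_divide A_int)
   fix x assume x: "x \<in> {a<..<b}"
   have "\<bar>V x * (cutoff \<delta> (u x) * Z x)\<bar> <= ((V x)^2 + (cutoff \<delta> (u x) * Z x)^2) / 2" by (rule abs_mult_le_sum_squares)
   also have "\<dots> <= (V x)^2 + (cutoff \<delta> (u x))^2 * (Z x)^2" by (simp add: power_mult_distrib)
   also have "\<dots> <= (V x)^2 + (u x) ^ 3 / \<delta> * (Z x)^2"
    using k(3)[of x] by (intro add_left_mono mult_right_mono) auto
   finally have "\<bar>V x * (cutoff \<delta> (u x) * Z x)\<bar> <= (V x)^2 + (u x) ^ 3 * (Z x)^2 / \<delta>" by simp
   then have "\<bar>\<psi> x\<bar> * \<bar>V x * (cutoff \<delta> (u x) * Z x)\<bar> <= B * ((V x)^2 + (u x) ^ 3 * (Z x)^2 / \<delta>)"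
    using bd(1)[OF x] B by (intro mult_mono) auto
   then show "\<bar>cutoff \<delta> (u x) * V x * Z x * \<psi> x\<bar> <= B * ((V x)^2 + (u x) ^ 3 * (Z x)^2 / \<delta>)"
    by (simp add: abs_mult mult_ac)
  qed measurable
  show "L1_on {a<..<b} (%x. 5/6 * cutoff1 \<delta> (u x) * (V x) ^ 3 * \<psi>1 x)"
  proof (rule set_integrable_bound_slice)
   show "L1_on {a<..<b} (%x. B * \<bar>V x\<bar> ^ 3)" by (intro set_integrable_mult_right V3_int)
   fix x assume x: "x \<in> {a<..<b}"
   have "\<bar>5/6 * cutoff1 \<delta> (u x) * (V x) ^ 3 * \<psi>1 x\<bar> = (5/6 * cutoff1 \<delta> (u x)) * \<bar>\<psi>1 x\<bar> * \<bar>V x\<bar> ^ 3"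
    using k(4)[of x] by (simp add: abs_mult power_abs)
   also have "\<dots> <= (1 * B) * \<bar>V x\<bar> ^ 3"
    using k(4,5)[of x] bd(2)[OF x] B by (intro mult_right_mono mult_mono) auto
   finally show "\<bar>5/6 * cutoff1 \<delta> (u x) * (V x) ^ 3 * \<psi>1 x\<bar> <= B * \<bar>V x\<bar> ^ 3" by simp
  qed measurable
  show "L1_on {a<..<b} (%x. 1/2 * cutoff \<delta> (u x) * (V x)^2 * \<psi>2 x)"
  proof (rule set_integrable_bound_slice)
   show "L1_on {a<..<b} (%x. M * B * (V x)^2)" by (intro set_integrable_mult_right E_int)
   fix x assume x: "x \<in> {a<..<b}"
   have "\<bar>1/2 * cutoff \<delta> (u x) * (V x)^2 * \<psi>2 x\<bar> = (1/2 * cutoff \<delta> (u x)) * \<bar>\<psi>2 x\<bar> * (V x)^2"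
    using k(1)[of x] by (simp add: abs_mult)
   also have "\<dots> <= M * B * (V x)^2"
    using k(1,2)[of x] bd(3)[OF x] B M(1) M(2)[OF x] by (intro mult_right_mono mult_mono) auto
   finally show "\<bar>1/2 * cutoff \<delta> (u x) * (V x)^2 * \<psi>2 x\<bar> <= M * B * (V x)^2" .
  qed measurable
 qed
 have fm: "meas_on {a<..<b} ?f"
  unfolding set_borel_measurable_def by measurable
 have f0: "0 <= ?f x" if "x \<in> {a<..<b}" for x
  using cutoff2_nonneg[OF \<delta>] \<psi>(4)[OF that] by auto
 have le: "?f x <= -1 * ?g x + ?h x" for x
 proof -
  have "?f x = -1 * ?g x + ?h x"
   by (simp add: power2_eq_square power3_eq_cube power4_eq_xxxx field_simps)
  then show ?thesis by simp
 qed
 have "0 <= (LBINT x:{a<..<b}. ?f x)"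
  unfolding set_lebesgue_integral_def using f0 by (intro integral_nonneg_AE AE_I2) (auto simp: indicator_def)
 also have "\<dots> <= -1 * 0 - -1 * 0 + (LBINT x:{a<..<b}. ?h x)"
  by (rule prim_on_limits_bound(2)[OF ab prim_on_cmult[OF G, of "-1"] fm f0 le hi lims']; assumption)
 finally show "0 <= (LBINT x:{a<..<b}. ?h x)" by simp
qed

text \<open>The left side is the formula for <T^eps, \<psi>>. Its truncated form plus k V Z \<psi>
  has a nonnegative integral. Removing the truncation adds (u - k) W^2 \<psi> >= 0 and produces
  errors from the cubic term, bounded by \<open>cubic\<close>, and from u - k <= 3 \<delta>; the
  term k V Z \<psi> is absorbed by the flux dissipation.\<close>

lemma defect_lower_bound:
 assumes \<delta>: "\<delta> > 0" and B: "B >= 0" and L: "L > 0"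
  and \<psi>: "!!x. (\<psi> has_real_derivative \<psi>1 x) (at x)" "!!x. (\<psi>1 has_real_derivative \<psi>2 x) (at x)"
   "continuous_on UNIV \<psi>2" "!!x. x \<in> {a<..<b} ==> 0 <= \<psi> x"
  and bd: "!!x. x \<in> {a<..<b} ==> \<bar>\<psi> x\<bar> <= B" "!!x. x \<in> {a<..<b} ==> \<bar>\<psi>1 x\<bar> <= B" "!!x. x \<in> {a<..<b} ==> \<bar>\<psi>2 x\<bar> <= B"
 shows "(LBINT x:{a<..<b}. u x * (W x)^2 * \<psi> x) - 5/6 * (LBINT x:{a<..<b}. (V x) ^ 3 * \<psi>1 x) - 1/2 * (LBINT x:{a<..<b}. u x * (V x)^2 * \<psi>2 x)
  >= - (B * ((E + L * A3) / (2 * sqrt (\<delta> * L)) + 5/6 * (sqrt \<delta> * (D + 3 * E)) + 3/2 * \<delta> * E))"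
proof -
 have c\<psi>: "continuous_on A \<psi>" "continuous_on A \<psi>1" "continuous_on A \<psi>2" for A
  using \<psi>(1,2) by (auto intro!: continuous_at_imp_continuous_on DERIV_isCont continuous_on_subset[OF \<psi>(3)])
 have m\<psi> [measurable]: "\<psi> \<in> borel_measurable borel" "\<psi>1 \<in> borel_measurable borel" "\<psi>2 \<in> borel_measurable borel"
  by (intro borel_measurable_continuous_onI c\<psi>)+
 note [measurable] = cutoff_measurable[OF \<delta>]
 obtain M where M: "M >= 1" "!!x. x \<in> {a<..<b} ==> u x <= M" by (rule u_bounded, rule that)
 have k: "0 <= cutoff \<delta> (u x)" "cutoff \<delta> (u x) <= u x" "(cutoff \<delta> (u x))^2 <= (u x) ^ 3 / \<delta>"
  "0 <= cutoff1 \<delta> (u x)" "cutoff1 \<delta> (u x) <= 1" "u x - cutoff \<delta> (u x) <= 3 * \<delta>" for x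
  using cutoff_nonneg cutoff_le cutoff_square_le cutoff1_bounds cutoff_defect \<delta> u_nonneg by auto
 let ?h = "%x. cutoff \<delta> (u x) * (W x)^2 * \<psi> x + cutoff \<delta> (u x) * V x * Z x * \<psi> x
   - 5/6 * cutoff1 \<delta> (u x) * (V x) ^ 3 * \<psi>1 x - 1/2 * cutoff \<delta> (u x) * (V x)^2 * \<psi>2 x"
 let ?t = "%x. u x * (W x)^2 * \<psi> x - 5/6 * ((V x) ^ 3 * \<psi>1 x) - 1/2 * (u x * (V x)^2 * \<psi>2 x)"
 \<comment> \<open>Young's weight: k^2 <= u^3/\<delta> produces 1/(\<delta> \<theta>) in front of
   u^3 Z^2, and 1/(\<delta> \<theta>) = \<theta> L, so \<open>E\<close> and \<open>L * A3\<close>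
   receive the same coefficient \<theta>/2.\<close>
 define \<theta> where "\<theta> = 1 / sqrt (\<delta> * L)"
 have \<theta>: "\<theta> > 0" "\<theta> * \<theta> * (\<delta> * L) = 1" using \<delta> L by (auto simp: \<theta>_def)
 let ?e = "%x. B * ((\<theta> / 2) * (V x)^2 + (\<theta> / 2 * L) * ((u x) ^ 3 * (Z x)^2) + 5/6 * ((1 - cutoff1 \<delta> (u x)) * \<bar>V x\<bar> ^ 3) + 3/2 * \<delta> * (V x)^2)"
 note T = truncated_defect_inequality[OF \<delta> B \<psi> bd]
 have hi: "L1_on {a<..<b} ?h" and h0: "0 <= (LBINT x:{a<..<b}. ?h x)"
  by (rule T; assumption)+
 have i1: "L1_on {a<..<b} (%x. u x * (W x)^2 * \<psi> x)"
 proof (rule set_integrable_bound_slice)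
  show "L1_on {a<..<b} (%x. B * (u x * (W x)^2))" by (intro set_integrable_mult_right D_int)
  fix x assume x: "x \<in> {a<..<b}"
  have "\<bar>u x * (W x)^2 * \<psi> x\<bar> = \<bar>\<psi> x\<bar> * (u x * (W x)^2)" using u_nonneg[of x] by (simp add: abs_mult)
  also have "\<dots> <= B * (u x * (W x)^2)" using bd(1)[OF x] u_nonneg[of x] by (intro mult_right_mono) auto
  finally show "\<bar>u x * (W x)^2 * \<psi> x\<bar> <= B * (u x * (W x)^2)" .
 qed measurable
 have i2: "L1_on {a<..<b} (%x. (V x) ^ 3 * \<psi>1 x)"
 proof (rule set_integrable_bound_slice)
  show "L1_on {a<..<b} (%x. B * \<bar>V x\<bar> ^ 3)" by (intro set_integrable_mult_right V3_int)
  fix x assume x: "x \<in> {a<..<b}"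
  have "\<bar>(V x) ^ 3 * \<psi>1 x\<bar> = \<bar>\<psi>1 x\<bar> * \<bar>V x\<bar> ^ 3" by (simp add: abs_mult power_abs)
  also have "\<dots> <= B * \<bar>V x\<bar> ^ 3" using bd(2)[OF x] by (intro mult_right_mono) auto
  finally show "\<bar>(V x) ^ 3 * \<psi>1 x\<bar> <= B * \<bar>V x\<bar> ^ 3" .
 qed measurable
 have i3: "L1_on {a<..<b} (%x. u x * (V x)^2 * \<psi>2 x)"
 proof (rule set_integrable_bound_slice)
  show "L1_on {a<..<b} (%x. M * B * (V x)^2)" by (intro set_integrable_mult_right E_int)
  fix x assume x: "x \<in> {a<..<b}"
  have "\<bar>u x * (V x)^2 * \<psi>2 x\<bar> = u x * \<bar>\<psi>2 x\<bar> * (V x)^2" using u_nonneg[of x] by (simp add: abs_mult)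
  also have "\<dots> <= M * B * (V x)^2"
   using u_nonneg[of x] bd(3)[OF x] B M(1) M(2)[OF x] by (intro mult_right_mono mult_mono) auto
  finally show "\<bar>u x * (V x)^2 * \<psi>2 x\<bar> <= M * B * (V x)^2" .
 qed measurable
 have ti: "L1_on {a<..<b} ?t"
  by (intro set_integral_diff set_integrable_mult_right i1 i2 i3)
 have teq: "(LBINT x:{a<..<b}. ?t x) = (LBINT x:{a<..<b}. u x * (W x)^2 * \<psi> x) - 5/6 * (LBINT x:{a<..<b}. (V x) ^ 3 * \<psi>1 x) - 1/2 * (LBINT x:{a<..<b}. u x * (V x)^2 * \<psi>2 x)"
  using i1 i2 i3 by (simp only: set_integral_diff set_integral_mult_right set_integrable_mult_right simp_thms)
 have e1: "L1_on {a<..<b} (%x. (\<theta> / 2) * (V x)^2)"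
  and e2: "L1_on {a<..<b} (%x. (\<theta> / 2 * L) * ((u x) ^ 3 * (Z x)^2))"
  and e3: "L1_on {a<..<b} (%x. 5/6 * ((1 - cutoff1 \<delta> (u x)) * \<bar>V x\<bar> ^ 3))"
  and e4: "L1_on {a<..<b} (%x. 3/2 * \<delta> * (V x)^2)"
  by (intro set_integrable_mult_right E_int A_int cubic(1) \<delta>)+
 have ei: "L1_on {a<..<b} ?e"
  by (intro set_integrable_mult_right set_integral_add(1) e1 e2 e3 e4)
 have eeq: "(LBINT x:{a<..<b}. ?e x) = B * ((\<theta> / 2) * E + (\<theta> / 2 * L) * A3 + 5/6 * (LBINT x:{a<..<b}. (1 - cutoff1 \<delta> (u x)) * \<bar>V x\<bar> ^ 3) + 3/2 * \<delta> * E)"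
  unfolding E_def A3_def set_integral_mult_right[symmetric]
  by (subst set_integral_add(2)[symmetric]; (intro e1 e2 e3 e4 set_integral_add(1))?)+ (simp only: set_integral_mult_right)
 have pt: "?h x - ?e x <= ?t x" if x: "x \<in> {a<..<b}" for x
 proof -
  let ?k = "cutoff \<delta> (u x)" and ?k1 = "cutoff1 \<delta> (u x)"
  have eq: "?t x - ?h x = (u x - ?k) * (W x)^2 * \<psi> x - ?k * V x * Z x * \<psi> x - 5/6 * ((1 - ?k1) * (V x) ^ 3 * \<psi>1 x) - 1/2 * ((u x - ?k) * (V x)^2 * \<psi>2 x)"
   by (simp add: algebra_simps)
  have p1: "0 <= (u x - ?k) * (W x)^2 * \<psi> x" using k(2)[of x] \<psi>(4)[OF x] by simp
  have p2: "\<bar>?k * V x * Z x * \<psi> x\<bar> <= B * ((\<theta> / 2) * (V x)^2 + (\<theta> / 2 * L) * ((u x) ^ 3 * (Z x)^2))"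
  proof -
   define s where "s = sqrt \<theta>"
   have s: "s > 0" "s^2 = \<theta>" using \<theta> by (auto simp: s_def)
   have "\<bar>V x * (?k * Z x)\<bar> = \<bar>(s * V x) * (?k * Z x / s)\<bar>" using s by simp
   also have "\<dots> <= ((s * V x)^2 + (?k * Z x / s)^2) / 2" by (rule abs_mult_le_sum_squares)
   also have "\<dots> = (\<theta> * (V x)^2 + ?k^2 * (Z x)^2 / \<theta>) / 2"
    using s by (simp add: power_mult_distrib power_divide)
   also have "\<dots> <= (\<theta> * (V x)^2 + ((u x) ^ 3 / \<delta>) * (Z x)^2 / \<theta>) / 2"
    using k(3)[of x] \<theta>(1) by (intro divide_right_mono add_left_mono mult_right_mono) auto
   also have "((u x) ^ 3 / \<delta>) * (Z x)^2 / \<theta> = \<theta> * L * ((u x) ^ 3 * (Z x)^2)"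
   proof -
    have "1 / (\<delta> * \<theta>) = \<theta> * L" using \<theta> \<delta> by (simp add: field_simps)
    then have "\<theta> * L * ((u x) ^ 3 * (Z x)^2) = 1 / (\<delta> * \<theta>) * ((u x) ^ 3 * (Z x)^2)" by simp
    then show ?thesis by simp
   qed
   finally have le: "\<bar>V x * (?k * Z x)\<bar> <= (\<theta> / 2) * (V x)^2 + (\<theta> / 2 * L) * ((u x) ^ 3 * (Z x)^2)"
    by (simp add: field_simps)
   have "\<bar>?k * V x * Z x * \<psi> x\<bar> = \<bar>\<psi> x\<bar> * \<bar>V x * (?k * Z x)\<bar>" by (simp add: abs_mult mult_ac)
   also have "\<dots> <= B * ((\<theta> / 2) * (V x)^2 + (\<theta> / 2 * L) * ((u x) ^ 3 * (Z x)^2))"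
    using bd(1)[OF x] le B by (intro mult_mono) auto
   finally show ?thesis .
  qed
  have p3: "\<bar>(1 - ?k1) * (V x) ^ 3 * \<psi>1 x\<bar> <= B * ((1 - ?k1) * \<bar>V x\<bar> ^ 3)"
  proof -
   have "\<bar>(1 - ?k1) * (V x) ^ 3 * \<psi>1 x\<bar> = \<bar>\<psi>1 x\<bar> * ((1 - ?k1) * \<bar>V x\<bar> ^ 3)"
    using k(5)[of x] by (simp add: abs_mult power_abs)
   also have "\<dots> <= B * ((1 - ?k1) * \<bar>V x\<bar> ^ 3)" using bd(2)[OF x] k(5)[of x] by (intro mult_right_mono) auto
   finally show ?thesis .
  qed
  have p4: "\<bar>(u x - ?k) * (V x)^2 * \<psi>2 x\<bar> <= B * (3 * \<delta> * (V x)^2)"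
  proof -
   have "\<bar>(u x - ?k) * (V x)^2 * \<psi>2 x\<bar> = \<bar>\<psi>2 x\<bar> * ((u x - ?k) * (V x)^2)"
    using k(2)[of x] by (simp add: abs_mult)
   also have "\<dots> <= B * (3 * \<delta> * (V x)^2)" using bd(3)[OF x] k(2,6)[of x] B by (intro mult_mono mult_right_mono) auto
   finally show ?thesis .
  qed
  have "?e x = B * ((\<theta> / 2) * (V x)^2 + (\<theta> / 2 * L) * ((u x) ^ 3 * (Z x)^2)) + 5/6 * (B * ((1 - ?k1) * \<bar>V x\<bar> ^ 3)) + 1/2 * (B * (3 * \<delta> * (V x)^2))"
   by (simp add: algebra_simps)
  then show ?thesis using eq p1 p2 p3 p4 by linarith
 qed
 have "(LBINT x:{a<..<b}. ?h x) - (LBINT x:{a<..<b}. ?e x) <= (LBINT x:{a<..<b}. ?t x)"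
 proof -
  have "(LBINT x:{a<..<b}. ?h x - ?e x) <= (LBINT x:{a<..<b}. ?t x)"
   using pt by (intro set_integral_mono set_integral_diff(1) hi ei ti)
  then show ?thesis by (simp only: set_integral_diff(2)[OF hi ei])
 qed
 moreover have "(LBINT x:{a<..<b}. ?e x) <= B * ((E + L * A3) / (2 * sqrt (\<delta> * L)) + 5/6 * (sqrt \<delta> * (D + 3 * E)) + 3/2 * \<delta> * E)"
 proof -
  have "(E + L * A3) / (2 * sqrt (\<delta> * L)) = (\<theta> / 2) * E + (\<theta> / 2 * L) * A3"
   by (simp add: \<theta>_def add_divide_distrib)
  then show ?thesis unfolding eeq using cubic(2)[OF \<delta>] B by (intro mult_left_mono) auto
 qed
 ultimately show ?thesis using h0 teq by linarith
qed

text \<open>The first integration by parts: the derivative of k(u) V integrates to 0, so the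
  weighted energy is at most the integral of u |W|, and u has mass 1.\<close>

lemma cut_energy_bound:
 assumes \<delta>: "\<delta> > 0" and mass: "(LBINT x:{a<..<b}. u x) = 1"
 shows "L1_on {a<..<b} (%x. cutoff1 \<delta> (u x) * (V x)^2)"
  and "(LBINT x:{a<..<b}. cutoff1 \<delta> (u x) * (V x)^2)^2 <= D"
proof -
 note [measurable] = cutoff_measurable[OF \<delta>]
 obtain M where M: "M >= 1" "!!x. x \<in> {a<..<b} ==> u x <= M" by (rule u_bounded, rule that)
 have k: "0 <= cutoff \<delta> (u x)" "cutoff \<delta> (u x) <= u x" "0 <= cutoff1 \<delta> (u x)" "cutoff1 \<delta> (u x) <= 1" for x
  using cutoff_nonneg cutoff_le cutoff1_bounds \<delta> u_nonneg by auto
 let ?f = "%x. cutoff1 \<delta> (u x) * (V x)^2" and ?G = "%x. cutoff \<delta> (u x) * V x"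
 let ?g = "%x. cutoff1 \<delta> (u x) * V x * V x + cutoff \<delta> (u x) * W x"
 show fi: "L1_on {a<..<b} ?f"
 proof (rule set_integrable_bound_slice[OF E_int])
  fix x show "\<bar>?f x\<bar> <= (V x)^2" using k(3,4)[of x] by (simp add: abs_mult mult_left_le_one_le)
 qed measurable
 have ui: "L1_on {a<..<b} u"
  by (rule set_integrable_subset[OF borel_integrable_atLeastAtMost'[of a b]]) (use u_cont continuous_on_subset in auto)
 have d: "(?G has_real_derivative ?g x) (at x)" if x: "x \<in> S" for x
 proof -
  have V: "(V has_real_derivative W x) (at x)" using V_deriv x by auto
  from DERIV_mult[OF cutoff_u_deriv(1)[OF \<delta> x] V] show ?thesis by (rule DERIV_cong) simp
 qed
 have "prim_on S ?G ?g"
  by (rule prim_on_deriv[OF d]) (assumption, intro continuous_intros cutoff_u_cont \<delta> V_cont W_cont)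
 then have G: "prim_on {a<..<b} ?G ?g"
  by (rule prim_on_patch[OF \<delta>]) (use cutoff_zero[OF \<delta>] in auto)
 have bnd: "\<bar>?G x\<bar> <= M * (1 + \<bar>W x\<bar> + \<bar>V x\<bar> + (V x)^2) * \<bar>V x\<bar>" if x: "x \<in> {a<..<b}" for x
 proof -
  have "\<bar>?G x\<bar> = cutoff \<delta> (u x) * 1 * \<bar>V x\<bar>" using k(1)[of x] by (simp add: abs_mult)
  also have "\<dots> <= M * (1 + \<bar>W x\<bar> + \<bar>V x\<bar> + (V x)^2) * \<bar>V x\<bar>"
   using k(1,2)[of x] M(1) M(2)[OF x] by (intro mult_right_mono mult_mono) auto
  finally show ?thesis .
 qed
 have zG: "?G x = 0" if "u x <= \<delta>" for x using cutoff_zero[OF \<delta> that] by simp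
 have lims: "(?G \<longlongrightarrow> 0) (at_right a)" "(?G \<longlongrightarrow> 0) (at_left b)"
  by (rule boundary_limits[OF \<delta> zG bnd]; assumption)+
 define X where "X = (LBINT x:{a<..<b}. ?f x)"
 have X0: "X >= 0" unfolding X_def set_lebesgue_integral_def using k(3)
  by (intro integral_nonneg_AE AE_I2) (auto simp: indicator_def)
 have fm: "meas_on {a<..<b} ?f"
  unfolding set_borel_measurable_def by measurable
 have "X^2 <= D"
 proof (cases "X = 0")
  case True then show ?thesis using D_nonneg by simp
 next
  case False
  then have X: "X > 0" using X0 by simp
  \<comment> \<open>Young's inequality with X itself as weight yields X <= D/(2X) + X/2, which is
    X^2 <= D.\<close>
  let ?h = "%x. (1 / X / 2) * (u x * (W x)^2) + (X / 2) * u x"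
  have hi: "L1_on {a<..<b} ?h" by (intro set_integral_add(1) set_integrable_mult_right D_int ui)
  have le: "?f x <= ?g x + ?h x" for x
  proof -
   have "\<bar>cutoff \<delta> (u x) * W x\<bar> <= ?h x"
   proof (cases "u x = 0")
    case True
    then show ?thesis using k(1,2)[of x] by simp
   next
    case False
    then have u0: "u x > 0" using u_nonneg[of x] by simp
    define s where "s = sqrt X"
    have s: "s > 0" "s^2 = X" using X by (auto simp: s_def)
    have "\<bar>cutoff \<delta> (u x) * W x\<bar> <= \<bar>(s * sqrt (u x)) * (sqrt (u x) * W x / s)\<bar>"
    proof -
     have "(s * sqrt (u x)) * (sqrt (u x) * W x / s) = u x * W x" using s u0 by simp
     then show ?thesis using k(1,2)[of x] by (simp add: abs_mult mult_right_mono)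
    qed
    also have "\<dots> <= ((s * sqrt (u x))^2 + (sqrt (u x) * W x / s)^2) / 2" by (rule abs_mult_le_sum_squares)
    also have "\<dots> = ?h x" using s u0 by (simp add: power_mult_distrib power_divide field_simps)
    finally show ?thesis .
   qed
   moreover have "?f x = ?g x - cutoff \<delta> (u x) * W x" by (simp add: power2_eq_square)
   ultimately show ?thesis by linarith
  qed
  have f0: "0 <= ?f x" for x using k(3)[of x] by simp
  have "(LBINT x:{a<..<b}. ?f x) <= 0 - 0 + (LBINT x:{a<..<b}. ?h x)"
   by (rule prim_on_limits_bound(2)[OF ab G fm f0 le hi lims])
  from this[folded X_def] have "X <= 0 - 0 + (LBINT x:{a<..<b}. ?h x)" .
  also have "(LBINT x:{a<..<b}. ?h x) = (1 / X / 2) * D + (X / 2) * 1"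
   unfolding D_def mass[symmetric] set_integral_mult_right[symmetric]
   by (rule set_integral_add(2)) (intro set_integrable_mult_right D_int ui)+
  finally have "X <= D / X" by simp
  then show ?thesis using X by (simp add: power2_eq_square pos_le_divide_eq)
 qed
 then show "(LBINT x:{a<..<b}. ?f x)^2 <= D" by (simp add: X_def)
qed

lemma cut_mass_bound:
 assumes \<delta>: "\<delta> > 0" and mass: "(LBINT x:{a<..<b}. u x) = 1" and small: "3 * \<delta> * (b - a) <= 1"
 shows "1 - 3 * \<delta> * (b - a) <= (LBINT x:{a<..<b}. cutoff \<delta> (u x))"
proof -
 have ui: "L1_on {a<..<b} u"
  by (rule set_integrable_subset[OF borel_integrable_atLeastAtMost'[of a b]]) (use u_cont continuous_on_subset in auto)
 have ci: "L1_on {a<..<b} (%x. cutoff \<delta> (u x))"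
  by (rule set_integrable_subset[OF borel_integrable_atLeastAtMost'[of a b]]) (use cutoff_u_cont(1)[OF \<delta>] in auto)
 have oi: "L1_on {a<..<b} (%x. 3 * \<delta>)"
  by (rule set_integrable_subset[OF borel_integrable_atLeastAtMost'[of a b]]) auto
 have "(LBINT x:{a<..<b}. u x) <= (LBINT x:{a<..<b}. cutoff \<delta> (u x) + 3 * \<delta>)"
  using cutoff_defect[OF \<delta>] by (intro set_integral_mono ui set_integral_add(1) ci oi) (auto simp: diff_le_eq add.commute)
 also have "\<dots> = (LBINT x:{a<..<b}. cutoff \<delta> (u x)) + (LBINT x:{a<..<b}. 3 * \<delta>)"
  by (rule set_integral_add(2)[OF ci oi])
 also have "(LBINT x:{a<..<b}. 3 * \<delta>) = 3 * \<delta> * (b - a)"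
  using ab by (simp add: set_lebesgue_integral_def)
 finally show ?thesis using mass by simp
qed

text \<open>The second integration by parts: \<open>integral_le_support_energy\<close> for f = k(u),
  whose positivity set is {u > \<delta>}. Since k'^2 <= k', the energy of f is at most the weighted
  energy of \<open>cut_energy_bound\<close>.\<close>

lemma piece_bound:
 assumes \<delta>: "\<delta> > 0" and cd: "a <= c" "c < d" "d <= b"
  and l: "l = measure lborel {x\<in>{c<..<d}. u x > \<delta>}" and bd: "(l - q) * cutoff \<delta> (u d) + q * cutoff \<delta> (u c) = 0"
 shows "(LBINT x:{c<..<d}. cutoff \<delta> (u x))^2 <= ((l - q) ^ 3 + q ^ 3) / 3 * (LBINT x:{c<..<d}. cutoff1 \<delta> (u x) * (V x)^2)"
  and "0 <= (LBINT x:{c<..<d}. cutoff1 \<delta> (u x) * (V x)^2)"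
proof -
 note [measurable] = cutoff_measurable[OF \<delta>]
 have k: "0 <= cutoff1 \<delta> (u x)" "cutoff1 \<delta> (u x) <= 1" for x using cutoff1_bounds[OF \<delta>] by auto
 let ?f = "%x. cutoff \<delta> (u x)" and ?g = "%x. cutoff1 \<delta> (u x) * V x"
 have sub: "{c<..<d} <= {a<..<b}" using cd by auto
 have f: "prim_on {c<..<d} ?f ?g"
 proof (rule prim_on_subset[OF prim_on_patch[OF \<delta>] sub])
  show "prim_on S ?f ?g"
   by (rule prim_on_deriv[OF cutoff_u_deriv(1)[OF \<delta>]]) (assumption, intro continuous_intros cutoff_u_cont \<delta> V_cont)
 qed (use cutoff_zero[OF \<delta>] in auto)
 have Vi: "L1_on {c<..<d} (%x. (V x)^2)" by (rule set_integrable_subset[OF E_int _ sub]) simp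
 have g2: "L1_on {c<..<d} (%x. (?g x)^2)" and f2: "L1_on {c<..<d} (%x. cutoff1 \<delta> (u x) * (V x)^2)"
 proof -
  have le: "\<bar>(?g x)^2\<bar> <= (V x)^2" "\<bar>cutoff1 \<delta> (u x) * (V x)^2\<bar> <= (V x)^2" for x
   using k[of x] by (auto simp: power_mult_distrib abs_mult mult_left_le_one_le power_le_one)
  show "L1_on {c<..<d} (%x. (?g x)^2)"
   by (rule set_integrable_bound[OF Vi]) (use le in \<open>auto simp: set_borel_measurable_def\<close>)
  show "L1_on {c<..<d} (%x. cutoff1 \<delta> (u x) * (V x)^2)"
   by (rule set_integrable_bound[OF Vi]) (use le in \<open>auto simp: set_borel_measurable_def\<close>)
 qed
 have pos: "?f x > 0 \<longleftrightarrow> u x > \<delta>" for x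
  using cutoff_pos[OF \<delta>, of "u x"] cutoff_zero(1)[OF \<delta>, of "u x"] by (cases "u x > \<delta>") auto
 have "(LBINT x:{c<..<d}. ?f x)^2 <= ((l - q) ^ 3 + q ^ 3) / 3 * (LBINT x:{c<..<d}. (?g x)^2)"
 proof (rule integral_le_support_energy[OF cd(2) f])
  show "continuous_on {c..d} ?f" by (rule cutoff_u_cont(1)[OF \<delta>])
  show "0 <= ?f x" for x by (rule cutoff_nonneg[OF \<delta>])
  show "meas_on {c<..<d} ?g" unfolding set_borel_measurable_def by measurable
  show "?g x = 0" if "?f x = 0" for x
  proof -
   have "u x <= \<delta>" using pos[of x] that by simp
   then show ?thesis using cutoff_zero(2)[OF \<delta>] by simp
  qed
  show "l = measure lborel {x\<in>{c<..<d}. ?f x > 0}" unfolding pos by (rule l)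
 qed (use g2 bd in auto)
 also have "\<dots> <= ((l - q) ^ 3 + q ^ 3) / 3 * (LBINT x:{c<..<d}. cutoff1 \<delta> (u x) * (V x)^2)"
 proof (rule mult_left_mono)
  show "(LBINT x:{c<..<d}. (?g x)^2) <= (LBINT x:{c<..<d}. cutoff1 \<delta> (u x) * (V x)^2)"
  proof (rule set_integral_mono[OF g2 f2])
   fix x
   have "(cutoff1 \<delta> (u x))^2 <= cutoff1 \<delta> (u x)" using k[of x] by (simp add: power2_eq_square mult_left_le_one_le)
   then show "(?g x)^2 <= cutoff1 \<delta> (u x) * (V x)^2" by (simp add: power_mult_distrib mult_right_mono)
  qed
  have "0 <= l" by (simp add: l)
  \<comment> \<open>Completing the square shows that the weight is nonnegative for every real
    q.\<close>
  then have "0 <= l * ((l - 3/2 * q)^2 + 3/4 * q^2)" by (intro mult_nonneg_nonneg add_nonneg_nonneg) auto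
  also have "\<dots> = (l - q) ^ 3 + q ^ 3" by (simp add: power2_eq_square power3_eq_cube algebra_simps)
  finally show "0 <= ((l - q) ^ 3 + q ^ 3) / 3" by simp
 qed
 finally show "(LBINT x:{c<..<d}. ?f x)^2 <= ((l - q) ^ 3 + q ^ 3) / 3 * (LBINT x:{c<..<d}. cutoff1 \<delta> (u x) * (V x)^2)" .
 show "0 <= (LBINT x:{c<..<d}. cutoff1 \<delta> (u x) * (V x)^2)"
  unfolding set_lebesgue_integral_def using k(1) by (intro integral_nonneg_AE AE_I2) (auto simp: indicator_def)
qed

lemma support_measurable: "{x\<in>{c<..<d}. u x > \<delta>} \<in> sets lborel"
proof -
 have "{x\<in>{c<..<d}. u x > \<delta>} = {c<..<d} \<inter> u -` {\<delta><..}" by auto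
 moreover have "open ({c<..<d} \<inter> u -` {\<delta><..})" using u_cont by (intro open_Int open_vimage) auto
 ultimately show ?thesis by simp
qed

text \<open>k(u) vanishes at x0, so q = 0 serves on the left piece and q = l on the right one. The
  two bounds add up by Cauchy-Schwarz, and since cubes are superadditive the pieces together cost at
  most l^3/3.\<close>

lemma mass_le_support_energy:
 assumes \<delta>: "\<delta> > 0" and x0: "x0 \<in> {a..b}" "u x0 <= \<delta>"
 shows "(LBINT x:{a<..<b}. cutoff \<delta> (u x))^2 <= (measure lborel {x\<in>{a<..<b}. u x > \<delta>}) ^ 3 / 3 * (LBINT x:{a<..<b}. cutoff1 \<delta> (u x) * (V x)^2)"
proof -
 have z: "cutoff \<delta> (u x0) = 0" by (rule cutoff_zero(1)[OF \<delta> x0(2)])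
 define I where "I c d = (LBINT x:{c<..<d}. cutoff \<delta> (u x))" for c d
 define X where "X c d = (LBINT x:{c<..<d}. cutoff1 \<delta> (u x) * (V x)^2)" for c d
 define l where "l c d = measure lborel {x\<in>{c<..<d}. u x > \<delta>}" for c d
 have left: "(I a x0)^2 <= (l a x0) ^ 3 / 3 * X a x0 & 0 <= X a x0" if "a < x0"
  using piece_bound[OF \<delta> order_refl that _ refl, of 0] x0 z by (auto simp: I_def X_def l_def)
 have right: "(I x0 b)^2 <= (l x0 b) ^ 3 / 3 * X x0 b & 0 <= X x0 b" if "x0 < b"
  using piece_bound[OF \<delta> _ that order_refl refl, of "l x0 b"] x0 z by (auto simp: I_def X_def l_def)
 consider "x0 = a" | "x0 = b" | "a < x0" "x0 < b" using x0 by force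
 then have "(I a b)^2 <= (l a b) ^ 3 / 3 * X a b"
 proof cases
  case 1 then show ?thesis using right ab by simp
 next
  case 2 then show ?thesis using left ab by simp
 next
  case 3
  have split: "(LBINT x:{a<..<b}. f x) = (LBINT x:{a<..<x0}. f x) + (LBINT x:{x0<..<b}. f x)"
   if f: "L1_on {a<..<b} f" for f :: "real => real"
  proof -
   have "(LBINT x:{a<..<b}. f x) = (LBINT x:{a<..<x0} \<union> {x0<..<b}. f x)"
    by (rule set_integral_discrete_difference[where X="{x0}"]) (use 3 in auto)
   also have "\<dots> = (LBINT x:{a<..<x0}. f x) + (LBINT x:{x0<..<b}. f x)"
    by (rule set_integral_Un) (use 3 in \<open>auto intro!: set_integrable_subset[OF f]\<close>)
   finally show ?thesis .
  qed
  have ci: "L1_on {a<..<b} (%x. cutoff \<delta> (u x))"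
   by (rule set_integrable_subset[OF borel_integrable_atLeastAtMost'[of a b]]) (use cutoff_u_cont(1)[OF \<delta>] in auto)
  have Xi: "L1_on {a<..<b} (%x. cutoff1 \<delta> (u x) * (V x)^2)"
  proof (rule set_integrable_bound_slice[OF E_int])
   note [measurable] = cutoff_measurable[OF \<delta>]
   show "(%x. cutoff1 \<delta> (u x) * (V x)^2) \<in> borel_measurable borel" by measurable
   fix x show "\<bar>cutoff1 \<delta> (u x) * (V x)^2\<bar> <= (V x)^2"
    using cutoff1_bounds[OF \<delta>, of "u x"] by (simp add: abs_mult mult_left_le_one_le)
  qed
  have Is: "I a b = I a x0 + I x0 b" unfolding I_def by (rule split[OF ci])
  have Xs: "X a b = X a x0 + X x0 b" unfolding X_def by (rule split[OF Xi])
  have ls: "l a x0 + l x0 b <= l a b"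
  proof -
   have fin: "emeasure lborel {x\<in>{c<..<d}. u x > \<delta>} \<noteq> \<infinity>" for c d
   proof -
    have "emeasure lborel {x\<in>{c<..<d}. u x > \<delta>} <= emeasure lborel {c..d}"
     by (rule emeasure_mono) auto
    also have "\<dots> < \<infinity>" by (simp add: emeasure_lborel_Icc_eq)
    finally show ?thesis by simp
   qed
   have "l a x0 + l x0 b = measure lborel ({x\<in>{a<..<x0}. u x > \<delta>} \<union> {x\<in>{x0<..<b}. u x > \<delta>})"
    unfolding l_def by (rule measure_Union[symmetric]) (use fin support_measurable in auto)
   also have "\<dots> <= measure lborel {x\<in>{a<..<b}. u x > \<delta>}"
   proof (rule measure_mono_fmeasurable)
    show "{x \<in> {a<..<x0}. \<delta> < u x} \<union> {x \<in> {x0<..<b}. \<delta> < u x} <= {x \<in> {a<..<b}. \<delta> < u x}" using 3 by auto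
    show "{x \<in> {a<..<x0}. \<delta> < u x} \<union> {x \<in> {x0<..<b}. \<delta> < u x} \<in> sets lborel" by (intro sets.Un support_measurable)
    show "{x \<in> {a<..<b}. \<delta> < u x} \<in> fmeasurable lborel"
     using fin support_measurable by (intro fmeasurableI) (auto simp: less_top)
   qed
   finally show ?thesis by (simp add: l_def)
  qed
  have l0: "0 <= l c d" for c d by (simp add: l_def)
  define \<alpha>1 \<alpha>2 where "\<alpha>1 = (l a x0) ^ 3 / 3" and "\<alpha>2 = (l x0 b) ^ 3 / 3"
  have \<alpha>0: "0 <= \<alpha>1" "0 <= \<alpha>2" using l0 by (auto simp: \<alpha>1_def \<alpha>2_def)
  have 1: "(I a x0)^2 <= \<alpha>1 * X a x0" "0 <= X a x0" and 2: "(I x0 b)^2 <= \<alpha>2 * X x0 b" "0 <= X x0 b"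
   using left[OF 3(1)] right[OF 3(2)] by (auto simp: \<alpha>1_def \<alpha>2_def)
  have "2 * (I a x0 * I x0 b) <= \<alpha>1 * X x0 b + \<alpha>2 * X a x0"
  proof (rule power2_le_imp_le)
   have "(2 * (I a x0 * I x0 b))^2 = 4 * ((I a x0)^2 * (I x0 b)^2)" by (simp add: power_mult_distrib)
   also have "\<dots> <= 4 * ((\<alpha>1 * X a x0) * (\<alpha>2 * X x0 b))"
    using 1 2 \<alpha>0 by (intro mult_left_mono mult_mono) auto
   also have "\<dots> <= (\<alpha>1 * X x0 b + \<alpha>2 * X a x0)^2"
    using zero_le_power2[of "\<alpha>1 * X x0 b - \<alpha>2 * X a x0"] by (simp add: power2_eq_square algebra_simps)
   finally show "(2 * (I a x0 * I x0 b))^2 <= (\<alpha>1 * X x0 b + \<alpha>2 * X a x0)^2" .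
  qed (use 1 2 \<alpha>0 in simp)
  then have "(I a x0 + I x0 b)^2 <= (\<alpha>1 + \<alpha>2) * (X a x0 + X x0 b)"
   using 1 2 by (simp add: power2_sum algebra_simps)
  also have "\<dots> <= (l a b) ^ 3 / 3 * (X a x0 + X x0 b)"
  proof (rule mult_right_mono)
   have "(l a x0) ^ 3 + (l x0 b) ^ 3 <= (l a x0 + l x0 b) ^ 3"
    using l0[of a x0] l0[of x0 b] by (simp add: power3_eq_cube algebra_simps)
   also have "\<dots> <= (l a b) ^ 3" using ls l0 by (intro power_mono) auto
   finally show "\<alpha>1 + \<alpha>2 <= (l a b) ^ 3 / 3" by (simp add: \<alpha>1_def \<alpha>2_def)
  qed (use 1 2 in simp)
  finally show ?thesis by (simp add: Is Xs)
 qed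
 then show ?thesis by (simp add: I_def X_def l_def)
qed

text \<open>From I^2 <= (l^3/m) X and X^2 <= D follows m^2 I^4 <= l^6 D, with I the truncated mass;
  m = 3 with one zero, m = 12 with the symmetric shift q = l/2. The factor 1 - 3 \<delta> (b - a)
  bounds I from below.\<close>

lemma dissipation_lower_bound:
 assumes \<delta>: "\<delta> > 0" and mass: "(LBINT x:{a<..<b}. u x) = 1" and small: "3 * \<delta> * (b - a) <= 1"
 defines "l \<equiv> measure lborel {x\<in>{a<..<b}. u x > \<delta>}"
 shows "x0 \<in> {a..b} ==> u x0 <= \<delta> ==> 9 * (1 - 3 * \<delta> * (b - a)) ^ 4 <= l ^ 6 * D"
  and "u a <= \<delta> ==> u b <= \<delta> ==> 144 * (1 - 3 * \<delta> * (b - a)) ^ 4 <= l ^ 6 * D"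
proof -
 define X where "X = (LBINT x:{a<..<b}. cutoff1 \<delta> (u x) * (V x)^2)"
 define I where "I = (LBINT x:{a<..<b}. cutoff \<delta> (u x))"
 have XD: "X^2 <= D" unfolding X_def by (rule cut_energy_bound(2)[OF \<delta> mass])
 have I: "1 - 3 * \<delta> * (b - a) <= I" unfolding I_def by (rule cut_mass_bound[OF \<delta> mass small])
 have l0: "0 <= l" by (simp add: l_def)
 have fin: "m^2 * (1 - 3 * \<delta> * (b - a)) ^ 4 <= l ^ 6 * D" if "I^2 <= l ^ 3 / m * X" "m > 0" for m :: real
 proof -
  have "m * (1 - 3 * \<delta> * (b - a))^2 <= m * I^2"
   using I small that by (intro mult_left_mono power_mono) auto
  also have "\<dots> <= l ^ 3 * X" using that by (simp add: field_simps)
  finally have "(m * (1 - 3 * \<delta> * (b - a))^2)^2 <= (l ^ 3 * X)^2"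
   using that by (intro power_mono) auto
  also have "\<dots> = l ^ 6 * X^2" by (simp add: power_mult_distrib flip: power_mult)
  also have "\<dots> <= l ^ 6 * D" using XD l0 by (intro mult_left_mono) auto
  finally show ?thesis by (simp add: power_mult_distrib flip: power_mult)
 qed
 show "9 * (1 - 3 * \<delta> * (b - a)) ^ 4 <= l ^ 6 * D" if "x0 \<in> {a..b}" "u x0 <= \<delta>"
  using fin[of 3] mass_le_support_energy[OF \<delta> that] by (simp add: I_def X_def l_def)
 show "144 * (1 - 3 * \<delta> * (b - a)) ^ 4 <= l ^ 6 * D" if "u a <= \<delta>" "u b <= \<delta>"
 proof -
  have "I^2 <= ((l - l / 2) ^ 3 + (l / 2) ^ 3) / 3 * X"
   unfolding I_def X_def
   by (rule piece_bound(1)[OF \<delta> order_refl ab order_refl]) (use cutoff_zero(1)[OF \<delta>] that in \<open>auto simp: l_def\<close>)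
  also have "((l - l / 2) ^ 3 + (l / 2) ^ 3) / 3 = l ^ 3 / 12" by (simp add: power3_eq_cube field_simps)
  finally show ?thesis using fin[of 12] by simp
 qed
qed

end

section \<open>Regularity of a weak time slice\<close>

lemma prim_on_cong:
 assumes "prim_on S F f" "!!x. x \<in> S ==> F x = G x" "!!x. x \<in> S ==> f x = g x"
 shows "prim_on S G g"
 unfolding prim_on_def
proof (intro allI impI)
 fix c d :: real assume cd: "c <= d" "{c..d} <= S"
 have "L1_on {c..d} f = L1_on {c..d} g"
  by (rule set_integrable_cong) (use assms(3) cd in auto)
 moreover have "(LBINT x:{c..d}. f x) = (LBINT x:{c..d}. g x)"
  by (rule set_lebesgue_integral_cong) (use assms(3) cd in auto)
 moreover have "c \<in> S" "d \<in> S" using cd by auto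
 ultimately show "L1_on {c..d} g & G d - G c = (LBINT x:{c..d}. g x)"
  using prim_onD[OF assms(1) cd] assms(2) by auto
qed

lemma set_integrable_cong_AE_imp:
 fixes f g :: "'a => real"
 assumes f: "set_integrable M A f" and g: "set_borel_measurable M A g" and ae: "AE x in M. x \<in> A --> f x = g x"
 shows "set_integrable M A g"
 unfolding set_integrable_def
proof (rule integrable_cong_AE_imp)
 show "integrable M (%x. indicator A x *\<^sub>R f x)" using f by (simp add: set_integrable_def)
 show "(%x. indicator A x *\<^sub>R g x) \<in> borel_measurable M" using g by (simp add: set_borel_measurable_def)
 show "AE x in M. indicator A x *\<^sub>R f x = indicator A x *\<^sub>R g x"
  using ae by eventually_elim (auto simp: indicator_def)
qed

text \<open>Where a primitive has a nonzero right derivative, its zeros are isolated from the right, and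
 there are only countably many such points.\<close>

lemma prim_on_zero_set:
 assumes u: "prim_on {a<..<b} u g" and gi: "L1_on {a<..<b} g"
 shows "AE x\<in>{a<..<b} in lborel. u x = 0 --> g x = 0"
proof -
 define f where "f z = indicator {a<..<b} z *\<^sub>R g z" for z
 have fi: "integrable lborel f" using gi by (simp add: set_integrable_def f_def[abs_def])
 define N where "N = {x\<in>{a<..<b}. u x = 0 & (\<exists>d>x. \<forall>y\<in>{x<..<d}. u y \<noteq> 0)}"
 have "countable N"
 proof -
  have "\<forall>x\<in>N. \<exists>q. q \<in> \<rat> & x < q & (\<forall>y\<in>N. x < y --> q < y)"
  proof
   fix x assume "x \<in> N"
   then obtain d where d: "x < d" "\<forall>y\<in>{x<..<d}. u y \<noteq> 0" by (auto simp: N_def)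
   obtain q where q: "q \<in> \<rat>" "x < q" "q < d" using Rats_dense_in_real[OF d(1)] by blast
   have "q < y" if "y \<in> N" "x < y" for y using that d(2) q by (force simp: N_def)
   then show "\<exists>q. q \<in> \<rat> & x < q & (\<forall>y\<in>N. x < y --> q < y)" using q by blast
  qed
  from bchoice[OF this] obtain h where h: "!!x. x \<in> N ==> h x \<in> \<rat>" "!!x. x \<in> N ==> x < h x"
   "!!x y. x \<in> N ==> y \<in> N ==> x < y ==> h x < y" by blast
  have "inj_on h N"
  proof (rule inj_onI)
   fix x y assume "x \<in> N" "y \<in> N" "h x = h y"
   then show "x = y" using h(2)[of x] h(2)[of y] h(3)[of x y] h(3)[of y x] by linarith
  qed
  moreover have "countable (h ` N)" by (rule countable_subset[OF _ countable_rat]) (use h(1) in auto)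
  ultimately show ?thesis by (rule countable_image_inj_on[rotated])
 qed
 from AE_not_in[OF countable_imp_null_set_lborel[OF this]] AE_right_average_tendsto[OF fi] show ?thesis
 proof eventually_elim
  case (elim x)
  show ?case
  proof (intro impI, rule ccontr)
   assume x: "x \<in> {a<..<b}" "u x = 0" "g x \<noteq> 0"
   then have "f x \<noteq> 0" by (simp add: f_def)
   from tendsto_imp_eventually_ne[OF elim(2) this] obtain e where e: "e > x"
    "!!h. 0 < h ==> h < e - x ==> (LBINT z:{x..x+h}. f z) / h \<noteq> 0"
    unfolding eventually_at_right_field by (metis add.commute add_less_cancel_left diff_add_cancel add_0)
   have "u y \<noteq> 0" if y: "y \<in> {x<..<min b e}" for y
   proof -
    have sub: "{x..y} <= {a<..<b}" using x y by auto
    have "(LBINT z:{x..y}. f z) = (LBINT z:{x..y}. g z)"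
     by (rule set_lebesgue_integral_cong) (use sub in \<open>auto simp: f_def\<close>)
    then show ?thesis using prim_onD(2)[OF u _ sub] e(2)[of "y - x"] x y by auto
   qed
   moreover have "x < min b e" using x e by simp
   ultimately have "x \<in> N" unfolding N_def using x by blast
   then show False using elim(1) by simp
  qed
 qed
qed

text \<open>The weak derivatives are replaced by representatives on the positivity set and by 0 off
  it. For u_x this is a change on a null set only, because u_x = 0 almost everywhere on {u = 0} by
  \<open>prim_on_zero_set\<close>. The function v continues u by constants, since
  \<open>regular_slice\<close> asks for continuity on the whole line.\<close>

lemma weak_slice_regular:
 assumes ab: "a < b" and cu: "continuous_on {a..b} u" and u0: "!!x. x \<in> {a..b} ==> 0 <= u x"
  and wd1: "weak_deriv_on {a<..<b} u ux" and wd2: "weak_deriv_on {x\<in>{a<..<b}. u x > 0} ux uxx"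
  and wd3: "weak_deriv_on {x\<in>{a<..<b}. u x > 0} uxx uxxx"
  and du: "(u has_real_derivative 0) (at a within {a..b})" "(u has_real_derivative 0) (at b within {a..b})"
  and m: "meas_on {a<..<b} ux" "meas_on {a<..<b} uxxx"
  and E: "L1_on {a<..<b} (%x. (ux x)^2)"
  and D: "L1_on {a<..<b} (%x. u x * (uxx x)^2)"
  and A: "L1_on {a<..<b} (%x. (u x) ^ 3 * (uxxx x)^2)"
 obtains v V W Z where "regular_slice a b v V W Z" "!!x. x \<in> {a..b} ==> v x = u x"
  "AE x\<in>{a<..<b} in lborel. ux x = V x"
  "AE x\<in>{a<..<b} in lborel. u x > 0 --> uxx x = W x"
  "AE x\<in>{a<..<b} in lborel. u x > 0 --> uxxx x = Z x"
proof -
 define S where "S = {x\<in>{a<..<b}. u x > 0}"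
 define v where "v x = u (max a (min b x))" for x
 have vu: "v x = u x" if "x \<in> {a..b}" for x using that by (simp add: v_def max_absorb2 min_absorb2)
 have cuo: "continuous_on {a<..<b} u" by (rule continuous_on_subset[OF cu]) auto
 have cv: "continuous_on UNIV v"
  unfolding v_def by (intro continuous_on_compose2[OF cu] continuous_intros) (use ab in auto)
 have oS: "open S"
 proof -
  have "open (u -` {0<..} \<inter> {a<..<b})" using cuo by (subst (asm) continuous_on_open_vimage) auto
  moreover have "u -` {0<..} \<inter> {a<..<b} = S" by (auto simp: S_def)
  ultimately show ?thesis by simp
 qed
 have SI: "S <= {a<..<b}" by (auto simp: S_def)
 obtain U0 where U0: "prim_on {a<..<b} U0 ux" "AE x\<in>{a<..<b} in lborel. u x = U0 x"
  using weak_deriv_on_prim[OF _ wd1] by auto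
 obtain V0 where V0: "prim_on S V0 uxx" "AE x\<in>S in lborel. ux x = V0 x"
  using weak_deriv_on_prim[OF oS wd2[folded S_def]] by auto
 obtain W0 where W0: "prim_on S W0 uxxx" "AE x\<in>S in lborel. uxx x = W0 x"
  using weak_deriv_on_prim[OF oS wd3[folded S_def]] by auto
 have cW: "continuous_on S W0" by (rule prim_on_continuous[OF W0(1) oS])
 have cV: "continuous_on S V0" by (rule prim_on_continuous[OF V0(1) oS])
 have uU: "u x = U0 x" if "x \<in> {a<..<b}" for x
  by (rule continuous_AE_eq_imp_eq[OF _ cuo prim_on_continuous[OF U0(1)] U0(2) that]) auto
 have pu: "prim_on {a<..<b} u ux" by (rule prim_on_cong[OF U0(1)]) (use uU in auto)
 have mc: "meas_on {c..d} g" if "continuous_on S g" "{c..d} <= S" for g :: "real => real" and c d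
  unfolding set_borel_measurable_def
  using borel_measurable_continuous_on_indicator[OF _ continuous_on_subset[OF that]] by simp
 have pVW: "prim_on S V0 W0" by (rule prim_on_cong_AE[OF V0(1) W0(2) mc[OF cW]])
 have puV: "prim_on S u V0" by (rule prim_on_cong_AE[OF prim_on_subset[OF pu SI] V0(2) mc[OF cV]])
 define V where "V x = indicator S x * V0 x" for x
 define W where "W x = indicator S x * W0 x" for x
 define Z where "Z x = indicator S x * uxxx x" for x
 have mV: "V \<in> borel_measurable borel" "W \<in> borel_measurable borel"
  unfolding V_def[abs_def] W_def[abs_def]
  using borel_measurable_continuous_on_indicator[OF _ cV] borel_measurable_continuous_on_indicator[OF _ cW] oS by auto
 have mZ: "Z \<in> borel_measurable borel"
 proof -
  have "(%x. indicator S x * (indicator {a<..<b} x *\<^sub>R uxxx x)) \<in> borel_measurable borel"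
   using m(2) oS by (intro borel_measurable_times) (auto simp: set_borel_measurable_def)
  moreover have "(%x. indicator S x * (indicator {a<..<b} x *\<^sub>R uxxx x)) = Z"
   using SI by (auto simp: Z_def indicator_def fun_eq_iff)
  ultimately show ?thesis by simp
 qed
 have uxi: "L1_on {a<..<b} ux"
 proof (rule set_integrable_bound[OF _ m(1)])
  have "L1_on {a<..<b} (%x. 1 :: real)"
   by (rule set_integrable_subset[OF borel_integrable_atLeastAtMost'[of a b]]) auto
  then show "L1_on {a<..<b} (%x. 1 + (ux x)^2)" using E by (intro set_integral_add)
  have "\<bar>ux x\<bar> <= 1 + (ux x)^2" for x using abs_mult_le_sum_squares[of "ux x" 1] by simp
  then show "AE x\<in>{a<..<b} in lborel. norm (ux x) <= norm (1 + (ux x)^2)" by auto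
 qed
 have "AE x\<in>{a<..<b} in lborel. u x = 0 --> ux x = 0"
  by (rule prim_on_zero_set[OF pu uxi])
 then have uxV: "AE x\<in>{a<..<b} in lborel. ux x = V x"
  using V0(2)
 proof eventually_elim
  case (elim x)
  show ?case
  proof
   assume x: "x \<in> {a<..<b}"
   show "ux x = V x"
    using elim x u0[of x] by (cases "u x = 0") (auto simp: V_def S_def indicator_def less_le)
  qed
 qed
 have uxxW: "AE x\<in>{a<..<b} in lborel. u x > 0 --> uxx x = W x"
  using W0(2) by eventually_elim (auto simp: W_def S_def)
 have uxxxZ: "uxxx x = Z x" if "x \<in> {a<..<b}" "u x > 0" for x
  using that by (auto simp: Z_def S_def)
 have Sv: "{x\<in>{a<..<b}. v x > 0} = S" using vu by (auto simp: S_def)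
 have mv: "v \<in> borel_measurable borel" by (rule borel_measurable_continuous_onI[OF cv])
 have "regular_slice a b v V W Z"
 proof
  show "a < b" by fact
  show "continuous_on UNIV v" by (rule cv)
  show "0 <= v x" for x unfolding v_def using ab by (intro u0) auto
  show "(v has_real_derivative V x) (at x)" if x: "x \<in> {a<..<b}" "v x > 0" for x
  proof -
   have xS: "x \<in> S" using x vu[of x] by (auto simp: S_def)
   have "(u has_real_derivative V0 x) (at x)" by (rule prim_on_has_deriv[OF puV oS cV xS])
   moreover have "eventually (%y. y \<in> {a<..<b}) (nhds x)" by (rule eventually_nhds_in_open) (use x in auto)
   then have "eventually (%y. u y = v y) (nhds x)" by eventually_elim (use vu in auto)
   ultimately show ?thesis
    using DERIV_cong_ev[of x x u v "V0 x" "V x"] xS by (simp add: V_def)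
  qed
  show "(V has_real_derivative W x) (at x)" if x: "x \<in> {a<..<b}" "v x > 0" for x
  proof -
   have xS: "x \<in> S" using x vu[of x] by (auto simp: S_def)
   have "(V0 has_real_derivative W0 x) (at x)" by (rule prim_on_has_deriv[OF pVW oS cW xS])
   moreover have "eventually (%y. y \<in> S) (nhds x)" by (rule eventually_nhds_in_open[OF oS xS])
   then have "eventually (%y. V0 y = V y) (nhds x)" by eventually_elim (auto simp: V_def)
   ultimately show ?thesis
    using DERIV_cong_ev[of x x V0 V "W0 x" "W x"] xS by (simp add: W_def)
  qed
  show "prim_on {x\<in>{a<..<b}. v x > 0} W Z"
   unfolding Sv by (rule prim_on_cong[OF W0(1)]) (auto simp: W_def Z_def)
  show "V x = 0" if "x \<in> {a<..<b}" "v x = 0" for x using that vu[of x] by (auto simp: V_def S_def)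
  show "V \<in> borel_measurable borel" "W \<in> borel_measurable borel" "Z \<in> borel_measurable borel" by (fact mV mZ)+
  show "(v has_real_derivative 0) (at e within {a..b})" if "e \<in> {a, b}" for e
  proof -
   have "(u has_real_derivative 0) (at e within {a..b})" using du that by auto
   moreover have "e \<in> {a..b}" using that ab by auto
   ultimately show ?thesis
    using vu by (auto intro: has_field_derivative_transform_within[where d=1])
  qed
  show "L1_on {a<..<b} (%x. (V x)^2)"
   by (rule set_integrable_cong_AE_imp[OF E]) (use uxV mV in \<open>auto simp: set_borel_measurable_def elim: eventually_mono\<close>)
  show "L1_on {a<..<b} (%x. v x * (W x)^2)"
  proof (rule set_integrable_cong_AE_imp[OF D])
   show "meas_on {a<..<b} (%x. v x * (W x)^2)"
    unfolding set_borel_measurable_def using mV mv by measurable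
   show "AE x\<in>{a<..<b} in lborel. u x * (uxx x)^2 = v x * (W x)^2"
    using uxxW by eventually_elim (use vu u0 in \<open>force simp: less_le\<close>)
  qed
  show "L1_on {a<..<b} (%x. (v x) ^ 3 * (Z x)^2)"
  proof (rule set_integrable_cong_AE_imp[OF A])
   show "meas_on {a<..<b} (%x. (v x) ^ 3 * (Z x)^2)"
    unfolding set_borel_measurable_def using mZ mv by measurable
   show "AE x\<in>{a<..<b} in lborel. (u x) ^ 3 * (uxxx x)^2 = (v x) ^ 3 * (Z x)^2"
   proof (intro AE_I2 impI)
    fix x assume x: "x \<in> {a<..<b}"
    show "(u x) ^ 3 * (uxxx x)^2 = (v x) ^ 3 * (Z x)^2"
     using uxxxZ[OF x] vu[of x] u0[of x] x by (cases "u x = 0") auto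
   qed
  qed
 qed
 then show thesis
  by (rule that) (use vu uxV uxxW uxxxZ in auto)
qed

section \<open>Integration over space-time cylinders\<close>

lemma Fubini_rectangle:
 fixes f :: "real => real => real"
 assumes f: "L1_on (A \<times> C) (%(t, x). f t x)"
 shows "AE t\<in>A in lborel. L1_on C (f t)"
  and "L1_on A (%t. LBINT x:C. f t x)"
  and "(LBINT z:A \<times> C. (case z of (t, x) => f t x)) = (LBINT t:A. LBINT x:C. f t x)"
proof -
 define F where "F z = indicator (A \<times> C) z *\<^sub>R (case z of (t, x) => f t x)" for z :: "real \<times> real"
 have F: "integrable (lborel \<Otimes>\<^sub>M lborel) F"
  using f unfolding set_integrable_def lborel_prod F_def .
 have Feq: "F (t, x) = indicator A t *\<^sub>R (indicator C x *\<^sub>R f t x)" for t x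
  by (auto simp: F_def indicator_def)
 show "AE t\<in>A in lborel. L1_on C (f t)"
  using lborel_pair.AE_integrable_fst'[OF F]
  by eventually_elim (auto simp: Feq set_integrable_def)
 have in_eq: "(\<integral>x. F (t, x) \<partial>lborel) = indicator A t *\<^sub>R (LBINT x:C. f t x)" for t
  unfolding Feq set_lebesgue_integral_def by simp
 show "L1_on A (%t. LBINT x:C. f t x)"
  using lborel_pair.integrable_fst'[OF F] unfolding in_eq set_integrable_def .
 show "(LBINT z:A \<times> C. (case z of (t, x) => f t x)) = (LBINT t:A. LBINT x:C. f t x)"
  using lborel_pair.integral_fst'[OF F] unfolding in_eq lborel_prod
  by (simp add: set_lebesgue_integral_def F_def[abs_def])
qed

lemma nn_set_integral_finite_imp_integrable:
 fixes f :: "'a => real"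
 assumes m: "set_borel_measurable M A f" and f0: "!!z. z \<in> A ==> 0 <= f z"
  and fin: "(\<integral>\<^sup>+z\<in>A. ennreal (f z) \<partial>M) <= ennreal c" and c: "0 <= c"
 shows "set_integrable M A f" "(LINT z:A|M. f z) <= c"
proof -
 let ?g = "%z. indicator A z *\<^sub>R f z"
 have eq: "ennreal (?g z) = ennreal (f z) * indicator A z" for z by (simp add: indicator_def)
 have g0: "AE z in M. 0 <= ?g z" using f0 by (auto simp: indicator_def)
 have gm: "?g \<in> borel_measurable M" using m by (simp add: set_borel_measurable_def)
 have le: "(\<integral>\<^sup>+z. ennreal (?g z) \<partial>M) <= ennreal c" unfolding eq by (rule fin)
 then have "(\<integral>\<^sup>+z. ennreal (?g z) \<partial>M) < \<infinity>" using le_less_trans by fastforce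
 then have gi: "integrable M ?g" using gm g0 by (simp add: integrableI_nonneg)
 then show "set_integrable M A f" by (simp add: set_integrable_def)
 have "ennreal (\<integral>z. ?g z \<partial>M) <= ennreal c"
  using le nn_integral_eq_integral[OF gi g0] by simp
 then show "(LINT z:A|M. f z) <= c" using c by (simp add: ennreal_le_iff set_lebesgue_integral_def)
qed

lemma set_nn_integral_eq_set_integral_real:
 fixes f :: "'a => real"
 assumes f: "set_integrable M A f" and f0: "!!z. z \<in> A ==> 0 <= f z"
 shows "(\<integral>\<^sup>+z\<in>A. ennreal (f z) \<partial>M) = ennreal (LINT z:A|M. f z)"
proof -
 let ?g = "%z. indicator A z *\<^sub>R f z"
 have eq: "ennreal (?g z) = ennreal (f z) * indicator A z" for z by (simp add: indicator_def)
 have "(\<integral>\<^sup>+z. ennreal (?g z) \<partial>M) = ennreal (\<integral>z. ?g z \<partial>M)"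
  using f f0 by (intro nn_integral_eq_integral) (auto simp: set_integrable_def indicator_def)
 then show ?thesis unfolding eq set_lebesgue_integral_def .
qed

lemma set_integral_nonneg_pointwise:
 fixes f :: "'a => real"
 shows "(!!x. x \<in> A ==> 0 <= f x) ==> 0 <= (LINT x:A|M. f x)"
 unfolding set_lebesgue_integral_def by (intro integral_nonneg_AE AE_I2) (auto simp: indicator_def)

lemma set_integrable_bounded_mult:
 fixes f g :: "'a => real"
 assumes f: "set_integrable M A f" and g: "set_borel_measurable M A g" and b: "!!z. z \<in> A ==> \<bar>g z\<bar> <= B"
 shows "set_integrable M A (%z. f z * g z)"
proof (rule set_integrable_bound)
 show "set_integrable M A (%z. B * f z)" using f by simp
 have "(%z. (indicator A z *\<^sub>R f z) * (indicator A z *\<^sub>R g z)) \<in> borel_measurable M"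
  using f g by (intro borel_measurable_times) (auto simp: set_integrable_def set_borel_measurable_def)
 then show "set_borel_measurable M A (%z. f z * g z)"
  unfolding set_borel_measurable_def
  by (rule measurable_cong[THEN iffD1, rotated]) (auto simp: indicator_def)
 show "AE z in M. z \<in> A --> norm (f z * g z) <= norm (B * f z)"
 proof (intro AE_I2 impI)
  fix z assume "z \<in> A"
  from b[OF this] show "norm (f z * g z) <= norm (B * f z)"
   by (simp add: abs_mult mult.commute[of "\<bar>f z\<bar>"] mult_right_mono)
 qed
qed

lemma set_integral_cong_AE_measurable:
 fixes f g :: "_ => real"
 assumes "set_borel_measurable M A f" "set_borel_measurable M A g" "AE x in M. x \<in> A --> f x = g x"
 shows "(LINT x:A|M. f x) = (LINT x:A|M. g x)"
 unfolding set_lebesgue_integral_def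
proof (rule integral_cong_AE)
 show "AE x in M. indicator A x *\<^sub>R f x = indicator A x *\<^sub>R g x"
  using assms(3) by eventually_elim (auto simp: indicator_def)
qed (use assms in \<open>auto simp: set_borel_measurable_def\<close>)

lemma set_integrable_const_interval: "L1_on {a<..<b::real} (%x. c :: real)"
 by (rule set_integrable_subset[OF borel_integrable_atLeastAtMost'[of a b]]) auto

lemma LBINT_const_interval: "a <= b ==> (LBINT x:{a<..<b::real}. c) = (b - a) * (c :: real)"
 by (simp add: set_lebesgue_integral_def)

lemma continuous_on_LBINT_param:
 fixes f :: "real => real => real"
 assumes f: "continuous_on (U \<times> {a..b}) (%(t, x). f t x)"
 shows "continuous_on U (%t. LBINT x:{a<..<b}. f t x)"
proof -
 have "continuous_on U (%t. integral (cbox a b) (f t))"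
  by (rule integral_continuous_on_param) (use f in \<open>simp add: cbox_interval\<close>)
 moreover have "(LBINT x:{a<..<b}. f t x) = integral (cbox a b) (f t)" if "t \<in> U" for t
 proof -
  have "continuous_on {a..b} (%x. (t, x))" "(%x. (t, x)) ` {a..b} <= U \<times> {a..b}"
   using that by (auto intro!: continuous_intros)
  from continuous_on_compose2[OF f this] have "continuous_on {a..b} (f t)" by simp
  then have "L1_on {a..b} (f t)" by (rule borel_integrable_atLeastAtMost')
  from set_borel_integral_eq_integral(2)[OF this] show ?thesis
   by (simp add: LBINT_Icc_eq_Ioo cbox_interval)
 qed
 ultimately show ?thesis by (subst continuous_on_cong[OF refl]) auto
qed

section \<open>Solutions at a fixed \<open>\<epsilon>\<close>\<close>

locale film =
 fixes a b n \<epsilon> :: real and uin duin :: "real => real" and u ux uxx uxxx :: "real => real => real"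
 assumes ab: "a < b" and n: "0 < n" "n < 3" and eps: "0 < \<epsilon>" "\<epsilon> < 1"
  and H1: "H1_deriv {a<..<b} uin duin" and mass_in: "(LBINT x:{a<..<b}. uin x) = 1"
  and sd: "spatial_derivs a b u ux uxx uxxx"
  and ws: "weak_solution a b n \<epsilon> uin u uxxx"
  and mc: "mass_conservation a b uin u"
  and en: "energy_inequality a b n \<epsilon> duin u ux uxxx"
  and ent: "entropy_inequality a b n \<epsilon> u uxx"
  and re: "rho_equation a b n \<epsilon> u ux uxx uxxx"
begin

definition "L = \<bar>ln \<epsilon>\<bar>"
definition "E0 = (LBINT x:{a<..<b}. (duin x)^2)"
definition "R = ({0<..} :: real set) \<times> {a<..<b}"
definition "Dd t = (LBINT x:{a<..<b}. u t x * (uxx t x)^2)"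
definition "Ad t = (LBINT x:{a<..<b}. L * mobility n \<epsilon> (u t x) * (uxxx t x)^2)"
definition "X \<phi> t = (LBINT x:{a<..<b}. B_eps n \<epsilon> (u t x) * \<phi> x)"
text \<open>A bound for u that does not depend on eps: the mean 1/(b - a) plus the oscillation
  allowed by \<open>u_holder\<close>. The maximum with 1 makes ln M nonnegative and meets the
  hypothesis of \<open>B_eps_upper\<close>.\<close>

definition "M = max 1 (1 / (b - a) + sqrt (E0 * (b - a)))"

lemma L_pos: "L > 0" unfolding L_def by (rule ln_eps(2)[OF n eps])

lemma u_cont: "continuous_on ({0..} \<times> {a..b}) (%(t, x). u t x)"
 and u_nonneg: "t >= 0 ==> x \<in> {a..b} ==> 0 <= u t x"
 and u_init: "AE x\<in>{a<..<b} in lborel. u 0 x = uin x"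
 and u_bdry: "AE t in lborel. t > 0 -->
    (u t has_real_derivative 0) (at a within {a..b}) & (u t has_real_derivative 0) (at b within {a..b})"
 using ws by (auto simp: weak_solution_def)

lemma u_cont_slice:
 assumes "t >= 0"
 shows "continuous_on {a..b} (u t)"
proof -
 have "continuous_on {a..b} (%x. (t, x))" "(%x. (t, x)) ` {a..b} <= {0..} \<times> {a..b}"
  using assms by (auto intro!: continuous_intros)
 from continuous_on_compose2[OF u_cont this] show ?thesis by simp
qed

lemma R_sets [measurable]: "R \<in> sets borel"
 unfolding R_def by (intro borel_open open_Times) auto

text \<open>Extensions by 0 to the plane: measurability on cylinders and on time slices then follows
  from a single Borel function.\<close>

definition "U z = indicator R z * (case z of (t, x) => u t x)"
definition "UX z = indicator R z * (case z of (t, x) => ux t x)"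
definition "UXX z = indicator R z * (case z of (t, x) => uxx t x)"
definition "UXXX z = indicator R z * (case z of (t, x) => uxxx t x)"

lemma U_measurable [measurable]: "U \<in> borel_measurable borel" "UX \<in> borel_measurable borel"
 "UXX \<in> borel_measurable borel" "UXXX \<in> borel_measurable borel"
proof -
 have "continuous_on R (%(t, x). u t x)"
  by (rule continuous_on_subset[OF u_cont]) (auto simp: R_def)
 from borel_measurable_continuous_on_indicator[OF _ this] show "U \<in> borel_measurable borel"
  by (simp add: U_def[abs_def])
 show "UX \<in> borel_measurable borel" "UXX \<in> borel_measurable borel" "UXXX \<in> borel_measurable borel"
  using sd by (simp_all add: spatial_derivs_def set_borel_measurable_def UX_def[abs_def] UXX_def[abs_def] UXXX_def[abs_def] R_def)
qed

lemma U_eq: "t > 0 ==> x \<in> {a<..<b} ==> U (t, x) = u t x" "t > 0 ==> x \<in> {a<..<b} ==> UX (t, x) = ux t x"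
 "t > 0 ==> x \<in> {a<..<b} ==> UXX (t, x) = uxx t x" "t > 0 ==> x \<in> {a<..<b} ==> UXXX (t, x) = uxxx t x"
 by (auto simp: U_def UX_def UXX_def UXXX_def R_def)

lemma cyl_measurable:
 fixes F :: "real \<times> real => real" and f :: "real => real => real"
 assumes "F \<in> borel_measurable borel" "!!t x. t > 0 ==> x \<in> {a<..<b} ==> F (t, x) = f t x"
 shows "meas_on (cyl T a b) (%(t, x). f t x)"
proof -
 have c: "cyl T a b \<in> sets borel" unfolding cyl_def by (intro borel_open open_Times) auto
 have "(%z. indicator (cyl T a b) z *\<^sub>R F z) \<in> borel_measurable borel" using assms(1) c by measurable
 moreover have "(%z. indicator (cyl T a b) z *\<^sub>R F z) = (%z. indicator (cyl T a b) z *\<^sub>R (case z of (t, x) => f t x))"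
  using assms(2) by (auto simp: fun_eq_iff indicator_def cyl_def)
 ultimately show ?thesis by (simp add: set_borel_measurable_def)
qed

lemma slice_measurable:
 fixes F :: "real \<times> real => real" and f :: "real => real"
 assumes "F \<in> borel_measurable borel" "!!x. x \<in> {a<..<b} ==> F (t, x) = f x"
 shows "meas_on {a<..<b} f"
proof -
 have "(%x. (t, x)) \<in> borel_measurable borel"
  by (intro borel_measurable_continuous_onI continuous_intros)
 from measurable_compose[OF this assms(1)]
 have "(%x. indicator {a<..<b} x *\<^sub>R F (t, x)) \<in> borel_measurable borel" by measurable
 moreover have "(%x. indicator {a<..<b} x *\<^sub>R F (t, x)) = (%x. indicator {a<..<b} x *\<^sub>R f x)"
  using assms(2) by (auto simp: fun_eq_iff indicator_def)
 ultimately show ?thesis by (simp add: set_borel_measurable_def)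
qed

lemma duin2: "L1_on {a<..<b} (%x. (duin x)^2)"
 using H1 by (simp add: H1_deriv_def in_L_def)

lemma E0_nonneg: "0 <= E0" unfolding E0_def by (rule set_integral_nonneg_pointwise) simp

lemma energy_rhs: "(\<integral>\<^sup>+x\<in>{a<..<b}. ennreal ((duin x)^2 / 2) \<partial>lborel) = ennreal (E0 / 2)"
 using set_nn_integral_eq_set_integral_real[OF set_integrable_divide[OF duin2, of 2]] by (simp add: E0_def)

lemma ux2:
 assumes t: "t > 0"
 shows "L1_on {a<..<b} (%x. (ux t x)^2)" "(LBINT x:{a<..<b}. (ux t x)^2) <= E0"
proof -
 have "(\<integral>\<^sup>+x\<in>{a<..<b}. ennreal ((ux t x)^2 / 2) \<partial>lborel) <= ennreal (E0 / 2)"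
  using en t unfolding energy_inequality_def energy_rhs by (meson add_increasing2 order_trans le_add_same_cancel1 zero_le order_refl)
 moreover have "meas_on {a<..<b} (%x. (ux t x)^2 / 2)"
  by (rule slice_measurable[of "%z. (UX z)^2 / 2" t]) (use U_eq t in auto)
 ultimately have *: "L1_on {a<..<b} (%x. (ux t x)^2 / 2)" "(LBINT x:{a<..<b}. (ux t x)^2 / 2) <= E0 / 2"
  using nn_set_integral_finite_imp_integrable[of lborel "{a<..<b}" "%x. (ux t x)^2 / 2" "E0 / 2"] E0_nonneg by auto
 from *(1) show "L1_on {a<..<b} (%x. (ux t x)^2)" by simp
 from *(2) show "(LBINT x:{a<..<b}. (ux t x)^2) <= E0" by simp
qed

text \<open>Cauchy-Schwarz and the energy bound give the estimate for t > 0 and interior points; t =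
  0 and the end points follow from the continuity of u up to the boundary.\<close>

lemma u_holder:
 assumes t: "t >= 0" and xy: "x \<in> {a..b}" "y \<in> {a..b}"
 shows "(u t x - u t y)^2 <= E0 * \<bar>x - y\<bar>"
proof -
 have pos: "(u t x - u t y)^2 <= E0 * (y - x)" if t: "t > 0" and xy: "a < x" "x < y" "y < b" for t x y
 proof -
  have wd: "weak_deriv_on {a<..<b} (u t) (ux t)" using sd t by (simp add: spatial_derivs_def)
  obtain U0 where U0: "prim_on {a<..<b} U0 (ux t)" "AE x\<in>{a<..<b} in lborel. u t x = U0 x"
   using weak_deriv_on_prim[OF _ wd] by auto
  have cuo: "continuous_on {a<..<b} (u t)" by (rule continuous_on_subset[OF u_cont_slice]) (use t in auto)
  have uU: "u t x = U0 x" if "x \<in> {a<..<b}" for x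
   by (rule continuous_AE_eq_imp_eq[OF _ cuo prim_on_continuous[OF U0(1)] U0(2) that]) auto
  have sub: "{x..y} <= {a<..<b}" using xy by auto
  have I: "L1_on {x..y} (ux t)" "u t y - u t x = (LBINT s:{x..y}. ux t s)"
   using prim_onD[OF U0(1) _ sub] xy uU by auto
  have i2: "L1_on {x..y} (%s. (ux t s)^2)" by (rule set_integrable_subset[OF ux2(1)[OF t] _ sub]) simp
  have m: "meas_on {x..y} (ux t)" using I(1) by (auto simp: set_integrable_def set_borel_measurable_def)
  have one: "L1_on {x..y} (%s. 1^2 :: real)" by (intro borel_integrable_atLeastAtMost') auto
  have "(LBINT s:{x..y}. 1 * ux t s)^2 <= (LBINT s:{x..y}. 1^2) * (LBINT s:{x..y}. (ux t s)^2)"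
   by (rule Cauchy_Schwarz_set_integral(2)[OF _ m one i2]) (simp add: set_borel_measurable_def)
  also have "(LBINT s:{x..y}. 1^2 :: real) = y - x" using xy by (simp add: set_lebesgue_integral_def)
  also have "(LBINT s:{x..y}. (ux t s)^2) <= (LBINT x:{a<..<b}. (ux t x)^2)"
   unfolding set_lebesgue_integral_def
   by (rule integral_mono) (use sub i2 ux2(1)[OF t] in \<open>auto simp: set_integrable_def indicator_def\<close>)
  also have "\<dots> <= E0" by (rule ux2(2)[OF t])
  finally have "(LBINT s:{x..y}. ux t s)^2 <= (y - x) * E0" using xy by (simp add: mult_left_mono)
  then show ?thesis unfolding I(2)[symmetric] by (simp add: power2_commute mult.commute)
 qed
 have clos: "(u t x - u t y)^2 <= E0 * (y - x)" if xy: "a <= x" "x < y" "y <= b" for x y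
 proof -
  define c where "c j = x + (y - x) / (real j + 3)" for j
  define d where "d j = y - (y - x) / (real j + 3)" for j
  define s where "s j = t + 1 / (real j + 1)" for j
  have h: "0 < (y - x) / (real j + 3)" "(y - x) / (real j + 3) <= (y - x) / 3" for j
  proof -
   show "0 < (y - x) / (real j + 3)" using xy by simp
   show "(y - x) / (real j + 3) <= (y - x) / 3" by (rule frac_le) (use xy in auto)
  qed
  have cd: "a < c j" "c j < d j" "d j < b" "0 < s j" for j
  proof -
   define H where "H = (y - x) / (real j + 3)"
   have H: "c j = x + H" "d j = y - H" "0 < H" "3 * H <= y - x"
    using h[of j, folded H_def] by (simp_all add: c_def d_def H_def[symmetric])
   show "a < c j" using H xy by simp
   show "c j < d j" unfolding H(1,2) using H(3,4) by simp
   show "d j < b" unfolding H(2) using H(3) xy by simp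
   show "0 < s j" unfolding s_def using t by (intro add_nonneg_pos) auto
  qed
  have lims: "c ----> x" "d ----> y" "s ----> t"
   unfolding c_def d_def s_def by real_asymp+
  have Ut: "(%j. (case (s j, e j) of (t, x) => u t x)) ----> (case (t, z) of (t, x) => u t x)"
   if e: "e ----> z" "!!j. e j \<in> {a..b}" "z \<in> {a..b}" for e z
  proof (rule continuous_on_tendsto_compose[OF u_cont])
   show "(%j. (s j, e j)) ----> (t, z)" by (intro tendsto_Pair lims e)
   show "EV j. (s j, e j) \<in> {0..} \<times> {a..b}"
    using e(2) less_imp_le[OF cd(4)] by (intro always_eventually) auto
  qed (use t e in auto)
  have le: "c j \<in> {a..b}" "d j \<in> {a..b}" for j using cd[of j] by auto
  have "(%j. (u (s j) (c j) - u (s j) (d j))^2) ----> (u t x - u t y)^2"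
   using Ut[OF lims(1) le(1)] Ut[OF lims(2) le(2)] xy by (intro tendsto_intros) auto
  moreover have "(%j. E0 * (d j - c j)) ----> E0 * (y - x)" by (intro tendsto_intros lims)
  ultimately show ?thesis by (rule LIMSEQ_le) (use pos cd in blast)
 qed
 consider "x < y" | "y < x" | "x = y" by linarith
 then show ?thesis
  using clos[of x y] clos[of y x] xy by cases (auto simp: power2_commute)
qed

lemma u_mass:
 assumes t: "t >= 0"
 shows "(LBINT x:{a<..<b}. u t x) = 1"
proof (cases "t = 0")
 case True
 have "meas_on {a<..<b} uin" using H1 by (simp add: H1_deriv_def in_L_def)
 moreover have "meas_on {a<..<b} (u 0)"
 proof -
  have "L1_on {a<..<b} (u 0)"
   by (rule set_integrable_subset[OF borel_integrable_atLeastAtMost'[OF u_cont_slice]]) auto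
  then show ?thesis by (auto simp: set_integrable_def set_borel_measurable_def)
 qed
 ultimately show ?thesis
  using set_integral_cong_AE_measurable[of lborel "{a<..<b}" "u 0" uin] u_init mass_in True by simp
next
 case False
 then show ?thesis using mc mass_in t by (simp add: mass_conservation_def)
qed

lemma M_ge_1: "M >= 1" by (simp add: M_def)

lemma u_le_M:
 assumes t: "t >= 0" and x: "x \<in> {a..b}"
 shows "u t x <= M"
proof -
 define h where "h = sqrt (E0 * (b - a))"
 have lb: "u t x - h <= u t y" if y: "y \<in> {a..b}" for y
 proof -
  have "(u t x - u t y)^2 <= E0 * \<bar>x - y\<bar>" by (rule u_holder[OF t x y])
  also have "\<dots> <= E0 * (b - a)" using x y E0_nonneg by (intro mult_left_mono) auto
  finally have "\<bar>u t x - u t y\<bar> <= h" unfolding h_def using real_le_rsqrt by (metis power2_abs)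
  then show ?thesis by linarith
 qed
 have ui: "L1_on {a<..<b} (u t)"
  by (rule set_integrable_subset[OF borel_integrable_atLeastAtMost'[OF u_cont_slice[OF t]]]) auto
 have "(LBINT y:{a<..<b}. u t x - h) <= (LBINT y:{a<..<b}. u t y)"
  by (rule set_integral_mono[OF set_integrable_const_interval ui]) (use lb in auto)
 then have "(b - a) * (u t x - h) <= 1" using LBINT_const_interval[of a b "u t x - h"] ab u_mass[OF t] by simp
 then have "u t x - h <= 1 / (b - a)" using ab by (simp add: field_simps)
 then show ?thesis unfolding M_def h_def by linarith
qed

lemma rho_cont: "continuous_on ({0..} \<times> {a..b}) (%(t, x). B_eps n \<epsilon> (u t x))"
proof -
 have "continuous_on ({0..} \<times> {a..b}) (%z. B_eps n \<epsilon> (case z of (t, x) => u t x))"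
  by (rule continuous_on_compose2[OF continuous_on_B_eps[OF n eps, of UNIV] u_cont]) auto
 then show ?thesis by (simp add: case_prod_unfold)
qed

definition "P = 1 + (B_fun n 1 + ln M) / L"

lemma rho_bounds:
 assumes "t >= 0" "x \<in> {a..b}"
 shows "0 <= B_eps n \<epsilon> (u t x)" "B_eps n \<epsilon> (u t x) <= P"
 using B_eps_nonneg[OF n eps] B_eps_upper[OF n eps u_le_M[OF assms] M_ge_1] by (auto simp: P_def L_def)

lemma rho_slice_integrable:
 assumes t: "t >= 0" and \<phi>: "continuous_on {a..b} \<phi>"
 shows "L1_on {a<..<b} (%x. B_eps n \<epsilon> (u t x) * \<phi> x)"
proof -
 have "continuous_on {a..b} (%x. B_eps n \<epsilon> (u t x))"
  by (rule continuous_on_compose2[OF continuous_on_B_eps[OF n eps, of UNIV] u_cont_slice[OF t]]) auto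
 then have "L1_on {a..b} (%x. B_eps n \<epsilon> (u t x) * \<phi> x)"
  by (intro borel_integrable_atLeastAtMost' continuous_intros \<phi>)
 then show ?thesis by (rule set_integrable_subset) auto
qed

lemma X_cont:
 assumes \<phi>: "continuous_on {a..b} \<phi>"
 shows "continuous_on {0..} (X \<phi>)"
proof -
 have "continuous_on ({0..} \<times> {a..b}) (%z. \<phi> (snd z))"
  by (rule continuous_on_compose2[OF \<phi>]) (auto intro!: continuous_intros)
 then have "continuous_on ({0..} \<times> {a..b}) (%z. (case z of (t, x) => B_eps n \<epsilon> (u t x)) * \<phi> (snd z))"
  by (intro continuous_intros rho_cont)
 then have "continuous_on ({0..} \<times> {a..b}) (%(t, x). B_eps n \<epsilon> (u t x) * \<phi> x)"
  by (simp add: case_prod_unfold)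
 then show ?thesis unfolding X_def[abs_def] by (rule continuous_on_LBINT_param)
qed

lemma X_one: "X (%x. 1) t = (LBINT x:{a<..<b}. B_eps n \<epsilon> (u t x))"
 by (simp add: X_def)

lemma X_one_bounds:
 assumes t: "t >= 0"
 shows "0 <= X (%x. 1) t" "X (%x. 1) t <= P * (b - a)"
proof -
 show "0 <= X (%x. 1) t" unfolding X_one using rho_bounds(1)[OF t] by (intro set_integral_nonneg_pointwise) auto
 have "X (%x. 1) t <= (LBINT x:{a<..<b}. P)"
  unfolding X_def using rho_bounds[OF t]
  by (intro set_integral_mono rho_slice_integrable t set_integrable_const_interval) auto
 then show "X (%x. 1) t <= P * (b - a)" using LBINT_const_interval[of a b P] ab by (simp add: mult.commute)
qed

text \<open>The mass of rho^eps is finite, so the inequality between [0,infinity]-valued quantities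
  can be rearranged. It compares T with time 0 and with no other time, which is the obstacle that
  \<open>X_one_increment\<close> overcomes.\<close>

lemma dissipation:
 assumes T: "T > 0"
 shows "L1_on (cyl T a b) (%(t, x). u t x * (uxx t x)^2)"
  and "(LBINT z:cyl T a b. (case z of (t, x) => u t x * (uxx t x)^2)) <= X (%x. 1) T - X (%x. 1) 0"
proof -
 let ?I = "\<integral>\<^sup>+z\<in>cyl T a b. ennreal (case z of (s, x) => u s x * (uxx s x)^2) \<partial>lborel"
 have "?I + ennreal (X (%x. 1) 0) <= ennreal (X (%x. 1) T)"
  using ent T unfolding entropy_inequality_def X_one by (simp add: case_prod_unfold)
 then have le: "?I <= ennreal (X (%x. 1) T - X (%x. 1) 0)"
 proof (cases ?I rule: ennreal_cases)
  case (real i)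
  have "ennreal (i + X (%x. 1) 0) <= ennreal (X (%x. 1) T)"
   using \<open>?I + ennreal (X (%x. 1) 0) <= ennreal (X (%x. 1) T)\<close> real X_one_bounds(1)[of 0]
   by (simp add: ennreal_plus)
  then have "i + X (%x. 1) 0 <= X (%x. 1) T"
   using X_one_bounds(1)[of T] T by (simp add: ennreal_le_iff)
  then show ?thesis using real by (simp add: ennreal_leI)
 next
  case top
  then show ?thesis using \<open>?I + ennreal (X (%x. 1) 0) <= ennreal (X (%x. 1) T)\<close> by (simp add: top_unique)
 qed
 have "ennreal (X (%x. 1) 0) <= ennreal (X (%x. 1) T)"
  using \<open>?I + ennreal (X (%x. 1) 0) <= ennreal (X (%x. 1) T)\<close> by (meson add_increasing order_trans zero_le order_refl)
 then have ge: "0 <= X (%x. 1) T - X (%x. 1) 0"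
  using X_one_bounds(1)[of T] T by (simp add: ennreal_le_iff)
 have m: "meas_on (cyl T a b) (%(t, x). u t x * (uxx t x)^2)"
  by (rule cyl_measurable[of "%z. U z * (UXX z)^2"]) (auto simp: U_eq)
 have nn: "0 <= (case z of (s, x) => u s x * (uxx s x)^2)" if "z \<in> cyl T a b" for z
  using that u_nonneg by (auto simp: cyl_def)
 note * = nn_set_integral_finite_imp_integrable[OF m nn le ge]
 show "L1_on (cyl T a b) (%(t, x). u t x * (uxx t x)^2)" by (rule *(1))
 show "(LBINT z:cyl T a b. (case z of (t, x) => u t x * (uxx t x)^2)) <= X (%x. 1) T - X (%x. 1) 0" by (rule *(2))
qed

lemma mobility_measurable [measurable]: "mobility n \<epsilon> \<in> borel_measurable borel"
 unfolding mobility_def[abs_def] by measurable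

lemma flux_dissipation:
 assumes T: "T > 0"
 shows "L1_on (cyl T a b) (%(t, x). L * mobility n \<epsilon> (u t x) * (uxxx t x)^2)"
  and "(LBINT z:cyl T a b. (case z of (t, x) => L * mobility n \<epsilon> (u t x) * (uxxx t x)^2)) <= E0 / 2"
proof -
 let ?I = "\<integral>\<^sup>+z\<in>cyl T a b. ennreal (case z of (s, x) => L * mobility n \<epsilon> (u s x) * (uxxx s x)^2) \<partial>lborel"
 have "(\<integral>\<^sup>+x\<in>{a<..<b}. ennreal ((ux T x)^2 / 2) \<partial>lborel) + ?I <= ennreal (E0 / 2)"
  using en T unfolding energy_inequality_def energy_rhs L_def by (simp add: case_prod_unfold)
 then have le: "?I <= ennreal (E0 / 2)" by (meson add_increasing order_trans zero_le order_refl)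
 have m: "meas_on (cyl T a b) (%(t, x). L * mobility n \<epsilon> (u t x) * (uxxx t x)^2)"
  by (rule cyl_measurable[of "%z. L * mobility n \<epsilon> (U z) * (UXXX z)^2"]) (auto simp: U_eq)
 have nn: "0 <= (case z of (s, x) => L * mobility n \<epsilon> (u s x) * (uxxx s x)^2)" if "z \<in> cyl T a b" for z
  using that u_nonneg mobility_nonneg[OF n _ eps(1)] L_pos by (auto simp: cyl_def)
 have e: "0 <= E0 / 2" using E0_nonneg by simp
 note * = nn_set_integral_finite_imp_integrable[OF m nn le e]
 show "L1_on (cyl T a b) (%(t, x). L * mobility n \<epsilon> (u t x) * (uxxx t x)^2)" by (rule *(1))
 show "(LBINT z:cyl T a b. (case z of (t, x) => L * mobility n \<epsilon> (u t x) * (uxxx t x)^2)) <= E0 / 2" by (rule *(2))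
qed

definition "TT \<phi> t = (LBINT x:{a<..<b}. T_eps u ux uxxx t x * \<phi> x)"

text \<open>The error of \<open>defect_lower_bound\<close>, with the slice quantities replaced by
  majorants that are constant or integrable in time.\<close>

definition "q \<delta> t = (E0 + Ad t) / (2 * sqrt (\<delta> * L)) + 5/6 * (sqrt \<delta> * (Dd t + 3 * E0)) + 3/2 * \<delta> * E0"

text \<open>The quantifiers over \<delta>, B and \<psi> stand inside, so that the exceptional null
  set of times depends on none of them.\<close>

definition good_time :: "real => bool" where
 "good_time t \<longleftrightarrow>
  TT (%x. 1) t = Dd t &
  (\<forall>\<delta> B \<psi>. \<delta> > 0 --> smooth \<psi> --> (\<forall>x\<in>{a<..<b}. 0 <= \<psi> x & \<bar>\<psi> x\<bar> <= B & \<bar>deriv \<psi> x\<bar> <= B & \<bar>deriv (deriv \<psi>) x\<bar> <= B) -->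
    - (B * q \<delta> t) <= TT \<psi> t) &
  (\<forall>\<delta>>0. 3 * \<delta> * (b - a) <= 1 -->
    ((\<exists>x\<in>{a..b}. u t x <= \<delta>) --> 9 * (1 - 3 * \<delta> * (b - a)) ^ 4 <= (measure lborel {x\<in>{a<..<b}. u t x > \<delta>}) ^ 6 * Dd t) &
    (u t a <= \<delta> --> u t b <= \<delta> --> 144 * (1 - 3 * \<delta> * (b - a)) ^ 4 <= (measure lborel {x\<in>{a<..<b}. u t x > \<delta>}) ^ 6 * Dd t))"

lemma AE_good_time:
 fixes T :: real
 assumes T: "T > 0"
 shows "AE t\<in>{0<..<T} in lborel. good_time t"
proof -
 have "AE t\<in>{0<..<T} in lborel. L1_on {a<..<b} (%x. u t x * (uxx t x)^2)"
  by (rule Fubini_rectangle(1)) (use dissipation(1)[OF T] in \<open>simp add: cyl_def\<close>)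
 moreover have "AE t\<in>{0<..<T} in lborel. L1_on {a<..<b} (%x. L * mobility n \<epsilon> (u t x) * (uxxx t x)^2)"
  by (rule Fubini_rectangle(1)) (use flux_dissipation(1)[OF T] in \<open>simp add: cyl_def\<close>)
 moreover have "AE t in lborel. t > 0 -->
    weak_deriv_on {x\<in>{a<..<b}. u t x > 0} (ux t) (uxx t) &
    weak_deriv_on {x\<in>{a<..<b}. u t x > 0} (uxx t) (uxxx t)"
  using sd by (simp add: spatial_derivs_def)
 moreover have "AE t in lborel. t > 0 -->
    (u t has_real_derivative 0) (at a within {a..b}) & (u t has_real_derivative 0) (at b within {a..b})"
  by (rule u_bdry)
 moreover have "AE t in lborel. t \<in> {0<..<T} -->
     (\<forall>\<phi>. smooth \<phi> -->
      (LBINT x:{a<..<b}. T_eps u ux uxxx t x * \<phi> x)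
      = (LBINT x:{a<..<b}. u t x * (uxx t x)^2 * \<phi> x)
       - 5/6 * (LBINT x:{a<..<b}. (ux t x) ^ 3 * deriv \<phi> x)
       - 1/2 * (LBINT x:{a<..<b}. u t x * (ux t x)^2 * deriv (deriv \<phi>) x))"
  using re T by (simp add: rho_equation_def)
 ultimately show ?thesis
 proof eventually_elim
  case (elim t)
  show ?case
  proof
   assume t: "t \<in> {0<..<T}"
   then have t0: "t > 0" "t >= 0" by auto
   have mu: "meas_on {a<..<b} (u t)"
    by (rule slice_measurable[of U t]) (use U_eq t0 in auto)
   have mux: "meas_on {a<..<b} (ux t)"
    by (rule slice_measurable[of UX t]) (use U_eq t0 in auto)
   have muxxx: "meas_on {a<..<b} (uxxx t)"
    by (rule slice_measurable[of UXXX t]) (use U_eq t0 in auto)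
   have m_ge: "(u t x) ^ 3 <= mobility n \<epsilon> (u t x)" for x by (simp add: mobility_def)
   have Aint: "L1_on {a<..<b} (%x. L * mobility n \<epsilon> (u t x) * (uxxx t x)^2)" using elim t by auto
   have A3: "L1_on {a<..<b} (%x. (u t x) ^ 3 * (uxxx t x)^2)"
   proof (rule set_integrable_bound[OF set_integrable_divide[OF Aint, of L]])
    show "meas_on {a<..<b} (%x. (u t x) ^ 3 * (uxxx t x)^2)"
     by (rule slice_measurable[of "%z. (U z) ^ 3 * (UXXX z)^2" t]) (use U_eq t0 in auto)
    show "AE x\<in>{a<..<b} in lborel. norm ((u t x) ^ 3 * (uxxx t x)^2) <= norm (L * mobility n \<epsilon> (u t x) * (uxxx t x)^2 / L)"
    proof (intro AE_I2 impI)
     fix x assume x: "x \<in> {a<..<b}"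
     then have "0 <= u t x" using u_nonneg t0 by auto
     then have "0 <= (u t x) ^ 3" by simp
     then show "norm ((u t x) ^ 3 * (uxxx t x)^2) <= norm (L * mobility n \<epsilon> (u t x) * (uxxx t x)^2 / L)"
      using m_ge[of x] L_pos by (simp add: abs_mult mult_right_mono)
    qed
   qed
   have wd1: "weak_deriv_on {a<..<b} (u t) (ux t)" using sd t0 by (simp add: spatial_derivs_def)
   obtain v V W Z where rs: "regular_slice a b v V W Z" and vu: "!!x. x \<in> {a..b} ==> v x = u t x"
    and VV: "AE x\<in>{a<..<b} in lborel. ux t x = V x"
    and WW: "AE x\<in>{a<..<b} in lborel. u t x > 0 --> uxx t x = W x"
    and ZZ: "AE x\<in>{a<..<b} in lborel. u t x > 0 --> uxxx t x = Z x"
   proof (rule weak_slice_regular[OF ab u_cont_slice[OF t0(2)] _ wd1 _ _ _ _ mux muxxx ux2(1)[OF t0(1)] _ A3])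
    show "0 <= u t x" if "x \<in> {a..b}" for x using u_nonneg t0 that by auto
   qed (use elim t that in auto)
   interpret rs: regular_slice a b v V W Z by (rule rs)
   have mv: "v \<in> borel_measurable borel" by (rule rs.u_meas)
   have muxx: "meas_on {a<..<b} (uxx t)"
    by (rule slice_measurable[of UXX t]) (use U_eq t0 in auto)
   have E_le: "rs.E <= E0"
   proof -
    have "rs.E = (LBINT x:{a<..<b}. (ux t x)^2)"
     unfolding rs.E_def
    proof (rule set_integral_cong_AE_integrable[OF rs.E_int ux2(1)[OF t0(1)]])
     show "AE x\<in>{a<..<b} in lborel. (V x)^2 = (ux t x)^2" using VV by eventually_elim auto
    qed
    then show ?thesis using ux2(2)[OF t0(1)] by simp
   qed
   have uW: "AE x\<in>{a<..<b} in lborel. v x * (W x)^2 = u t x * (uxx t x)^2"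
    using WW by eventually_elim (use vu u_nonneg[OF t0(2)] in \<open>force simp: less_le\<close>)
   have D_eq: "rs.D = Dd t"
    unfolding rs.D_def Dd_def
    by (rule set_integral_cong_AE_integrable[OF rs.D_int _ uW]) (use elim t in auto)
   have A_le: "L * rs.A3 <= Ad t"
   proof -
    have "rs.A3 = (LBINT x:{a<..<b}. (u t x) ^ 3 * (uxxx t x)^2)"
     unfolding rs.A3_def
    proof (rule set_integral_cong_AE_integrable[OF rs.A_int A3])
     show "AE x\<in>{a<..<b} in lborel. (v x) ^ 3 * (Z x)^2 = (u t x) ^ 3 * (uxxx t x)^2"
      using ZZ by eventually_elim (use vu u_nonneg[OF t0(2)] in \<open>force simp: less_le\<close>)
    qed
    then have "L * rs.A3 = (LBINT x:{a<..<b}. L * ((u t x) ^ 3 * (uxxx t x)^2))" by simp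
    also have "\<dots> <= Ad t"
     unfolding Ad_def
    proof (rule set_integral_mono[OF _ Aint])
     show "L1_on {a<..<b} (%x. L * ((u t x) ^ 3 * (uxxx t x)^2))" using A3 by simp
     show "L * ((u t x) ^ 3 * (uxxx t x)^2) <= L * mobility n \<epsilon> (u t x) * (uxxx t x)^2" for x
      using m_ge[of x] L_pos by (simp add: mult.assoc mult_left_mono mult_right_mono)
    qed
    finally show ?thesis .
   qed
   have mass: "(LBINT x:{a<..<b}. v x) = 1"
   proof -
    have "(LBINT x:{a<..<b}. v x) = (LBINT x:{a<..<b}. u t x)"
     by (rule set_lebesgue_integral_cong) (use vu in auto)
    then show ?thesis using u_mass[OF t0(2)] by simp
   qed
   have supp: "{x\<in>{a<..<b}. v x > \<delta>} = {x\<in>{a<..<b}. u t x > \<delta>}" for \<delta> using vu by auto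
   have TT_eq: "TT \<psi> t = (LBINT x:{a<..<b}. v x * (W x)^2 * \<psi> x) - 5/6 * (LBINT x:{a<..<b}. (V x) ^ 3 * deriv \<psi> x) - 1/2 * (LBINT x:{a<..<b}. v x * (V x)^2 * deriv (deriv \<psi>) x)"
    if \<psi>: "smooth \<psi>" for \<psi>
   proof -
    have p2: "(%z :: real \<times> real. g (snd z)) \<in> borel_measurable borel" if "g \<in> borel_measurable borel" for g :: "real => real"
     by (rule measurable_compose[OF _ that]) (intro borel_measurable_continuous_onI continuous_intros)
    have [measurable]: "\<psi> \<in> borel_measurable borel" "deriv \<psi> \<in> borel_measurable borel" "deriv (deriv \<psi>) \<in> borel_measurable borel"
     using \<psi> smooth_measurable smooth_deriv by auto
    note [measurable] = mv
    note [measurable] = p2[of \<psi>] p2[of "deriv \<psi>"] p2[of "deriv (deriv \<psi>)"]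
    have c: "(LBINT x:{a<..<b}. g x) = (LBINT x:{a<..<b}. h x)"
     if "h \<in> borel_measurable borel" "AE x\<in>{a<..<b} in lborel. g x = h x" "meas_on {a<..<b} g" for g h :: "real => real"
    proof (rule set_integral_cong_AE_measurable[OF that(3) _ that(2)])
     show "meas_on {a<..<b} h" unfolding set_borel_measurable_def using that(1) by measurable
    qed
    have 1: "(LBINT x:{a<..<b}. u t x * (uxx t x)^2 * \<psi> x) = (LBINT x:{a<..<b}. v x * (W x)^2 * \<psi> x)"
    proof (rule c)
     show "AE x\<in>{a<..<b} in lborel. u t x * (uxx t x)^2 * \<psi> x = v x * (W x)^2 * \<psi> x"
      using uW by eventually_elim auto
     show "meas_on {a<..<b} (%x. u t x * (uxx t x)^2 * \<psi> x)"
      by (rule slice_measurable[of "%z. U z * (UXX z)^2 * \<psi> (snd z)" t], measurable) (use U_eq t0 in auto)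
    qed measurable
    have 2: "(LBINT x:{a<..<b}. (ux t x) ^ 3 * deriv \<psi> x) = (LBINT x:{a<..<b}. (V x) ^ 3 * deriv \<psi> x)"
    proof (rule c)
     show "AE x\<in>{a<..<b} in lborel. (ux t x) ^ 3 * deriv \<psi> x = (V x) ^ 3 * deriv \<psi> x"
      using VV by eventually_elim auto
     show "meas_on {a<..<b} (%x. (ux t x) ^ 3 * deriv \<psi> x)"
      by (rule slice_measurable[of "%z. (UX z) ^ 3 * deriv \<psi> (snd z)" t], measurable) (use U_eq t0 in auto)
    qed measurable
    have 3: "(LBINT x:{a<..<b}. u t x * (ux t x)^2 * deriv (deriv \<psi>) x) = (LBINT x:{a<..<b}. v x * (V x)^2 * deriv (deriv \<psi>) x)"
    proof (rule c)
     show "AE x\<in>{a<..<b} in lborel. u t x * (ux t x)^2 * deriv (deriv \<psi>) x = v x * (V x)^2 * deriv (deriv \<psi>) x"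
      using VV by eventually_elim (use vu in auto)
     show "meas_on {a<..<b} (%x. u t x * (ux t x)^2 * deriv (deriv \<psi>) x)"
      by (rule slice_measurable[of "%z. U z * (UX z)^2 * deriv (deriv \<psi>) (snd z)" t], measurable) (use U_eq t0 in auto)
    qed measurable
    show ?thesis unfolding TT_def using elim t \<psi> by (simp add: 1 2 3)
   qed
   show "good_time t"
    unfolding good_time_def
   proof (intro conjI allI impI)
    have "deriv (%x::real. 1::real) = (%x. 0)" by auto
    then have "TT (%x. 1) t = (LBINT x:{a<..<b}. v x * (W x)^2)"
     unfolding TT_eq[OF smooth_const[of 1]] by simp
    then show "TT (%x. 1) t = Dd t" using D_eq by (simp add: rs.D_def)
   next
    fix \<delta> B :: real and \<psi> :: "real => real"
    assume \<delta>: "\<delta> > 0" and s: "smooth \<psi>" and bd: "\<forall>x\<in>{a<..<b}. 0 <= \<psi> x & \<bar>\<psi> x\<bar> <= B & \<bar>deriv \<psi> x\<bar> <= B & \<bar>deriv (deriv \<psi>) x\<bar> <= B"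
    have "(a + b) / 2 \<in> {a<..<b}" using ab by auto
    then have B: "B >= 0" using bd by (meson abs_ge_zero order_trans)
    have "- (B * ((rs.E + L * rs.A3) / (2 * sqrt (\<delta> * L)) + 5/6 * (sqrt \<delta> * (rs.D + 3 * rs.E)) + 3/2 * \<delta> * rs.E)) <= TT \<psi> t"
     unfolding TT_eq[OF s]
     by (rule rs.defect_lower_bound[OF \<delta> B L_pos smooth_has_deriv[OF s] smooth_has_deriv[OF smooth_deriv[OF s]]
        smooth_continuous[OF smooth_deriv[OF smooth_deriv[OF s]]]]) (use bd in blast)+
    moreover have "(rs.E + L * rs.A3) / (2 * sqrt (\<delta> * L)) + 5/6 * (sqrt \<delta> * (rs.D + 3 * rs.E)) + 3/2 * \<delta> * rs.E <= q \<delta> t"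
     unfolding q_def D_eq using E_le A_le \<delta> L_pos
     by (intro add_mono divide_right_mono mult_left_mono) auto
    ultimately show "- (B * q \<delta> t) <= TT \<psi> t" using mult_left_mono[OF _ B] by (smt (verit))
   next
    fix \<delta> :: real assume \<delta>: "\<delta> > 0" and sm: "3 * \<delta> * (b - a) <= 1" and ex: "\<exists>x\<in>{a..b}. u t x <= \<delta>"
    then obtain x0 where "x0 \<in> {a..b}" "v x0 <= \<delta>" using vu by auto
    from rs.dissipation_lower_bound(1)[OF \<delta> mass sm this, unfolded supp D_eq]
    show "9 * (1 - 3 * \<delta> * (b - a)) ^ 4 <= (measure lborel {x\<in>{a<..<b}. u t x > \<delta>}) ^ 6 * Dd t"
     .
   next
    fix \<delta> :: real assume \<delta>: "\<delta> > 0" and sm: "3 * \<delta> * (b - a) <= 1" and "u t a <= \<delta>" "u t b <= \<delta>"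
    then have "v a <= \<delta>" "v b <= \<delta>" using vu ab by auto
    from rs.dissipation_lower_bound(2)[OF \<delta> mass sm this, unfolded supp D_eq]
    show "144 * (1 - 3 * \<delta> * (b - a)) ^ 4 <= (measure lborel {x\<in>{a<..<b}. u t x > \<delta>}) ^ 6 * Dd t"
     .
   qed
  qed
 qed
qed

end

section \<open>The evolution of \<open>\<rho>\<close> at a fixed \<open>\<epsilon>\<close>\<close>

lemma tensor_test_fun2:
 assumes \<theta>: "\<theta> \<in> test_fun S" and \<phi>: "\<phi> \<in> test_fun S'"
 shows "(%t x. \<theta> t * \<phi> x) \<in> test_fun2 (S \<times> S')"
proof -
 have sm: "smooth ((deriv ^^ i) f)" if "smooth f" for f i using that by (induction i) (auto intro: smooth_deriv)
 have s: "smooth \<theta>" "smooth \<phi>" using \<theta> \<phi> by (auto simp: test_fun_def)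
 obtain K K' where K: "compact K" "K <= S" "!!x. x \<notin> K ==> \<theta> x = 0"
  and K': "compact K'" "K' <= S'" "!!x. x \<notin> K' ==> \<phi> x = 0" using \<theta> \<phi> by (auto simp: test_fun_def)
 have "smooth2 (%t x. \<theta> t * \<phi> x)"
 proof -
  define D where "D i j t x = (deriv ^^ i) \<theta> t * (deriv ^^ j) \<phi> x" for i j and t x :: real
  have D0: "D 0 0 = (%t x. \<theta> t * \<phi> x)" by (simp add: D_def fun_eq_iff)
  have Dc: "continuous_on UNIV (%(t, x). D i j t x)" for i j
   unfolding D_def case_prod_unfold
   by (intro continuous_on_mult continuous_on_compose2[OF smooth_continuous[OF sm, of _ UNIV]] s continuous_intros) auto
  have Dt: "((%s. D i j s x) has_real_derivative D (Suc i) j t x) (at t)" for i j t x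
   unfolding D_def using DERIV_cmult_right[OF smooth_has_deriv[OF sm[OF s(1), of i]]] by simp
  have Dx: "(D i j t has_real_derivative D i (Suc j) t x) (at x)" for i j t x
   unfolding D_def[abs_def] using DERIV_cmult[OF smooth_has_deriv[OF sm[OF s(2), of j]]] by simp
  show ?thesis unfolding smooth2_def using D0 Dc Dt Dx by blast
 qed
 moreover have "compact (K \<times> K')" using K K' by (intro compact_Times)
 ultimately show ?thesis unfolding test_fun2_def using K K' by (auto intro!: exI[of _ "K \<times> K'"])
qed

lemma dt_tensor: "smooth \<theta> ==> dt (%t x. \<theta> t * \<phi> x) t x = deriv \<theta> t * \<phi> x"
 unfolding dt_def by (intro DERIV_imp_deriv DERIV_cmult_right smooth_has_deriv)

lemma dx_tensor: "smooth \<phi> ==> dx (%t x. \<theta> t * \<phi> x) t x = \<theta> t * deriv \<phi> x"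
 unfolding dx_def by (intro DERIV_imp_deriv DERIV_cmult smooth_has_deriv)

lemma L2_L1_integrable:
 assumes f: "L2_L1 T a b f"
 shows "L1_on (cyl T a b) (%(t, x). f t x)"
proof -
 define F where "F z = indicator (cyl T a b) z *\<^sub>R (case z of (t, x) => f t x)" for z :: "real \<times> real"
 have Feq: "F (t, x) = indicator {0<..<T} t *\<^sub>R (indicator {a<..<b} x *\<^sub>R f t x)" for t x
  by (auto simp: F_def indicator_def cyl_def)
 have F: "F \<in> borel_measurable (lborel \<Otimes>\<^sub>M lborel)"
  using f unfolding L2_L1_def set_borel_measurable_def lborel_prod F_def[abs_def] by simp
 define v where "v t = (\<integral>x. norm (F (t, x)) \<partial>lborel)" for t
 have veq: "v t = indicator {0<..<T} t *\<^sub>R (LBINT x:{a<..<b}. \<bar>f t x\<bar>)" for t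
  unfolding v_def Feq set_lebesgue_integral_def by (simp add: abs_mult indicator_def)
 have vm: "v \<in> borel_measurable lborel"
  unfolding v_def[abs_def] using F by measurable
 have "integrable lborel v"
 proof (rule Bochner_Integration.integrable_bound[OF _ vm])
  show "integrable lborel (%t. indicator {0<..<T} t *\<^sub>R (1 :: real) + indicator {0<..<T} t *\<^sub>R (LBINT x:{a<..<b}. \<bar>f t x\<bar>)^2)"
   using f set_integrable_const_interval[of 0 T 1] by (intro Bochner_Integration.integrable_add) (auto simp: L2_L1_def set_integrable_def)
  have "\<bar>y\<bar> <= 1 + y^2" for y :: real
   using zero_le_power2[of "\<bar>y\<bar> - 1"] by (simp add: power2_diff)
  then show "AE t in lborel. norm (v t) <= norm (indicator {0<..<T} t *\<^sub>R (1 :: real) + indicator {0<..<T} t *\<^sub>R (LBINT x:{a<..<b}. \<bar>f t x\<bar>)^2)"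
   unfolding veq by (intro AE_I2) (auto simp: indicator_def)
 qed
 moreover have "AE t in lborel. integrable lborel (%x. F (t, x))"
 proof -
  have "AE t\<in>{0<..<T} in lborel. L1_on {a<..<b} (f t)" using f by (simp add: L2_L1_def)
  then show ?thesis by eventually_elim (auto simp: Feq set_integrable_def indicator_def split: if_splits)
 qed
 ultimately have "integrable (lborel \<Otimes>\<^sub>M lborel) F"
  using lborel_pair.Fubini_integrable[OF F] unfolding v_def by blast
 then show ?thesis unfolding set_integrable_def lborel_prod F_def .
qed

text \<open>The constant of \<open>R_eps_bound\<close>, fixed as a function of n alone, so that it
  is the same for all eps.\<close>

definition R_const :: "real => real" where
 "R_const n = (SOME C. C >= 0 & (\<forall>\<epsilon> M u uxxx t x. 0 < \<epsilon> --> \<epsilon> < 1 --> 0 <= u t x --> u t x <= M -->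
  \<bar>R_eps n \<epsilon> u uxxx t x\<bar> <= (\<bar>ln \<epsilon>\<bar> * mobility n \<epsilon> (u t x) * (uxxx t x)^2 + C + 2 * M) / (2 * sqrt \<bar>ln \<epsilon>\<bar>)))"

lemma R_const:
 assumes n: "0 < n" "n < 3"
 shows "R_const n >= 0"
  "0 < \<epsilon> ==> \<epsilon> < 1 ==> 0 <= u t x ==> u t x <= M ==>
  \<bar>R_eps n \<epsilon> u uxxx t x\<bar> <= (\<bar>ln \<epsilon>\<bar> * mobility n \<epsilon> (u t x) * (uxxx t x)^2 + R_const n + 2 * M) / (2 * sqrt \<bar>ln \<epsilon>\<bar>)"
proof -
 have ex: "\<exists>C. C >= 0 & (\<forall>\<epsilon> M u uxxx t x. 0 < \<epsilon> --> \<epsilon> < 1 --> 0 <= u t x --> u t x <= M -->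
  \<bar>R_eps n \<epsilon> u uxxx t x\<bar> <= (\<bar>ln \<epsilon>\<bar> * mobility n \<epsilon> (u t x) * (uxxx t x)^2 + C + 2 * M) / (2 * sqrt \<bar>ln \<epsilon>\<bar>))"
 proof (rule R_eps_bound[OF n])
  fix C :: real
  assume C: "C >= 0" and *: "!!\<epsilon> M u uxxx t x. 0 < \<epsilon> ==> \<epsilon> < 1 ==> 0 <= u t x ==> u t x <= M ==>
   \<bar>R_eps n \<epsilon> u uxxx t x\<bar> <= (\<bar>ln \<epsilon>\<bar> * mobility n \<epsilon> (u t x) * (uxxx t x)^2 + C + 2 * M) / (2 * sqrt \<bar>ln \<epsilon>\<bar>)"
  show ?thesis by (intro exI[of _ C] conjI allI impI C *)
 qed
 note * = someI_ex[OF ex, folded R_const_def]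
 show "R_const n >= 0" using * by (rule conjunct1)
 show "0 < \<epsilon> ==> \<epsilon> < 1 ==> 0 <= u t x ==> u t x <= M ==>
  \<bar>R_eps n \<epsilon> u uxxx t x\<bar> <= (\<bar>ln \<epsilon>\<bar> * mobility n \<epsilon> (u t x) * (uxxx t x)^2 + R_const n + 2 * M) / (2 * sqrt \<bar>ln \<epsilon>\<bar>)"
  using *[THEN conjunct2] by blast
qed

context film
begin

definition "LR \<phi> t = (LBINT x:{a<..<b}. R_eps n \<epsilon> u uxxx t x * deriv \<phi> x)"
definition "RA t = (LBINT x:{a<..<b}. \<bar>R_eps n \<epsilon> u uxxx t x\<bar>)"

lemma cyl_sets: "cyl T a b \<in> sets borel"
 unfolding cyl_def by (intro borel_open open_Times) auto

lemma cyl_const: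
 assumes T: "T > 0"
 shows "L1_on (cyl T a b) (%z. c :: real)" "(LBINT z:cyl T a b. c) = c * (T * (b - a))"
proof -
 have "L1_on ({0..T} \<times> {a..b}) (%z. c)"
  unfolding set_integrable_def by (rule borel_integrable_compact) (auto intro: compact_Times)
 then show i: "L1_on (cyl T a b) (%z. c)"
  by (rule set_integrable_subset) (use cyl_sets in \<open>auto simp: cyl_def\<close>)
 have "(LBINT z:cyl T a b. c) = (LBINT t:{0<..<T}. LBINT x:{a<..<b}. c)"
  using Fubini_rectangle(3)[of "{0<..<T}" "{a<..<b}" "%t x. c"] i by (simp add: cyl_def case_prod_unfold)
 then show "(LBINT z:cyl T a b. c) = c * (T * (b - a))"
  using LBINT_const_interval[of 0 T "(b - a) * c"] LBINT_const_interval[of a b c] ab T by simp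
qed

lemma rho_eq:
 fixes T :: real
 assumes "T > 0"
 shows "L2_L1 T a b (T_eps u ux uxxx)"
  and "compact K ==> K <= cyl T a b ==> L1_on K (%(t, x). R_eps n \<epsilon> u uxxx t x)"
  and "\<phi> \<in> test_fun2 (cyl T a b) ==>
   - (LBINT z:cyl T a b. (case z of (t, x) => B_eps n \<epsilon> (u t x) * dt \<phi> t x))
    = (LBINT z:cyl T a b. (case z of (t, x) => T_eps u ux uxxx t x * \<phi> t x))
     - (LBINT z:cyl T a b. (case z of (t, x) => R_eps n \<epsilon> u uxxx t x * dx \<phi> t x))"
 using re assms unfolding rho_equation_def by blast+

text \<open>\<open>R_eps\<close> contains \<open>deriv\<close> of B^eps at u; its measurability is
  read off from the local integrability in \<open>rho_equation\<close>, by exhausting the cylinder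
  with compact boxes.\<close>

lemma R_measurable:
 assumes T: "T > 0"
 shows "meas_on (cyl T a b) (%(t, x). R_eps n \<epsilon> u uxxx t x)"
proof -
 obtain c d where cd: "!!k. 0 < c k" "!!k. c k < d k" "!!k. d k < T"
  "!!x. x \<in> {0<..<T} ==> eventually (%k. x \<in> {c k..d k}) sequentially"
  by (rule interval_exhaustion[OF T], rule that)
 obtain c' d' where cd': "!!k. a < c' k" "!!k. c' k < d' k" "!!k. d' k < b"
  "!!x. x \<in> {a<..<b} ==> eventually (%k. x \<in> {c' k..d' k}) sequentially"
  by (rule interval_exhaustion[OF ab], rule that)
 define K where "K k = {c k..d k} \<times> {c' k..d' k}" for k
 have Ksub: "K k <= cyl T a b" for k
  using cd(1,3)[of k] cd'(1,3)[of k] by (auto simp: K_def cyl_def)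
 have "L1_on (K k) (%(t, x). R_eps n \<epsilon> u uxxx t x)" for k
  by (rule rho_eq(2)[OF T _ Ksub]) (simp add: K_def compact_Times)
 then have m: "(%z. indicator (K k) z *\<^sub>R (case z of (t, x) => R_eps n \<epsilon> u uxxx t x)) \<in> borel_measurable lborel" for k
  by (auto simp: set_integrable_def)
 show ?thesis
  unfolding set_borel_measurable_def
 proof (rule borel_measurable_LIMSEQ_real[OF _ m])
  fix z :: "real \<times> real"
  show "(%k. indicator (K k) z *\<^sub>R (case z of (t, x) => R_eps n \<epsilon> u uxxx t x)) ---->
   indicator (cyl T a b) z *\<^sub>R (case z of (t, x) => R_eps n \<epsilon> u uxxx t x)"
  proof (cases "z \<in> cyl T a b")
   case True
   then have "eventually (%k. fst z \<in> {c k..d k}) sequentially" "eventually (%k. snd z \<in> {c' k..d' k}) sequentially"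
    using cd(4) cd'(4) by (auto simp: cyl_def)
   then have "eventually (%k. indicator (K k) z *\<^sub>R (case z of (t, x) => R_eps n \<epsilon> u uxxx t x) =
     indicator (cyl T a b) z *\<^sub>R (case z of (t, x) => R_eps n \<epsilon> u uxxx t x)) sequentially"
    by eventually_elim (use True in \<open>auto simp: K_def mem_Times_iff indicator_def\<close>)
   then show ?thesis by (rule tendsto_eventually)
  next
   case False
   then have "z \<notin> K k" for k using Ksub by blast
   then show ?thesis using False by simp
  qed
 qed
qed

lemma R_integrable:
 assumes T: "T > 0"
 shows "L1_on (cyl T a b) (%(t, x). R_eps n \<epsilon> u uxxx t x)"
  and "(LBINT z:cyl T a b. \<bar>case z of (t, x) => R_eps n \<epsilon> u uxxx t x\<bar>) <= (E0 / 2 + (R_const n + 2 * M) * (T * (b - a))) / (2 * sqrt L)"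
proof -
 define G where "G z = ((case z of (t, x) => L * mobility n \<epsilon> (u t x) * (uxxx t x)^2) + (R_const n + 2 * M)) / (2 * sqrt L)" for z
 note Gi = set_integral_add[OF flux_dissipation(1)[OF T] cyl_const(1)[OF T, of "R_const n + 2 * M"]]
 have G: "L1_on (cyl T a b) G"
  unfolding G_def[abs_def] using set_integrable_divide[OF Gi(1), of "2 * sqrt L"] by simp
 have le: "\<bar>case z of (t, x) => R_eps n \<epsilon> u uxxx t x\<bar> <= G z" if z: "z \<in> cyl T a b" for z
 proof -
  obtain t x where tx: "z = (t, x)" "t > 0" "x \<in> {a<..<b}" using z by (auto simp: cyl_def)
  have "0 <= u t x" "u t x <= M" using u_nonneg[of t x] u_le_M[of t x] tx by auto
  from R_const(2)[where u=u and t=t and x=x, OF n eps this, of uxxx] show ?thesis unfolding G_def tx L_def by (simp add: add.assoc)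
 qed
 show i: "L1_on (cyl T a b) (%(t, x). R_eps n \<epsilon> u uxxx t x)"
 proof (rule set_integrable_bound[OF G R_measurable[OF T]])
  show "AE z\<in>cyl T a b in lborel. norm (case z of (t, x) => R_eps n \<epsilon> u uxxx t x) <= norm (G z)"
   using le by (intro AE_I2 impI) (fastforce intro: order_trans[OF _ abs_ge_self])
 qed
 have "(LBINT z:cyl T a b. \<bar>case z of (t, x) => R_eps n \<epsilon> u uxxx t x\<bar>) <= (LBINT z:cyl T a b. G z)"
  by (rule set_integral_mono[OF set_integrable_abs[OF i] G le])
 also have "\<dots> = ((LBINT z:cyl T a b. (case z of (t, x) => L * mobility n \<epsilon> (u t x) * (uxxx t x)^2)) + (R_const n + 2 * M) * (T * (b - a))) / (2 * sqrt L)"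
  unfolding G_def set_integral_divide_zero Gi(2) cyl_const(2)[OF T] ..
 also have "\<dots> <= (E0 / 2 + (R_const n + 2 * M) * (T * (b - a))) / (2 * sqrt L)"
  using flux_dissipation(2)[OF T] L_pos by (intro divide_right_mono add_right_mono) auto
 finally show "(LBINT z:cyl T a b. \<bar>case z of (t, x) => R_eps n \<epsilon> u uxxx t x\<bar>) <= (E0 / 2 + (R_const n + 2 * M) * (T * (b - a))) / (2 * sqrt L)" .
qed

lemma cyl_snd_measurable:
 fixes g :: "real => real"
 assumes "g \<in> borel_measurable borel"
 shows "meas_on (cyl T a b) (%(t, x). g x)"
proof (rule cyl_measurable[of "%z. g (snd z)"])
 show "(%z. g (snd z)) \<in> borel_measurable borel"
  by (rule measurable_compose[OF _ assms]) (intro borel_measurable_continuous_onI continuous_intros)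
qed auto

lemma cyl_fst_measurable:
 fixes g :: "real => real"
 assumes "g \<in> borel_measurable borel"
 shows "meas_on (cyl T a b) (%(t, x). g t)"
proof (rule cyl_measurable[of "%z. g (fst z)"])
 show "(%z. g (fst z)) \<in> borel_measurable borel"
  by (rule measurable_compose[OF _ assms]) (intro borel_measurable_continuous_onI continuous_intros)
qed auto

lemma cyl_mult_integrable:
 fixes f :: "real => real => real" and g :: "real => real"
 assumes f: "L1_on (cyl T a b) (%(t, x). f t x)"
  and g: "g \<in> borel_measurable borel" and B: "!!x. \<bar>g x\<bar> <= B"
 shows "L1_on (cyl T a b) (%(t, x). f t x * g x)"
  and "L1_on (cyl T a b) (%(t, x). f t x * g t)"
proof -
 have "L1_on (cyl T a b) (%z. (case z of (t, x) => f t x) * (case z of (t, x) => g x))"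
  by (rule set_integrable_bounded_mult[OF f cyl_snd_measurable[OF g], of B]) (use B in auto)
 then show "L1_on (cyl T a b) (%(t, x). f t x * g x)" by (simp add: case_prod_unfold)
 have "L1_on (cyl T a b) (%z. (case z of (t, x) => f t x) * (case z of (t, x) => g t))"
  by (rule set_integrable_bounded_mult[OF f cyl_fst_measurable[OF g], of B]) (use B in auto)
 then show "L1_on (cyl T a b) (%(t, x). f t x * g t)" by (simp add: case_prod_unfold)
qed

lemma T_integrable:
 fixes T :: real
 shows "T > 0 ==> L1_on (cyl T a b) (%(t, x). T_eps u ux uxxx t x)"
 by (intro L2_L1_integrable rho_eq(1))

lemma rho_cyl_integrable:
 assumes T: "T > 0"
 shows "L1_on (cyl T a b) (%(t, x). B_eps n \<epsilon> (u t x))"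
proof -
 have "L1_on ({0..T} \<times> {a..b}) (%(t, x). B_eps n \<epsilon> (u t x))"
  unfolding set_integrable_def
  by (rule borel_integrable_compact) (auto intro: compact_Times continuous_on_subset[OF rho_cont])
 then show ?thesis by (rule set_integrable_subset) (use cyl_sets in \<open>auto simp: cyl_def\<close>)
qed

text \<open>Products \<theta>(t) \<phi>(x) as test functions turn the distributional equation into
  one in time alone; after Fubini, \<open>TT\<close> carries the defect and \<open>LR\<close> the
  flux.\<close>

lemma X_weak_deriv:
 assumes T: "T > 0" and \<phi>: "\<phi> \<in> test_fun {a<..<b}"
 shows "weak_deriv_on {0<..<T} (X \<phi>) (%t. TT \<phi> t - LR \<phi> t)"
  and "L1_on {0<..<T} (TT \<phi>)" and "L1_on {0<..<T} (LR \<phi>)"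
proof -
 have s: "smooth \<phi>" "smooth (deriv \<phi>)" using \<phi> smooth_deriv by (auto simp: test_fun_def)
 obtain B where B: "!!x. \<bar>\<phi> x\<bar> <= B" "!!x. \<bar>deriv \<phi> x\<bar> <= B"
  by (rule test_fun_bounded[OF \<phi>], rule that)
 note m = smooth_measurable[OF s(1)] smooth_measurable[OF s(2)]
 have Ti: "L1_on (cyl T a b) (%(t, x). T_eps u ux uxxx t x * \<phi> x)"
  by (rule cyl_mult_integrable(1)[OF T_integrable[OF T] m(1) B(1)])
 have Ri: "L1_on (cyl T a b) (%(t, x). R_eps n \<epsilon> u uxxx t x * deriv \<phi> x)"
  by (rule cyl_mult_integrable(1)[OF R_integrable(1)[OF T] m(2) B(2)])
 have Xi: "L1_on (cyl T a b) (%(t, x). B_eps n \<epsilon> (u t x) * \<phi> x)"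
  by (rule cyl_mult_integrable(1)[OF rho_cyl_integrable[OF T] m(1) B(1)])
 show TTi: "L1_on {0<..<T} (TT \<phi>)"
  unfolding TT_def[abs_def] by (rule Fubini_rectangle(2)[OF Ti[unfolded cyl_def]])
 show LRi: "L1_on {0<..<T} (LR \<phi>)"
  unfolding LR_def[abs_def] by (rule Fubini_rectangle(2)[OF Ri[unfolded cyl_def]])
 have XXi: "L1_on {0<..<T} (X \<phi>)"
  unfolding X_def[abs_def] by (rule Fubini_rectangle(2)[OF Xi[unfolded cyl_def]])
 have tensor: "(LBINT z:cyl T a b. (case z of (t, x) => f t x * g t)) = (LBINT t:{0<..<T}. (LBINT x:{a<..<b}. f t x) * g t)"
  if "L1_on (cyl T a b) (%(t, x). f t x)" "smooth g" "!!t. \<bar>g t\<bar> <= C" for f g C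
  using Fubini_rectangle(3)[OF cyl_mult_integrable(2)[OF that(1) smooth_measurable[OF that(2)] that(3), unfolded cyl_def]]
  unfolding cyl_def by simp
 show "weak_deriv_on {0<..<T} (X \<phi>) (%t. TT \<phi> t - LR \<phi> t)"
  unfolding weak_deriv_on_def
 proof (intro conjI allI impI ballI)
  fix K :: "real set" assume K: "compact K" "K <= {0<..<T}"
  then have Ks: "K \<in> sets lborel" by (simp add: borel_compact)
  show "L1_on K (X \<phi>)" by (rule set_integrable_subset[OF XXi Ks K(2)])
  show "L1_on K (%t. TT \<phi> t - LR \<phi> t)"
   by (rule set_integrable_subset[OF set_integral_diff(1)[OF TTi LRi] Ks K(2)])
 next
  fix \<theta> assume \<theta>: "\<theta> \<in> test_fun {0<..<T}"
  have st: "smooth \<theta>" "smooth (deriv \<theta>)" using \<theta> smooth_deriv by (auto simp: test_fun_def)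
  obtain C where C: "!!x. \<bar>\<theta> x\<bar> <= C" "!!x. \<bar>deriv \<theta> x\<bar> <= C"
   by (rule test_fun_bounded[OF \<theta>], rule that)
  have mem: "(%t x. \<theta> t * \<phi> x) \<in> test_fun2 (cyl T a b)"
   unfolding cyl_def by (rule tensor_test_fun2[OF \<theta> \<phi>])
  have eq: "- (LBINT z:cyl T a b. (case z of (t, x) => B_eps n \<epsilon> (u t x) * (deriv \<theta> t * \<phi> x)))
     = (LBINT z:cyl T a b. (case z of (t, x) => T_eps u ux uxxx t x * (\<theta> t * \<phi> x)))
      - (LBINT z:cyl T a b. (case z of (t, x) => R_eps n \<epsilon> u uxxx t x * (\<theta> t * deriv \<phi> x)))"
   using rho_eq(3)[OF T mem] by (simp add: dt_tensor[OF st(1)] dx_tensor[OF s(1)])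
  have e1: "(LBINT z:cyl T a b. (case z of (t, x) => B_eps n \<epsilon> (u t x) * (deriv \<theta> t * \<phi> x))) = (LBINT t:{0<..<T}. X \<phi> t * deriv \<theta> t)"
   using tensor[OF Xi st(2) C(2)] by (simp add: X_def mult_ac)
  have e2: "(LBINT z:cyl T a b. (case z of (t, x) => T_eps u ux uxxx t x * (\<theta> t * \<phi> x))) = (LBINT t:{0<..<T}. TT \<phi> t * \<theta> t)"
   using tensor[OF Ti st(1) C(1)] by (simp add: TT_def mult_ac)
  have e3: "(LBINT z:cyl T a b. (case z of (t, x) => R_eps n \<epsilon> u uxxx t x * (\<theta> t * deriv \<phi> x))) = (LBINT t:{0<..<T}. LR \<phi> t * \<theta> t)"
   using tensor[OF Ri st(1) C(1)] by (simp add: LR_def mult_ac)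
  have th: "meas_on {0<..<T} \<theta>"
   unfolding set_borel_measurable_def using smooth_measurable[OF st(1)] by measurable
  have i: "L1_on {0<..<T} (%t. TT \<phi> t * \<theta> t)" "L1_on {0<..<T} (%t. LR \<phi> t * \<theta> t)"
   by (rule set_integrable_bounded_mult[OF TTi th C(1)] set_integrable_bounded_mult[OF LRi th C(1)])+
  show "(LBINT t:{0<..<T}. X \<phi> t * deriv \<theta> t) = - (LBINT t:{0<..<T}. (TT \<phi> t - LR \<phi> t) * \<theta> t)"
   using eq unfolding e1 e2 e3 left_diff_distrib set_integral_diff(2)[OF i] by simp
 qed
qed

text \<open>\<open>X \<phi>\<close> is continuous, so it equals its absolutely continuous
  representative at every positive time up to t. Integrability of the derivative on (0, t+1) and
  continuity at 0 admit s = 0.\<close>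

lemma X_increment:
 assumes st: "0 <= s" "s < t" and \<phi>: "\<phi> \<in> test_fun {a<..<b}"
 shows "X \<phi> t - X \<phi> s = (LBINT \<sigma>:{s<..<t}. TT \<phi> \<sigma>) - (LBINT \<sigma>:{s<..<t}. LR \<phi> \<sigma>)"
proof -
 have T: "t + 1 > 0" using st by simp
 note W = X_weak_deriv[OF T \<phi>]
 have \<phi>c: "continuous_on {a..b} \<phi>" using \<phi> by (intro smooth_continuous) (simp add: test_fun_def)
 obtain F where F: "prim_on {0<..<t+1} F (%t. TT \<phi> t - LR \<phi> t)" "AE x\<in>{0<..<t+1} in lborel. X \<phi> x = F x"
  by (rule weak_deriv_on_prim[OF _ W(1)]) simp
 have "X \<phi> x = F x" if "x \<in> {0<..<t+1}" for x
  by (rule continuous_AE_eq_imp_eq[OF _ _ prim_on_continuous[OF F(1)] F(2) that])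
   (auto intro: continuous_on_subset[OF X_cont[OF \<phi>c]])
 then have P: "prim_on {0<..<t+1} (X \<phi>) (%t. TT \<phi> t - LR \<phi> t)"
  by (intro prim_on_cong[OF F(1)]) simp_all
 have sub: "{s<..<t} <= {0<..<t+1}" using st by auto
 have i: "L1_on {s<..<t} (TT \<phi>)" "L1_on {s<..<t} (LR \<phi>)"
  by (rule set_integrable_subset[OF W(2) _ sub] set_integrable_subset[OF W(3) _ sub], simp)+
 have c: "continuous_on {s..t} (X \<phi>)" by (rule continuous_on_subset[OF X_cont[OF \<phi>c]]) (use st in auto)
 have "(LBINT \<sigma>:{s<..<t}. TT \<phi> \<sigma> - LR \<phi> \<sigma>) = X \<phi> t - X \<phi> s"
 proof (rule prim_on_open_interval_limits[OF st(2) prim_on_subset[OF P sub] set_integral_diff(1)[OF i]])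
  show "(X \<phi> \<longlongrightarrow> X \<phi> s) (at_right s)" "(X \<phi> \<longlongrightarrow> X \<phi> t) (at_left t)"
   using c st(2) by (auto simp: continuous_on_Icc_at_rightD continuous_on_Icc_at_leftD)
 qed
 then show ?thesis using set_integral_diff(2)[OF i] by simp
qed

text \<open>L^(-1/4) is the common rate at the level \<delta> = 1/sqrt(L): there 1/sqrt(\<delta> L)
  and sqrt(\<delta>) both equal \<open>w\<close>, while \<delta> and the flux error are of order
  w^2. \<open>K0\<close> collects the coefficients and does not depend on eps.\<close>

definition "w = 1 / sqrt (sqrt L)"
definition "K0 T = (E0 * T + E0 / 2) / 2 + 5/6 * ((1 + B_fun n 1 + ln M) * (b - a) + 3 * E0 * T) + 3/2 * E0 * T
 + (E0 / 2 + (R_const n + 2 * M) * (T * (b - a))) / 2"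

lemma P_le:
 assumes L1: "L >= 1"
 shows "P <= 1 + B_fun n 1 + ln M"
proof -
 have "0 <= B_fun n 1 + ln M" using M_ge_1 B_fun_nonneg[OF n] by simp
 then have "(B_fun n 1 + ln M) / L <= B_fun n 1 + ln M" using L1 mult_left_mono[of 1 L "B_fun n 1 + ln M"] by (simp add: divide_le_eq)
 then show ?thesis unfolding P_def by simp
qed

lemma dissipation_bound:
 assumes T: "T > 0"
 shows "L1_on {0<..<T} Dd" "(LBINT t:{0<..<T}. Dd t) <= X (%x. 1) T - X (%x. 1) 0"
  "L1_on {0<..<T} Ad" "(LBINT t:{0<..<T}. Ad t) <= E0 / 2"
  "L1_on {0<..<T} RA" "(LBINT t:{0<..<T}. RA t) <= (E0 / 2 + (R_const n + 2 * M) * (T * (b - a))) / (2 * sqrt L)"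
proof -
 note f = dissipation[OF T, unfolded cyl_def] and g = flux_dissipation[OF T, unfolded cyl_def]
 have r: "L1_on ({0<..<T} \<times> {a<..<b}) (%(t, x). \<bar>R_eps n \<epsilon> u uxxx t x\<bar>)"
  using set_integrable_abs[OF R_integrable(1)[OF T, unfolded cyl_def]] by (simp add: case_prod_unfold)
 show "L1_on {0<..<T} Dd" "L1_on {0<..<T} Ad" "L1_on {0<..<T} RA"
  using Fubini_rectangle(2)[OF f(1)] Fubini_rectangle(2)[OF g(1)] Fubini_rectangle(2)[OF r]
  unfolding Dd_def Ad_def RA_def by auto
 show "(LBINT t:{0<..<T}. Dd t) <= X (%x. 1) T - X (%x. 1) 0" "(LBINT t:{0<..<T}. Ad t) <= E0 / 2"
  using Fubini_rectangle(3)[OF f(1)] Fubini_rectangle(3)[OF g(1)] f(2) g(2)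
  unfolding Dd_def Ad_def by auto
 show "(LBINT t:{0<..<T}. RA t) <= (E0 / 2 + (R_const n + 2 * M) * (T * (b - a))) / (2 * sqrt L)"
  using Fubini_rectangle(3)[OF r] R_integrable(2)[OF T, unfolded cyl_def] unfolding RA_def by (simp add: case_prod_unfold)
qed

lemma RA_nonneg: "0 <= RA t" unfolding RA_def by (rule set_integral_nonneg_pointwise) simp

lemma Dd_nonneg: "0 <= t ==> 0 <= Dd t"
 unfolding Dd_def using u_nonneg by (intro set_integral_nonneg_pointwise) auto

lemma Ad_nonneg: "0 <= t ==> 0 <= Ad t"
 unfolding Ad_def using u_nonneg mobility_nonneg[OF n _ eps(1)] L_pos by (intro set_integral_nonneg_pointwise) auto

lemma q_nonneg: "0 <= t ==> \<delta> > 0 ==> 0 <= q \<delta> t"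
 unfolding q_def using Dd_nonneg[of t] Ad_nonneg[of t] E0_nonneg L_pos by simp

lemma q_integrable:
 assumes T: "T > 0"
 shows "L1_on {0<..<T} (q \<delta>)"
  "(LBINT t:{0<..<T}. q \<delta> t) = (E0 * T + (LBINT t:{0<..<T}. Ad t)) / (2 * sqrt (\<delta> * L)) + 5/6 * (sqrt \<delta> * ((LBINT t:{0<..<T}. Dd t) + 3 * E0 * T)) + 3/2 * \<delta> * E0 * T"
proof -
 note c = set_integrable_const_interval[of 0 T] and d = dissipation_bound[OF T]
 have lc: "(LBINT t:{0<..<T}. c) = T * c" for c :: real using LBINT_const_interval[of 0 T c] T by simp
 have 1: "L1_on {0<..<T} (%t. (E0 + Ad t) / (2 * sqrt (\<delta> * L)))"
  by (intro set_integrable_divide set_integral_add c d)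
 have 2: "L1_on {0<..<T} (%t. 5/6 * (sqrt \<delta> * (Dd t + 3 * E0)))"
  by (intro set_integrable_mult_right set_integral_add c d)
 show "L1_on {0<..<T} (q \<delta>)"
  unfolding q_def[abs_def] by (intro set_integral_add 1 2 c)
 show "(LBINT t:{0<..<T}. q \<delta> t) = (E0 * T + (LBINT t:{0<..<T}. Ad t)) / (2 * sqrt (\<delta> * L)) + 5/6 * (sqrt \<delta> * ((LBINT t:{0<..<T}. Dd t) + 3 * E0 * T)) + 3/2 * \<delta> * E0 * T"
  unfolding q_def set_integral_add(2)[OF set_integral_add(1)[OF 1 2] c] set_integral_add(2)[OF 1 2] set_integral_divide_zero
   set_integral_mult_right set_integral_add(2)[OF c d(3)] set_integral_add(2)[OF d(1) c] lc by (simp add: mult_ac)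
qed

lemma error_bound:
 assumes T: "T > 0" and L1: "L >= 1"
 shows "(LBINT t:{0<..<T}. q (1 / sqrt L) t) + (LBINT t:{0<..<T}. RA t) <= K0 T * w"
proof -
 define s where "s = sqrt L"
 have s: "s >= 1" "s > 0" using L1 by (auto simp: s_def)
 have Ls: "L = s * s" using L1 by (simp add: s_def)
 have w: "w = 1 / sqrt s" "sqrt (1 / s) = w" "w * w = 1 / s" "0 < w" "w <= 1"
  unfolding w_def s_def[symmetric] using s by (auto simp: real_sqrt_divide)
 have sw: "1 / s <= w" using w(3) w(4,5) mult_left_mono[of w 1 w] by simp
 have r: "sqrt (1 / s * L) = sqrt s" unfolding Ls using s by simp
 have D: "(LBINT t:{0<..<T}. Dd t) <= (1 + B_fun n 1 + ln M) * (b - a)"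
 proof -
  have "(LBINT t:{0<..<T}. Dd t) <= P * (b - a)"
   using dissipation_bound(2)[OF T] X_one_bounds(2)[of T] X_one_bounds(1)[of 0] T by simp
  also have "\<dots> <= (1 + B_fun n 1 + ln M) * (b - a)" using P_le[OF L1] ab by (intro mult_right_mono) auto
  finally show ?thesis .
 qed
 have "(E0 * T + (LBINT t:{0<..<T}. Ad t)) / (2 * sqrt s) <= (E0 * T + E0 / 2) / (2 * sqrt s)"
  using dissipation_bound(4)[OF T] s by (intro divide_right_mono) auto
 also have "\<dots> = (E0 * T + E0 / 2) / 2 * w" using w(1) by simp
 finally have 1: "(E0 * T + (LBINT t:{0<..<T}. Ad t)) / (2 * sqrt s) <= (E0 * T + E0 / 2) / 2 * w" .
 have 2: "5/6 * (w * ((LBINT t:{0<..<T}. Dd t) + 3 * E0 * T)) <= 5/6 * (w * ((1 + B_fun n 1 + ln M) * (b - a) + 3 * E0 * T))"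
  using D w by (intro mult_left_mono) auto
 have 3: "3/2 * (1 / s) * E0 * T <= 3/2 * w * E0 * T"
  using sw E0_nonneg T by (intro mult_right_mono mult_left_mono) auto
 have nn: "0 <= (E0 / 2 + (R_const n + 2 * M) * (T * (b - a))) / 2"
  using E0_nonneg R_const(1)[OF n] M_ge_1 T ab by simp
 have "(LBINT t:{0<..<T}. RA t) <= (E0 / 2 + (R_const n + 2 * M) * (T * (b - a))) / 2 * (1 / s)"
  using dissipation_bound(6)[OF T] by (simp add: s_def mult_ac)
 also have "\<dots> <= (E0 / 2 + (R_const n + 2 * M) * (T * (b - a))) / 2 * w"
  by (rule mult_left_mono[OF sw nn])
 finally have 4: "(LBINT t:{0<..<T}. RA t) <= (E0 / 2 + (R_const n + 2 * M) * (T * (b - a))) / 2 * w" .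
 have "(LBINT t:{0<..<T}. q (1 / sqrt L) t) = (E0 * T + (LBINT t:{0<..<T}. Ad t)) / (2 * sqrt s)
   + 5/6 * (w * ((LBINT t:{0<..<T}. Dd t) + 3 * E0 * T)) + 3/2 * (1 / s) * E0 * T"
  unfolding q_integrable(2)[OF T] s_def[symmetric] r w(2) ..
 moreover have "K0 T * w = (E0 * T + E0 / 2) / 2 * w + 5/6 * (w * ((1 + B_fun n 1 + ln M) * (b - a) + 3 * E0 * T))
   + 3/2 * w * E0 * T + (E0 / 2 + (R_const n + 2 * M) * (T * (b - a))) / 2 * w"
  unfolding K0_def by (simp add: algebra_simps)
 ultimately show ?thesis using 1 2 3 4 by linarith
qed

lemma AE_slice_integrable:
 assumes T: "T > 0"
 shows "AE t\<in>{0<..<T} in lborel. L1_on {a<..<b} (%x. T_eps u ux uxxx t x) &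
  L1_on {a<..<b} (%x. R_eps n \<epsilon> u uxxx t x)"
 using Fubini_rectangle(1)[OF T_integrable[OF T, unfolded cyl_def]]
  Fubini_rectangle(1)[OF R_integrable(1)[OF T, unfolded cyl_def]]
 by eventually_elim auto

lemma LR_bound:
 assumes T: "T > 0" and \<phi>: "\<phi> \<in> test_fun {a<..<b}" and B: "!!x. \<bar>deriv \<phi> x\<bar> <= B"
  and S: "S <= {0<..<T}" "S \<in> sets lborel"
 shows "\<bar>LBINT t:S. LR \<phi> t\<bar> <= B * (LBINT t:{0<..<T}. RA t)"
proof -
 have s: "smooth (deriv \<phi>)" using \<phi> smooth_deriv by (auto simp: test_fun_def)
 have B0: "B >= 0" using B[of 0] by linarith
 note i = set_integrable_subset[OF X_weak_deriv(3)[OF T \<phi>] S(2,1)] and r = dissipation_bound(5)[OF T]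
 have "AE t\<in>{0<..<T} in lborel. \<bar>LR \<phi> t\<bar> <= B * RA t"
  using AE_slice_integrable[OF T]
 proof eventually_elim
  case (elim t)
  show ?case
  proof
   assume t: "t \<in> {0<..<T}"
   have dm: "meas_on {a<..<b} (deriv \<phi>)"
    unfolding set_borel_measurable_def using smooth_measurable[OF s] by measurable
   have R: "L1_on {a<..<b} (%x. R_eps n \<epsilon> u uxxx t x)" using elim t by auto
   have "\<bar>LR \<phi> t\<bar> <= (LBINT x:{a<..<b}. \<bar>R_eps n \<epsilon> u uxxx t x * deriv \<phi> x\<bar>)"
    unfolding LR_def by (rule set_integral_abs_le[OF set_integrable_bounded_mult[OF R dm B]])
   also have "\<dots> <= (LBINT x:{a<..<b}. B * \<bar>R_eps n \<epsilon> u uxxx t x\<bar>)"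
   proof (rule set_integral_mono)
    show "\<bar>R_eps n \<epsilon> u uxxx t x * deriv \<phi> x\<bar> <= B * \<bar>R_eps n \<epsilon> u uxxx t x\<bar>" for x
     using B[of x] by (simp add: abs_mult mult.commute[of B] mult_left_mono)
   qed (use set_integrable_abs[OF set_integrable_bounded_mult[OF R dm B]] set_integrable_abs[OF R] in auto)
   finally show "\<bar>LR \<phi> t\<bar> <= B * RA t" by (simp add: RA_def)
  qed
 qed
 then have ae: "AE t in lborel. indicator S t *\<^sub>R \<bar>LR \<phi> t\<bar> <= indicator {0<..<T} t *\<^sub>R (B * RA t)"
  by eventually_elim (use S B0 RA_nonneg in \<open>auto simp: indicator_def\<close>)
 have "\<bar>LBINT t:S. LR \<phi> t\<bar> <= (LBINT t:S. \<bar>LR \<phi> t\<bar>)" by (rule set_integral_abs_le[OF i])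
 also have "\<dots> <= (LBINT t:{0<..<T}. B * RA t)"
  unfolding set_lebesgue_integral_def
  by (rule integral_mono_AE[OF _ _ ae]) (use set_integrable_abs[OF i] set_integrable_mult_right[of B, OF r] in \<open>auto simp: set_integrable_def\<close>)
 finally show ?thesis by simp
qed

lemma set_integral_lower_bound:
 fixes f g :: "real => real"
 assumes T: "T > 0" and f: "L1_on {0<..<T} f" and S: "S <= {0<..<T}" "S \<in> sets lborel"
  and ae: "AE t\<in>{0<..<T} in lborel. - (B * q \<delta> t) <= f t" and B: "B >= 0" and \<delta>: "\<delta> > 0"
 shows "(LBINT t:S. f t) >= - (B * (LBINT t:{0<..<T}. q \<delta> t))"
proof -
 have "(LBINT t:{0<..<T}. - (B * q \<delta> t)) <= (LBINT t:S. f t)"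
  unfolding set_lebesgue_integral_def
 proof (rule integral_mono_AE)
  show "AE t in lborel. indicator {0<..<T} t *\<^sub>R - (B * q \<delta> t) <= indicator S t *\<^sub>R f t"
   using ae
  proof eventually_elim
   case (elim t)
   have "t \<in> {0<..<T} ==> 0 <= B * q \<delta> t" using B q_nonneg[of t \<delta>] \<delta> by simp
   then show ?case using elim S by (auto simp: indicator_def)
  qed
  show "integrable lborel (%t. indicator {0<..<T} t *\<^sub>R - (B * q \<delta> t))"
   using set_integrable_mult_right[of "-B", OF q_integrable(1)[OF T]] by (simp add: set_integrable_def)
  show "integrable lborel (%t. indicator S t *\<^sub>R f t)"
   using set_integrable_subset[OF f S(2,1)] by (simp add: set_integrable_def)
 qed
 moreover have "(LBINT t:{0<..<T}. - (B * q \<delta> t)) = - (B * (LBINT t:{0<..<T}. q \<delta> t))"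
  using set_integral_mult_right[of lborel "{0<..<T}" "- B" "q \<delta>"] by (simp add: set_lebesgue_integral_def)
 ultimately show ?thesis by simp
qed

text \<open>The lower bound of \<open>TT \<phi>\<close> for \<phi> >= 0, integrated at \<delta> =
  1/sqrt(L), and the flux bound \<open>LR_bound\<close> are the two parts of
  \<open>error_bound\<close>. The test function enters the error only through the bound B.\<close>

lemma X_almost_increasing:
 assumes L1: "L >= 1" and st: "0 <= s" "s <= t" "t <= T" and \<phi>: "\<phi> \<in> test_fun {a<..<b}" and \<phi>0: "!!x. 0 <= \<phi> x"
  and B: "!!x. \<bar>\<phi> x\<bar> <= B" "!!x. \<bar>deriv \<phi> x\<bar> <= B" "!!x. \<bar>deriv (deriv \<phi>) x\<bar> <= B"
 shows "X \<phi> t - X \<phi> s >= - (B * (K0 T * w))"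
proof (cases "s = t")
 case True
 have "0 <= K0 T * w"
 proof (cases "T = 0")
  case True
  have "0 <= (1 + B_fun n 1 + ln M) * (b - a)" using M_ge_1 B_fun_nonneg[OF n, of 1] ab by simp
  then show ?thesis using True E0_nonneg L_pos by (simp add: K0_def w_def)
 next
  case False
  then have T: "T > 0" using st by simp
  have "0 <= (LBINT t:{0<..<T}. q (1 / sqrt L) t)" "0 <= (LBINT t:{0<..<T}. RA t)"
   using q_nonneg L_pos RA_nonneg by (auto intro!: set_integral_nonneg_pointwise)
  then show ?thesis using error_bound[OF T L1] by linarith
 qed
 moreover have "0 <= B" using B(1)[of 0] by linarith
 ultimately show ?thesis using True by simp
next
 case False
 then have T: "T > 0" and lt: "s < t" using st by auto
 have B0: "B >= 0" using B(1)[of 0] by linarith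
 have sub: "{s<..<t} <= {0<..<T}" using st by auto
 have sm: "smooth \<phi>" using \<phi> by (simp add: test_fun_def)
 have ae: "AE t\<in>{0<..<T} in lborel. - (B * q (1 / sqrt L) t) <= TT \<phi> t"
  using AE_good_time[OF T]
 proof eventually_elim
  case (elim t)
  then show ?case using sm B \<phi>0 L_pos unfolding good_time_def by auto
 qed
 have "(LBINT \<sigma>:{s<..<t}. TT \<phi> \<sigma>) >= - (B * (LBINT t:{0<..<T}. q (1 / sqrt L) t))"
  by (rule set_integral_lower_bound[OF T X_weak_deriv(2)[OF T \<phi>] sub _ ae B0]) (use L_pos in auto)
 moreover have "\<bar>LBINT t:{s<..<t}. LR \<phi> t\<bar> <= B * (LBINT t:{0<..<T}. RA t)"
  by (rule LR_bound[OF T \<phi> B(2) sub]) simp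
 moreover have "B * ((LBINT t:{0<..<T}. q (1 / sqrt L) t) + (LBINT t:{0<..<T}. RA t)) <= B * (K0 T * w)"
  by (rule mult_left_mono[OF error_bound[OF T L1] B0])
 ultimately show ?thesis unfolding X_increment[OF st(1) lt \<phi>] distrib_left by linarith
qed

text \<open>The constant 1 has no compact support in the interval, so the equation cannot be tested
  with it. With \<psi> = 1 - \<phi>, \<open>Dd - TT \<phi>\<close> is <T^eps, \<psi>> and hence at
  least -B q; so its integral over (s,t) is at most that over (0,T) up to an error. By the entropy
  inequality and the equation for \<phi>, the latter is at most
  \<open>X \<psi> T - X \<psi> 0\<close> plus a flux term. Since 0 <= \<open>X \<psi>\<close> <= P
  int \<psi>, the loss is small when \<phi> is close to 1.\<close>

lemma X_one_increment:
 assumes L1: "L >= 1" and st: "0 <= s" "s < t" "t <= T" and \<phi>: "\<phi> \<in> test_fun {a<..<b}" and \<phi>0: "!!x. 0 <= \<phi> x" "!!x. \<phi> x <= 1"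
  and B: "B >= 1" "!!x. \<bar>deriv \<phi> x\<bar> <= B" "!!x. \<bar>deriv (deriv \<phi>) x\<bar> <= B"
 shows "X (%x. 1) t - X (%x. 1) s >= (LBINT \<sigma>:{s<..<t}. Dd \<sigma>) - 2 * (P * (LBINT x:{a<..<b}. 1 - \<phi> x)) - 2 * (B * (K0 T * w))"
proof -
 have T: "T > 0" using st by auto
 have sub: "{s<..<t} <= {0<..<T}" using st by auto
 have sm: "smooth \<phi>" using \<phi> by (simp add: test_fun_def)
 have \<phi>c: "continuous_on {a..b} \<phi>" by (rule smooth_continuous[OF sm])
 define \<psi> where "\<psi> x = 1 - \<phi> x" for x
 have s\<psi>: "smooth \<psi>" unfolding \<psi>_def[abs_def] by (intro smooth_diff smooth_const sm)
 have d1: "deriv \<psi> = (%x. - deriv \<phi> x)"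
  unfolding \<psi>_def by (rule ext, rule DERIV_imp_deriv) (auto intro!: derivative_eq_intros smooth_has_deriv[OF sm])
 have d2: "deriv (deriv \<psi>) = (%x. - deriv (deriv \<phi>) x)"
  unfolding d1 by (rule ext, rule DERIV_imp_deriv, rule DERIV_minus, rule smooth_has_deriv[OF smooth_deriv[OF sm]])
 have B0: "B >= 0" using B(1) by simp
 let ?q = "q (1 / sqrt L)"
 have Nae: "AE t\<in>{0<..<T} in lborel. - (B * ?q t) <= Dd t - TT \<phi> t"
  using AE_good_time[OF T] AE_slice_integrable[OF T]
 proof eventually_elim
  case (elim t)
  show ?case
  proof
   assume t: "t \<in> {0<..<T}"
   have Ti: "L1_on {a<..<b} (%x. T_eps u ux uxxx t x)" using elim t by auto
   have pm: "meas_on {a<..<b} \<phi>"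
    unfolding set_borel_measurable_def using smooth_measurable[OF sm] by measurable
   have T\<phi>: "L1_on {a<..<b} (%x. T_eps u ux uxxx t x * \<phi> x)"
    by (rule set_integrable_bounded_mult[OF Ti pm, of 1]) (use \<phi>0 in \<open>auto simp: abs_le_iff intro: order_trans[of _ 0]\<close>)
   have g: "good_time t" using elim t by auto
   have "TT \<psi> t = TT (%x. 1) t - TT \<phi> t"
    using set_integral_diff(2)[OF Ti T\<phi>] by (simp add: TT_def \<psi>_def right_diff_distrib)
   moreover have "TT (%x. 1) t = Dd t" using g by (simp add: good_time_def)
   moreover have "- (B * ?q t) <= TT \<psi> t"
   proof -
    have "\<bar>\<psi> x\<bar> <= B" "0 <= \<psi> x" for x using \<phi>0[of x] B(1) by (auto simp: \<psi>_def)
    then have "\<forall>x\<in>{a<..<b}. 0 <= \<psi> x & \<bar>\<psi> x\<bar> <= B & \<bar>deriv \<psi> x\<bar> <= B & \<bar>deriv (deriv \<psi>) x\<bar> <= B"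
     unfolding d2 unfolding d1 using B by simp
    moreover have "1 / sqrt L > 0" using L_pos by simp
    ultimately show ?thesis using g s\<psi> unfolding good_time_def by blast
   qed
   ultimately show "- (B * ?q t) <= Dd t - TT \<phi> t" by simp
  qed
 qed
 note W = X_weak_deriv[OF T \<phi>] and db = dissipation_bound[OF T]
 have Ni: "L1_on {0<..<T} (%t. Dd t - TT \<phi> t)" by (rule set_integral_diff(1)[OF db(1) W(2)])
 have comp: "X (%x. 1) \<sigma> - X \<phi> \<sigma> = X \<psi> \<sigma>" "0 <= X \<psi> \<sigma>" "X \<psi> \<sigma> <= P * (LBINT x:{a<..<b}. \<psi> x)" if \<sigma>: "\<sigma> >= 0" for \<sigma>
 proof -
  note i = rho_slice_integrable[OF \<sigma> continuous_on_const[of "{a..b}" 1]] rho_slice_integrable[OF \<sigma> \<phi>c]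
  show "X (%x. 1) \<sigma> - X \<phi> \<sigma> = X \<psi> \<sigma>"
   unfolding X_def set_integral_diff(2)[OF i, symmetric] by (simp add: \<psi>_def right_diff_distrib)
  have nn: "0 <= \<psi> x" for x using \<phi>0[of x] by (simp add: \<psi>_def)
  show "0 <= X \<psi> \<sigma>" unfolding X_def using nn rho_bounds(1)[OF \<sigma>] by (intro set_integral_nonneg_pointwise mult_nonneg_nonneg) auto
  have \<psi>c: "continuous_on {a..b} \<psi>" by (rule smooth_continuous[OF s\<psi>])
  have "X \<psi> \<sigma> <= (LBINT x:{a<..<b}. P * \<psi> x)"
   unfolding X_def
  proof (rule set_integral_mono[OF rho_slice_integrable[OF \<sigma> \<psi>c]])
   show "L1_on {a<..<b} (%x. P * \<psi> x)"
    by (rule set_integrable_subset[OF borel_integrable_atLeastAtMost'[of a b]]) (auto intro!: continuous_intros \<psi>c)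
   show "B_eps n \<epsilon> (u \<sigma> x) * \<psi> x <= P * \<psi> x" if "x \<in> {a<..<b}" for x
    using rho_bounds(2)[OF \<sigma>, of x] nn[of x] that by (intro mult_right_mono) auto
  qed
  then show "X \<psi> \<sigma> <= P * (LBINT x:{a<..<b}. \<psi> x)" by simp
 qed
 have i: "L1_on {s<..<t} Dd" "L1_on {s<..<t} (TT \<phi>)"
  by (rule set_integrable_subset[OF db(1) _ sub] set_integrable_subset[OF W(2) _ sub], simp)+
 have C1: "{0<..<T} - {s<..<t} <= {0<..<T}" and C2: "{0<..<T} - {s<..<t} \<in> sets lborel" by auto
 have un: "{s<..<t} \<union> ({0<..<T} - {s<..<t}) = {0<..<T}" using sub by auto
 have "(LBINT t:{0<..<T}. Dd t - TT \<phi> t) = (LBINT t:{s<..<t}. Dd t - TT \<phi> t) + (LBINT t:{0<..<T} - {s<..<t}. Dd t - TT \<phi> t)"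
  using set_integral_Un[of "{s<..<t}" "{0<..<T} - {s<..<t}" lborel "%t. Dd t - TT \<phi> t"]
   set_integrable_subset[OF Ni _ sub] set_integrable_subset[OF Ni C2 C1] unfolding un by auto
 moreover have "(LBINT t:{0<..<T} - {s<..<t}. Dd t - TT \<phi> t) >= - (B * (LBINT t:{0<..<T}. ?q t))"
  by (rule set_integral_lower_bound[OF T Ni C1 C2 Nae B0]) (use L_pos in auto)
 moreover have "(LBINT t:{0<..<T}. Dd t - TT \<phi> t) = (LBINT t:{0<..<T}. Dd t) - (LBINT t:{0<..<T}. TT \<phi> t)"
  by (rule set_integral_diff(2)[OF db(1) W(2)])
 moreover have "X \<phi> T - X \<phi> 0 = (LBINT t:{0<..<T}. TT \<phi> t) - (LBINT t:{0<..<T}. LR \<phi> t)"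
  by (rule X_increment[OF order_refl T \<phi>])
 moreover have "\<bar>LBINT t:{0<..<T}. LR \<phi> t\<bar> <= B * (LBINT t:{0<..<T}. RA t)"
  by (rule LR_bound[OF T \<phi> B(2)]) auto
 moreover have "\<bar>LBINT t:{s<..<t}. LR \<phi> t\<bar> <= B * (LBINT t:{0<..<T}. RA t)"
  by (rule LR_bound[OF T \<phi> B(2) sub]) simp
 moreover have "X \<phi> t - X \<phi> s = (LBINT \<sigma>:{s<..<t}. TT \<phi> \<sigma>) - (LBINT \<sigma>:{s<..<t}. LR \<phi> \<sigma>)"
  by (rule X_increment[OF st(1,2) \<phi>])
 moreover have "(LBINT t:{s<..<t}. Dd t - TT \<phi> t) = (LBINT t:{s<..<t}. Dd t) - (LBINT t:{s<..<t}. TT \<phi> t)"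
  by (rule set_integral_diff(2)[OF i])
 moreover have "B * ((LBINT t:{0<..<T}. ?q t) + (LBINT t:{0<..<T}. RA t)) <= B * (K0 T * w)"
  by (rule mult_left_mono[OF error_bound[OF T L1] B0])
 moreover have "0 <= B * (LBINT t:{0<..<T}. ?q t)"
  using B0 q_nonneg L_pos by (intro mult_nonneg_nonneg set_integral_nonneg_pointwise) auto
 ultimately show ?thesis
  using comp[of s] comp[of t] comp[of 0] comp[of T] db(2) st T unfolding \<psi>_def[symmetric] distrib_left by linarith
qed

end

section \<open>The negative norm\<close>

lemma norm_Wm11_bounds:
 fixes f :: "real => real"
 assumes f: "L1_on {a<..<b} f"
 shows "\<phi> \<in> test_fun {a<..<b} ==> (!!x. \<bar>\<phi> x\<bar> <= 1) ==> (!!x. \<bar>deriv \<phi> x\<bar> <= 1) ==>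
   \<bar>LBINT x:{a<..<b}. f x * \<phi> x\<bar> <= norm_Wm11 a b f"
  and "0 <= norm_Wm11 a b f" and "norm_Wm11 a b f <= (LBINT x:{a<..<b}. \<bar>f x\<bar>)"
proof -
 define S where "S = {\<phi> \<in> test_fun {a<..<b}. \<forall>x. \<bar>\<phi> x\<bar> <= 1 & \<bar>deriv \<phi> x\<bar> <= 1}"
 have le: "\<bar>LBINT x:{a<..<b}. f x * \<phi> x\<bar> <= (LBINT x:{a<..<b}. \<bar>f x\<bar>)" if "\<phi> \<in> S" for \<phi>
 proof -
  have \<phi>: "smooth \<phi>" "!!x. \<bar>\<phi> x\<bar> <= 1" using that by (auto simp: S_def test_fun_def)
  have m: "meas_on {a<..<b} \<phi>"
   unfolding set_borel_measurable_def using smooth_measurable[OF \<phi>(1)] by measurable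
  note i = set_integrable_bounded_mult[OF f m \<phi>(2)]
  have "\<bar>LBINT x:{a<..<b}. f x * \<phi> x\<bar> <= (LBINT x:{a<..<b}. \<bar>f x * \<phi> x\<bar>)" by (rule set_integral_abs_le[OF i])
  also have "\<dots> <= (LBINT x:{a<..<b}. \<bar>f x\<bar>)"
   by (rule set_integral_mono[OF set_integrable_abs[OF i] set_integrable_abs[OF f]])
    (use \<phi>(2) in \<open>auto simp: abs_mult intro: mult_left_le\<close>)
  finally show ?thesis .
 qed
 have bdd: "bdd_above ((%\<phi>. \<bar>LBINT x:{a<..<b}. f x * \<phi> x\<bar>) ` S)" by (rule bdd_aboveI2[OF le])
 have "deriv (%x::real. 0::real) = (%x. 0)" by auto
 then have z: "(%x. 0) \<in> S" unfolding S_def test_fun_def using smooth_const[of 0] by auto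
 have eq: "norm_Wm11 a b f = (SUP \<phi>\<in>S. \<bar>LBINT x:{a<..<b}. f x * \<phi> x\<bar>)" by (simp add: norm_Wm11_def S_def)
 show "\<bar>LBINT x:{a<..<b}. f x * \<phi> x\<bar> <= norm_Wm11 a b f"
  if "\<phi> \<in> test_fun {a<..<b}" "!!x. \<bar>\<phi> x\<bar> <= 1" "!!x. \<bar>deriv \<phi> x\<bar> <= 1" for \<phi>
  unfolding eq by (rule cSUP_upper[OF _ bdd]) (use that in \<open>auto simp: S_def\<close>)
 show "0 <= norm_Wm11 a b f" unfolding eq using cSUP_upper[OF z bdd] by simp
 show "norm_Wm11 a b f <= (LBINT x:{a<..<b}. \<bar>f x\<bar>)"
  unfolding eq by (rule cSUP_least[OF _ le]) (use z in auto)
qed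

text \<open>Reduces convergence in L^p to convergence in L^1 pointwise in time, so that the negative
  norm enters only through monotonicity of the [0,infinity]-valued integral. Above \<eta> the
  inequality is x = x^(1-p) x^p <= \<eta>^(1-p) x^p.\<close>

lemma powr_interpolation:
 fixes x p \<eta> :: real
 assumes "0 <= x" "1 <= p" "0 < \<eta>"
 shows "x <= \<eta> + \<eta> powr (1 - p) * x powr p"
proof (cases "x <= \<eta>")
 case True
 have "0 <= \<eta> powr (1 - p) * x powr p" by simp
 then show ?thesis using True by linarith
next
 case False
 then have x: "x > 0" using assms by simp
 have "x = x powr (1 - p) * x powr p" using x by (simp add: powr_add[symmetric])
 also have "\<dots> <= \<eta> powr (1 - p) * x powr p"
  by (rule mult_right_mono[OF powr_mono2']) (use False assms in auto)
 finally show ?thesis using assms by linarith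
qed

lemma LBINT_bounds_const:
 fixes f :: "real => real"
 assumes "L1_on {s<..<q} f" "s <= q"
 shows "(!!t. t \<in> {s<..<q} ==> f t <= c) ==> (LBINT t:{s<..<q}. f t) <= (q - s) * c"
  and "(!!t. t \<in> {s<..<q} ==> c <= f t) ==> (q - s) * c <= (LBINT t:{s<..<q}. f t)"
 using set_integral_mono[OF assms(1) set_integrable_const_interval, of c]
  set_integral_mono[OF set_integrable_const_interval assms(1), of c] LBINT_const_interval[OF assms(2), of c] by auto

lemma set_integrable_bounded_interval:
 fixes f :: "real => real"
 assumes "meas_on {s<..<q} f" "!!t. t \<in> {s<..<q} ==> \<bar>f t\<bar> <= c"
 shows "L1_on {s<..<q} f"
 using set_integrable_bounded_mult[OF set_integrable_const_interval[of s q 1] assms] by simp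

section \<open>Passing to the limit\<close>

text \<open>What the limit passage uses: bounds on v, moments that increase in time up to o(1), L^1
  convergence of the initial values and convergence in the negative norm. The thin film equation
  itself no longer appears.\<close>

locale rho_limit =
 fixes a b T p :: real and v :: "nat => real => real => real" and P :: "nat => real"
  and \<rho> :: "real => real => real" and r0 :: "real => real" and X :: "nat => (real => real) => real => real"
 assumes ab: "a < b" and T: "0 < T" and p: "1 <= p"
  and X_def: "!!k \<phi> t. X k \<phi> t = (LBINT x:{a<..<b}. v k t x * \<phi> x)"
  and v_cont: "!!k. continuous_on ({0..} \<times> {a..b}) (%(t, x). v k t x)"
  and v_bounds: "!!k t x. 0 <= t ==> x \<in> {a..b} ==> 0 <= v k t x & v k t x <= P k"
  and P: "P ----> 1"
  and inc: "!!\<phi> \<eta>. \<phi> \<in> test_fun {a<..<b} ==> (!!x. 0 <= \<phi> x) ==> 0 < \<eta> ==>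
   EV k. \<forall>s t. 0 <= s --> s <= t --> t <= T --> X k \<phi> s - \<eta> <= X k \<phi> t"
  and inc_one: "!!\<eta>. 0 < \<eta> ==>
   EV k. \<forall>s t. 0 <= s --> s <= t --> t <= T --> X k (%x. 1) s - \<eta> <= X k (%x. 1) t"
  and conv: "tendsto_Lp_Wm11 p T a b v \<rho>"
  and rho_meas: "meas_on (cyl T a b) (%(t, x). \<rho> t x)"
  and rho_bounds: "AE z\<in>cyl T a b in lborel. (case z of (t, x) => 0 <= \<rho> t x & \<rho> t x <= 1)"
  and r0: "r0 \<in> borel_measurable borel" "!!x. 0 <= r0 x" "!!x. r0 x <= 1"
  and init: "(%k. LBINT x:{a<..<b}. \<bar>v k 0 x - r0 x\<bar>) ----> 0"
begin

text \<open>The clamping makes all slices and window averages measurable and bounded without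
  exceptional sets; on the cylinder it changes \<rho> on a null set only.\<close>

definition "rr z = indicator (cyl T a b) z * max 0 (min 1 (indicator (cyl T a b) z *\<^sub>R (case z of (t, x) => \<rho> t x)))"

lemma rr_measurable [measurable]: "rr \<in> borel_measurable borel"
proof -
 have "cyl T a b \<in> sets borel" unfolding cyl_def by (intro borel_open open_Times) auto
 then show ?thesis unfolding rr_def[abs_def] using rho_meas unfolding set_borel_measurable_def by measurable
qed

lemma rr_bounds: "0 <= rr z" "rr z <= 1" by (auto simp: rr_def indicator_def)

lemma rr_eq: "AE z\<in>cyl T a b in lborel. rr z = (case z of (t, x) => \<rho> t x)"
 using rho_bounds by eventually_elim (auto simp: rr_def)

lemma rr_pair_measurable [measurable]:
 "(%x. rr (t, x)) \<in> borel_measurable borel" "(%t. rr (t, x)) \<in> borel_measurable borel"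
 by (rule measurable_compose[OF _ rr_measurable], intro borel_measurable_continuous_onI continuous_intros)+

definition "J s q x = (LBINT t:{s<..<q}. rr (t, x))"
definition "A s q x = J s q x / (q - s)"
definition "Y \<phi> t = (LBINT x:{a<..<b}. rr (t, x) * \<phi> x)"
definition "win = {(s, q). s \<in> \<rat> & q \<in> \<rat> & 0 <= s & s < (q :: real)}"
text \<open>Rational windows keep the supremum countable, hence jointly measurable in t and x. Only
  windows that end strictly before t count, which makes r increasing and left-continuous on t > 0
  for every x and not just for almost every one.\<close>

definition "r t x = (if t <= 0 then r0 x else (SUP i\<in>win. (if snd i < t then A (fst i) (snd i) x else 0)))"

lemma rr_slice_integrable: "L1_on {s<..<q} (%t. rr (t, x))" "L1_on {c<..<d} (%x. rr (t, x))"
 by (rule set_integrable_bounded_interval[of _ _ _ 1]; use rr_bounds in \<open>auto simp: set_borel_measurable_def\<close>)+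

lemma J_bounds: "s <= q ==> 0 <= J s q x" "s <= q ==> J s q x <= q - s"
 using LBINT_bounds_const[OF rr_slice_integrable(1)[of s q x]] rr_bounds unfolding J_def by (metis mult_zero_right, metis mult.right_neutral)

lemma A_bounds: "s < q ==> 0 <= A s q x" "s < q ==> A s q x <= 1"
 using J_bounds[of s q x] by (auto simp: A_def)

lemma J_measurable [measurable]: "J s q \<in> borel_measurable borel"
proof -
 have "(%(x, t). indicator {s<..<q} t *\<^sub>R rr (t, x)) \<in> borel_measurable (lborel \<Otimes>\<^sub>M lborel)"
 proof -
  have "(%z :: real \<times> real. rr (snd z, fst z)) \<in> borel_measurable borel"
   by (rule measurable_compose[OF _ rr_measurable]) (intro borel_measurable_continuous_onI continuous_intros)
  then have 1: "(%z :: real \<times> real. rr (snd z, fst z)) \<in> borel_measurable (lborel \<Otimes>\<^sub>M lborel)"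
   unfolding lborel_prod by simp
  show ?thesis unfolding case_prod_unfold by (intro borel_measurable_scaleR 1) measurable
 qed
 from lborel.borel_measurable_lebesgue_integral[OF this]
 show ?thesis unfolding J_def[abs_def] set_lebesgue_integral_def by simp
qed

lemma A_measurable [measurable]: "A s q \<in> borel_measurable borel"
 unfolding A_def[abs_def] by measurable

lemma Y_measurable:
 assumes [measurable]: "\<phi> \<in> borel_measurable borel"
 shows "Y \<phi> \<in> borel_measurable borel"
proof -
 have "(%(t, x). indicator {a<..<b} x *\<^sub>R (rr (t, x) * \<phi> x)) \<in> borel_measurable (lborel \<Otimes>\<^sub>M lborel)"
 proof -
  have 1: "(%z. rr z) \<in> borel_measurable (lborel \<Otimes>\<^sub>M lborel)"
   unfolding lborel_prod by simp
  show ?thesis unfolding case_prod_unfold using 1 by measurable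
 qed
 from lborel.borel_measurable_lebesgue_integral[OF this]
 show ?thesis unfolding Y_def[abs_def] set_lebesgue_integral_def by simp
qed

lemma slice_integrable:
 fixes f \<phi> :: "real => real"
 assumes "\<phi> \<in> borel_measurable borel" "!!x. \<bar>\<phi> x\<bar> <= B"
  and "f \<in> borel_measurable borel" "!!x. 0 <= f x" "!!x. f x <= 1"
 shows "L1_on {c<..<d} (%x. f x * \<phi> x)"
proof (rule set_integrable_bounded_interval)
 show "meas_on {c<..<d} (%x. f x * \<phi> x)" using assms(1,3) by (auto simp: set_borel_measurable_def)
 show "\<bar>f x * \<phi> x\<bar> <= 1 * B" for x
  unfolding abs_mult by (rule mult_mono) (use assms in \<open>auto simp: abs_le_iff intro: order_trans[of _ 0]\<close>)
qed

lemma Y_bound: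
 assumes "\<phi> \<in> borel_measurable borel" "!!x. \<bar>\<phi> x\<bar> <= B"
 shows "\<bar>Y \<phi> t\<bar> <= (b - a) * B"
proof -
 have i: "L1_on {a<..<b} (%x. rr (t, x) * \<phi> x)"
  by (rule slice_integrable[OF assms]) (use rr_bounds in auto)
 have "\<bar>rr (t, x) * \<phi> x\<bar> <= 1 * B" for x
  unfolding abs_mult by (rule mult_mono) (use assms rr_bounds in auto)
 then have "(LBINT x:{a<..<b}. \<bar>rr (t, x) * \<phi> x\<bar>) <= (b - a) * B"
  by (intro LBINT_bounds_const(1)[OF set_integrable_abs[OF i]]) (use ab in auto)
 then show ?thesis unfolding Y_def using set_integral_abs_le[OF i] by linarith
qed

lemma Y_integrable:
 assumes "\<phi> \<in> borel_measurable borel" "!!x. \<bar>\<phi> x\<bar> <= B"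
 shows "L1_on {s<..<q} (Y \<phi>)"
 by (rule set_integrable_bounded_interval[OF _ Y_bound[OF assms]]) (use Y_measurable[OF assms(1)] in \<open>auto simp: set_borel_measurable_def\<close>)

lemma J_Y:
 assumes \<phi>: "\<phi> \<in> borel_measurable borel" "!!x. \<bar>\<phi> x\<bar> <= B"
 shows "(LBINT x:{a<..<b}. J s q x * \<phi> x) = (LBINT t:{s<..<q}. Y \<phi> t)"
proof -
 define f where "f t x = indicator {s<..<q} t * indicator {a<..<b} x * (rr (t, x) * \<phi> x)" for t x :: real
 have m: "(%z. rr z) \<in> borel_measurable (lborel \<Otimes>\<^sub>M lborel)" unfolding lborel_prod by simp
 have fm: "case_prod f \<in> borel_measurable (lborel \<Otimes>\<^sub>M lborel)"
  unfolding f_def[abs_def] case_prod_unfold using m \<phi>(1) by measurable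
 have B0: "0 <= B" using \<phi>(2)[of 0] by linarith
 have "integrable (lborel \<Otimes>\<^sub>M lborel) (%z :: real \<times> real. indicator ({s<..<q} \<times> {a<..<b}) z *\<^sub>R B)"
 proof -
  have "L1_on ({s..q} \<times> {a..b}) (%z. B)"
   unfolding set_integrable_def by (rule borel_integrable_compact) (auto intro: compact_Times)
  then have "L1_on ({s<..<q} \<times> {a<..<b}) (%z. B)"
   by (rule set_integrable_subset) (auto intro!: borel_open open_Times)
  then show ?thesis unfolding set_integrable_def lborel_prod .
 qed
 then have fi: "integrable (lborel \<Otimes>\<^sub>M lborel) (case_prod f)"
 proof (rule Bochner_Integration.integrable_bound[OF _ fm])
  show "AE z in lborel \<Otimes>\<^sub>M lborel. norm (case_prod f z) <= norm (indicator ({s<..<q} \<times> {a<..<b}) z *\<^sub>R B)"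
  proof (rule AE_I2)
   fix z :: "real \<times> real"
   have "\<bar>rr z * \<phi> (snd z)\<bar> <= 1 * B"
    unfolding abs_mult by (rule mult_mono) (use \<phi> rr_bounds in auto)
   then show "norm (case_prod f z) <= norm (indicator ({s<..<q} \<times> {a<..<b}) z *\<^sub>R B)"
    using B0 by (cases z) (auto simp: f_def indicator_def)
  qed
 qed
 have "(\<integral>x. (\<integral>t. f t x \<partial>lborel) \<partial>lborel) = (\<integral>t. (\<integral>x. f t x \<partial>lborel) \<partial>lborel)"
  by (rule lborel_pair.Fubini_integral[OF fi])
 moreover have "(\<integral>t. f t x \<partial>lborel) = indicator {a<..<b} x *\<^sub>R (J s q x * \<phi> x)" for x
  unfolding J_def set_lebesgue_integral_def f_def
  by (subst mult.commute) (simp add: ac_simps flip: integral_mult_right_zero)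
 moreover have "(\<integral>x. f t x \<partial>lborel) = indicator {s<..<q} t *\<^sub>R Y \<phi> t" for t
  unfolding Y_def set_lebesgue_integral_def f_def by (simp add: mult.assoc)
 ultimately show ?thesis by (simp add: set_lebesgue_integral_def)
qed

lemma v_slice:
 assumes "0 <= t"
 shows "continuous_on {a..b} (v k t)"
proof -
 have "continuous_on {a..b} (%x. (t, x))" "(%x. (t, x)) ` {a..b} <= {0..} \<times> {a..b}"
  using assms by (auto intro!: continuous_intros)
 from continuous_on_compose2[OF v_cont this] show ?thesis by simp
qed

lemma v_integrable:
 assumes "0 <= t" "continuous_on {a..b} \<phi>"
 shows "L1_on {a<..<b} (%x. v k t x * \<phi> x)"
 by (rule set_integrable_subset[OF borel_integrable_atLeastAtMost'[of a b]])
  (auto intro!: continuous_intros v_slice assms)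

lemma X_continuous:
 assumes \<phi>: "continuous_on {a..b} \<phi>"
 shows "continuous_on {0..} (X k \<phi>)"
proof -
 have "continuous_on ({0..} \<times> {a..b}) (%z. \<phi> (snd z))"
  by (rule continuous_on_compose2[OF \<phi>]) (auto intro!: continuous_intros)
 then have "continuous_on ({0..} \<times> {a..b}) (%z. (case z of (t, x) => v k t x) * \<phi> (snd z))"
  by (intro continuous_intros v_cont)
 then have "continuous_on ({0..} \<times> {a..b}) (%(t, x). v k t x * \<phi> x)"
  by (simp add: case_prod_unfold)
 then show ?thesis unfolding X_def[abs_def] by (rule continuous_on_LBINT_param)
qed

lemma X_integrable:
 assumes "continuous_on {a..b} \<phi>" "0 <= s"
 shows "L1_on {s<..<q} (X k \<phi>)"
 by (rule set_integrable_subset[OF borel_integrable_atLeastAtMost'[of s q]])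
  (use assms(2) in \<open>auto intro!: continuous_on_subset[OF X_continuous[OF assms(1)]]\<close>)

text \<open>\<phi>/B is a competitor in the negative norm, so \<open>X k \<phi> t\<close> and
  \<open>Y \<phi> t\<close> differ by at most B times that norm for almost every t. Convergence
  follows for time integrals; no single time is controlled.\<close>

lemma X_tendsto:
 assumes \<phi>: "\<phi> \<in> test_fun {a<..<b}" and s: "0 <= s" "s <= q" "q <= T"
 shows "(%k. LBINT t:{s<..<q}. X k \<phi> t) ----> (LBINT t:{s<..<q}. Y \<phi> t)"
proof -
 have sm: "smooth \<phi>" using \<phi> by (simp add: test_fun_def)
 obtain B where B: "!!x. \<bar>\<phi> x\<bar> <= B" "!!x. \<bar>deriv \<phi> x\<bar> <= B" "B > 0"
  by (rule test_fun_bounded[OF \<phi>], rule that)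
 note m = smooth_measurable[OF sm] and c = smooth_continuous[OF sm, of "{a..b}"]
 define N where "N k t = norm_Wm11 a b (%x. v k t x - \<rho> t x)" for k t
 define Z where "Z k t = X k \<phi> t - Y \<phi> t" for k t
 have Zi: "L1_on {0<..<T} (Z k)" for k
  unfolding Z_def[abs_def] by (rule set_integral_diff(1)[OF X_integrable[OF c order_refl] Y_integrable[OF m B(1)]])
 have slice: "AE t\<in>{0<..<T} in lborel. (AE x\<in>{a<..<b} in lborel. rr (t, x) = \<rho> t x) & meas_on {a<..<b} (\<rho> t)"
 proof -
  have "AE z in lborel \<Otimes>\<^sub>M lborel. z \<in> cyl T a b --> rr z = (case z of (t, x) => \<rho> t x)"
   using rr_eq unfolding lborel_prod .
  from lborel_pair.AE_pair[OF this]
  have *: "AE t in lborel. AE x in lborel. (t, x) \<in> cyl T a b --> rr (t, x) = \<rho> t x" by simp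
  have ms: "meas_on {a<..<b} (\<rho> t)" if t: "t \<in> {0<..<T}" for t
  proof -
   have "(%x. (t, x)) \<in> borel_measurable borel"
    by (intro borel_measurable_continuous_onI continuous_intros)
   from measurable_compose[OF this, of "%z. indicator (cyl T a b) z *\<^sub>R (case z of (t, x) => \<rho> t x)" borel]
   have "(%x. indicator (cyl T a b) (t, x) *\<^sub>R \<rho> t x) \<in> borel_measurable borel"
    using rho_meas by (simp add: set_borel_measurable_def)
   moreover have "indicator (cyl T a b) (t, x) = (indicator {a<..<b} x :: real)" for x
    using t by (auto simp: cyl_def indicator_def)
   ultimately show ?thesis by (simp add: set_borel_measurable_def)
  qed
  show ?thesis
   using *
  proof eventually_elim
   case (elim t)
   have "AE x\<in>{a<..<b} in lborel. rr (t, x) = \<rho> t x" if t: "t \<in> {0<..<T}"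
    using elim by eventually_elim (use t in \<open>auto simp: cyl_def\<close>)
   then show ?case using ms by blast
  qed
 qed
 have ZN: "AE t\<in>{0<..<T} in lborel. \<bar>Z k t\<bar> <= B * N k t" for k
  using slice
 proof eventually_elim
  case (elim t)
  show ?case
  proof
   assume t: "t \<in> {0<..<T}"
   then have t0: "0 <= t" by simp
   have ae: "AE x\<in>{a<..<b} in lborel. rr (t, x) = \<rho> t x" and ms: "meas_on {a<..<b} (\<rho> t)"
    using elim t by auto
   have \<rho>i: "L1_on {a<..<b} (\<rho> t)"
    by (rule set_integrable_cong_AE_imp[OF rr_slice_integrable(2)[of a b t] ms]) (use ae in eventually_elim, auto)
   have v1: "L1_on {a<..<b} (v k t)" using v_integrable[OF t0 continuous_on_const[of _ 1]] by simp
   have fi: "L1_on {a<..<b} (%x. v k t x - \<rho> t x)" by (rule set_integral_diff(1)[OF v1 \<rho>i])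
   have pm: "meas_on {a<..<b} \<phi>" using m by (auto simp: set_borel_measurable_def)
   note i = set_integrable_bounded_mult[OF v1 pm B(1)] set_integrable_bounded_mult[OF \<rho>i pm B(1)]
   have Yeq: "Y \<phi> t = (LBINT x:{a<..<b}. \<rho> t x * \<phi> x)"
    unfolding Y_def
   proof (rule set_integral_cong_AE_integrable[OF _ i(2)])
    show "L1_on {a<..<b} (%x. rr (t, x) * \<phi> x)"
     by (rule set_integrable_bounded_mult[OF rr_slice_integrable(2) pm B(1)])
    show "AE x\<in>{a<..<b} in lborel. rr (t, x) * \<phi> x = \<rho> t x * \<phi> x" using ae by eventually_elim auto
   qed
   have Zeq: "Z k t = B * (LBINT x:{a<..<b}. (v k t x - \<rho> t x) * (\<phi> x / B))"
   proof -
    have "Z k t = (LBINT x:{a<..<b}. (v k t x - \<rho> t x) * \<phi> x)"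
     unfolding Z_def X_def Yeq left_diff_distrib set_integral_diff(2)[OF i] ..
    also have "\<dots> = (LBINT x:{a<..<b}. B * ((v k t x - \<rho> t x) * (\<phi> x / B)))"
     using B(3) by simp
    finally show ?thesis by simp
   qed
   have tf: "(%x. \<phi> x / B) \<in> test_fun {a<..<b}"
   proof -
    have "smooth (%x. \<phi> x * inverse B)" by (intro smooth_mult smooth_const sm)
    then show ?thesis using \<phi> by (auto simp: test_fun_def divide_inverse)
   qed
   have "deriv (%x. \<phi> x / B) x = deriv \<phi> x / B" for x
    by (intro DERIV_imp_deriv DERIV_cdivide smooth_has_deriv sm)
   then have "\<bar>LBINT x:{a<..<b}. (v k t x - \<rho> t x) * (\<phi> x / B)\<bar> <= N k t"
    unfolding N_def by (intro norm_Wm11_bounds(1)[OF fi tf]) (use B in auto)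
   from mult_left_mono[OF this less_imp_le[OF B(3)]] show "\<bar>Z k t\<bar> <= B * N k t"
    unfolding Zeq abs_mult abs_of_pos[OF B(3)] .
  qed
 qed
 have lim: "(%k. \<integral>\<^sup>+t\<in>{0<..<T}. ennreal (N k t powr p) \<partial>lborel) ----> 0"
  using conv by (simp add: tendsto_Lp_Wm11_def N_def)
 have ZI: "(%k. LBINT t:{0<..<T}. \<bar>Z k t\<bar>) ----> 0"
 proof (rule LIMSEQ_I)
  fix e :: real assume e: "e > 0"
  \<comment> \<open>\<eta> and \<kappa> are chosen so that the two final terms, T B \<eta> and c
    \<kappa>, are e/4 each.\<close>
  define \<eta> where "\<eta> = e / (4 * B * T)"
  have \<eta>: "\<eta> > 0" using e B T by (simp add: \<eta>_def)
  define \<kappa> where "\<kappa> = e / (4 * B * \<eta> powr (1 - p))"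
  have \<kappa>: "\<kappa> > 0" using e B \<eta> by (simp add: \<kappa>_def)
  have "EV k. (\<integral>\<^sup>+t\<in>{0<..<T}. ennreal (N k t powr p) \<partial>lborel) < ennreal \<kappa>"
   by (rule order_tendstoD(2)[OF lim]) (use \<kappa> in simp)
  then obtain K where K: "!!k. k >= K ==> (\<integral>\<^sup>+t\<in>{0<..<T}. ennreal (N k t powr p) \<partial>lborel) < ennreal \<kappa>"
   by (auto simp: eventually_sequentially)
  show "\<exists>no. \<forall>k\<ge>no. norm ((LBINT t:{0<..<T}. \<bar>Z k t\<bar>) - 0) < e"
  proof (intro exI[of _ K] allI impI)
   fix k assume "k >= K"
   define c where "c = B * \<eta> powr (1 - p)"
   have c: "c > 0" using B \<eta> by (simp add: c_def)
   \<comment> \<open>The part of |Z| above B \<eta>, in units of c. It is measurable and dominated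
     by the p-th power of the negative norm, so its Bochner integral can be compared with the given
     [0,infinity]-valued one.\<close>
   define H where "H t = max 0 (\<bar>Z k t\<bar> - B * \<eta>) / c" for t
   have Hi: "L1_on {0<..<T} H"
   proof (rule set_integrable_bound[OF set_integrable_divide[OF set_integrable_abs[OF Zi[of k]], of c]])
    have "(%t. indicator {0<..<T} t *\<^sub>R (max 0 (\<bar>indicator {0<..<T} t *\<^sub>R Z k t\<bar> - B * \<eta>) / c)) \<in> borel_measurable lborel"
     using Zi[of k] unfolding set_integrable_def by measurable
    then show "meas_on {0<..<T} H"
     unfolding set_borel_measurable_def H_def[abs_def]
     by (rule measurable_cong[THEN iffD1, rotated]) (auto simp: indicator_def)
    show "AE t\<in>{0<..<T} in lborel. norm (H t) <= norm (\<bar>Z k t\<bar> / c)"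
     using c B \<eta> by (intro AE_I2) (auto simp: H_def intro!: divide_right_mono)
   qed
   have H0: "0 <= H t" for t using c by (simp add: H_def)
   have le: "AE t in lborel. ennreal (H t) * indicator {0<..<T} t <= ennreal (N k t powr p) * indicator {0<..<T} t"
    using ZN[of k]
   proof eventually_elim
    case (elim t)
    show ?case
    proof (cases "t \<in> {0<..<T}")
     case True
     then have z: "\<bar>Z k t\<bar> <= B * N k t" using elim by simp
     then have "0 <= B * N k t" by linarith
     then have N0: "0 <= N k t" using B(3) by (simp add: zero_le_mult_iff)
     have "\<bar>Z k t\<bar> <= B * (\<eta> + \<eta> powr (1 - p) * N k t powr p)"
      by (rule order_trans[OF z mult_left_mono[OF powr_interpolation[OF N0 p \<eta>]]]) (use B in simp)
     then have "\<bar>Z k t\<bar> - B * \<eta> <= c * N k t powr p" by (simp add: c_def algebra_simps)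
     moreover have "0 <= c * N k t powr p" using c by simp
     ultimately have "H t <= N k t powr p" unfolding H_def using c by (simp add: divide_le_eq mult.commute)
     then show ?thesis using True by (simp add: ennreal_leI)
    qed simp
   qed
   have "ennreal (LBINT t:{0<..<T}. H t) = (\<integral>\<^sup>+t\<in>{0<..<T}. ennreal (H t) \<partial>lborel)"
    by (rule set_nn_integral_eq_set_integral_real[symmetric, OF Hi H0])
   also have "\<dots> <= (\<integral>\<^sup>+t\<in>{0<..<T}. ennreal (N k t powr p) \<partial>lborel)"
    by (rule nn_integral_mono_AE[OF le])
   also have "\<dots> <= ennreal \<kappa>" using K[OF \<open>k >= K\<close>] by simp
   finally have H\<kappa>: "(LBINT t:{0<..<T}. H t) <= \<kappa>" using \<kappa> by (simp add: ennreal_le_iff)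
   have "(LBINT t:{0<..<T}. \<bar>Z k t\<bar>) <= (LBINT t:{0<..<T}. B * \<eta> + c * H t)"
   proof (rule set_integral_mono[OF set_integrable_abs[OF Zi]])
    show "L1_on {0<..<T} (%t. B * \<eta> + c * H t)"
     using Hi by (intro set_integral_add set_integrable_const_interval) simp
    show "\<bar>Z k t\<bar> <= B * \<eta> + c * H t" for t using c by (simp add: H_def)
   qed
   also have "\<dots> = (LBINT t:{0<..<T}. B * \<eta>) + (LBINT t:{0<..<T}. c * H t)"
    using Hi by (intro set_integral_add set_integrable_const_interval) simp
   also have "\<dots> = T * (B * \<eta>) + c * (LBINT t:{0<..<T}. H t)" using LBINT_const_interval[of 0 T "B * \<eta>"] T by simp
   also have "\<dots> <= T * (B * \<eta>) + c * \<kappa>" using H\<kappa> c by (simp add: mult_left_mono)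
   also have "\<dots> = e / 4 + e / 4"
   proof -
    have "T * (B * \<eta>) = e / 4" using B T by (simp add: \<eta>_def)
    moreover have "c * \<kappa> = e / 4" using c B \<eta> by (simp add: \<kappa>_def c_def)
    ultimately show ?thesis by simp
   qed
   finally have "(LBINT t:{0<..<T}. \<bar>Z k t\<bar>) <= e / 4 + e / 4" .
   moreover have "0 <= (LBINT t:{0<..<T}. \<bar>Z k t\<bar>)" by (rule set_integral_nonneg_pointwise) simp
   ultimately show "norm ((LBINT t:{0<..<T}. \<bar>Z k t\<bar>) - 0) < e" using e by simp
  qed
 qed
 have "(%k. (LBINT t:{s<..<q}. X k \<phi> t) - (LBINT t:{s<..<q}. Y \<phi> t)) ----> 0"
 proof (rule tendsto_rabs_zero_cancel[OF tendsto_sandwich[OF _ _ tendsto_const ZI]])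
  have "\<bar>(LBINT t:{s<..<q}. X k \<phi> t) - (LBINT t:{s<..<q}. Y \<phi> t)\<bar> <= (LBINT t:{0<..<T}. \<bar>Z k t\<bar>)" for k
  proof -
   have i: "L1_on {s<..<q} (Z k)" by (rule set_integrable_subset[OF Zi]) (use s in auto)
   have "(LBINT t:{s<..<q}. X k \<phi> t) - (LBINT t:{s<..<q}. Y \<phi> t) = (LBINT t:{s<..<q}. Z k t)"
    unfolding Z_def by (rule set_integral_diff(2)[symmetric, OF X_integrable[OF c s(1)] Y_integrable[OF m B(1)]])
   also have "\<bar>\<dots>\<bar> <= (LBINT t:{s<..<q}. \<bar>Z k t\<bar>)" by (rule set_integral_abs_le[OF i])
   also have "\<dots> <= (LBINT t:{0<..<T}. \<bar>Z k t\<bar>)"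
    unfolding set_lebesgue_integral_def
    by (rule integral_mono)
     (use set_integrable_abs[OF Zi[of k]] set_integrable_abs[OF i] s in \<open>auto simp: set_integrable_def indicator_def\<close>)
   finally show ?thesis .
  qed
  then show "EV k. \<bar>(LBINT t:{s<..<q}. X k \<phi> t) - (LBINT t:{s<..<q}. Y \<phi> t)\<bar> <= (LBINT t:{0<..<T}. \<bar>Z k t\<bar>)"
   by simp
 qed simp
 from tendsto_add[OF this tendsto_const[of "LBINT t:{s<..<q}. Y \<phi> t"]] show ?thesis by simp
qed

end

lemma test_fun_approximates_one:
 fixes a b \<eta> :: real
 assumes ab: "a < b" and \<eta>: "0 < \<eta>"
 obtains \<phi> where "\<phi> \<in> test_fun {a<..<b}" "!!x. 0 <= \<phi> x" "!!x. \<phi> x <= 1" "(LBINT x:{a<..<b}. 1 - \<phi> x) < \<eta>"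
proof -
 define h where "h = min (\<eta> / 4) ((b - a) / 4)"
 have h: "0 < h" "h <= \<eta> / 4" "h <= (b - a) / 4"
  using ab \<eta> min.cobounded1[of "\<eta> / 4" "(b - a) / 4"] min.cobounded2[of "\<eta> / 4" "(b - a) / 4"]
  unfolding h_def by (simp_all only: min_less_iff_conj) simp
 define c d where "c = a + h" and "d = b - h"
 have cd: "a < c" "c < d" "d < b" using h ab by (auto simp: c_def d_def)
 note one = set_integrable_const_interval[of a b "1 :: real"]
 have sub: "{c<..<d} <= {a<..<b}" using cd by auto
 have lim: "(%j. LBINT x:{a<..<b}. bump c d j x) ----> d - c"
  using bump_integral_tendsto(1)[OF one _ sub] LBINT_const_interval[of c d 1] cd by simp
 have "d - c > b - a - \<eta>" using h \<eta> by (simp add: c_def d_def)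
 from order_tendstoD(1)[OF lim this] obtain j where j: "(LBINT x:{a<..<b}. bump c d j x) > b - a - \<eta>"
  by (auto simp: eventually_sequentially)
 have bi: "L1_on {a<..<b} (bump c d j)"
  using bump_integral_tendsto(2)[OF one _ sub, of j] by simp
 show ?thesis
 proof (rule that[of "bump c d j"])
  show "bump c d j \<in> test_fun {a<..<b}" by (rule bump_test_fun) (use cd in auto)
  show "(LBINT x:{a<..<b}. 1 - bump c d j x) < \<eta>"
   using set_integral_diff(2)[OF one bi] LBINT_const_interval[of a b 1] ab j by simp
 qed (rule bump_nonneg bump_le_1)+
qed

lemma mono_on_discontinuities_null:
 fixes f :: "real => real"
 assumes "mono_on {c<..} f"
 shows "AE t in lborel. t > c --> isCont f t"
proof -
 have "countable {t \<in> {c<..}. \<not> isCont f t}" by (rule mono_on_ctble_discont_open[OF _ assms]) simp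
 from AE_not_in[OF countable_imp_null_set_lborel[OF this]] show ?thesis by eventually_elim auto
qed

section \<open>Ordered window averages and the left-continuous representative\<close>

context rho_limit
begin

lemma X_one_diff:
 assumes \<phi>: "continuous_on {a..b} \<phi>" "!!x. 0 <= \<phi> x" "!!x. \<phi> x <= 1" and t: "0 <= t"
 shows "X k \<phi> t <= X k (%x. 1) t" "X k (%x. 1) t <= X k \<phi> t + P k * (LBINT x:{a<..<b}. 1 - \<phi> x)"
proof -
 note i = v_integrable[OF t \<phi>(1), of k] v_integrable[OF t continuous_on_const[of _ "1 :: real"], of k]
 show "X k \<phi> t <= X k (%x. 1) t"
  unfolding X_def by (rule set_integral_mono[OF i]) (use \<phi> v_bounds[OF t] in \<open>auto intro: mult_left_le\<close>)
 have oi: "L1_on {a<..<b} (%x. P k * (1 - \<phi> x))"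
  by (rule set_integrable_subset[OF borel_integrable_atLeastAtMost'[of a b]]) (auto intro!: continuous_intros \<phi>(1))
 have "X k (%x. 1) t <= (LBINT x:{a<..<b}. v k t x * \<phi> x + P k * (1 - \<phi> x))"
  unfolding X_def
 proof (rule set_integral_mono[OF i(2) set_integral_add(1)[OF i(1) oi]])
  fix x assume x: "x \<in> {a<..<b}"
  have "v k t x * (1 - \<phi> x) <= P k * (1 - \<phi> x)"
   by (rule mult_right_mono) (use v_bounds[OF t, of x k] \<phi>(3)[of x] x in auto)
  then show "v k t x * 1 <= v k t x * \<phi> x + P k * (1 - \<phi> x)" by (simp add: algebra_simps)
 qed
 also have "\<dots> = X k \<phi> t + P k * (LBINT x:{a<..<b}. 1 - \<phi> x)"
  unfolding X_def set_integral_add(2)[OF i(1) oi] by simp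
 finally show "X k (%x. 1) t <= X k \<phi> t + P k * (LBINT x:{a<..<b}. 1 - \<phi> x)" .
qed

lemma Y_one_diff:
 assumes \<phi>: "continuous_on UNIV \<phi>" "!!x. 0 <= \<phi> x" "!!x. \<phi> x <= 1"
 shows "Y \<phi> t <= Y (%x. 1) t" "Y (%x. 1) t <= Y \<phi> t + (LBINT x:{a<..<b}. 1 - \<phi> x)"
proof -
 have m: "\<phi> \<in> borel_measurable borel" by (rule borel_measurable_continuous_onI[OF \<phi>(1)])
 have b: "\<bar>\<phi> x\<bar> <= 1" for x using \<phi>(2,3)[of x] by simp
 have i: "L1_on {a<..<b} (%x. rr (t, x) * \<phi> x)" "L1_on {a<..<b} (%x. rr (t, x) * 1)"
  using slice_integrable[OF m b, of "%x. rr (t, x)"] rr_slice_integrable(2) rr_bounds by auto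
 show "Y \<phi> t <= Y (%x. 1) t"
  unfolding Y_def by (rule set_integral_mono[OF i]) (use \<phi> rr_bounds in \<open>auto intro: mult_left_le\<close>)
 have oi: "L1_on {a<..<b} (%x. 1 - \<phi> x)"
  by (rule set_integrable_subset[OF borel_integrable_atLeastAtMost'[of a b]])
   (auto intro!: continuous_intros continuous_on_subset[OF \<phi>(1)])
 have "Y (%x. 1) t <= (LBINT x:{a<..<b}. rr (t, x) * \<phi> x + (1 - \<phi> x))"
  unfolding Y_def
 proof (rule set_integral_mono[OF i(2) set_integral_add(1)[OF i(1) oi]])
  fix x
  have "rr (t, x) * (1 - \<phi> x) <= 1 * (1 - \<phi> x)"
   by (rule mult_right_mono) (use rr_bounds \<phi>(3)[of x] in auto)
  then show "rr (t, x) * 1 <= rr (t, x) * \<phi> x + (1 - \<phi> x)" by (simp add: algebra_simps)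
 qed
 also have "\<dots> = Y \<phi> t + (LBINT x:{a<..<b}. 1 - \<phi> x)" unfolding Y_def by (rule set_integral_add(2)[OF i(1) oi])
 finally show "Y (%x. 1) t <= Y \<phi> t + (LBINT x:{a<..<b}. 1 - \<phi> x)" .
qed

text \<open>1 is replaced by a test function with small int (1 - \<phi>); the error is uniform in k,
  since P k < 2 for large k.\<close>

lemma X_one_tendsto:
 assumes s: "0 <= s" "s <= q" "q <= T"
 shows "(%k. LBINT t:{s<..<q}. X k (%x. 1) t) ----> (LBINT t:{s<..<q}. Y (%x. 1) t)"
proof (rule LIMSEQ_I)
 fix e :: real assume e: "e > 0"
 define \<eta> where "\<eta> = e / (4 * T)"
 have \<eta>: "\<eta> > 0" using e T by (simp add: \<eta>_def)
 obtain \<phi> where \<phi>: "\<phi> \<in> test_fun {a<..<b}" "!!x. 0 <= \<phi> x" "!!x. \<phi> x <= 1" "(LBINT x:{a<..<b}. 1 - \<phi> x) < \<eta>"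
  by (rule test_fun_approximates_one[OF ab \<eta>], rule that)
 define I where "I = (LBINT x:{a<..<b}. 1 - \<phi> x)"
 have I0: "0 <= I" unfolding I_def by (rule set_integral_nonneg_pointwise) (use \<phi> in auto)
 have c: "continuous_on S \<phi>" for S using \<phi>(1) by (intro smooth_continuous) (simp add: test_fun_def)
 have m: "\<phi> \<in> borel_measurable borel" by (rule borel_measurable_continuous_onI[OF c])
 have b: "\<bar>\<phi> x\<bar> <= 1" for x using \<phi>(2,3)[of x] by simp
 note Xi = X_integrable[OF c s(1), of q] X_integrable[OF continuous_on_const[of _ "1 :: real"] s(1), of q]
 have Yi: "L1_on {s<..<q} (Y \<phi>)" "L1_on {s<..<q} (Y (%x. 1))"
  by (rule Y_integrable[OF m b], rule Y_integrable[of _ 1]) auto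
 have X1: "(LBINT t:{s<..<q}. X k \<phi> t) <= (LBINT t:{s<..<q}. X k (%x. 1) t)"
   "(LBINT t:{s<..<q}. X k (%x. 1) t) <= (LBINT t:{s<..<q}. X k \<phi> t) + (q - s) * (P k * I)" for k
 proof -
  note d = X_one_diff[OF c \<phi>(2,3), folded I_def]
  show "(LBINT t:{s<..<q}. X k \<phi> t) <= (LBINT t:{s<..<q}. X k (%x. 1) t)"
   by (rule set_integral_mono[OF Xi]) (use d(1) s in auto)
  have "(LBINT t:{s<..<q}. X k (%x. 1) t) <= (LBINT t:{s<..<q}. X k \<phi> t + P k * I)"
   by (rule set_integral_mono[OF Xi(2) set_integral_add(1)[OF Xi(1) set_integrable_const_interval]]) (use d(2) s in auto)
  then show "(LBINT t:{s<..<q}. X k (%x. 1) t) <= (LBINT t:{s<..<q}. X k \<phi> t) + (q - s) * (P k * I)"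
   unfolding set_integral_add(2)[OF Xi(1) set_integrable_const_interval] LBINT_const_interval[OF s(2)] .
 qed
 have Y1: "(LBINT t:{s<..<q}. Y \<phi> t) <= (LBINT t:{s<..<q}. Y (%x. 1) t)"
   "(LBINT t:{s<..<q}. Y (%x. 1) t) <= (LBINT t:{s<..<q}. Y \<phi> t) + (q - s) * I"
 proof -
  note d = Y_one_diff[OF c \<phi>(2,3), folded I_def]
  show "(LBINT t:{s<..<q}. Y \<phi> t) <= (LBINT t:{s<..<q}. Y (%x. 1) t)"
   by (rule set_integral_mono[OF Yi]) (use d(1) in auto)
  have "(LBINT t:{s<..<q}. Y (%x. 1) t) <= (LBINT t:{s<..<q}. Y \<phi> t + I)"
   by (rule set_integral_mono[OF Yi(2) set_integral_add(1)[OF Yi(1) set_integrable_const_interval]]) (use d(2) in auto)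
  then show "(LBINT t:{s<..<q}. Y (%x. 1) t) <= (LBINT t:{s<..<q}. Y \<phi> t) + (q - s) * I"
   using set_integral_add(2)[OF Yi(1) set_integrable_const_interval] LBINT_const_interval[OF s(2)] by simp
 qed
 have TI: "(q - s) * I <= e / 4"
 proof -
  have "(q - s) * I <= T * \<eta>" by (rule mult_mono) (use s \<phi>(4) I0 T in \<open>auto simp: I_def\<close>)
  then show ?thesis using T by (simp add: \<eta>_def)
 qed
 have "EV k. dist (LBINT t:{s<..<q}. X k \<phi> t) (LBINT t:{s<..<q}. Y \<phi> t) < e / 4"
  using tendstoD[OF X_tendsto[OF \<phi>(1) s], of "e / 4"] e by simp
 moreover have "EV k. P k < 2" by (rule order_tendstoD(2)[OF P]) simp
 ultimately have "EV k. norm ((LBINT t:{s<..<q}. X k (%x. 1) t) - (LBINT t:{s<..<q}. Y (%x. 1) t)) < e"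
 proof eventually_elim
  case (elim k)
  have "(q - s) * (P k * I) <= (q - s) * (2 * I)" using elim s I0 by (intro mult_left_mono mult_right_mono) auto
  then show ?case using elim X1[of k] Y1 TI e unfolding dist_real_def real_norm_def by linarith
 qed
 then show "\<exists>no. \<forall>k\<ge>no. norm ((LBINT t:{s<..<q}. X k (%x. 1) t) - (LBINT t:{s<..<q}. Y (%x. 1) t)) < e"
  by (simp add: eventually_sequentially)
qed

text \<open>The constant 1 is no test function on the interval, but the total mass needs it; it
  shares the two properties used in the limit, almost monotonicity and convergence of time
  integrals.\<close>

definition "admissible \<phi> \<longleftrightarrow> (\<phi> \<in> test_fun {a<..<b} & (\<forall>x. 0 <= \<phi> x)) \<or> \<phi> = (%x. 1)"

lemma admissible_one: "admissible (%x. 1)" by (simp add: admissible_def)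

lemma admissible:
 assumes "admissible \<phi>"
 shows "continuous_on S \<phi>" "\<phi> \<in> borel_measurable borel" "0 <= \<phi> x" "\<exists>B. \<forall>x. \<bar>\<phi> x\<bar> <= B"
  and "0 < \<eta> ==> EV k. \<forall>s t. 0 <= s --> s <= t --> t <= T --> X k \<phi> s - \<eta> <= X k \<phi> t"
  and "0 <= s ==> s <= q ==> q <= T ==> (%k. LBINT t:{s<..<q}. X k \<phi> t) ----> (LBINT t:{s<..<q}. Y \<phi> t)"
proof -
 show c: "continuous_on S \<phi>" for S
  using assms by (auto simp: admissible_def test_fun_def intro: smooth_continuous)
 show "\<phi> \<in> borel_measurable borel" by (rule borel_measurable_continuous_onI[OF c])
 show "0 <= \<phi> x" using assms by (auto simp: admissible_def)
 show "\<exists>B. \<forall>x. \<bar>\<phi> x\<bar> <= B"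
 proof (cases "\<phi> = (%x. 1)")
  case False
  then have "\<phi> \<in> test_fun {a<..<b}" using assms by (simp add: admissible_def)
  then show ?thesis by (rule test_fun_bounded) blast
 qed auto
 show "0 < \<eta> ==> EV k. \<forall>s t. 0 <= s --> s <= t --> t <= T --> X k \<phi> s - \<eta> <= X k \<phi> t"
  using assms inc[of \<phi> \<eta>] inc_one[of \<eta>] by (auto simp: admissible_def)
 show "0 <= s ==> s <= q ==> q <= T ==> (%k. LBINT t:{s<..<q}. X k \<phi> t) ----> (LBINT t:{s<..<q}. Y \<phi> t)"
  using assms X_tendsto[of \<phi> s q] X_one_tendsto[of s q] by (auto simp: admissible_def)
qed

text \<open>For large k, averages of \<open>X k \<phi>\<close> over the earlier window are at most
  its value at the separating time q, and over the later window at least that value, each up to e/2.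
  Averages converge, so the order survives.\<close>

lemma average_increasing:
 assumes \<phi>: "admissible \<phi>" and s: "0 <= s" "s < q" "q <= s'" "s' < q'" "q' <= T"
 shows "(LBINT t:{s<..<q}. Y \<phi> t) / (q - s) <= (LBINT t:{s'<..<q'}. Y \<phi> t) / (q' - s')"
proof (rule field_le_epsilon)
 fix e :: real assume e: "e > 0"
 note lim = admissible(6)[OF \<phi>]
 have ev: "EV k. \<forall>s t. 0 <= s --> s <= t --> t <= T --> X k \<phi> s - e / 2 <= X k \<phi> t"
  by (rule admissible(5)[OF \<phi>]) (use e in simp)
 have "(%k. (LBINT t:{s'<..<q'}. X k \<phi> t) / (q' - s') - (LBINT t:{s<..<q}. X k \<phi> t) / (q - s)) ---->
   (LBINT t:{s'<..<q'}. Y \<phi> t) / (q' - s') - (LBINT t:{s<..<q}. Y \<phi> t) / (q - s)"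
  by (intro tendsto_intros lim) (use s in auto)
 moreover have "EV k. - e <= (LBINT t:{s'<..<q'}. X k \<phi> t) / (q' - s') - (LBINT t:{s<..<q}. X k \<phi> t) / (q - s)"
  using ev
 proof eventually_elim
  case (elim k)
  have "(LBINT t:{s<..<q}. X k \<phi> t) <= (q - s) * (X k \<phi> q + e / 2)"
   by (rule LBINT_bounds_const(1)[OF X_integrable[OF admissible(1)[OF \<phi>] s(1)]])
    (use elim[rule_format, of _ q] s in \<open>auto simp: diff_le_eq\<close>)
  then have "(LBINT t:{s<..<q}. X k \<phi> t) / (q - s) <= X k \<phi> q + e / 2" using s by (simp add: divide_le_eq mult.commute)
  moreover have "(q' - s') * (X k \<phi> q - e / 2) <= (LBINT t:{s'<..<q'}. X k \<phi> t)"
   by (rule LBINT_bounds_const(2)[OF X_integrable[OF admissible(1)[OF \<phi>]]])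
    (use elim[rule_format, of q] s in auto)
  then have "X k \<phi> q - e / 2 <= (LBINT t:{s'<..<q'}. X k \<phi> t) / (q' - s')" using s by (simp add: le_divide_eq mult.commute)
  ultimately show ?case by linarith
 qed
 ultimately have "- e <= (LBINT t:{s'<..<q'}. Y \<phi> t) / (q' - s') - (LBINT t:{s<..<q}. Y \<phi> t) / (q - s)"
  by (rule tendsto_lowerbound) simp
 then show "(LBINT t:{s<..<q}. Y \<phi> t) / (q - s) <= (LBINT t:{s'<..<q'}. Y \<phi> t) / (q' - s') + e" by linarith
qed

text \<open>Testing with bumps and letting them tend to indicators gives the order of the integrals
  over every inner interval; Lebesgue differentiation turns it into an order for almost every
  x.\<close>

lemma A_increasing:
 assumes s: "0 <= s" "s < q" "q <= s'" "s' < q'" "q' <= T"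
 shows "AE x\<in>{a<..<b} in lborel. A s q x <= A s' q' x"
proof -
 have Ai: "L1_on {a<..<b} (A s q)" if "s < q" for s q
  by (rule set_integrable_bounded_interval[of _ _ _ 1]) (use A_bounds[OF that] in \<open>auto simp: set_borel_measurable_def\<close>)
 have Am: "(LBINT x:{a<..<b}. A s q x * bump c d j x) = (LBINT t:{s<..<q}. Y (bump c d j) t) / (q - s)" for s q c d j
 proof -
  have "(LBINT x:{a<..<b}. J s q x * bump c d j x) = (LBINT t:{s<..<q}. Y (bump c d j) t)"
   by (rule J_Y[OF smooth_measurable[OF smooth_bump], of _ _ _ 1]) (simp add: bump_nonneg bump_le_1)
  then show ?thesis unfolding A_def by simp
 qed
 define w where "w x = A s' q' x - A s q x" for x
 have wi: "L1_on {a<..<b} w" unfolding w_def[abs_def] by (rule set_integral_diff(1)) (use Ai s in auto)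
 have "AE x\<in>{a<..<b} in lborel. 0 <= w x"
 proof (rule AE_nonneg_if_intervals[OF wi])
  fix c d assume cd: "a < c" "c < d" "d < b"
  have sub: "{c<..<d} <= {a<..<b}" using cd by auto
  have "0 <= (LBINT x:{a<..<b}. w x * bump c d j x)" for j
  proof -
   have "{c..d} <= {a<..<b}" using cd by auto
   then have "admissible (bump c d j)" unfolding admissible_def using bump_test_fun[of c d "{a<..<b}" j] bump_nonneg by blast
   from average_increasing[OF this s] have "0 <= (LBINT x:{a<..<b}. A s' q' x * bump c d j x) - (LBINT x:{a<..<b}. A s q x * bump c d j x)"
    unfolding Am by simp
   then show ?thesis unfolding w_def left_diff_distrib
    using set_integral_diff(2)[OF bump_integral_tendsto(2)[OF Ai _ sub, of s' q' j] bump_integral_tendsto(2)[OF Ai _ sub, of s q j]] s by simp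
  qed
  then show "0 <= (LBINT x:{c<..<d}. w x)"
   by (intro LIMSEQ_le_const[OF bump_integral_tendsto(1)[OF wi _ sub]]) auto
 qed
 then show ?thesis by eventually_elim (simp add: w_def)
qed

lemma countable_win: "countable win"
proof -
 have "win <= \<rat> \<times> \<rat>" by (auto simp: win_def)
 then show ?thesis by (rule countable_subset) (intro countable_SIGMA countable_rat)
qed

lemma win_nonempty: "win \<noteq> {}"
proof -
 have "(0, 1) \<in> win" by (simp add: win_def)
 then show ?thesis by blast
qed

lemma r_term_bounds: "i \<in> win ==> 0 <= (if snd i < t then A (fst i) (snd i) x else 0)"
 "i \<in> win ==> (if snd i < t then A (fst i) (snd i) x else 0) <= 1"
 using A_bounds[of "fst i" "snd i" x] by (auto simp: win_def)

lemma r_bdd: "bdd_above ((%i. if snd i < t then A (fst i) (snd i) x else 0) ` win)"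
 by (rule bdd_aboveI2[OF r_term_bounds(2)])

lemma r_bounds: "0 <= r t x" "r t x <= 1"
proof -
 obtain i where i: "i \<in> win" using win_nonempty by blast
 show "0 <= r t x" using r0 cSUP_upper[OF i r_bdd, of t x] r_term_bounds(1)[OF i, of t x] by (auto simp: r_def simp del: if_split)
 show "r t x <= 1" using r0 cSUP_least[OF win_nonempty r_term_bounds(2)] by (auto simp: r_def)
qed

lemma r_upper:
 assumes "(s, q) \<in> win" "q < t"
 shows "A s q x <= r t x"
 using cSUP_upper[OF assms(1) r_bdd, of t x] assms by (auto simp: r_def win_def)

lemma r_mono:
 assumes t: "0 < t" "t <= t'"
 shows "r t x <= r t' x"
proof -
 have "(SUP i\<in>win. (if snd i < t then A (fst i) (snd i) x else 0)) <= (SUP i\<in>win. (if snd i < t' then A (fst i) (snd i) x else 0))"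
 proof (rule cSUP_mono[OF win_nonempty r_bdd])
  fix i assume i: "i \<in> win"
  show "\<exists>j\<in>win. (if snd i < t then A (fst i) (snd i) x else 0) <= (if snd j < t' then A (fst j) (snd j) x else 0)"
   by (rule bexI[OF _ i]) (use t r_term_bounds(1)[OF i, of t' x] in auto)
 qed
 then show ?thesis using t by (simp add: r_def)
qed

lemma r_left_continuous:
 assumes t: "0 < t" and S: "S ----> t" "!!j. S j < t"
 shows "(%j. r (S j) x) ----> r t x"
proof (rule LIMSEQ_I)
 fix e :: real assume e: "e > 0"
 have "r t x - e < (SUP i\<in>win. (if snd i < t then A (fst i) (snd i) x else 0))" using t e by (simp add: r_def)
 then obtain i where i: "i \<in> win" "r t x - e < (if snd i < t then A (fst i) (snd i) x else 0)"
  using less_cSUP_iff[OF win_nonempty r_bdd] by blast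
 have "EV j. r t x - e < r (S j) x & r (S j) x <= r t x"
 proof (cases "snd i < t")
  case True
  have "snd i >= 0" using i by (auto simp: win_def)
  have "EV j. snd i < S j" by (rule order_tendstoD(1)[OF S(1) True])
  then show ?thesis
  proof eventually_elim
   case (elim j)
   have "A (fst i) (snd i) x <= r (S j) x" using r_upper[of "fst i" "snd i" "S j" x] i elim by simp
   moreover have "r (S j) x <= r t x" by (rule r_mono) (use S(2)[of j] elim \<open>snd i >= 0\<close> in auto)
   ultimately show ?case using i True by simp
  qed
 next
  case False
  then have "r t x < e" using i by simp
  have "EV j. 0 < S j" by (rule order_tendstoD(1)[OF S(1) t])
  then show ?thesis
  proof eventually_elim
   case (elim j)
   have "r (S j) x <= r t x" by (rule r_mono) (use S(2)[of j] elim in auto)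
   then show ?case using \<open>r t x < e\<close> r_bounds(1)[of "S j" x] by simp
  qed
 qed
 then show "\<exists>no. \<forall>j\<ge>no. norm (r (S j) x - r t x) < e"
  unfolding eventually_sequentially real_norm_def
  by (elim exE) (rule exI, intro allI impI, drule spec, drule (1) mp, linarith)
qed

lemma r_measurable: "(%z. r (fst z) (snd z)) \<in> borel_measurable borel"
proof -
 have m: "(%z :: real \<times> real. g (snd z)) \<in> borel_measurable borel" if "g \<in> borel_measurable borel" for g :: "real => real"
  by (rule measurable_compose[OF _ that]) (intro borel_measurable_continuous_onI continuous_intros)
 have f: "{z :: real \<times> real. c < fst z} \<in> sets borel" "{z :: real \<times> real. fst z <= c} \<in> sets borel" for c
  by (rule borel_open, rule open_Collect_less, intro continuous_intros, intro continuous_intros)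
   (rule borel_closed, rule closed_Collect_le, intro continuous_intros, intro continuous_intros)
 have 1: "(%z. SUP i\<in>win. (if snd i < fst z then A (fst i) (snd i) (snd z) else 0)) \<in> borel_measurable (borel :: (real \<times> real) measure)"
 proof (rule borel_measurable_cSUP[OF countable_win])
  show "(%z. if snd i < fst z then A (fst i) (snd i) (snd z) else 0) \<in> borel_measurable borel" for i
   by (rule measurable_If) (use m[OF A_measurable] f in auto)
  show "bdd_above ((%i. if snd i < fst z then A (fst i) (snd i) (snd z) else 0) ` win)" for z :: "real \<times> real" by (rule r_bdd)
 qed
 show ?thesis unfolding r_def by (rule measurable_If[OF m[OF r0(1)] 1]) (use f in auto)
qed

lemma r_slice_measurable [measurable]: "r t \<in> borel_measurable borel" "(%t. r t x) \<in> borel_measurable borel"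
 using measurable_compose[OF _ r_measurable, of "%x. (t, x)" borel] measurable_compose[OF _ r_measurable, of "%t. (t, x)" borel]
 by (auto intro!: borel_measurable_continuous_onI continuous_intros)

lemma J_subset_mono:
 assumes "s' <= s" "q <= q'"
 shows "J s q x <= J s' q' x"
 unfolding J_def set_lebesgue_integral_def
 by (rule integral_mono) (use rr_slice_integrable(1) rr_bounds assms in \<open>auto simp: set_integrable_def indicator_def\<close>)

text \<open>For almost every x all rational windows are ordered; then for almost every t the right
  averages of \<open>rr\<close> converge and the increasing function r(., x) is continuous. Rational
  windows just inside and just around (t, t+h) squeeze the right average between r(t) and r(t + 2h),
  up to O(h). The null sets are found for x first and t second; measurability of r exchanges the
  order.\<close>

lemma r_eq_rr: "AE z\<in>cyl T a b in lborel. r (fst z) (snd z) = rr z"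
proof -
 have good: "AE x in lborel. \<forall>i\<in>win \<times> win. x \<in> {a<..<b} --> snd (fst i) <= fst (snd i) --> snd (snd i) <= T -->
   A (fst (fst i)) (snd (fst i)) x <= A (fst (snd i)) (snd (snd i)) x"
 proof (intro AE_ball_countable' countable_SIGMA countable_win)
  fix i assume i: "i \<in> win \<times> win"
  show "AE x\<in>{a<..<b} in lborel. snd (fst i) <= fst (snd i) --> snd (snd i) <= T -->
   A (fst (fst i)) (snd (fst i)) x <= A (fst (snd i)) (snd (snd i)) x"
  proof (cases "snd (fst i) <= fst (snd i) & snd (snd i) <= T")
   case True
   have "AE x\<in>{a<..<b} in lborel. A (fst (fst i)) (snd (fst i)) x <= A (fst (snd i)) (snd (snd i)) x"
    by (rule A_increasing) (use i True in \<open>auto simp: win_def\<close>)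
   then show ?thesis by eventually_elim auto
  qed auto
 qed
 have AEx: "AE x in lborel. AE t in lborel. (t, x) \<in> cyl T a b --> r t x = rr (t, x)"
  using good
 proof eventually_elim
  case (elim x)
  show ?case
  proof (cases "x \<in> {a<..<b}")
   case False
   then show ?thesis by (auto simp: cyl_def)
  next
   case True
   have mono: "A s q x <= A s' q' x" if "(s, q) \<in> win" "(s', q') \<in> win" "q <= s'" "q' <= T" for s q s' q'
    using elim that True by force
   define f where "f t = rr (t, x)" for t
   have f_out: "f t = 0" if "t \<notin> {0<..<T}" for t using that by (auto simp: f_def rr_def cyl_def indicator_def)
   have fi: "integrable lborel f"
   proof -
    have "integrable lborel (%t. indicator {0<..<T} t *\<^sub>R f t)"
     using rr_slice_integrable(1)[of 0 T x] by (simp add: set_integrable_def f_def)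
    moreover have "(%t. indicator {0<..<T} t *\<^sub>R f t) = f" using f_out by (auto simp: fun_eq_iff indicator_def)
    ultimately show ?thesis by simp
   qed
   have Jf: "(LBINT t:{c..d}. f t) = J c d x" for c d
    unfolding J_def f_def by (rule LBINT_Icc_eq_Ioo)
   have "mono_on {0<..} (%t. r t x)" by (rule mono_onI) (auto intro: r_mono)
   from mono_on_discontinuities_null[OF this] AE_right_average_tendsto[OF fi]
   have "AE t\<in>{0<..<T} in lborel. r t x = f t"
   proof eventually_elim
    case (elim t)
    show ?case
    proof
     assume t: "t \<in> {0<..<T}"
     have lim: "((%h. J t (t + h) x / h) \<longlongrightarrow> f t) (at_right 0)" using elim(2) unfolding Jf .
     have ev: "\<forall>\<^sub>F h in at_right 0. 0 < h & h < min (min 1 t) (T - t)"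
      using t by (intro eventually_conj eventually_at_right_less) (auto simp: eventually_at_right_field intro!: exI[of _ "min (min 1 t) (T - t)"])
     have up: "\<forall>\<^sub>F h in at_right 0. r t x * (1 - h) <= J t (t + h) x / h"
      using ev
     proof eventually_elim
      case (elim h)
      then have h: "0 < h" "h < 1" "h < T - t" by auto
      \<comment> \<open>Margins of size h^2/2 leave the inner window a length of at least h (1 - h),
        so the loss vanishes after division by h.\<close>
      have hh: "0 < h * h / 2" "h * h < h" using h by simp_all
      obtain s where s: "s \<in> \<rat>" "t < s" "s < t + h * h / 2" using Rats_dense_in_real[of t "t + h * h / 2"] hh by auto
      obtain q where q: "q \<in> \<rat>" "t + h - h * h / 2 < q" "q < t + h" using Rats_dense_in_real[of "t + h - h * h / 2" "t + h"] hh by auto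
      have sq: "(s, q) \<in> win" using s q hh t by (auto simp: win_def)
      have "r t x <= A s q x"
      proof -
       have "(SUP i\<in>win. (if snd i < t then A (fst i) (snd i) x else 0)) <= A s q x"
       proof (rule cSUP_least[OF win_nonempty])
        fix i assume i: "i \<in> win"
        show "(if snd i < t then A (fst i) (snd i) x else 0) <= A s q x"
         using mono[of "fst i" "snd i" s q] i sq s q h A_bounds(1)[of s q x] by (auto simp: win_def)
       qed
       then show ?thesis using t by (simp add: r_def)
      qed
      have len: "h * (1 - h) <= q - s" using s q by (simp add: algebra_simps)
      have "r t x * (h * (1 - h)) <= A s q x * (q - s)"
       by (rule mult_mono[OF \<open>r t x <= A s q x\<close> len]) (use h sq A_bounds in \<open>auto simp: win_def\<close>)
      also have "\<dots> = J s q x" using sq by (auto simp: A_def win_def)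
      also have "\<dots> <= J t (t + h) x" by (rule J_subset_mono) (use s q in auto)
      finally show ?case using h by (simp add: le_divide_eq mult_ac)
     qed
     have "((%h. r t x * (1 - h)) \<longlongrightarrow> r t x * (1 - 0)) (at_right 0)" by (intro tendsto_intros)
     from tendsto_le[OF _ lim this up] have 1: "r t x <= f t" by simp
     have lo: "\<forall>\<^sub>F h in at_right 0. J t (t + h) x / h <= r (t + 2 * h) x + 2 * h"
      using ev
     proof eventually_elim
      case (elim h)
      then have h: "0 < h" "h < 1" "h < t" by auto
      \<comment> \<open>The outer window exceeds (t, t+h) by less than h^2 at either end and ends
        before t + 2h.\<close>
      have hh: "0 < h * h" "h * h < h" using h by simp_all
      obtain s where s: "s \<in> \<rat>" "t - h * h < s" "s < t" using Rats_dense_in_real[of "t - h * h" t] hh by auto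
      obtain q where q: "q \<in> \<rat>" "t + h < q" "q < t + h + h * h" using Rats_dense_in_real[of "t + h" "t + h + h * h"] hh by auto
      have s0: "0 <= s" and qt: "q < t + 2 * h" and len: "q - s <= h * (1 + 2 * h)"
       using s q h unfolding distrib_left using hh by linarith+
      have sq: "(s, q) \<in> win" using s q h s0 by (auto simp: win_def)
      have "J t (t + h) x <= J s q x" by (rule J_subset_mono) (use s q in auto)
      also have "\<dots> = A s q x * (q - s)" using sq by (auto simp: A_def win_def)
      also have "\<dots> <= r (t + 2 * h) x * (h * (1 + 2 * h))"
       by (rule mult_mono[OF r_upper[OF sq qt] len r_bounds(1)]) (use s q h in simp)
      also have "\<dots> <= h * (r (t + 2 * h) x + 2 * h)"
       using r_bounds(2)[of "t + 2 * h" x] hh by (simp add: algebra_simps mult_left_le)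
      finally show ?case using h by (simp add: divide_le_eq mult_ac)
     qed
     have "isCont (%t. r t x) t" using elim(1) t by auto
     then have "((%h. r (t + 2 * h) x) \<longlongrightarrow> r t x) (at_right 0)"
      by (rule isCont_tendsto_compose) (auto intro!: tendsto_eq_intros)
     then have "((%h. r (t + 2 * h) x + 2 * h) \<longlongrightarrow> r t x + 2 * 0) (at_right 0)" by (intro tendsto_intros)
     from tendsto_le[OF _ this lim lo] have "f t <= r t x" by simp
     with 1 show "r t x = f t" by simp
    qed
   qed
   then show ?thesis by eventually_elim (auto simp: cyl_def f_def)
  qed
 qed
 have ms: "{z \<in> space (lborel \<Otimes>\<^sub>M lborel). (fst z, snd z) \<in> cyl T a b --> r (fst z) (snd z) = rr (fst z, snd z)} \<in> sets (lborel \<Otimes>\<^sub>M lborel)"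
 proof -
  have "cyl T a b \<in> sets borel" unfolding cyl_def by (intro borel_open open_Times) auto
  then have "{z. z \<in> cyl T a b --> r (fst z) (snd z) = rr z} \<in> sets (borel :: (real \<times> real) measure)"
   using r_measurable by measurable
  then show ?thesis unfolding lborel_prod by simp
 qed
 have "AE t in lborel. AE x in lborel. (t, x) \<in> cyl T a b --> r t x = rr (t, x)"
  using lborel_pair.AE_commute[OF ms] AEx by simp
 then have "AE z in lborel \<Otimes>\<^sub>M lborel. (fst z, snd z) \<in> cyl T a b --> r (fst z) (snd z) = rr (fst z, snd z)"
  by (intro lborel_pair.AE_pair_measure[OF ms]) simp
 then show ?thesis unfolding lborel_prod by simp
qed

end

section \<open>Moments of the representative and their comparison with the approximations\<close>

context rho_limit
begin

definition "Lm \<phi> t = (LBINT x:{a<..<b}. r t x * \<phi> x)"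

lemma Lm_integrable:
 assumes "admissible \<phi>"
 shows "L1_on {a<..<b} (%x. r t x * \<phi> x)"
proof -
 obtain B where "!!x. \<bar>\<phi> x\<bar> <= B" using admissible(4)[OF assms] by blast
 from slice_integrable[OF admissible(2)[OF assms] this r_slice_measurable(1) r_bounds] show ?thesis .
qed

lemma Lm_mono:
 assumes \<phi>: "admissible \<phi>" and t: "0 < s" "s <= t"
 shows "Lm \<phi> s <= Lm \<phi> t"
 unfolding Lm_def
 by (rule set_integral_mono[OF Lm_integrable[OF \<phi>] Lm_integrable[OF \<phi>]])
  (rule mult_right_mono[OF r_mono[OF t] admissible(3)[OF \<phi>]])

lemma r_L1_left:
 assumes t: "0 < t" and S: "S ----> t" "!!j. S j < t"
 shows "(%j. LBINT x:{a<..<b}. \<bar>r (S j) x - r t x\<bar>) ----> 0"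
proof -
 have "(%j. LBINT x:{a<..<b}. \<bar>r (S j) x - r t x\<bar>) ----> (LBINT x:{a<..<b}. 0)"
  unfolding set_lebesgue_integral_def
 proof (rule integral_dominated_convergence[where w="%x. indicator {a<..<b} x *\<^sub>R 1"])
  show "integrable lborel (%x. indicator {a<..<b} x *\<^sub>R (1 :: real))"
   using set_integrable_const_interval[of a b 1] by (simp add: set_integrable_def)
  show "AE x in lborel. (%j. indicator {a<..<b} x *\<^sub>R \<bar>r (S j) x - r t x\<bar>) ----> indicator {a<..<b} x *\<^sub>R 0"
  proof (rule AE_I2)
   fix x
   have "(%j. indicator {a<..<b} x *\<^sub>R \<bar>r (S j) x - r t x\<bar>) ----> indicator {a<..<b} x *\<^sub>R \<bar>r t x - r t x\<bar>"
    by (intro tendsto_intros r_left_continuous[OF t S])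
   then show "(%j. indicator {a<..<b} x *\<^sub>R \<bar>r (S j) x - r t x\<bar>) ----> indicator {a<..<b} x *\<^sub>R 0" by simp
  qed
  show "AE x in lborel. norm (indicator {a<..<b} x *\<^sub>R \<bar>r (S j) x - r t x\<bar>) <= indicator {a<..<b} x *\<^sub>R 1" for j
  proof (rule AE_I2)
   fix x
   show "norm (indicator {a<..<b} x *\<^sub>R \<bar>r (S j) x - r t x\<bar>) <= indicator {a<..<b} x *\<^sub>R 1"
    using r_bounds[of "S j" x] r_bounds[of t x] by (auto simp: indicator_def abs_le_iff)
  qed
 next
  show "(%x. indicator {a<..<b} x *\<^sub>R \<bar>r (S j) x - r t x\<bar>) \<in> borel_measurable lborel" for j
   by (intro borel_measurable_scaleR borel_measurable_indicator borel_measurable_abs borel_measurable_diff) simp_all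
 qed simp_all
 then show ?thesis by simp
qed

lemma r_slice_integrable: "L1_on {a<..<b} (r t)"
 using Lm_integrable[OF admissible_one] by simp

lemma Lm_left_continuous:
 assumes \<phi>: "admissible \<phi>" and t: "0 < t" and S: "S ----> t" "!!j. S j < t"
 shows "(%j. Lm \<phi> (S j)) ----> Lm \<phi> t"
proof -
 obtain B where B: "!!x. \<bar>\<phi> x\<bar> <= B" using admissible(4)[OF \<phi>] by blast
 have le: "\<bar>Lm \<phi> (S j) - Lm \<phi> t\<bar> <= B * (LBINT x:{a<..<b}. \<bar>r (S j) x - r t x\<bar>)" for j
 proof -
  note i = set_integral_diff[OF Lm_integrable[OF \<phi>] Lm_integrable[OF \<phi>]]
  have d: "L1_on {a<..<b} (%x. r (S j) x - r t x)"
   by (rule set_integral_diff(1)[OF r_slice_integrable r_slice_integrable])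
  have "\<bar>Lm \<phi> (S j) - Lm \<phi> t\<bar> <= (LBINT x:{a<..<b}. \<bar>r (S j) x * \<phi> x - r t x * \<phi> x\<bar>)"
   unfolding Lm_def i(2)[symmetric] by (rule set_integral_abs_le[OF i(1)])
  also have "\<dots> <= (LBINT x:{a<..<b}. B * \<bar>r (S j) x - r t x\<bar>)"
  proof (rule set_integral_mono[OF set_integrable_abs[OF i(1)]])
   show "L1_on {a<..<b} (%x. B * \<bar>r (S j) x - r t x\<bar>)" using set_integrable_abs[OF d] by simp
   show "\<bar>r (S j) x * \<phi> x - r t x * \<phi> x\<bar> <= B * \<bar>r (S j) x - r t x\<bar>" for x
    unfolding left_diff_distrib[symmetric] abs_mult using B[of x] by (subst mult.commute) (simp add: mult_right_mono)
  qed
  finally show ?thesis by simp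
 qed
 have lim: "(%j. B * (LBINT x:{a<..<b}. \<bar>r (S j) x - r t x\<bar>)) ----> 0"
  using tendsto_mult_left[OF r_L1_left[OF t S], of B] by simp
 have "(%j. \<bar>Lm \<phi> (S j) - Lm \<phi> t\<bar>) ----> 0"
  by (rule tendsto_sandwich[OF _ _ tendsto_const lim]; intro always_eventually allI; rule le abs_ge_zero)
 then have "(%j. Lm \<phi> (S j) - Lm \<phi> t) ----> 0" by (rule tendsto_rabs_zero_cancel)
 then show ?thesis by (simp add: LIM_zero_iff)
qed

lemma Y_eq_Lm:
 assumes \<phi>: "admissible \<phi>" and s: "0 <= s" "s <= q" "q <= T"
 shows "(LBINT t:{s<..<q}. Y \<phi> t) = (LBINT t:{s<..<q}. Lm \<phi> t)" "L1_on {s<..<q} (Lm \<phi>)"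
proof -
 obtain B where B: "!!x. \<bar>\<phi> x\<bar> <= B" using admissible(4)[OF \<phi>] by blast
 note m [measurable] = admissible(2)[OF \<phi>]
 have Yi: "L1_on {s<..<q} (Y \<phi>)" by (rule Y_integrable[OF m B])
 have "AE z in lborel \<Otimes>\<^sub>M lborel. z \<in> cyl T a b --> r (fst z) (snd z) = rr z" using r_eq_rr unfolding lborel_prod .
 from lborel_pair.AE_pair[OF this]
 have ae: "AE t\<in>{s<..<q} in lborel. Y \<phi> t = Lm \<phi> t"
 proof eventually_elim
  case (elim t)
  show ?case
  proof
   assume t: "t \<in> {s<..<q}"
   show "Y \<phi> t = Lm \<phi> t"
    unfolding Y_def Lm_def
   proof (rule set_integral_cong_AE_integrable[OF _ Lm_integrable[OF \<phi>]])
    show "L1_on {a<..<b} (%x. rr (t, x) * \<phi> x)"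
     by (rule slice_integrable[OF m B]) (use rr_bounds in auto)
    show "AE x\<in>{a<..<b} in lborel. rr (t, x) * \<phi> x = r t x * \<phi> x"
     using elim by eventually_elim (use t s in \<open>auto simp: cyl_def\<close>)
   qed
  qed
 qed
 have "(%(t, x). indicator {a<..<b} x *\<^sub>R (r t x * \<phi> x)) \<in> borel_measurable (lborel \<Otimes>\<^sub>M lborel)"
 proof -
  have 1: "(%z. r (fst z) (snd z)) \<in> borel_measurable (lborel \<Otimes>\<^sub>M lborel)"
   unfolding lborel_prod using r_measurable by simp
  show ?thesis unfolding case_prod_unfold using 1 by measurable
 qed
 from lborel.borel_measurable_lebesgue_integral[OF this]
 have "Lm \<phi> \<in> borel_measurable borel" unfolding Lm_def[abs_def] set_lebesgue_integral_def by simp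
 then have Lme: "meas_on {s<..<q} (Lm \<phi>)" by (simp add: set_borel_measurable_def)
 show i: "L1_on {s<..<q} (Lm \<phi>)" by (rule set_integrable_cong_AE_imp[OF Yi Lme ae])
 show "(LBINT t:{s<..<q}. Y \<phi> t) = (LBINT t:{s<..<q}. Lm \<phi> t)" by (rule set_integral_cong_AE_integrable[OF Yi i ae])
qed

text \<open>By almost monotonicity \<open>X k \<phi> \<sigma>\<close> is below the average of
  \<open>X k \<phi>\<close> over (t - h, t), which tends to the average of \<open>Lm \<phi>\<close>
  and so to at most \<open>Lm \<phi> t\<close>. The gap h is the price for having time integrals
  only; in return the bound is uniform in \<sigma>.\<close>

lemma X_eventually_le:
 assumes \<phi>: "admissible \<phi>" and t: "0 < h" "h <= t" "t <= T" and \<eta>: "0 < \<eta>"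
 shows "EV k. \<forall>\<sigma>\<in>{0..t - h}. X k \<phi> \<sigma> <= Lm \<phi> t + \<eta>"
proof -
 have s: "0 <= t - h" "t - h <= t" "t <= T" using t by auto
 have "(LBINT \<sigma>:{t - h<..<t}. Lm \<phi> \<sigma>) <= (t - (t - h)) * Lm \<phi> t"
  by (rule LBINT_bounds_const(1)[OF Y_eq_Lm(2)[OF \<phi> s]]) (use t in \<open>auto intro: Lm_mono[OF \<phi>]\<close>)
 then have "(LBINT \<sigma>:{t - h<..<t}. Y \<phi> \<sigma>) < h * (Lm \<phi> t + \<eta> / 2)"
  unfolding Y_eq_Lm(1)[OF \<phi> s] distrib_left using mult_pos_pos[OF t(1), of "\<eta> / 2"] \<eta> by simp
 from order_tendstoD(2)[OF admissible(6)[OF \<phi> s] this]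
 have e1: "EV k. (LBINT \<sigma>:{t - h<..<t}. X k \<phi> \<sigma>) < h * (Lm \<phi> t + \<eta> / 2)" .
 have "EV k. \<forall>s t. 0 <= s --> s <= t --> t <= T --> X k \<phi> s - \<eta> / 2 <= X k \<phi> t"
  by (rule admissible(5)[OF \<phi>]) (use \<eta> in simp)
 with e1 show ?thesis
 proof eventually_elim
  case (elim k)
  show ?case
  proof
   fix \<sigma> assume \<sigma>: "\<sigma> \<in> {0..t - h}"
   have "(t - (t - h)) * (X k \<phi> \<sigma> - \<eta> / 2) <= (LBINT \<sigma>:{t - h<..<t}. X k \<phi> \<sigma>)"
    by (rule LBINT_bounds_const(2)[OF X_integrable[OF admissible(1)[OF \<phi>] s(1)] s(2)])
     (use elim(2)[rule_format, of \<sigma>] \<sigma> t in auto)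
   then have "h * (X k \<phi> \<sigma> - \<eta> / 2) < h * (Lm \<phi> t + \<eta> / 2)" using elim(1) by simp
   then have "X k \<phi> \<sigma> - \<eta> / 2 < Lm \<phi> t + \<eta> / 2" using t by (simp add: mult_less_cancel_left_pos)
   then show "X k \<phi> \<sigma> <= Lm \<phi> t + \<eta>" by simp
  qed
 qed
qed

lemma X_one_init: "(%k. X k (%x. 1) 0) ----> Lm (%x. 1) 0"
proof -
 have i: "L1_on {a<..<b} (%x. v k 0 x)" for k
  using v_integrable[of 0 "%x. 1" k] by simp
 have j: "L1_on {a<..<b} r0" using r_slice_integrable[of 0] by (simp add: r_def[abs_def])
 have le: "\<bar>X k (%x. 1) 0 - Lm (%x. 1) 0\<bar> <= (LBINT x:{a<..<b}. \<bar>v k 0 x - r0 x\<bar>)" for k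
 proof -
  have "X k (%x. 1) 0 - Lm (%x. 1) 0 = (LBINT x:{a<..<b}. v k 0 x - r0 x)"
   unfolding X_def Lm_def using set_integral_diff(2)[OF i j] by (simp add: r_def)
  then show ?thesis using set_integral_abs_le[OF set_integral_diff(1)[OF i j]] by simp
 qed
 have "(%k. \<bar>X k (%x. 1) 0 - Lm (%x. 1) 0\<bar>) ----> 0"
  by (rule tendsto_sandwich[OF _ _ tendsto_const init]; intro always_eventually allI; rule le abs_ge_zero)
 then have "(%k. X k (%x. 1) 0 - Lm (%x. 1) 0) ----> 0" by (rule tendsto_rabs_zero_cancel)
 then show ?thesis by (simp add: LIM_zero_iff)
qed

text \<open>Left-continuity makes the average of \<open>Lm\<close> over a short window before t
  nearly \<open>Lm (%x. 1) t\<close>, and almost monotonicity bounds the averages by the value at t.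
  At t = 0 there is no earlier window, and the convergence of the initial values is used.\<close>

lemma X_one_eventually_ge:
 assumes t: "t \<in> {0..T}" and \<eta>: "0 < \<eta>"
 shows "EV k. Lm (%x. 1) t - \<eta> <= X k (%x. 1) t"
proof (cases "t = 0")
 case True
 have "EV k. Lm (%x. 1) 0 - \<eta> < X k (%x. 1) 0"
  by (rule order_tendstoD(1)[OF X_one_init]) (use \<eta> in simp)
 then show ?thesis unfolding True by eventually_elim simp
next
 case False
 then have t0: "0 < t" using t by simp
 note one = admissible_one
 have "(%j. Lm (%x. 1) (t - t / (real j + 2))) ----> Lm (%x. 1) t"
  by (rule Lm_left_continuous[OF one t0]) (use t0 in \<open>real_asymp, simp\<close>)
 from order_tendstoD(1)[OF this, of "Lm (%x. 1) t - \<eta> / 3"] \<eta>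
 obtain j where j: "Lm (%x. 1) t - \<eta> / 3 < Lm (%x. 1) (t - t / (real j + 2))"
  by (auto simp: eventually_sequentially)
 define h where "h = t / (real j + 2)"
 have h: "0 < h" "h < t" using t0 by (auto simp: h_def divide_less_eq)
 have s: "0 <= t - h" "t - h <= t" "t <= T" using h t by auto
 have "(t - (t - h)) * (Lm (%x. 1) t - \<eta> / 3) <= (LBINT \<sigma>:{t - h<..<t}. Lm (%x. 1) \<sigma>)"
 proof (rule LBINT_bounds_const(2)[OF Y_eq_Lm(2)[OF one s] s(2)])
  fix \<sigma> assume "\<sigma> \<in> {t - h<..<t}"
  then have "Lm (%x. 1) (t - h) <= Lm (%x. 1) \<sigma>" using h by (intro Lm_mono[OF one]) auto
  then show "Lm (%x. 1) t - \<eta> / 3 <= Lm (%x. 1) \<sigma>" using j by (simp add: h_def)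
 qed
 moreover have "h * (Lm (%x. 1) t - \<eta> * 2 / 3) < h * (Lm (%x. 1) t - \<eta> / 3)"
  using h \<eta> by (intro mult_strict_left_mono) auto
 ultimately have "h * (Lm (%x. 1) t - \<eta> * 2 / 3) < (LBINT \<sigma>:{t - h<..<t}. Y (%x. 1) \<sigma>)"
  unfolding Y_eq_Lm(1)[OF one s] by simp
 from order_tendstoD(1)[OF admissible(6)[OF one s] this]
 have e1: "EV k. h * (Lm (%x. 1) t - \<eta> * 2 / 3) < (LBINT \<sigma>:{t - h<..<t}. X k (%x. 1) \<sigma>)" .
 have "EV k. \<forall>s t. 0 <= s --> s <= t --> t <= T --> X k (%x. 1) s - \<eta> / 3 <= X k (%x. 1) t"
  by (rule admissible(5)[OF one]) (use \<eta> in simp)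
 with e1 show ?thesis
 proof eventually_elim
  case (elim k)
  have "(LBINT \<sigma>:{t - h<..<t}. X k (%x. 1) \<sigma>) <= (t - (t - h)) * (X k (%x. 1) t + \<eta> / 3)"
   by (rule LBINT_bounds_const(1)[OF X_integrable[OF admissible(1)[OF one] s(1)] s(2)])
    (use elim(2)[rule_format, of _ t] h s in \<open>auto simp: diff_le_eq\<close>)
  then have "h * (Lm (%x. 1) t - \<eta> * 2 / 3) < h * (X k (%x. 1) t + \<eta> / 3)" using elim(1) by simp
  then have "Lm (%x. 1) t - \<eta> * 2 / 3 < X k (%x. 1) t + \<eta> / 3" using h by (simp add: mult_less_cancel_left_pos)
  then show ?case by simp
 qed
qed

text \<open>At t = 0 the representative is defined separately, so the comparison with later times
  has to go through the approximations.\<close>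

lemma Lm_one_mono:
 assumes t: "0 <= s" "s <= t" "t <= T"
 shows "Lm (%x. 1) s <= Lm (%x. 1) t"
proof (cases "0 < s \<or> t = 0")
 case True
 then show ?thesis using Lm_mono[OF admissible_one, of s t] t by auto
next
 case False
 then have [simp]: "s = 0" and t0: "0 < t" using t by auto
 show ?thesis
 proof (rule field_le_epsilon)
  fix e :: real assume e: "0 < e"
  have "EV k. X k (%x. 1) 0 <= Lm (%x. 1) t + e"
   using X_eventually_le[OF admissible_one t0 order_refl t(3) e] by simp
  from tendsto_upperbound[OF X_one_init this] show "Lm (%x. 1) s <= Lm (%x. 1) t + e" by simp
 qed
qed

text \<open>Left-continuity in the negative norm follows from left-continuity in L^1, which
  dominates that norm; the same holds for the initial values.\<close>

lemma r_time_representative: "time_representative T a b (%k x. v k 0 x) \<rho> r"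
 unfolding time_representative_def
proof (intro conjI ballI)
 have "{0..T} \<times> {a<..<b} \<in> sets borel"
  unfolding borel_prod[symmetric] by (intro pair_measureI) auto
 then show "meas_on ({0..T} \<times> {a<..<b}) (%(t, x). r t x)"
  unfolding set_borel_measurable_def case_prod_unfold using r_measurable by measurable
 show "AE x\<in>{a<..<b} in lborel. 0 <= r t x & r t x <= 1" for t using r_bounds by auto
 show "AE z\<in>cyl T a b in lborel. (case z of (t, x) => r t x = \<rho> t x)"
  using r_eq_rr rr_eq by eventually_elim auto
 show "((%s. norm_Wm11 a b (%x. r s x - r t x)) \<longlongrightarrow> 0) (at_left t)" if t: "t \<in> {0<..T}" for t
 proof (rule tendsto_at_left_sequentially[of 0])
  show "0 < t" using t by simp
  fix S :: "nat => real" assume S: "!!j. S j < t" "S ----> t"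
  note n = norm_Wm11_bounds(2,3)[OF set_integral_diff(1)[OF r_slice_integrable r_slice_integrable]]
  show "(%j. norm_Wm11 a b (%x. r (S j) x - r t x)) ----> 0"
   by (rule tendsto_sandwich[OF _ _ tendsto_const r_L1_left[of t S]]) (use t S n in auto)
 qed
 have i: "L1_on {a<..<b} (%x. v k 0 x - r 0 x)" for k
  using v_integrable[of 0 "%x. 1" k] by (intro set_integral_diff(1) r_slice_integrable) simp
 have r0: "r 0 = r0" by (simp add: r_def[abs_def])
 show "(%k. norm_Wm11 a b (%x. v k 0 x - r 0 x)) ----> 0"
  by (rule tendsto_sandwich[OF _ _ tendsto_const init]) (use norm_Wm11_bounds(2,3)[OF i] r0 in auto)
qed

end

section \<open>A discrete differential inequality\<close>

text \<open>The step hypothesis has l^6 at the right end, and l may jump. On a partition, a step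
  with ratio at most 1 + \<theta> loses a factor (1 + \<theta>)^6; a step with a larger ratio gains
  enough by itself, since N makes the required increment d at most \<theta> l(0)^7. Finally \<theta>
  tends to 0.\<close>

lemma power_growth:
 fixes l :: "real => real"
 assumes t: "0 <= t" and c: "0 <= c" and l0: "0 < l 0"
  and mono: "!!s s'. 0 <= s ==> s <= s' ==> s' <= t ==> l s <= l s'"
  and step: "!!s s'. 0 <= s ==> s < s' ==> s' <= t ==> c * (s' - s) <= l s' ^ 6 * (l s' - l s)"
 shows "l 0 ^ 7 + 7 * c * t <= l t ^ 7"
proof -
 have key: "l 0 ^ 7 + 7 * c * t / (1 + \<theta>) ^ 6 <= l t ^ 7" if \<theta>: "0 < \<theta>" for \<theta> :: real
 proof -
  obtain N :: nat where N: "c * t / (\<theta> * l 0 ^ 7) < real N" using reals_Archimedean2 by blast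
  have "0 <= c * t / (\<theta> * l 0 ^ 7)" using c t \<theta> l0 by simp
  then have N0: "0 < N" using N by (metis gr0I less_le_not_le of_nat_0)
  define d where "d = c * t / N"
  define y where "y i = l (i * t / N)" for i :: nat
  have d0: "0 <= d" using c t by (simp add: d_def)
  have dN: "d <= \<theta> * l 0 ^ 7" using N N0 \<theta> l0 by (simp add: d_def field_simps)
  have part: "0 <= i * t / N" "i * t / N <= Suc i * t / N" for i :: nat
   using t by (auto simp: divide_right_mono mult_right_mono)
  have top: "Suc i * t / N <= t" if "i < N" for i :: nat
  proof -
   have "Suc i * t <= N * t" using that t by (intro mult_right_mono) auto
   then show ?thesis using N0 by (simp add: divide_le_eq mult.commute)
  qed
  have "l 0 ^ 7 + i * (7 * d / (1 + \<theta>) ^ 6) <= y i ^ 7" if "i <= N" for i :: nat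
   using that
  proof (induction i)
   case 0
   then show ?case by (simp add: y_def)
  next
   case (Suc i)
   then have i: "i < N" by simp
   have IH: "l 0 ^ 7 + i * (7 * d / (1 + \<theta>) ^ 6) <= y i ^ 7" using Suc by simp
   have y0: "l 0 <= y i" unfolding y_def by (rule mono) (use part[of i] top[OF i] in auto)
   have yy: "y i <= y (Suc i)" unfolding y_def by (rule mono[OF part top[OF i]])
   have yp: "0 < y i" "0 < y (Suc i)" using y0 yy l0 by auto
   have stp: "d <= y (Suc i) ^ 6 * (y (Suc i) - y i)"
   proof (cases "t = 0")
    case True
    then show ?thesis using yy yp by (simp add: d_def)
   next
    case False
    have "i * t / N < Suc i * t / N" using False t N0 by (simp add: divide_strict_right_mono)
    from step[OF part(1) this top[OF i]] have "c * (Suc i * t / N - i * t / N) <= y (Suc i) ^ 6 * (y (Suc i) - y i)"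
     by (simp add: y_def)
    moreover have "c * (Suc i * t / N - i * t / N) = d" by (simp add: d_def algebra_simps add_divide_distrib)
    ultimately show ?thesis by simp
   qed
   have "7 * d / (1 + \<theta>) ^ 6 <= y (Suc i) ^ 7 - y i ^ 7"
   proof (cases "y (Suc i) <= y i * (1 + \<theta>)")
    case True
    define x z where "x = y (Suc i)" and "z = y i"
    have xz: "0 < z" "z <= x" "x <= z * (1 + \<theta>)" "d <= x ^ 6 * (x - z)" using yp yy True stp by (auto simp: x_def z_def)
    have "x ^ 6 <= (z * (1 + \<theta>)) ^ 6" using xz by (intro power_mono) auto
    then have "x ^ 6 * (x - z) <= (z * (1 + \<theta>)) ^ 6 * (x - z)" using xz by (intro mult_right_mono) auto
    then have "d <= (1 + \<theta>) ^ 6 * (z ^ 6 * (x - z))" using xz by (simp add: power_mult_distrib mult_ac)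
    then have 1: "d / (1 + \<theta>) ^ 6 <= z ^ 6 * (x - z)" using \<theta> by (simp add: divide_le_eq mult.commute)
    have "x ^ 7 - z ^ 7 = (x - z) * (\<Sum>j<7. z ^ (7 - Suc j) * x ^ j)" by (rule power_diff_sumr2)
    also have "\<dots> >= (x - z) * (\<Sum>j<(7::nat). z ^ 6)"
    proof (intro mult_left_mono sum_mono)
     fix j :: nat assume "j \<in> {..<7}"
     then have "z ^ 6 = z ^ (7 - Suc j) * z ^ j" by (simp flip: power_add)
     also have "\<dots> <= z ^ (7 - Suc j) * x ^ j" using xz by (intro mult_left_mono power_mono) auto
     finally show "z ^ 6 <= z ^ (7 - Suc j) * x ^ j" .
    qed (use xz in auto)
    finally have "7 * (z ^ 6 * (x - z)) <= x ^ 7 - z ^ 7" by (simp add: mult_ac)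
    then show ?thesis using 1 unfolding x_def z_def by linarith
   next
    case False
    \<comment> \<open>A jump by more than the factor 1 + \<theta> raises y^7 by at least 7 \<theta>
      y^7, by Bernoulli's inequality, and \<theta> y^7 >= \<theta> l(0)^7 >= d.\<close>
    have "7 * d / (1 + \<theta>) ^ 6 <= 7 * d" using \<theta> d0 by (simp add: divide_le_eq mult_right_mono one_le_power mult_le_cancel_left1)
    also have "\<dots> <= 7 * (\<theta> * y i ^ 7)"
     using dN \<theta> power_mono[OF y0, of 7] l0 by (smt (verit) mult_left_mono)
    also have "\<dots> <= ((1 + \<theta>) ^ 7 - 1) * y i ^ 7"
    proof -
     have "1 + 7 * \<theta> <= (1 + \<theta>) ^ 7" using Bernoulli_inequality[of \<theta> 7] \<theta> by simp
     then have "7 * \<theta> * y i ^ 7 <= ((1 + \<theta>) ^ 7 - 1) * y i ^ 7" using yp by (intro mult_right_mono) auto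
     then show ?thesis by simp
    qed
    also have "\<dots> = (y i * (1 + \<theta>)) ^ 7 - y i ^ 7" by (simp add: power_mult_distrib left_diff_distrib right_diff_distrib mult.commute)
    also have "\<dots> <= y (Suc i) ^ 7 - y i ^ 7" using False yp \<theta> by (intro diff_right_mono power_mono) auto
    finally show ?thesis .
   qed
   moreover have "real (Suc i) * (7 * d / (1 + \<theta>) ^ 6) = i * (7 * d / (1 + \<theta>) ^ 6) + 7 * d / (1 + \<theta>) ^ 6"
    unfolding of_nat_Suc distrib_right by simp
   ultimately show ?case using IH by linarith
  qed
  from this[of N] show ?thesis using N0 by (simp add: d_def y_def mult.assoc)
 qed
 have "((%\<theta>. l 0 ^ 7 + 7 * c * t / (1 + \<theta>) ^ 6) \<longlongrightarrow> l 0 ^ 7 + 7 * c * t / (1 + 0) ^ 6) (at_right (0::real))"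
  by (intro tendsto_intros) auto
 moreover have "\<forall>\<^sub>F \<theta> in at_right (0::real). l 0 ^ 7 + 7 * c * t / (1 + \<theta>) ^ 6 <= l t ^ 7"
  using eventually_at_right_less[of "0::real"] by eventually_elim (rule key)
 ultimately have "l 0 ^ 7 + 7 * c * t / (1 + 0) ^ 6 <= l t ^ 7" by (rule tendsto_upperbound) simp
 then show ?thesis by simp
qed

section \<open>The limit of the thin film solutions\<close>

lemma set_measure_eq: "A \<in> sets borel ==> measure lebesgue A = measure lborel (A :: real set)"
 by (simp add: measure_completion)

locale film_sequence =
 fixes a b n T p :: real and uin duin :: "real => real" and u ux uxx uxxx :: "nat => real => real => real"
  and eps :: "nat => real" and \<rho> :: "real => real => real"
 assumes film: "!!k. film a b n (eps k) uin duin (u k) (ux k) (uxx k) (uxxx k)"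
  and eps0: "eps ----> 0" and T: "0 < T" and p: "1 <= p"
  and conv: "tendsto_Lp_Wm11 p T a b (%k t x. B_eps n (eps k) (u k t x)) \<rho>"
  and rho_meas: "meas_on (cyl T a b) (%(t, x). \<rho> t x)"
  and rho_bd: "AE z\<in>cyl T a b in lborel. (case z of (t, x) => 0 <= \<rho> t x & \<rho> t x <= 1)"
begin

text \<open>Copies of the quantities of \<open>film\<close>, indexed by k. \<open>E0\<close>,
  \<open>M\<close> and \<open>K\<close> carry no index: the estimates are uniform along the
  sequence.\<close>

definition "v k t x = B_eps n (eps k) (u k t x)"
definition "X k \<phi> t = (LBINT x:{a<..<b}. v k t x * \<phi> x)"
definition "D k t = (LBINT x:{a<..<b}. u k t x * (uxx k t x)^2)"
definition "L k = \<bar>ln (eps k)\<bar>"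
definition "E0 = (LBINT x:{a<..<b}. (duin x)^2)"
definition "M = max 1 (1 / (b - a) + sqrt (E0 * (b - a)))"
definition "P k = 1 + (B_fun n 1 + ln M) / L k"
definition "w k = 1 / sqrt (sqrt (L k))"
definition "K = (E0 * T + E0 / 2) / 2 + 5/6 * ((1 + B_fun n 1 + ln M) * (b - a) + 3 * E0 * T) + 3/2 * E0 * T
 + (E0 / 2 + (R_const n + 2 * M) * (T * (b - a))) / 2"
text \<open>\<open>u 0 0\<close> is the first solution of the sequence at time 0, the continuous
  representative of \<open>uin\<close>; by \<open>u_init_eq\<close> all solutions share it. The
  limit of the initial values is the indicator of its positivity set.\<close>

definition "r0 x = (indicator {x \<in> {a<..<b}. 0 < u 0 0 x} x :: real)"

lemma ab: "a < b" and n: "0 < n" "n < 3" and eps: "0 < eps k" "eps k < 1"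
 using film[of 0] film[of k] by (auto simp: film_def)

lemma v_facts:
 shows v_cont: "continuous_on ({0..} \<times> {a..b}) (%(t, x). v k t x)"
  and v_bounds: "0 <= t ==> x \<in> {a..b} ==> 0 <= v k t x & v k t x <= P k"
  and u_nonneg: "0 <= t ==> x \<in> {a..b} ==> 0 <= u k t x"
  and u_cont_slice: "0 <= t ==> continuous_on {a..b} (u k t)"
  and u_holder: "0 <= t ==> x \<in> {a..b} ==> y \<in> {a..b} ==> (u k t x - u k t y)^2 <= E0 * \<bar>x - y\<bar>"
  and D_nonneg: "0 <= t ==> 0 <= D k t"
  and D_integrable: "L1_on {0<..<T} (D k)"
  and L_pos: "0 < L k"
  and E0_nonneg: "0 <= E0"
  and u_init: "AE x\<in>{a<..<b} in lborel. u k 0 x = uin x"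
  and mass0: "(LBINT x:{a<..<b}. u k 0 x) = 1"
proof -
 interpret F: film a b n "eps k" uin duin "u k" "ux k" "uxx k" "uxxx k" by (rule film)
 have eqs: "F.L = L k" "F.E0 = E0" "F.M = M" "F.P = P k" "F.Dd = D k"
  by (simp_all add: fun_eq_iff F.L_def F.E0_def F.M_def F.P_def F.Dd_def L_def E0_def M_def P_def D_def)
 show "continuous_on ({0..} \<times> {a..b}) (%(t, x). v k t x)" unfolding v_def by (rule F.rho_cont)
 show "0 <= t ==> x \<in> {a..b} ==> 0 <= v k t x & v k t x <= P k" unfolding v_def using F.rho_bounds[of t x] eqs by simp
 show "0 <= t ==> x \<in> {a..b} ==> 0 <= u k t x" by (rule F.u_nonneg)
 show "0 <= t ==> continuous_on {a..b} (u k t)" by (rule F.u_cont_slice)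
 show "0 <= t ==> x \<in> {a..b} ==> y \<in> {a..b} ==> (u k t x - u k t y)^2 <= E0 * \<bar>x - y\<bar>"
  using F.u_holder[of t x y] eqs by simp
 show "0 <= t ==> 0 <= D k t" using F.Dd_nonneg[of t] eqs by simp
 show "L1_on {0<..<T} (D k)" using F.dissipation_bound(1)[OF T] eqs by simp
 show "0 < L k" using F.L_pos eqs by simp
 show "0 <= E0" using F.E0_nonneg eqs by simp
 show "AE x\<in>{a<..<b} in lborel. u k 0 x = uin x" by (rule F.u_init)
 show "(LBINT x:{a<..<b}. u k 0 x) = 1" by (rule F.u_mass) simp
qed

lemma X_incr_k:
 assumes L1: "1 <= L k" and st: "0 <= s" "s <= t" "t <= T" and \<phi>: "\<phi> \<in> test_fun {a<..<b}" and \<phi>0: "!!x. 0 <= \<phi> x"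
  and B: "!!x. \<bar>\<phi> x\<bar> <= B" "!!x. \<bar>deriv \<phi> x\<bar> <= B" "!!x. \<bar>deriv (deriv \<phi>) x\<bar> <= B"
 shows "- (B * (K * w k)) <= X k \<phi> t - X k \<phi> s"
proof -
 interpret F: film a b n "eps k" uin duin "u k" "ux k" "uxx k" "uxxx k" by (rule film)
 have eqs: "F.L = L k" "F.X = X k" "F.w = w k" "F.K0 T = K"
  by (simp_all add: fun_eq_iff F.L_def F.E0_def F.M_def F.X_def F.w_def F.K0_def L_def E0_def M_def X_def v_def w_def K_def)
 show ?thesis using F.X_almost_increasing[unfolded eqs(1-3), OF L1 st \<phi> \<phi>0 B] unfolding eqs(4) .
qed

lemma X_one_incr_k:
 assumes L1: "1 <= L k" and st: "0 <= s" "s < t" "t <= T" and \<phi>: "\<phi> \<in> test_fun {a<..<b}" and \<phi>0: "!!x. 0 <= \<phi> x" "!!x. \<phi> x <= 1"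
  and B: "B >= 1" "!!x. \<bar>deriv \<phi> x\<bar> <= B" "!!x. \<bar>deriv (deriv \<phi>) x\<bar> <= B"
 shows "(LBINT \<sigma>:{s<..<t}. D k \<sigma>) - 2 * (P k * (LBINT x:{a<..<b}. 1 - \<phi> x)) - 2 * (B * (K * w k)) <= X k (%x. 1) t - X k (%x. 1) s"
proof -
 interpret F: film a b n "eps k" uin duin "u k" "ux k" "uxx k" "uxxx k" by (rule film)
 have eqs: "F.L = L k" "F.X = X k" "F.w = w k" "F.P = P k" "F.Dd = D k" "F.K0 T = K"
  by (simp_all add: fun_eq_iff F.L_def F.E0_def F.M_def F.X_def F.w_def F.K0_def F.P_def F.Dd_def D_def P_def L_def E0_def M_def X_def v_def w_def K_def)
 show ?thesis using F.X_one_increment[unfolded eqs(1-5), OF L1 st \<phi> \<phi>0 B] unfolding eqs(6) .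
qed

lemma D_lower_k:
 "AE t\<in>{0<..<T} in lborel. (\<forall>\<delta>>0. 3 * \<delta> * (b - a) <= 1 -->
    ((\<exists>x\<in>{a..b}. u k t x <= \<delta>) --> 9 * (1 - 3 * \<delta> * (b - a)) ^ 4 <= (measure lborel {x\<in>{a<..<b}. u k t x > \<delta>}) ^ 6 * D k t) &
    (u k t a <= \<delta> --> u k t b <= \<delta> --> 144 * (1 - 3 * \<delta> * (b - a)) ^ 4 <= (measure lborel {x\<in>{a<..<b}. u k t x > \<delta>}) ^ 6 * D k t))"
proof -
 interpret F: film a b n "eps k" uin duin "u k" "ux k" "uxx k" "uxxx k" by (rule film)
 have eq: "F.Dd = D k" by (simp add: fun_eq_iff F.Dd_def D_def)
 show ?thesis using F.AE_good_time[OF T] unfolding F.good_time_def eq by eventually_elim blast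
qed

lemma L_at_top: "filterlim L at_top sequentially"
proof -
 have "filterlim eps (at_right 0) sequentially"
  using eps0 eps by (simp add: filterlim_at order_less_imp_not_eq2)
 from filterlim_compose[OF ln_at_0 this] have "filterlim (%k. - ln (eps k)) at_top sequentially"
  by (simp add: filterlim_uminus_at_top)
 moreover have "L = (%k. - ln (eps k))" using ln_eps(1)[OF n eps] by (simp add: L_def fun_eq_iff)
 ultimately show ?thesis by simp
qed

lemma L_ge: "EV k. c <= L k"
 using L_at_top by (simp add: filterlim_at_top)

lemma div_L: "(%k. c / L k) ----> 0"
 by (rule tendsto_divide_0[OF tendsto_const]) (rule filterlim_at_top_imp_at_infinity[OF L_at_top])

lemma P_lim: "P ----> 1"
 unfolding P_def[abs_def] using tendsto_add[OF tendsto_const div_L, of 1] by simp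

lemma w_lim: "w ----> 0"
proof -
 have "filterlim (%k. sqrt (sqrt (L k))) at_top sequentially"
  by (intro filterlim_compose[OF sqrt_at_top] L_at_top)
 then show ?thesis unfolding w_def[abs_def]
  by (intro tendsto_divide_0[OF tendsto_const] filterlim_at_top_imp_at_infinity)
qed

lemma B_eps_lim: 
 assumes "0 < \<delta>"
 shows "(%k. B_eps n (eps k) \<delta>) ----> 1"
proof (rule tendsto_sandwich)
 have "EV k. eps k < \<delta>" by (rule order_tendstoD(2)[OF eps0 assms])
 then show "EV k. 1 + (ln \<delta> - 1 / ((4 - n) * (3 - n))) / L k <= B_eps n (eps k) \<delta>"
  by eventually_elim (use B_eps_lower[OF n eps] in \<open>auto simp: L_def\<close>)
 show "EV k. B_eps n (eps k) \<delta> <= 1 + (B_fun n 1 + ln (max 1 \<delta>)) / L k"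
  using B_eps_upper[OF n eps, of \<delta> "max 1 \<delta>"] by (intro always_eventually allI) (simp add: L_def)
qed (use tendsto_add[OF tendsto_const div_L, of 1] in simp_all)

lemma small: "0 < \<eta> ==> EV k. C * (K * w k) < \<eta>"
 using order_tendstoD(2)[OF tendsto_mult_left[OF tendsto_mult_left[OF w_lim, of K], of C], of \<eta>] by simp

lemma X_increasing:
 assumes \<phi>: "\<phi> \<in> test_fun {a<..<b}" "!!x. 0 <= \<phi> x" and \<eta>: "0 < \<eta>"
 shows "EV k. \<forall>s t. 0 <= s --> s <= t --> t <= T --> X k \<phi> s - \<eta> <= X k \<phi> t"
proof -
 obtain B where B: "!!x. \<bar>\<phi> x\<bar> <= B" "!!x. \<bar>deriv \<phi> x\<bar> <= B" "!!x. \<bar>deriv (deriv \<phi>) x\<bar> <= B"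
  by (rule test_fun_bounded[OF \<phi>(1)], rule that)
 show ?thesis
  using L_ge[of 1] small[OF \<eta>, of B]
 proof eventually_elim
  case (elim k)
  show ?case
  proof (intro allI impI)
   fix s t assume "0 <= s" "s <= t" "t <= T"
   from X_incr_k[OF elim(1) this \<phi> B] elim(2) show "X k \<phi> s - \<eta> <= X k \<phi> t" by linarith
  qed
 qed
qed

text \<open>The order of choices matters: \<phi> is fixed close to 1 first. The bound B on its
  derivatives may be large, but it multiplies \<open>w k\<close>, which tends to 0.\<close>

lemma X_one_dissipation:
 assumes \<eta>: "0 < \<eta>"
 shows "EV k. \<forall>s t. 0 <= s --> s < t --> t <= T -->
  X k (%x. 1) s + (LBINT \<sigma>:{s<..<t}. D k \<sigma>) - \<eta> <= X k (%x. 1) t"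
proof -
 have \<eta>8: "0 < \<eta> / 8" using \<eta> by simp
 obtain \<phi> where \<phi>: "\<phi> \<in> test_fun {a<..<b}" "!!x. 0 <= \<phi> x" "!!x. \<phi> x <= 1" "(LBINT x:{a<..<b}. 1 - \<phi> x) < \<eta> / 8"
  by (rule test_fun_approximates_one[OF ab \<eta>8], rule that)
 have I0: "0 <= (LBINT x:{a<..<b}. 1 - \<phi> x)" by (rule set_integral_nonneg_pointwise) (use \<phi> in auto)
 obtain B0 where B0: "!!x. \<bar>\<phi> x\<bar> <= B0" "!!x. \<bar>deriv \<phi> x\<bar> <= B0" "!!x. \<bar>deriv (deriv \<phi>) x\<bar> <= B0"
  by (rule test_fun_bounded[OF \<phi>(1)], rule that)
 define B where "B = max 1 B0"
 have B: "1 <= B" "!!x. \<bar>deriv \<phi> x\<bar> <= B" "!!x. \<bar>deriv (deriv \<phi>) x\<bar> <= B"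
  using B0 by (auto simp: B_def intro: order_trans[OF _ max.cobounded2])
 have "EV k. P k < 2" by (rule order_tendstoD(2)[OF P_lim]) simp
 moreover have "EV k. B * (K * w k) < \<eta> / 4" by (rule small) (use \<eta> in simp)
 ultimately show ?thesis
  using L_ge[of 1]
 proof eventually_elim
  case (elim k)
  show ?case
  proof (intro allI impI)
   fix s t assume st: "0 <= s" "s < t" "t <= T"
   have "P k * (LBINT x:{a<..<b}. 1 - \<phi> x) <= 2 * (LBINT x:{a<..<b}. 1 - \<phi> x)"
    using elim(1) I0 by (intro mult_right_mono) auto
   with X_one_incr_k[OF elim(3) st \<phi>(1-3) B] elim(2) \<phi>(4)
   show "X k (%x. 1) s + (LBINT \<sigma>:{s<..<t}. D k \<sigma>) - \<eta> <= X k (%x. 1) t" by linarith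
  qed
 qed
qed

lemma X_one_increasing:
 assumes \<eta>: "0 < \<eta>"
 shows "EV k. \<forall>s t. 0 <= s --> s <= t --> t <= T --> X k (%x. 1) s - \<eta> <= X k (%x. 1) t"
 using X_one_dissipation[OF \<eta>]
proof eventually_elim
 case (elim k)
 show ?case
 proof (intro allI impI)
  fix s t assume st: "0 <= s" "s <= t" "t <= T"
  show "X k (%x. 1) s - \<eta> <= X k (%x. 1) t"
  proof (cases "s = t")
   case False
   have "0 <= (LBINT \<sigma>:{s<..<t}. D k \<sigma>)" by (rule set_integral_nonneg_pointwise) (use D_nonneg st in auto)
   then show ?thesis using elim[rule_format, of s t] st False by simp
  qed (use \<eta> in simp)
 qed
qed

lemma u_init_eq: "x \<in> {a<..<b} ==> u k 0 x = u 0 0 x"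
proof (rule continuous_AE_eq_imp_eq[of "{a<..<b}" "u k 0" "u 0 0"])
 show "AE x\<in>{a<..<b} in lborel. u k 0 x = u 0 0 x"
  using u_init[of k] u_init[of 0] by eventually_elim auto
qed (auto intro: continuous_on_subset[OF u_cont_slice])

lemma positive_set: "{x \<in> {a<..<b}. c < u k t x} \<in> sets borel" if "0 <= t"
proof -
 have "continuous_on {a<..<b} (u k t)" by (rule continuous_on_subset[OF u_cont_slice[OF that]]) auto
 then have "open ({a<..<b} \<inter> u k t -` {c<..})" by (rule continuous_open_preimage) auto
 moreover have "{a<..<b} \<inter> u k t -` {c<..} = {x \<in> {a<..<b}. c < u k t x}" by auto
 ultimately show ?thesis by (metis borel_open)
qed

lemma r0_facts: "r0 \<in> borel_measurable borel" "0 <= r0 x" "r0 x <= 1"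
 using positive_set[of 0 0 0] by (auto simp: r0_def[abs_def] intro: borel_measurable_indicator)

text \<open>B^eps(s) tends to 1 for s > 0 and is 0 at s = 0, with the bounded sequence
  \<open>P\<close> as majorant.\<close>

lemma initial_limit: "(%k. LBINT x:{a<..<b}. \<bar>v k 0 x - r0 x\<bar>) ----> 0"
proof -
 obtain C where C: "!!k. norm (P k) <= C"
  using convergent_imp_Bseq[OF convergentI[OF P_lim]] by (auto simp: Bseq_def)
 have v1: "L1_on {a<..<b} (v k 0)" for k
 proof -
  have "continuous_on {a..b} (%x. (0::real, x))" "(%x. (0::real, x)) ` {a..b} <= {0..} \<times> {a..b}"
   by (auto intro!: continuous_intros)
  from continuous_on_compose2[OF v_cont this] have "continuous_on {a..b} (v k 0)" by simp
  then show ?thesis by (intro set_integrable_subset[OF borel_integrable_atLeastAtMost']) auto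
 qed
 have pt: "(%k. v k 0 x) ----> r0 x" if x: "x \<in> {a<..<b}" for x
 proof (cases "u 0 0 x = 0")
  case True
  then have "v k 0 x = 0" "r0 x = 0" for k using B_eps_0[OF n eps] u_init_eq[OF x, of k] by (auto simp: v_def r0_def)
  then show ?thesis by simp
 next
  case False
  then have pos: "0 < u 0 0 x" using u_nonneg[of 0 x 0] x by simp
  have "v k 0 x = B_eps n (eps k) (u 0 0 x)" "r0 x = 1" for k
   using u_init_eq[OF x, of k] pos x by (auto simp: v_def r0_def)
  then show ?thesis using B_eps_lim[OF pos] by simp
 qed
 have "(%k. LBINT x:{a<..<b}. \<bar>v k 0 x - r0 x\<bar>) ----> (LBINT x:{a<..<b}. 0)"
  unfolding set_lebesgue_integral_def
 proof (rule integral_dominated_convergence[where w="%x. indicator {a<..<b} x *\<^sub>R (C + 1)"])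
  show "integrable lborel (%x. indicator {a<..<b} x *\<^sub>R (C + 1))"
   using set_integrable_const_interval[of a b "C + 1"] by (simp add: set_integrable_def)
  show "AE x in lborel. (%k. indicator {a<..<b} x *\<^sub>R \<bar>v k 0 x - r0 x\<bar>) ----> indicator {a<..<b} x *\<^sub>R 0"
  proof (rule AE_I2)
   fix x
   show "(%k. indicator {a<..<b} x *\<^sub>R \<bar>v k 0 x - r0 x\<bar>) ----> indicator {a<..<b} x *\<^sub>R 0"
   proof (cases "x \<in> {a<..<b}")
    case True
    have "(%k. \<bar>v k 0 x - r0 x\<bar>) ----> \<bar>r0 x - r0 x\<bar>" by (intro tendsto_intros pt[OF True])
    then show ?thesis using True by simp
   qed simp
  qed
  show "AE x in lborel. norm (indicator {a<..<b} x *\<^sub>R \<bar>v k 0 x - r0 x\<bar>) <= indicator {a<..<b} x *\<^sub>R (C + 1)" for k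
  proof (rule AE_I2)
   fix x
   show "norm (indicator {a<..<b} x *\<^sub>R \<bar>v k 0 x - r0 x\<bar>) <= indicator {a<..<b} x *\<^sub>R (C + 1)"
   proof (cases "x \<in> {a<..<b}")
    case True
    then have "0 <= v k 0 x" "v k 0 x <= C" using v_bounds[of 0 x k] C[of k] by auto
    then have "\<bar>v k 0 x - r0 x\<bar> <= C + 1" using r0_facts(2,3)[of x] by linarith
    then show ?thesis using True by simp
   qed simp
  qed
  show "(%x. indicator {a<..<b} x *\<^sub>R \<bar>v k 0 x - r0 x\<bar>) \<in> borel_measurable lborel" for k
  proof -
   have r0i: "L1_on {a<..<b} r0"
    by (rule set_integrable_bounded_interval[of _ _ _ 1]) (use r0_facts in \<open>auto simp: set_borel_measurable_def\<close>)
   show ?thesis using set_integrable_abs[OF set_integral_diff(1)[OF v1[of k] r0i]] by (auto simp: set_integrable_def)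
  qed
 qed simp_all
 then show ?thesis by simp
qed

sublocale lim: rho_limit a b T p v P \<rho> r0 X
proof (unfold_locales)
 show "tendsto_Lp_Wm11 p T a b v \<rho>" using conv unfolding v_def[abs_def] .
qed (use ab T p v_cont v_bounds P_lim X_increasing X_one_increasing rho_meas rho_bd r0_facts initial_limit in \<open>auto simp: X_def\<close>)

definition "l t = lim.Lm (%x. 1) t"

lemma l_eq: "l t = (LBINT x:{a<..<b}. lim.r t x)" by (simp add: l_def lim.Lm_def)

lemma l_mono: "0 <= s ==> s <= t ==> t <= T ==> l s <= l t"
 unfolding l_def by (rule lim.Lm_one_mono)

lemma l_init: "l 0 = measure lborel {x \<in> {a<..<b}. 0 < u 0 0 x}"
proof -
 have "l 0 = (\<integral>x. indicator {x \<in> {a<..<b}. 0 < u 0 0 x} x \<partial>lborel)"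
  unfolding l_eq set_lebesgue_integral_def
  by (rule Bochner_Integration.integral_cong) (auto simp: lim.r_def r0_def indicator_def)
 then show ?thesis by simp
qed

lemma finite_positive_set: "emeasure lborel {x \<in> {a<..<b}. c < u k t x} < \<infinity>" if "0 <= t"
proof -
 have "emeasure lborel {x \<in> {a<..<b}. c < u k t x} <= emeasure lborel {a<..<b}"
  by (rule emeasure_mono) auto
 also have "\<dots> < \<infinity>" using ab by simp
 finally show ?thesis .
qed

lemma l_init_pos: "0 < l 0"
proof (rule ccontr)
 assume "\<not> 0 < l 0"
 then have z: "measure lborel {x \<in> {a<..<b}. 0 < u 0 0 x} = 0" using l_init by (simp add: zero_less_measure_iff)
 then have "emeasure lborel {x \<in> {a<..<b}. 0 < u 0 0 x} = 0"
  using finite_positive_set[of 0 0 0] by (simp add: emeasure_eq_ennreal_measure)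
 then have "{x \<in> {a<..<b}. 0 < u 0 0 x} \<in> null_sets lborel" using positive_set[of 0 0 0] by auto
 from AE_not_in[OF this] have "AE x\<in>{a<..<b} in lborel. u 0 0 x = 0"
  by eventually_elim (use u_nonneg[of 0 _ 0] in \<open>force simp: less_le\<close>)
 then have "AE x in lborel. indicator {a<..<b} x *\<^sub>R u 0 0 x = 0"
  by eventually_elim (auto simp: indicator_def)
 then have "(LBINT x:{a<..<b}. u 0 0 x) = 0"
  unfolding set_lebesgue_integral_def by (rule integral_eq_zero_AE)
 then show False using mass0[of 0] by simp
qed

lemma X_one_ge_measure:
 assumes t: "0 <= t"
 shows "B_eps n (eps k) \<delta> * measure lborel {x \<in> {a<..<b}. \<delta> < u k t x} <= X k (%x. 1) t"
proof -
 let ?S = "{x \<in> {a<..<b}. \<delta> < u k t x}"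
 have i: "L1_on {a<..<b} (%x. v k t x * 1)"
  by (rule lim.v_integrable[OF t continuous_on_const])
 have "B_eps n (eps k) \<delta> * measure lborel ?S = (\<integral>x. B_eps n (eps k) \<delta> * indicator ?S x \<partial>lborel)" by simp
 also have "\<dots> <= X k (%x. 1) t"
  unfolding X_def set_lebesgue_integral_def
 proof (rule integral_mono)
  show "integrable lborel (%x. B_eps n (eps k) \<delta> * indicator ?S x)"
   using positive_set[OF t] finite_positive_set[OF t] by (intro integrable_mult_right integrable_real_indicator) auto
  show "integrable lborel (%x. indicator {a<..<b} x *\<^sub>R (v k t x * 1))" using i by (simp add: set_integrable_def)
  show "B_eps n (eps k) \<delta> * indicator ?S x <= indicator {a<..<b} x *\<^sub>R (v k t x * 1)" for x
   using B_eps_mono[OF n eps, of \<delta> "u k t x" k] v_bounds[OF t, of x k] by (auto simp: indicator_def v_def)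
 qed
 finally show ?thesis .
qed

text \<open>One parameter e serves as truncation level, time gap and error size. Since B^eps(e) >
  1/(1 + e) and \<open>X k (%x. 1)\<close> is at most l t + e up to time t - e, the measure of {u >
  e} is at most (l t + e)(1 + e). Integrating the hypothesis over (s, t - e) and inserting
  \<open>X_one_dissipation\<close> gives the inequality with errors, and e tends to 0.\<close>

lemma growth_step:
 assumes c: "0 <= c" and st: "0 <= s" "s < t" "t <= T"
  and H: "!!\<delta> h. 0 < \<delta> ==> 3 * \<delta> * (b - a) <= 1 ==> 0 < h ==> h < t ==>
   EV k. AE \<sigma> in lborel. \<sigma> \<in> {0<..<t - h} -->
    c * (1 - 3 * \<delta> * (b - a)) ^ 4 <= measure lborel {x\<in>{a<..<b}. u k \<sigma> x > \<delta>} ^ 6 * D k \<sigma>"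
 shows "c * (t - s) <= l t ^ 6 * (l t - l s)"
proof -
 have l0: "0 <= l t" using l_mono[of 0 t] l_init_pos st by simp
 have key: "c * (1 - 3 * e * (b - a)) ^ 4 * (t - e - s) <= ((l t + e) * (1 + e)) ^ 6 * (l t - l s + 3 * e)"
  if e: "0 < e" "e < t - s" "3 * e * (b - a) <= 1" for e
 proof -
  define \<Lambda> where "\<Lambda> = (l t + e) * (1 + e)"
  define \<kappa> where "\<kappa> = c * (1 - 3 * e * (b - a)) ^ 4"
  have et: "e < t" "e <= t" using e st by auto
  have s: "s \<in> {0..T}" using st by auto
  have "EV k. 1 / (1 + e) < B_eps n (eps k) e"
   by (rule order_tendstoD(1)[OF B_eps_lim]) (use e in auto)
  moreover note H[OF e(1,3) e(1) et(1)] lim.X_eventually_le[OF lim.admissible_one e(1) et(2) st(3) e(1)]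
   lim.X_one_eventually_ge[OF s e(1)] X_one_dissipation[OF e(1)]
  ultimately have "EV k. \<kappa> * (t - e - s) <= \<Lambda> ^ 6 * (l t - l s + 3 * e)"
  proof eventually_elim
   case (elim k)
   have m: "measure lborel {x\<in>{a<..<b}. u k \<sigma> x > e} <= \<Lambda>" if \<sigma>: "\<sigma> \<in> {0<..<t - e}" for \<sigma>
   proof -
    have "1 / (1 + e) * measure lborel {x\<in>{a<..<b}. u k \<sigma> x > e} <= B_eps n (eps k) e * measure lborel {x\<in>{a<..<b}. u k \<sigma> x > e}"
     using elim(1) by (intro mult_right_mono) auto
    also have "\<dots> <= X k (%x. 1) \<sigma>" by (rule X_one_ge_measure) (use \<sigma> in simp)
    also have "\<dots> <= l t + e" using elim(3) \<sigma> by (auto simp: l_def)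
    finally show ?thesis using e by (simp add: \<Lambda>_def divide_le_eq)
   qed
   have ae: "AE \<sigma>\<in>{s<..<t - e} in lborel. \<kappa> <= \<Lambda> ^ 6 * D k \<sigma>"
    using elim(2)
   proof eventually_elim
    case (elim \<sigma>)
    show ?case
    proof
     assume "\<sigma> \<in> {s<..<t - e}"
     then have \<sigma>: "\<sigma> \<in> {0<..<t - e}" using st by auto
     have "measure lborel {x\<in>{a<..<b}. u k \<sigma> x > e} ^ 6 * D k \<sigma> <= \<Lambda> ^ 6 * D k \<sigma>"
      using m[OF \<sigma>] D_nonneg[of \<sigma>] \<sigma> by (intro mult_right_mono power_mono) auto
     then show "\<kappa> <= \<Lambda> ^ 6 * D k \<sigma>" using elim \<sigma> by (auto simp: \<kappa>_def)
    qed
   qed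
   have Di: "L1_on {s<..<t - e} (D k)"
    by (rule set_integrable_subset[OF D_integrable]) (use st e in auto)
   have "\<kappa> * (t - e - s) = (LBINT \<sigma>:{s<..<t - e}. \<kappa>)" using LBINT_const_interval[of s "t - e" \<kappa>] e by simp
   also have "\<dots> <= (LBINT \<sigma>:{s<..<t - e}. \<Lambda> ^ 6 * D k \<sigma>)"
    unfolding set_lebesgue_integral_def
   proof (rule integral_mono_AE)
    show "integrable lborel (%\<sigma>. indicator {s<..<t - e} \<sigma> *\<^sub>R \<kappa>)"
     using set_integrable_const_interval[of s "t - e" \<kappa>] by (simp add: set_integrable_def)
    show "integrable lborel (%\<sigma>. indicator {s<..<t - e} \<sigma> *\<^sub>R (\<Lambda> ^ 6 * D k \<sigma>))"
     using set_integrable_mult_right[of "\<Lambda> ^ 6", OF Di] by (simp add: set_integrable_def)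
    show "AE \<sigma> in lborel. indicator {s<..<t - e} \<sigma> *\<^sub>R \<kappa> <= indicator {s<..<t - e} \<sigma> *\<^sub>R (\<Lambda> ^ 6 * D k \<sigma>)"
     using ae by eventually_elim (auto simp: indicator_def)
   qed
   also have "\<dots> = \<Lambda> ^ 6 * (LBINT \<sigma>:{s<..<t - e}. D k \<sigma>)" by simp
   also have "\<dots> <= \<Lambda> ^ 6 * (l t - l s + 3 * e)"
   proof (rule mult_left_mono)
    have "X k (%x. 1) s + (LBINT \<sigma>:{s<..<t - e}. D k \<sigma>) - e <= X k (%x. 1) (t - e)"
     using elim(5)[rule_format, of s "t - e"] st e by auto
    moreover have "X k (%x. 1) (t - e) <= l t + e" using elim(3) et by (auto simp: l_def)
    moreover have "l s - e <= X k (%x. 1) s" using elim(4) by (simp add: l_def)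
    ultimately show "(LBINT \<sigma>:{s<..<t - e}. D k \<sigma>) <= l t - l s + 3 * e" by linarith
   qed simp
   finally show ?case .
  qed
  then have "\<kappa> * (t - e - s) <= \<Lambda> ^ 6 * (l t - l s + 3 * e)" by (simp add: eventually_const)
  then show ?thesis by (simp add: \<kappa>_def \<Lambda>_def)
 qed
 have 1: "((%e. c * (1 - 3 * e * (b - a)) ^ 4 * (t - e - s)) \<longlongrightarrow> c * (1 - 3 * 0 * (b - a)) ^ 4 * (t - 0 - s)) (at_right (0::real))"
  by (intro tendsto_intros)
 have 2: "((%e. ((l t + e) * (1 + e)) ^ 6 * (l t - l s + 3 * e)) \<longlongrightarrow> ((l t + 0) * (1 + 0)) ^ 6 * (l t - l s + 3 * 0)) (at_right (0::real))"
  by (intro tendsto_intros)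
 define e0 where "e0 = min (t - s) (1 / (3 * (b - a)))"
 have e0: "0 < e0" using st ab by (simp add: e0_def)
 have "\<forall>\<^sub>F e in at_right (0::real). e \<in> {0<..<e0}" by (rule eventually_at_right_real[OF e0])
 then have "\<forall>\<^sub>F e in at_right (0::real). c * (1 - 3 * e * (b - a)) ^ 4 * (t - e - s) <= ((l t + e) * (1 + e)) ^ 6 * (l t - l s + 3 * e)"
 proof eventually_elim
  case (elim e)
  then have "e < t - s" "e <= 1 / (3 * (b - a))" by (auto simp: e0_def)
  then show ?case using elim ab by (intro key) (auto simp: field_simps)
 qed
 from tendsto_le[OF _ 2 1 this] show ?thesis by simp
qed

text \<open>If u exceeded \<delta> on the whole interval, the mass would be at least B^eps(\<delta>)
  (b - a), which tends to b - a > l t. So a point with u <= \<delta> exists, for all times before t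
  - h at once.\<close>

lemma dissipation_interior:
 assumes t: "0 < t" "t <= T" and lt: "l t < b - a" and \<delta>: "0 < \<delta>" "3 * \<delta> * (b - a) <= 1" and h: "0 < h" "h < t"
 shows "EV k. AE \<sigma> in lborel. \<sigma> \<in> {0<..<t - h} -->
  9 * (1 - 3 * \<delta> * (b - a)) ^ 4 <= measure lborel {x\<in>{a<..<b}. u k \<sigma> x > \<delta>} ^ 6 * D k \<sigma>"
proof -
 define \<eta> where "\<eta> = (b - a - l t) / 2"
 have \<eta>: "0 < \<eta>" "l t + \<eta> < b - a" using lt by (simp_all add: \<eta>_def) (simp add: field_simps)
 have "(l t + \<eta>) / (b - a) < 1" using \<eta> ab by simp
 from order_tendstoD(1)[OF B_eps_lim[OF \<delta>(1)] this]
 have "EV k. (l t + \<eta>) / (b - a) < B_eps n (eps k) \<delta>" .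
 with lim.X_eventually_le[OF lim.admissible_one h(1) less_imp_le[OF h(2)] t(2) \<eta>(1)] show ?thesis
 proof eventually_elim
  case (elim k)
  have ex: "\<exists>x\<in>{a..b}. u k \<sigma> x <= \<delta>" if \<sigma>: "\<sigma> \<in> {0<..<t - h}" for \<sigma>
  proof (rule ccontr)
   assume "\<not> (\<exists>x\<in>{a..b}. u k \<sigma> x <= \<delta>)"
   then have "\<delta> < u k \<sigma> x" if "x \<in> {a<..<b}" for x
    using that by (meson atLeastAtMost_iff greaterThanLessThan_iff less_imp_le not_le)
   then have "{x\<in>{a<..<b}. u k \<sigma> x > \<delta>} = {a<..<b}" by blast
   then have "B_eps n (eps k) \<delta> * (b - a) <= X k (%x. 1) \<sigma>"
    using X_one_ge_measure[of \<sigma> k \<delta>] \<sigma> ab by simp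
   also have "\<dots> <= l t + \<eta>" using elim(1) \<sigma> by (auto simp: l_def)
   finally show False using elim(2) ab by (simp add: divide_less_eq)
  qed
  show ?case using D_lower_k[of k] by eventually_elim (use ex \<delta> h t in auto)
 qed
qed

text \<open>\<open>I1\<close> and \<open>I2\<close> supply windows arbitrarily close to the ends
  where 1 - \<rho>(t0) has positive integral. A bump \<phi> in such a window has moment below int
  \<phi> at t0, hence at earlier times too, which excludes u > \<delta>/2 throughout the window;
  from a point with u <= \<delta>/2 the end point is reached by \<open>u_holder\<close>.\<close>

lemma dissipation_boundary:
 assumes t: "0 < t" "t <= t0" "t0 <= T" and \<delta>: "0 < \<delta>" "3 * \<delta> * (b - a) <= 1" and h: "0 < h" "h < t"
  and I1: "!!e. 0 < e ==> e < b - a ==> \<exists>e'. 0 < e' & e' <= e & (LBINT x:{a<..<a+e'}. 1 - lim.r t0 x) > 0"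
  and I2: "!!e. 0 < e ==> e < b - a ==> \<exists>e'. 0 < e' & e' <= e & (LBINT x:{b-e'<..<b}. 1 - lim.r t0 x) > 0"
 shows "EV k. AE \<sigma> in lborel. \<sigma> \<in> {0<..<t - h} -->
  144 * (1 - 3 * \<delta> * (b - a)) ^ 4 <= measure lborel {x\<in>{a<..<b}. u k \<sigma> x > \<delta>} ^ 6 * D k \<sigma>"
proof -
 have near: "EV k. \<forall>\<sigma>\<in>{0..t - h}. \<exists>x\<in>{c<..<d}. u k \<sigma> x <= \<delta> / 2"
  if cd: "a <= c" "c < d" "d <= b" and pos: "(LBINT x:{c<..<d}. 1 - lim.r t0 x) > 0" for c d
 proof -
  have wi: "L1_on {c<..<d} (%x. 1 - lim.r t0 x)" if "c <= d" for c d
   by (rule set_integrable_bounded_interval[of _ _ _ 1])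
    (use lim.r_bounds[of t0] in \<open>auto simp: set_borel_measurable_def\<close>)
  \<comment> \<open>The window may touch a or b, while a bump needs its closed support inside the
    interval; a slightly smaller window keeps the strict inequality.\<close>
  obtain c' d' where e: "!!j. c < c' j" "!!j. c' j < d' j" "!!j. d' j < d"
   "!!x. x \<in> {c<..<d} ==> eventually (%j. x \<in> {c' j..d' j}) sequentially"
   by (rule interval_exhaustion[OF cd(2)], rule that)
  from order_tendstoD(1)[OF set_integral_interval_exhaustion[OF wi e(1,3,4)] pos] cd(2)
  obtain j where j: "(LBINT x:{c' j..d' j}. 1 - lim.r t0 x) > 0" by (auto simp: eventually_sequentially)
  define c1 d1 where "c1 = c' j" and "d1 = d' j"
  have cd1: "c < c1" "c1 < d1" "d1 < d" using e(1-3)[of j] by (auto simp: c1_def d1_def)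
  have sub: "{c1<..<d1} <= {a<..<b}" and sub': "{c1..d1} <= {a<..<b}" using cd cd1 by auto
  have pos1: "(LBINT x:{c1<..<d1}. 1 - lim.r t0 x) > 0" using j unfolding LBINT_Icc_eq_Ioo by (simp add: c1_def d1_def)
  note bi = bump_integral_tendsto[OF wi[OF less_imp_le[OF ab]] _ sub]
  from order_tendstoD(1)[OF bi(1) pos1]
  obtain i where i: "(LBINT x:{a<..<b}. (1 - lim.r t0 x) * bump c1 d1 i x) > 0" by (auto simp: eventually_sequentially)
  define \<phi> where "\<phi> = bump c1 d1 i"
  have \<phi>: "lim.admissible \<phi>" unfolding lim.admissible_def \<phi>_def using bump_test_fun[OF sub'] bump_nonneg by blast
  define I where "I = (LBINT x:{a<..<b}. \<phi> x)"
  have pI: "L1_on {a<..<b} \<phi>"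
   using bump_integral_tendsto(2)[OF set_integrable_const_interval[of a b 1] _ sub, of i] by (simp add: \<phi>_def)
  have less: "lim.Lm \<phi> t0 < I"
   using i set_integral_diff(2)[OF pI lim.Lm_integrable[OF \<phi>]] unfolding \<phi>_def[symmetric] I_def lim.Lm_def left_diff_distrib by simp
  have I0: "0 < I"
  proof -
   have "0 <= lim.Lm \<phi> t0" unfolding lim.Lm_def
    by (rule set_integral_nonneg_pointwise) (use lim.r_bounds lim.admissible(3)[OF \<phi>] in simp)
   then show ?thesis using less by simp
  qed
  define \<eta> where "\<eta> = (I - lim.Lm \<phi> t0) / 2"
  have \<eta>: "0 < \<eta>" "lim.Lm \<phi> t0 + \<eta> < I" using less by (simp_all add: \<eta>_def) (simp add: field_simps)
  have mono: "lim.Lm \<phi> t <= lim.Lm \<phi> t0" by (rule lim.Lm_mono[OF \<phi> t(1,2)])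
  have "(lim.Lm \<phi> t0 + \<eta>) / I < 1" using \<eta> I0 by simp
  from order_tendstoD(1)[OF B_eps_lim this, of "\<delta> / 2"] \<delta>
  have "EV k. (lim.Lm \<phi> t0 + \<eta>) / I < B_eps n (eps k) (\<delta> / 2)" by simp
  moreover have "t <= T" using t by simp
  note lim.X_eventually_le[OF \<phi> h(1) less_imp_le[OF h(2)] this \<eta>(1)]
  ultimately show ?thesis
  proof eventually_elim
   case (elim k)
   show ?case
   proof (rule ballI, rule ccontr)
    fix \<sigma> assume \<sigma>: "\<sigma> \<in> {0..t - h}" and "\<not> (\<exists>x\<in>{c<..<d}. u k \<sigma> x <= \<delta> / 2)"
    then have big: "\<delta> / 2 < u k \<sigma> x" if "x \<in> {c<..<d}" for x using that by force
    have s0: "0 <= \<sigma>" using \<sigma> by simp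
    have "(LBINT x:{a<..<b}. B_eps n (eps k) (\<delta> / 2) * \<phi> x) <= X k \<phi> \<sigma>"
     unfolding X_def
    proof (rule set_integral_mono[OF _ lim.v_integrable[OF s0 lim.admissible(1)[OF \<phi>]]])
     show "L1_on {a<..<b} (%x. B_eps n (eps k) (\<delta> / 2) * \<phi> x)" using pI by simp
     fix x
     show "B_eps n (eps k) (\<delta> / 2) * \<phi> x <= v k \<sigma> x * \<phi> x"
     proof (cases "x \<in> {c1<..<d1}")
      case True
      then have "\<delta> / 2 <= u k \<sigma> x" using big[of x] cd1 by simp
      then show ?thesis unfolding v_def by (intro mult_right_mono B_eps_mono[OF n eps] lim.admissible(3)[OF \<phi>])
     next
      case False
      then show ?thesis by (simp add: \<phi>_def bump_outside)
     qed
    qed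
    then have "B_eps n (eps k) (\<delta> / 2) * I <= X k \<phi> \<sigma>" by (simp add: I_def)
    also have "\<dots> <= lim.Lm \<phi> t + \<eta>" using elim(2) \<sigma> by blast
    also have "\<dots> <= lim.Lm \<phi> t0 + \<eta>" using mono by simp
    finally show False using elim(1) I0 by (simp add: divide_less_eq)
   qed
  qed
 qed
 \<comment> \<open>With this e, E0 e <= (\<delta>/2)^2, so moving by at most e changes u by at most
   \<delta>/2. The summand 1 excludes a division by 0.\<close>
 define e where "e = min ((b - a) / 2) (\<delta>^2 / (4 * (E0 + 1)))"
 have e: "0 < e" "e < b - a" using ab \<delta> E0_nonneg by (auto simp: e_def min_less_iff_disj)
 have Ee: "E0 * e <= (\<delta> / 2)^2"
 proof -
  have "E0 * e <= (E0 + 1) * (\<delta>^2 / (4 * (E0 + 1)))"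
   using E0_nonneg e by (intro mult_mono) (auto simp: e_def)
  also have "\<dots> = (\<delta> / 2)^2"
  proof -
   have *: "E0 + 1 \<noteq> 0" using E0_nonneg by linarith
   have "x * (y / (4 * x)) = y / 4" if "x \<noteq> 0" for x y :: real using that by simp
   from this[OF *, of "\<delta>^2"] show ?thesis by (simp only: power_divide) simp
  qed
  finally show ?thesis .
 qed
 have transfer: "u k \<sigma> y <= \<delta>" if "0 <= \<sigma>" "x \<in> {a..b}" "y \<in> {a..b}" "\<bar>y - x\<bar> <= e" "u k \<sigma> x <= \<delta> / 2" for k \<sigma> x y
 proof -
  have "(u k \<sigma> y - u k \<sigma> x)^2 <= E0 * \<bar>y - x\<bar>" by (rule u_holder) (use that in auto)
  also have "\<dots> <= E0 * e" using that E0_nonneg by (intro mult_left_mono) auto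
  also note Ee
  finally have "\<bar>u k \<sigma> y - u k \<sigma> x\<bar> <= \<bar>\<delta> / 2\<bar>" unfolding abs_le_square_iff .
  then show ?thesis using that \<delta> by linarith
 qed
 obtain e1 where e1: "0 < e1" "e1 <= e" "(LBINT x:{a<..<a+e1}. 1 - lim.r t0 x) > 0" using I1[OF e] by blast
 obtain e2 where e2: "0 < e2" "e2 <= e" "(LBINT x:{b-e2<..<b}. 1 - lim.r t0 x) > 0" using I2[OF e] by blast
 have "EV k. \<forall>\<sigma>\<in>{0..t - h}. \<exists>x\<in>{a<..<a+e1}. u k \<sigma> x <= \<delta> / 2"
  by (rule near) (use e1 e in auto)
 moreover have "EV k. \<forall>\<sigma>\<in>{0..t - h}. \<exists>x\<in>{b-e2<..<b}. u k \<sigma> x <= \<delta> / 2"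
  by (rule near) (use e2 e in auto)
 ultimately show ?thesis
 proof eventually_elim
  case (elim k)
  have ua: "u k \<sigma> a <= \<delta> & u k \<sigma> b <= \<delta>" if \<sigma>: "\<sigma> \<in> {0<..<t - h}" for \<sigma>
  proof -
   have "\<sigma> \<in> {0..t - h}" using \<sigma> by auto
   with elim obtain x y where "x \<in> {a<..<a+e1}" "u k \<sigma> x <= \<delta> / 2" "y \<in> {b-e2<..<b}" "u k \<sigma> y <= \<delta> / 2" by blast
   then show ?thesis using transfer[of \<sigma> x a k] transfer[of \<sigma> y b k] \<sigma> e1 e2 e ab by auto
  qed
  show ?case using D_lower_k[of k] by eventually_elim (use ua \<delta> h t in auto)
 qed
qed

end

section \<open>Growth of the limit mass, the frontier condition and the lower limit of the
  measures\<close>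

context film_sequence
begin

text \<open>\<open>uin\<close> is given up to null sets only; its positivity set agrees almost
  everywhere with that of the continuous representative, which determines l 0.\<close>

lemma positivity_measure: "measure lebesgue {x \<in> {a<..<b}. 0 < uin x} = l 0"
proof -
 have "meas_on {a<..<b} uin"
  using film[of 0] by (auto simp: film_def H1_deriv_def in_L_def)
 then have "{x \<in> space borel. 0 < indicator {a<..<b} x *\<^sub>R uin x} \<in> sets borel"
  unfolding set_borel_measurable_def by measurable
 moreover have "{x \<in> space borel. 0 < indicator {a<..<b} x *\<^sub>R uin x} = {x \<in> {a<..<b}. 0 < uin x}"
  by (auto simp: indicator_def)
 ultimately have m: "{x \<in> {a<..<b}. 0 < uin x} \<in> sets borel" by simp
 have "measure lborel {x \<in> {a<..<b}. 0 < uin x} = measure lborel {x \<in> {a<..<b}. 0 < u 0 0 x}"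
 proof (rule measure_eq_AE)
  show "AE x in lborel. (x \<in> {x \<in> {a<..<b}. 0 < uin x}) = (x \<in> {x \<in> {a<..<b}. 0 < u 0 0 x})"
   using u_init[of 0] by eventually_elim auto
 qed (use m positive_set[of 0 0 0] in simp_all)
 then show ?thesis using set_measure_eq[OF m] l_init by simp
qed

lemma growth:
 assumes c: "0 <= c" and t: "0 <= t" "t <= T"
  and H: "!!s. 0 < s ==> s <= t ==> (!!\<delta> h. 0 < \<delta> ==> 3 * \<delta> * (b - a) <= 1 ==> 0 < h ==> h < s ==>
   EV k. AE \<sigma> in lborel. \<sigma> \<in> {0<..<s - h} -->
    c * (1 - 3 * \<delta> * (b - a)) ^ 4 <= measure lborel {x\<in>{a<..<b}. u k \<sigma> x > \<delta>} ^ 6 * D k \<sigma>)"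
 shows "(7 * c * t + l 0 ^ 7) powr (1 / 7) <= l t"
proof -
 have le: "l 0 ^ 7 + 7 * c * t <= l t ^ 7"
 proof (rule power_growth[of t c l, OF t(1) c l_init_pos])
  show "l s <= l s'" if "0 <= s" "s <= s'" "s' <= t" for s s' using l_mono[of s s'] that t by simp
  show "c * (s' - s) <= l s' ^ 6 * (l s' - l s)" if s: "0 <= s" "s < s'" "s' <= t" for s s'
   by (rule growth_step[OF c s(1,2)]) (use s t H[of s'] in auto)
 qed
 have lt: "0 < l t" using l_mono[of 0 t] l_init_pos t by simp
 have "(7 * c * t + l 0 ^ 7) powr (1 / 7) <= (l t ^ 7) powr (1 / 7)"
  by (rule powr_mono2) (use le c t l_init_pos in auto)
 also have "\<dots> = l t"
 proof -
  have "l t ^ 7 = l t powr 7" using lt by simp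
  then have "(l t ^ 7) powr (1 / 7) = l t powr (7 * (1 / 7))" by (simp only: powr_powr)
  then show ?thesis using lt by simp
 qed
 finally show ?thesis .
qed

text \<open>63 is 7 * 9. If l t < b - a, monotonicity gives the same at all earlier times, where
  \<open>dissipation_interior\<close> applies; otherwise the minimum is at most b - a.\<close>

lemma lower_bound:
 assumes t: "t \<in> {0..T}"
 shows "min ((63 * t + l 0 ^ 7) powr (1 / 7)) (b - a) <= l t"
proof (cases "l t < b - a")
 case True
 have "(7 * 9 * t + l 0 ^ 7) powr (1 / 7) <= l t"
 proof (rule growth)
  fix s \<delta> h assume s: "0 < s" "s <= t" and "0 < \<delta>" "3 * \<delta> * (b - a) <= 1" "0 < h" "h < s"
  moreover have "l s < b - a" "s <= T" using l_mono[of s t] s t True by auto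
  ultimately show "EV k. AE \<sigma> in lborel. \<sigma> \<in> {0<..<s - h} -->
    9 * (1 - 3 * \<delta> * (b - a)) ^ 4 <= measure lborel {x\<in>{a<..<b}. u k \<sigma> x > \<delta>} ^ 6 * D k \<sigma>"
   by (intro dissipation_interior)
 qed (use t in auto)
 then show ?thesis by simp
qed simp

text \<open>Sigma lies in the open interval, so an end point is never interior to it; were it in the
  closure, it would be a frontier point outside the interval. Hence Sigma keeps a distance from both
  ends, and the point at distance e'/2 from an end is not in Sigma, so that 1 - \<rho> has nonzero
  integral over the radius e'/2 around it.\<close>

lemma frontier_Sigma:
 assumes fr: "frontier (Sigma_set a b lim.r t0) <= {a<..<b}" and e: "0 < e" "e < b - a"
 shows "\<exists>e'. 0 < e' & e' <= e & (LBINT x:{a<..<a+e'}. 1 - lim.r t0 x) > 0"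
  and "\<exists>e'. 0 < e' & e' <= e & (LBINT x:{b-e'<..<b}. 1 - lim.r t0 x) > 0"
proof -
 let ?S = "Sigma_set a b lim.r t0"
 have sub: "?S <= {a<..<b}" by (auto simp: Sigma_set_def)
 have out: "\<exists>d>0. ball y d \<inter> ?S = {}" if y: "y \<notin> {a<..<b}" for y
 proof -
  have "y \<notin> closure ?S"
  proof
   assume "y \<in> closure ?S"
   moreover have "y \<notin> interior ?S" using sub y interior_subset by blast
   ultimately have "y \<in> frontier ?S" by (simp add: frontier_def)
   then show False using fr y by blast
  qed
  then have "y \<in> - closure ?S" by simp
  then obtain d where "d > 0" "ball y d <= - closure ?S"
   using open_contains_ball[of "- closure ?S"] by (auto simp: open_Compl)
  then show ?thesis using closure_subset by blast
 qed
 have half: "(LBINT y:{x - r<..<x + r}. 1 - lim.r t0 y) > 0" if x: "x \<in> {a<..<b}" "x \<notin> ?S" and r: "0 < r" "a <= x - r" "x + r <= b" for x r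
 proof -
  have "{x - r<..<x + r} \<inter> {a<..<b} = {x - r<..<x + r}" using r by auto
  then have "(LBINT y:{x - r<..<x + r}. 1 - lim.r t0 y) \<noteq> 0"
   using x r unfolding Sigma_set_def by auto
  moreover have "0 <= (LBINT y:{x - r<..<x + r}. 1 - lim.r t0 y)"
   by (rule set_integral_nonneg_pointwise) (use lim.r_bounds in auto)
  ultimately show ?thesis by linarith
 qed
 show "\<exists>e'. 0 < e' & e' <= e & (LBINT x:{a<..<a+e'}. 1 - lim.r t0 x) > 0"
 proof -
  obtain d where d: "d > 0" "ball a d \<inter> ?S = {}" using out[of a] by auto
  define e' where "e' = min e d"
  have e': "0 < e'" "e' <= e" "e' <= d" using d e by (auto simp: e'_def)
  have "a + e' / 2 \<in> ball a d" using e' d by (auto simp: dist_real_def)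
  then have "a + e' / 2 \<notin> ?S" using d by blast
  from half[OF _ this, of "e' / 2"] have "(LBINT x:{a<..<a+e'}. 1 - lim.r t0 x) > 0"
   using e e' by simp (simp add: add.commute)
  then show ?thesis using e' by blast
 qed
 show "\<exists>e'. 0 < e' & e' <= e & (LBINT x:{b-e'<..<b}. 1 - lim.r t0 x) > 0"
 proof -
  obtain d where d: "d > 0" "ball b d \<inter> ?S = {}" using out[of b] by auto
  define e' where "e' = min e d"
  have e': "0 < e'" "e' <= e" "e' <= d" using d e by (auto simp: e'_def)
  have "b - e' / 2 \<in> ball b d" using e' d by (auto simp: dist_real_def)
  then have "b - e' / 2 \<notin> ?S" using d by blast
  from half[OF _ this, of "e' / 2"] have "(LBINT x:{b-e'<..<b}. 1 - lim.r t0 x) > 0"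
   using e e' by simp
  then show ?thesis using e' by blast
 qed
qed

lemma strong_lower_bound:
 assumes fr: "frontier (Sigma_set a b lim.r t0) <= {a<..<b}" and t: "0 <= t" "t <= t0" "t0 <= T"
 shows "(1008 * t + l 0 ^ 7) powr (1 / 7) <= l t"
proof -
 have "(7 * 144 * t + l 0 ^ 7) powr (1 / 7) <= l t"
 proof (rule growth)
  fix s \<delta> h assume s: "0 < s" "s <= t" and \<delta>: "0 < \<delta>" "3 * \<delta> * (b - a) <= 1" "0 < h" "h < s"
  show "EV k. AE \<sigma> in lborel. \<sigma> \<in> {0<..<s - h} -->
    144 * (1 - 3 * \<delta> * (b - a)) ^ 4 <= measure lborel {x\<in>{a<..<b}. u k \<sigma> x > \<delta>} ^ 6 * D k \<sigma>"
   by (rule dissipation_boundary[OF s(1) _ t(3) \<delta> frontier_Sigma[OF fr]]) (use s t in auto)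
 qed (use t in auto)
 then show ?thesis by simp
qed

text \<open>rho^eps is at most \<open>P k\<close> where u >= eps and at most B(1)/\<open>L k\<close>
  elsewhere. So the mass, which is eventually at least l t minus any small error, is at most
  \<open>P k\<close> times the measure plus o(1), and \<open>P k\<close> tends to 1.\<close>

lemma measure_liminf:
 assumes t: "t \<in> {0..T}"
 shows "ereal (l t) <= liminf (%k. ereal (measure lebesgue {x\<in>{a<..<b}. eps k <= u k t x}))"
 unfolding le_Liminf_iff
proof (intro allI impI)
 fix y assume y: "y < ereal (l t)"
 have t0: "0 <= t" using t by simp
 define m where "m k = measure lborel {x\<in>{a<..<b}. eps k <= u k t x}" for k
 have S: "{x\<in>{a<..<b}. eps k <= u k t x} \<in> sets borel" for k
 proof -
  have "{a..b} \<inter> u k t -` {eps k..} \<in> sets borel"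
   by (intro borel_closed continuous_closed_preimage u_cont_slice t0) auto
  then have "({a..b} \<inter> u k t -` {eps k..}) \<inter> {a<..<b} \<in> sets borel" by (rule sets.Int) simp
  moreover have "({a..b} \<inter> u k t -` {eps k..}) \<inter> {a<..<b} = {x\<in>{a<..<b}. eps k <= u k t x}" by auto
  ultimately show ?thesis by simp
 qed
 have meq: "measure lebesgue {x\<in>{a<..<b}. eps k <= u k t x} = m k" for k
  unfolding m_def by (rule set_measure_eq[OF S])
 have Xm: "X k (%x. 1) t <= P k * m k + (b - a) * (B_fun n 1 / L k)" for k
 proof -
  let ?S = "{x\<in>{a<..<b}. eps k <= u k t x}"
  have fin: "emeasure lborel ?S < \<infinity>"
  proof -
   have "emeasure lborel ?S <= emeasure lborel {a<..<b}" by (rule emeasure_mono) auto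
   also have "\<dots> < \<infinity>" using ab by simp
   finally show ?thesis .
  qed
  have i1: "integrable lborel (%x. P k * indicator ?S x)"
   using S[of k] fin by (intro integrable_mult_right integrable_real_indicator) auto
  have i2: "integrable lborel (%x. indicator {a<..<b} x *\<^sub>R (B_fun n 1 / L k))"
   using set_integrable_const_interval[of a b "B_fun n 1 / L k"] by (simp add: set_integrable_def)
  have "X k (%x. 1) t <= (\<integral>x. P k * indicator ?S x + indicator {a<..<b} x *\<^sub>R (B_fun n 1 / L k) \<partial>lborel)"
   unfolding X_def set_lebesgue_integral_def
  proof (rule integral_mono[OF _ Bochner_Integration.integrable_add[OF i1 i2]])
   show "integrable lborel (%x. indicator {a<..<b} x *\<^sub>R (v k t x * 1))"
    using lim.v_integrable[OF t0 continuous_on_const[of _ 1], of k] by (simp add: set_integrable_def)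
   fix x
   show "indicator {a<..<b} x *\<^sub>R (v k t x * 1) <= P k * indicator ?S x + indicator {a<..<b} x *\<^sub>R (B_fun n 1 / L k)"
   proof (cases "x \<in> {a<..<b}")
    case True
    have nn: "0 <= B_fun n 1 / L k" using B_fun_nonneg[OF n, of 1] L_pos[of k] by simp
    show ?thesis
    proof (cases "eps k <= u k t x")
     case True
     then show ?thesis using v_bounds[OF t0, of x k] \<open>x \<in> {a<..<b}\<close> nn by (auto simp: indicator_def)
    next
     case False
     then show ?thesis using B_eps_small[OF n eps, of "u k t x" k] \<open>x \<in> {a<..<b}\<close>
      by (auto simp: v_def L_def indicator_def)
    qed
   qed (auto simp: indicator_def)
  qed
  also have "\<dots> = P k * m k + (b - a) * (B_fun n 1 / L k)"
   unfolding Bochner_Integration.integral_add[OF i1 i2] m_def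
   using LBINT_const_interval[of a b "B_fun n 1 / L k"] ab by (simp add: set_lebesgue_integral_def)
  finally show ?thesis .
 qed
 show "EV k. y < ereal (measure lebesgue {x\<in>{a<..<b}. eps k <= u k t x})"
  unfolding meq
 proof (cases y)
  case (real z)
  then have z: "z < l t" using y by simp
  define \<eta> where "\<eta> = (l t - z) / 2"
  have \<eta>: "0 < \<eta>" "z < l t - \<eta>" using z by (simp_all add: \<eta>_def) (simp add: field_simps)
  have "(%k. P k * z + (b - a) * (B_fun n 1 / L k)) ----> 1 * z + (b - a) * 0"
   by (intro tendsto_intros P_lim div_L)
  from order_tendstoD(2)[OF this, of "l t - \<eta>"] \<eta>
  have "EV k. P k * z + (b - a) * (B_fun n 1 / L k) < l t - \<eta>" by simp
  moreover have "EV k. 0 < P k" by (rule order_tendstoD(1)[OF P_lim]) simp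
  ultimately show "EV k. y < ereal (m k)"
   using lim.X_one_eventually_ge[OF t \<eta>(1)]
  proof eventually_elim
   case (elim k)
   have "P k * z < P k * m k" using elim Xm[of k] unfolding l_def by linarith
   then show ?case using elim(2) real by (simp add: mult_less_cancel_left_pos)
  qed
 qed (use y in auto)
qed

end

theorem corollary1p12:
  fixes a b n p T :: real
    and uin duin :: "real \<Rightarrow> real"
    and u :: "real \<Rightarrow> real \<Rightarrow> real \<Rightarrow> real"
    and eps :: "nat \<Rightarrow> real"
    and \<rho> :: "real \<Rightarrow> real \<Rightarrow> real"
  assumes "a < b" and "0 < n" and "n < 3" and "1 \<le> p" and "0 < T"
    and "H1_deriv {a<..<b} uin duin"
    and "AE x in lborel. x \<in> {a<..<b} \<longrightarrow> uin x \<ge> 0"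
    and "(LBINT x:{a<..<b}. uin x) = 1"
    and "\<And>\<epsilon>. 0 < \<epsilon> \<Longrightarrow> \<epsilon> < 1 \<Longrightarrow> thin_film_solution a b n \<epsilon> uin duin (u \<epsilon>)"
    and "\<And>k. 0 < eps k" and "\<And>k. eps k < 1" and "eps \<longlonglongrightarrow> 0"
    and "set_borel_measurable lborel (cyl T a b) (\<lambda>(t, x). \<rho> t x)"
    and "AE z in lborel. z \<in> cyl T a b \<longrightarrow> (case z of (t, x) \<Rightarrow> 0 \<le> \<rho> t x \<and> \<rho> t x \<le> 1)"
    and "tendsto_Lp_Wm11 p T a b (\<lambda>k t x. B_eps n (eps k) (u (eps k) t x)) \<rho>"
  shows "\<exists>r. time_representative T a b (\<lambda>k x. B_eps n (eps k) (u (eps k) 0 x)) \<rho> r \<and>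
    (\<forall>t\<in>{0..T}.
       liminf (\<lambda>k. ereal (measure lebesgue {x\<in>{a<..<b}. u (eps k) t x \<ge> eps k}))
         \<ge> ereal (LBINT x:{a<..<b}. r t x) \<and>
       (LBINT x:{a<..<b}. r t x)
         \<ge> min ((63 * t + measure lebesgue {x\<in>{a<..<b}. uin x > 0} ^ 7) powr (1/7))
               (measure lebesgue {a<..<b})) \<and>
    (\<forall>t\<^sub>0\<in>{0..T}. frontier (Sigma_set a b r t\<^sub>0) \<subseteq> {a<..<b} \<longrightarrow>
       (\<forall>t\<in>{0..t\<^sub>0}.
          (LBINT x:{a<..<b}. r t x)
            \<ge> (1008 * t + measure lebesgue {x\<in>{a<..<b}. uin x > 0} ^ 7) powr (1/7)))"
proof -
 have "\<forall>k. \<exists>ux uxx uxxx. film a b n (eps k) uin duin (u (eps k)) ux uxx uxxx"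
 proof
  fix k
  obtain ux uxx uxxx where "spatial_derivs a b (u (eps k)) ux uxx uxxx"
   "weak_solution a b n (eps k) uin (u (eps k)) uxxx" "mass_conservation a b uin (u (eps k))"
   "energy_inequality a b n (eps k) duin (u (eps k)) ux uxxx" "entropy_inequality a b n (eps k) (u (eps k)) uxx"
   "rho_equation a b n (eps k) (u (eps k)) ux uxx uxxx"
   using assms(9)[OF assms(10,11)] unfolding thin_film_solution_def by blast
  then show "\<exists>ux uxx uxxx. film a b n (eps k) uin duin (u (eps k)) ux uxx uxxx"
   using assms by (auto simp: film_def)
 qed
 then obtain ux uxx uxxx where film: "!!k. film a b n (eps k) uin duin (u (eps k)) (ux k) (uxx k) (uxxx k)"
  unfolding choice_iff by blast
 interpret film_sequence a b n T p uin duin "%k. u (eps k)" ux uxx uxxx eps \<rho>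
 proof (rule film_sequence.intro)
  show "film a b n (eps k) uin duin (u (eps k)) (ux k) (uxx k) (uxxx k)" for k by (rule film)
 qed (rule assms)+
 have O: "measure lebesgue {a<..<b} = b - a" using assms(1) by (simp add: set_measure_eq)
 show ?thesis
  unfolding positivity_measure O
 proof (intro exI[of _ lim.r] conjI ballI impI)
  show "time_representative T a b (%k x. B_eps n (eps k) (u (eps k) 0 x)) \<rho> lim.r"
   using lim.r_time_representative unfolding v_def .
 qed (use measure_liminf lower_bound strong_lower_bound in \<open>simp_all add: l_eq\<close>)
qed

end
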